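(* Let $\alpha,\beta\in\mathbb{R}$. Suppose there exists a function $v\colon [0,T]\times \mathbb{R}^n\to \mathbb{R}$ that is continuously differentiable in $t$ and twice continuously differentiable in $x$, satisfying $$\begin{cases}\mathcal{L}v(t,x)\leq \alpha v(t,x)+\beta, & \forall x\in \mathcal{X},\ \forall t \in [0,T],\\ \frac{\partial v(t,x)}{\partial t}\leq \alpha v(t,x)+\beta, & \forall x\in \partial \mathcal{X},\ \forall t\in [0,T],\\ v(T,x)\geq 1_{\mathcal{X}_s}(x), & \forall x\in \overline{\mathcal{X}}.\end{cases}$$ Then, for every $x_0\in \mathcal{X}\setminus \mathcal{X}_s$, $$\mathbb{P}_{x_0}^{T}\leq \begin{cases} v(0,x_0)+\beta T, & \text{if } \alpha=0,\\ e^{\alpha T}v(0,x_0)+\frac{\beta}{\alpha}(e^{\alpha T}-1), & \text{if } \alpha\neq 0.\end{cases}$$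
   Context: Let $b\colon\mathbb{R}^n\to\mathbb{R}^n$ and $\sigma\colon\mathbb{R}^n\to\mathbb{R}^{n\times k}$ be locally Lipschitz continuous, and let $W$ be a standard $k$-dimensional Wiener process on a probability space $(\Omega,\mathbb{P})$. For $x_0\in\mathbb{R}^n$, the SDE $dX=b(X)\,dt+\sigma(X)\,dW$ with initial state $x_0$ has a unique maximal local strong solution $X_{x_0}^{w}(t)$, $t\in[0,T^{x_0}(w))$, with continuous sample paths, where $T^{x_0}(w)\in(0,\infty]$. Let $\mathcal{X}\subseteq\mathbb{R}^n$ be open and bounded, $\mathcal{X}_s\subseteq\mathcal{X}$ a closed set, and $0<T<\infty$. An overline denotes closure, $\partial$ denotes topological boundary, and $1_A$ is the indicator function of $A$. For $x_0\in\mathcal{X}\setminus\mathcal{X}_s$ define $$\mathbb{P}_{x_0}^{T}:=\mathbb{P}\big(\{w\in\Omega \mid X_{x_0}^{w}(T)\in\mathcal{X}_s\ \wedge\ \forall\tau\in[0,T).\ X_{x_0}^{w}(\tau)\in\mathcal{X}\}\big),$$ where the path is required to be defined at the times involved. For a function $v(t,x)$ that is continuously differentiable in $t$ and twice continuously differentiable in $x$ (class $C^{1,2}$), $$\mathcal{L}v(t,x)=\frac{\partial v(t,x)}{\partial t}+\frac{\partial v(t,x)}{\partial x}b(x)+\frac12\mathrm{tr}\Big(\sigma(x)^{\top}\frac{\partial^2 v(t,x)}{\partial x^2}\sigma(x)\Big).$$ *)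

theory Defs
  imports "HOL-Probability.Probability"
begin

section \<open>Wiener processes and their filtration\<close>

locale wiener_process = prob_space M for M :: "'w measure" +
  fixes W :: "real \<Rightarrow> 'w \<Rightarrow> real ^ 'k"
  assumes measurable_W: "\<And>t. 0 \<le> t \<Longrightarrow> W t \<in> borel_measurable M"
    and W_start: "AE w in M. W 0 w = 0"
    and W_continuous: "AE w in M. continuous_on {0..} (\<lambda>t. W t w)"
    and W_normal: "\<And>s t i. 0 \<le> s \<Longrightarrow> s < t \<Longrightarrow>
      distributed M lborel (\<lambda>w. (W t w - W s w) $ i) (normal_density 0 (sqrt (t - s)))"
    and W_indep_components: "\<And>s t. 0 \<le> s \<Longrightarrow> s < t \<Longrightarrow>
      indep_vars (\<lambda>_. borel) (\<lambda>i w. (W t w - W s w) $ i) UNIV"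
    and W_indep_increments: "\<And>(p :: nat \<Rightarrow> real) N. 0 \<le> p 0 \<Longrightarrow> mono p \<Longrightarrow>
      indep_vars (\<lambda>_. borel) (\<lambda>j w. W (p (Suc j)) w - W (p j) w) {..<N}"

text \<open>The natural filtration of \<open>W\<close>, augmented by the null sets of \<open>M\<close>. Times live in
  \<^typ>\<open>ennreal\<close>, so that \<^const>\<open>stopping_time\<close> also covers random times with the value \<open>\<infinity>\<close>.\<close>

definition wiener_filtration ::
    "'w measure \<Rightarrow> (real \<Rightarrow> 'w \<Rightarrow> real ^ 'k) \<Rightarrow> ennreal \<Rightarrow> 'w measure" where
  "wiener_filtration M W t = sigma (space M)
     ({W s -` A \<inter> space M | s A. 0 \<le> s \<and> ennreal s \<le> t \<and> A \<in> sets borel} \<union> null_sets M)"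


section \<open>The Ito integral\<close>

text \<open>A simple integrand with data \<open>N\<close>, \<open>p\<close>, \<open>\<xi>\<close> is the process
  \<open>\<Sum>i<N. 1\<^bsub>(p i, p (i+1)]\<^esub> \<cdot> \<xi> i\<close> with bounded coefficients \<open>\<xi> i\<close>
  that are known at time \<open>p i\<close>.\<close>

definition simple_integrand_data ::
    "'w measure \<Rightarrow> (real \<Rightarrow> 'w \<Rightarrow> real ^ 'k) \<Rightarrow> nat \<Rightarrow> (nat \<Rightarrow> real) \<Rightarrow>
     (nat \<Rightarrow> 'w \<Rightarrow> real ^ 'k ^ 'n) \<Rightarrow> bool" where
  "simple_integrand_data M W N p \<xi> \<longleftrightarrow> 0 \<le> p 0 \<and> mono p \<and>
     (\<forall>i<N. \<xi> i \<in> borel_measurable (wiener_filtration M W (ennreal (p i))) \<and>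
            bounded (\<xi> i ` space M))"

definition simple_integrand ::
    "nat \<Rightarrow> (nat \<Rightarrow> real) \<Rightarrow> (nat \<Rightarrow> 'w \<Rightarrow> real ^ 'k ^ 'n) \<Rightarrow> real \<Rightarrow> 'w \<Rightarrow> real ^ 'k ^ 'n" where
  "simple_integrand N p \<xi> s w = (\<Sum>i<N. indicator {p i<..p (Suc i)} s *\<^sub>R \<xi> i w)"

definition simple_ito_integral ::
    "(real \<Rightarrow> 'w \<Rightarrow> real ^ 'k) \<Rightarrow> nat \<Rightarrow> (nat \<Rightarrow> real) \<Rightarrow> (nat \<Rightarrow> 'w \<Rightarrow> real ^ 'k ^ 'n) \<Rightarrow>
     real \<Rightarrow> 'w \<Rightarrow> real ^ 'n" where
  "simple_ito_integral W N p \<xi> t w =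
     (\<Sum>i<N. \<xi> i w *v (W (min t (p (Suc i))) w - W (min t (p i)) w))"

text \<open>\<open>has_ito_integral M W H t Z\<close> says that \<open>Z\<close> is a version of the integral of \<open>H\<close> against \<open>W\<close>
  over \<open>[0, t]\<close>: there are simple integrands \<open>S j\<close> with
  \<open>\<integral>\<^sub>0\<^sup>t |S j - H|\<^sup>2 ds \<longlonglongrightarrow> 0\<close> and \<open>\<integral>\<^sub>0\<^sup>t S j dW \<longlonglongrightarrow> Z\<close>, both in probability. The first condition
  already forces \<open>\<integral>\<^sub>0\<^sup>t |H|\<^sup>2 ds < \<infinity>\<close> almost surely. The norm on matrices is the Frobenius norm.
  Measurability of \<open>H\<close> and \<open>Z\<close> is required because \<^const>\<open>measure\<close> is \<open>0\<close> on non-measurable sets.\<close>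

definition progressively_measurable ::
    "(ennreal \<Rightarrow> 'w measure) \<Rightarrow> real \<Rightarrow> (real \<Rightarrow> 'w \<Rightarrow> 'b :: topological_space) \<Rightarrow> bool" where
  "progressively_measurable F t H \<longleftrightarrow>
     (\<forall>r\<in>{0..t}. (\<lambda>(s, w). H s w) \<in>
        borel_measurable (restrict_space borel {0..r} \<Otimes>\<^sub>M F (ennreal r)))"

definition has_ito_integral ::
    "'w measure \<Rightarrow> (real \<Rightarrow> 'w \<Rightarrow> real ^ 'k) \<Rightarrow> (real \<Rightarrow> 'w \<Rightarrow> real ^ 'k ^ 'n) \<Rightarrow> real \<Rightarrow>
     ('w \<Rightarrow> real ^ 'n) \<Rightarrow> bool" where
  "has_ito_integral M W H t Z \<longleftrightarrow>
     progressively_measurable (wiener_filtration M W) t H \<and> Z \<in> borel_measurable M \<and>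
     (\<exists>N p \<xi>.
        (\<forall>j. simple_integrand_data M W (N j) (p j) (\<xi> j)) \<and>
        (\<forall>\<epsilon>>0. (\<lambda>j. measure M {w \<in> space M. ennreal \<epsilon> <
            (\<integral>\<^sup>+ s \<in> {0..t}. ennreal ((norm (simple_integrand (N j) (p j) (\<xi> j) s w - H s w))\<^sup>2)
              \<partial>lborel)}) \<longlonglongrightarrow> 0) \<and>
        (\<forall>\<epsilon>>0. (\<lambda>j. measure M {w \<in> space M. \<epsilon> <
            norm (simple_ito_integral W (N j) (p j) (\<xi> j) t w - Z w)}) \<longlonglongrightarrow> 0))"


section \<open>Maximal local strong solutions\<close>

text \<open>\<open>X\<close> is a local strong solution on \<open>[0, \<zeta>)\<close> of \<open>dX = b(X) dt + \<sigma>(X) dW\<close> with \<open>X 0 = x0\<close>: it is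
  adapted to the augmented filtration of \<open>W\<close>, and the integral equation stopped at \<open>\<tau> m\<close> holds
  for some sequence of stopping times \<open>\<tau> m < \<zeta>\<close> increasing to \<open>\<zeta>\<close>. The values of \<open>X t w\<close> for
  \<open>t \<ge> \<zeta> w\<close> are irrelevant. The stopped paths are continuous, so stating the equation almost
  surely for each \<open>t\<close> fixes it almost surely for all \<open>t\<close>.\<close>

definition local_strong_solution ::
    "'w measure \<Rightarrow> (real \<Rightarrow> 'w \<Rightarrow> real ^ 'k) \<Rightarrow> (real ^ 'n \<Rightarrow> real ^ 'n) \<Rightarrow>
     (real ^ 'n \<Rightarrow> real ^ 'k ^ 'n) \<Rightarrow> real ^ 'n \<Rightarrow> (real \<Rightarrow> 'w \<Rightarrow> real ^ 'n) \<Rightarrow>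
     ('w \<Rightarrow> ennreal) \<Rightarrow> bool" where
  "local_strong_solution M W b \<sigma> x0 X \<zeta> \<longleftrightarrow>
     stopping_time (wiener_filtration M W) \<zeta> \<and>
     (\<forall>w \<in> space M. 0 < \<zeta> w \<and> X 0 w = x0 \<and>
        continuous_on {t. 0 \<le> t \<and> ennreal t < \<zeta> w} (\<lambda>t. X t w)) \<and>
     (\<forall>t\<ge>0. X t \<in> borel_measurable
        (restrict_space (wiener_filtration M W (ennreal t)) {w \<in> space M. ennreal t < \<zeta> w})) \<and>
     (\<exists>\<tau> :: nat \<Rightarrow> 'w \<Rightarrow> real.
        (\<forall>m. stopping_time (wiener_filtration M W) (\<lambda>w. ennreal (\<tau> m w))) \<and>
        (\<forall>w \<in> space M. incseq (\<lambda>m. \<tau> m w) \<and> (\<forall>m. 0 \<le> \<tau> m w \<and> ennreal (\<tau> m w) < \<zeta> w) \<and>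
           (\<lambda>m. ennreal (\<tau> m w)) \<longlonglongrightarrow> \<zeta> w) \<and>
        (\<forall>m. \<forall>t\<ge>0. \<exists>Z.
           has_ito_integral M W (\<lambda>s w. if s \<le> \<tau> m w then \<sigma> (X s w) else 0) t Z \<and>
           (AE w in M. X (min t (\<tau> m w)) w =
              x0 + (LINT s:{0..min t (\<tau> m w)}|lborel. b (X s w)) + Z w)))"

text \<open>Maximality is explosion of the path at a finite lifetime, as in X. Mao, \<^emph>\<open>Stochastic
  Differential Equations and Applications\<close>, where a maximal local solution is defined this way.\<close>

definition maximal_local_strong_solution ::
    "'w measure \<Rightarrow> (real \<Rightarrow> 'w \<Rightarrow> real ^ 'k) \<Rightarrow> (real ^ 'n \<Rightarrow> real ^ 'n) \<Rightarrow>
     (real ^ 'n \<Rightarrow> real ^ 'k ^ 'n) \<Rightarrow> real ^ 'n \<Rightarrow> (real \<Rightarrow> 'w \<Rightarrow> real ^ 'n) \<Rightarrow>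
     ('w \<Rightarrow> ennreal) \<Rightarrow> bool" where
  "maximal_local_strong_solution M W b \<sigma> x0 X \<zeta> \<longleftrightarrow>
     local_strong_solution M W b \<sigma> x0 X \<zeta> \<and>
     (AE w in M. \<zeta> w < \<infinity> \<longrightarrow>
        Limsup (at_left (enn2real (\<zeta> w))) (\<lambda>t. ereal (norm (X t w))) = \<infinity>)"


section \<open>Reach-avoid probability and generator\<close>

definition reach_avoid_prob ::
    "'w measure \<Rightarrow> (real \<Rightarrow> 'w \<Rightarrow> real ^ 'n) \<Rightarrow> ('w \<Rightarrow> ennreal) \<Rightarrow>
     (real ^ 'n) set \<Rightarrow> (real ^ 'n) set \<Rightarrow> real \<Rightarrow> real" where
  "reach_avoid_prob M X \<zeta> D G T =
     measure M {w \<in> space M. ennreal T < \<zeta> w \<and> X T w \<in> G \<and> (\<forall>t\<in>{0..<T}. X t w \<in> D)}"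

text \<open>\<open>v\<close> is of class \<open>C\<^sup>1\<^sup>,\<^sup>2\<close> on \<open>[0, T] \<times> \<real>\<^sup>n\<close>, with time derivative \<open>vt\<close> (one-sided at the ends),
  spatial gradient \<open>vx\<close> and spatial Hessian \<open>vxx\<close>; these three are determined by \<open>v\<close>.\<close>

definition C12_with_derivatives ::
    "real \<Rightarrow> (real \<Rightarrow> real ^ 'n \<Rightarrow> real) \<Rightarrow> (real \<Rightarrow> real ^ 'n \<Rightarrow> real) \<Rightarrow>
     (real \<Rightarrow> real ^ 'n \<Rightarrow> real ^ 'n) \<Rightarrow> (real \<Rightarrow> real ^ 'n \<Rightarrow> real ^ 'n ^ 'n) \<Rightarrow> bool" where
  "C12_with_derivatives T v vt vx vxx \<longleftrightarrow>
     (\<forall>t\<in>{0..T}. \<forall>x.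
        ((\<lambda>s. v s x) has_real_derivative vt t x) (at t within {0..T}) \<and>
        (v t has_derivative (\<lambda>h. vx t x \<bullet> h)) (at x) \<and>
        (vx t has_derivative (\<lambda>h. vxx t x *v h)) (at x)) \<and>
     continuous_on ({0..T} \<times> UNIV) (\<lambda>(t, x). v t x) \<and>
     continuous_on ({0..T} \<times> UNIV) (\<lambda>(t, x). vt t x) \<and>
     continuous_on ({0..T} \<times> UNIV) (\<lambda>(t, x). vx t x) \<and>
     continuous_on ({0..T} \<times> UNIV) (\<lambda>(t, x). vxx t x)"

definition generator ::
    "(real ^ 'n \<Rightarrow> real ^ 'n) \<Rightarrow> (real ^ 'n \<Rightarrow> real ^ 'k ^ 'n) \<Rightarrow> (real \<Rightarrow> real ^ 'n \<Rightarrow> real) \<Rightarrow>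
     (real \<Rightarrow> real ^ 'n \<Rightarrow> real ^ 'n) \<Rightarrow> (real \<Rightarrow> real ^ 'n \<Rightarrow> real ^ 'n ^ 'n) \<Rightarrow>
     real \<Rightarrow> real ^ 'n \<Rightarrow> real" where
  "generator b \<sigma> vt vx vxx t x =
     vt t x + vx t x \<bullet> b x + 1 / 2 * trace (transpose (\<sigma> x) ** vxx t x ** \<sigma> x)"

end

theory Submission
  imports Defs
begin

text \<open>Stop \<open>X\<close> at its exit from \<open>D\<close> (and at a localizing time \<open>\<tau>\<close>). The stopped process \<open>Y\<close> stays in
  the compact closure of \<open>D\<close>, moves by the generator before the exit and is frozen on the boundary
  afterwards, so by Dynkin's formula the hypotheses make \<open>exp (- \<alpha> t) v(t, Y t)\<close> grow in mean at most
  at the rate \<open>\<beta> exp (- \<alpha> t)\<close>; at time \<open>T\<close> it dominates \<open>exp (- \<alpha> T)\<close> times the indicator of the target.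

  Dynkin's formula is obtained from two facts only: the noise increments of \<open>Y\<close> have conditional mean
  zero and conditional covariance \<open>\<integral> \<sigma> \<sigma>\<^sup>T\<close>. A second order Taylor expansion along a grid then gives it,
  because a bounded process with these properties has quadratic variation bounded in mean square.
  The two facts come from the Ito isometry for simple integrands: the integrand of \<open>Y\<close> is bounded, so
  the simple integrands approximating it may be truncated, which turns convergence in probability into
  convergence in mean square.\<close>

section \<open>Increments of the Wiener process\<close>

text \<open>The equation is given only up to localizing times \<open>\<tau> m\<close>, and for each
  of them only at one deterministic time at a time, almost surely. This shapes two parts of the
  proof. The stochastic integral up to the exit time has to be built from integrals over
  deterministic intervals, by rounding the exit time up to a grid. And for fixed \<open>m\<close>
  the estimate carries an error proportional to the probability that \<open>\<tau> m\<close> comes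
  before \<open>T\<close> while the path is still inside \<open>D\<close>; it disappears as
  \<open>m\<close> grows because a path confined to the bounded set \<open>D\<close> cannot explode,
  so that maximality forces its lifetime beyond \<open>T\<close>. Conditional expectations do not
  appear as objects: martingale properties are tested against weights that are known at the earlier
  time. Estimates in mean square use Young's inequality with a free parameter that is sent to zero
  last. The factor \<open>exp (- \<alpha> * t)\<close> is the integrating factor that absorbs
  \<open>\<alpha> * v\<close>, and the integral of \<open>\<beta> * exp (- \<alpha> * t)\<close>
  over the time interval produces the two cases of the bound.\<close>

lemma finite_set_as_grid:
  fixes A :: "real set"
  assumes "finite A" "A \<noteq> {}"
  obtains q :: "nat \<Rightarrow> real" and n where "mono q" "q ` {..n} = A"
proof -
  define rs where "rs = sorted_list_of_set A"
  define n where "n = length rs - 1"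
  have rs: "set rs = A" "sorted rs" "length rs > 0" "length rs = Suc n"
    using assms by (auto simp: rs_def n_def Suc_le_eq card_gt_0_iff)
  \<comment> \<open>Constant after the last element, because \<open>W_indep_increments\<close> and
    all grids below ask for monotonicity on the whole of \<open>nat\<close>.\<close>
  define q where "q i = rs ! min i n" for i
  have "mono q"
    using rs by (auto simp: mono_def q_def intro!: sorted_nth_mono)
  moreover have "q ` {..n} = A"
  proof -
    have "q ` {..n} = (\<lambda>i. rs ! i) ` {..<length rs}"
      using rs by (intro image_cong) (auto simp: q_def)
    also have "\<dots> = set rs"
      by (auto simp: set_conv_nth)
    finally show ?thesis using rs by simp
  qed
  ultimately show ?thesis by (rule that)
qed

section \<open>The augmented filtration and its independence from later increments\<close>

context wiener_process
begin

abbreviation \<F> :: "real \<Rightarrow> 'w measure" where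
  "\<F> t \<equiv> wiener_filtration M W (ennreal t)"

lemma wiener_generator_sets:
  "{W s -` A \<inter> space M | s A. 0 \<le> s \<and> ennreal s \<le> t \<and> A \<in> sets borel} \<union> null_sets M \<subseteq> sets M"
  using measurable_W by (auto intro: measurable_sets)

lemma space_wiener_filtration [simp]: "space (wiener_filtration M W t) = space M"
  by (simp add: wiener_filtration_def space_measure_of_conv)

lemma sets_wiener_filtration:
  "sets (wiener_filtration M W t) = sigma_sets (space M)
     ({W s -` A \<inter> space M | s A. 0 \<le> s \<and> ennreal s \<le> t \<and> A \<in> sets borel} \<union> null_sets M)"
  unfolding wiener_filtration_def
  by (rule sets_measure_of) (use wiener_generator_sets[of t] sets.sets_into_space in blast)

lemma sets_wiener_filtration_subset: "sets (wiener_filtration M W t) \<subseteq> sets M"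
  unfolding sets_wiener_filtration
  by (rule sets.sigma_sets_subset) (rule wiener_generator_sets)

lemma subalgebra_wiener_filtration: "subalgebra M (wiener_filtration M W t)"
  by (simp add: subalgebra_def sets_wiener_filtration_subset)

lemma sets_wiener_filtration_mono: "s \<le> t \<Longrightarrow> sets (\<F> s) \<subseteq> sets (\<F> t)"
  unfolding sets_wiener_filtration
  by (intro sigma_sets_mono' Un_mono order_refl Collect_mono) (blast intro: order_trans ennreal_leI)

lemma measurable_filtration_mono:
  "f \<in> borel_measurable (\<F> s) \<Longrightarrow> s \<le> t \<Longrightarrow> f \<in> borel_measurable (\<F> t)"
  using sets_wiener_filtration_mono by (auto simp: measurable_def)

lemma measurable_filtration_M: "f \<in> borel_measurable (\<F> s) \<Longrightarrow> f \<in> borel_measurable M"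
  by (rule measurable_from_subalg[OF subalgebra_wiener_filtration])

text \<open>An intersection-stable generator of \<open>\<F> s\<close> for \<open>0 \<le> s\<close>.
  The null sets are a separate part because the filtration is augmented by them. The sets
  \<open>A r\<close> are Borel for every \<open>r\<close>, not just on \<open>R\<close>, so that two
  index sets can be merged.\<close>

definition cylinders :: "real \<Rightarrow> 'w set set" where
  "cylinders s = {{w \<in> space M. \<forall>r\<in>R. W r w \<in> A r} | R A.
     finite R \<and> R \<subseteq> {0..s} \<and> (\<forall>r. A r \<in> sets borel)} \<union> null_sets M"

lemma cylinders_sets: "cylinders s \<subseteq> sets M"
proof -
  have "{w \<in> space M. \<forall>r\<in>R. W r w \<in> A r} \<in> sets M"
    if "finite R" "R \<subseteq> {0..s}" "\<forall>r. A r \<in> sets borel" for R A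
  proof -
    have "{w \<in> space M. W r w \<in> A r} \<in> sets M" if "r \<in> R" for r
      using measurable_sets[OF measurable_W[of r], of "A r"] that \<open>R \<subseteq> _\<close> \<open>\<forall>r. A r \<in> _\<close>
      by (auto simp: vimage_def Int_def conj_commute)
    then show ?thesis
      using that by (intro sets.sets_Collect_finite_All) auto
  qed
  then show ?thesis unfolding cylinders_def by auto
qed

lemma Int_stable_cylinders: "Int_stable (cylinders s)"
proof (rule Int_stableI)
  fix a b assume ab: "a \<in> cylinders s" "b \<in> cylinders s"
  show "a \<inter> b \<in> cylinders s"
  proof (cases "a \<in> null_sets M \<or> b \<in> null_sets M")
    case True
    then have "a \<inter> b \<in> null_sets M"
      using ab cylinders_sets by (auto intro: null_set_Int1 null_set_Int2)
    then show ?thesis by (simp add: cylinders_def)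
  next
    case False
    then obtain R A R' A' where
      a: "a = {w \<in> space M. \<forall>r\<in>R. W r w \<in> A r}" "finite R" "R \<subseteq> {0..s}" "\<forall>r. A r \<in> sets borel" and
      b: "b = {w \<in> space M. \<forall>r\<in>R'. W r w \<in> A' r}" "finite R'" "R' \<subseteq> {0..s}" "\<forall>r. A' r \<in> sets borel"
      using ab unfolding cylinders_def by blast
    \<comment> \<open>A time that occurs in only one of the two rectangles gets the trivial
      constraint \<open>UNIV\<close> from the other.\<close>
    define B where "B r = (if r \<in> R then A r else UNIV) \<inter> (if r \<in> R' then A' r else UNIV)" for r
    have "a \<inter> b = {w \<in> space M. \<forall>r\<in>R \<union> R'. W r w \<in> B r}"
      unfolding a b B_def by auto
    moreover have "\<forall>r. B r \<in> sets borel" using a b by (auto simp: B_def)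
    ultimately show ?thesis
      unfolding cylinders_def using a b
      by (intro UnI1 CollectI exI[of _ "R \<union> R'"] exI[of _ B]) auto
  qed
qed

lemma sets_filtration_cylinders:
  assumes "0 \<le> s" shows "sets (\<F> s) = sigma_sets (space M) (cylinders s)"
proof (rule antisym)
  show "sets (\<F> s) \<subseteq> sigma_sets (space M) (cylinders s)"
    unfolding sets_wiener_filtration
  proof (rule sigma_sets_mono, safe)
    fix r and A :: "(real ^ 'k) set" assume "0 \<le> r" "ennreal r \<le> ennreal s" "A \<in> sets borel"
    then have "W r -` A \<inter> space M \<in> cylinders s"
      using assms unfolding cylinders_def
      by (intro UnI1 CollectI exI[of _ "{r}"] exI[of _ "\<lambda>_. A"]) auto
    then show "W r -` A \<inter> space M \<in> sigma_sets (space M) (cylinders s)" by auto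
  qed (auto simp: cylinders_def)
  have "{w \<in> space M. \<forall>r\<in>R. W r w \<in> A r} \<in> sets (\<F> s)"
    if "finite R" "R \<subseteq> {0..s}" "\<forall>r. A r \<in> sets borel" for R A
  proof -
    have "{w \<in> space (\<F> s). W r w \<in> A r} \<in> sets (\<F> s)" if "r \<in> R" for r
    proof -
      have "W r -` A r \<inter> space M \<in> sets (\<F> s)"
        unfolding sets_wiener_filtration using that \<open>R \<subseteq> _\<close> \<open>\<forall>r. A r \<in> _\<close> assms
        by (intro sigma_sets.Basic UnI1 CollectI exI[of _ r] exI[of _ "A r"]) (auto intro: ennreal_leI)
      then show ?thesis by (auto simp: vimage_def Int_def conj_commute)
    qed
    then have "{w \<in> space (\<F> s). \<forall>r\<in>R. W r w \<in> A r} \<in> sets (\<F> s)"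
      using that by (intro sets.sets_Collect_finite_All) auto
    then show ?thesis by simp
  qed
  moreover have "null_sets M \<subseteq> sets (\<F> s)"
    unfolding sets_wiener_filtration by auto
  ultimately have "cylinders s \<subseteq> sets (\<F> s)"
    unfolding cylinders_def by auto
  from sets.sigma_sets_subset[OF this] show "sigma_sets (space M) (cylinders s) \<subseteq> sets (\<F> s)" by simp
qed

text \<open>Along a grid through \<open>0\<close>, the times in \<open>R\<close> and
  \<open>s\<close>, with \<open>t\<close> as the next node, the values of \<open>W r - W 0\<close>
  for \<open>r\<close> in \<open>R\<close> are partial sums of the first \<open>n\<close>
  increments, whereas \<open>W t - W s\<close> is the increment of the following cell. Grouping
  independent increments into these two blocks gives the product.\<close>

lemma prob_cylinder_increment:
  assumes st: "0 \<le> s" "s < t" and R: "finite R" "R \<subseteq> {0..s}" and A: "\<And>r. A r \<in> sets borel"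
    and B: "B \<in> sets borel"
  shows "prob ({w \<in> space M. \<forall>r\<in>R. W r w \<in> A r} \<inter> {w \<in> space M. W t w - W s w \<in> B})
       = prob {w \<in> space M. \<forall>r\<in>R. W r w \<in> A r} * prob {w \<in> space M. W t w - W s w \<in> B}"
proof -
  have "finite (R \<union> {0, s})" "R \<union> {0, s} \<noteq> {}" using R by auto
  then obtain q :: "nat \<Rightarrow> real" and n where q: "mono q" and q_img: "q ` {..n} = R \<union> {0, s}"
    by (rule finite_set_as_grid)
  define p where "p i = (if i \<le> n then q i else t)" for i
  have p_le: "q i \<in> {0..s}" if "i \<le> n" for i
  proof -
    have "q i \<in> q ` {..n}" using that by simp
    then have "q i \<in> R \<union> {0, s}" unfolding q_img .
    then show ?thesis using R st by auto
  qed
  have p_mono: "mono p"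
  proof (rule monoI)
    fix i j :: nat assume "i \<le> j"
    then show "p i \<le> p j"
      using monoD[OF q, of i j] p_le[of i] st by (cases "i \<le> n"; cases "j \<le> n") (auto simp: p_def)
  qed
  have "0 \<in> q ` {..n}" using q_img by simp
  then obtain i0 where "i0 \<le> n" "q i0 = 0" by auto
  then have p0: "p 0 = 0" using monoD[OF q, of 0 i0] p_le[of 0] by (auto simp: p_def)
  have "s \<in> q ` {..n}" using q_img by simp
  then obtain i1 where "i1 \<le> n" "q i1 = s" by auto
  then have pn: "p n = s" using monoD[OF q, of i1 n] p_le[of n] by (auto simp: p_def)
  have pn1: "p (Suc n) = t" by (simp add: p_def)
  have "\<forall>r\<in>R. \<exists>k\<le>n. p k = r"
  proof
    fix r assume "r \<in> R"
    then have "r \<in> q ` {..n}" using q_img by simp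
    then show "\<exists>k\<le>n. p k = r" by (auto simp: p_def)
  qed
  then obtain \<kappa> where \<kappa>: "\<And>r. r \<in> R \<Longrightarrow> \<kappa> r \<le> n" "\<And>r. r \<in> R \<Longrightarrow> p (\<kappa> r) = r" by metis
  define U where "U j w = W (p (Suc j)) w - W (p j) w" for j w
  have ind: "indep_vars (\<lambda>_. borel) U {..<Suc n}"
    using W_indep_increments[of p "Suc n"] p0 p_mono by (simp add: U_def[abs_def])
  have sumU: "(\<Sum>j<k. U j w) = W (p k) w - W 0 w" for k w
    unfolding U_def using sum_lessThan_telescope[of "\<lambda>j. W (p j) w" k] p0 by simp
  let ?PA = "PiM {..<n} (\<lambda>_. borel :: (real ^ 'k) measure)"
  let ?PB = "PiM {n} (\<lambda>_. borel :: (real ^ 'k) measure)"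
  have iv: "indep_var ?PA (\<lambda>w. restrict (\<lambda>i. U i w) {..<n}) ?PB (\<lambda>w. restrict (\<lambda>i. U i w) {n})"
    by (rule indep_var_restrict[OF ind]) auto
  define E where "E = {f \<in> space ?PA. \<forall>r\<in>R. (\<Sum>j<\<kappa> r. f j) \<in> A r}"
  have E: "E \<in> sets ?PA"
  proof -
    have "{f \<in> space ?PA. (\<Sum>j<\<kappa> r. f j) \<in> A r} \<in> sets ?PA" if "r \<in> R" for r
    proof -
      have "(\<lambda>f. \<Sum>j<\<kappa> r. f j) \<in> measurable ?PA borel"
        using \<kappa>(1)[OF that] by (intro borel_measurable_sum measurable_component_singleton) auto
      from measurable_sets[OF this A[of r]] show ?thesis
        by (auto simp: vimage_def Int_def conj_commute)
    qed
    then show ?thesis unfolding E_def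
      using R by (intro sets.sets_Collect_finite_All) auto
  qed
  define E' where "E' = {f \<in> space ?PB. f n \<in> B}"
  have E': "E' \<in> sets ?PB"
    unfolding E'_def using B by measurable
  have rE: "restrict (\<lambda>i. U i w) {..<n} \<in> E \<longleftrightarrow> (\<forall>r\<in>R. W r w - W 0 w \<in> A r)" for w
  proof -
    have "(\<Sum>j<\<kappa> r. restrict (\<lambda>i. U i w) {..<n} j) = W r w - W 0 w" if "r \<in> R" for r
    proof -
      have "(\<Sum>j<\<kappa> r. restrict (\<lambda>i. U i w) {..<n} j) = (\<Sum>j<\<kappa> r. U j w)"
        using \<kappa>(1)[OF that] by (intro sum.cong) auto
      then show ?thesis by (simp add: sumU \<kappa>(2)[OF that])
    qed
    then show ?thesis unfolding E_def by (auto simp: space_PiM)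
  qed
  have rE': "restrict (\<lambda>i. U i w) {n} \<in> E' \<longleftrightarrow> W t w - W s w \<in> B" for w
    unfolding E'_def by (auto simp: space_PiM U_def pn pn1)
  have mes: "{w \<in> space M. \<forall>r\<in>R. W r w \<in> A r} \<in> sets M"
    using cylinders_sets[of s] R A unfolding cylinders_def by blast
  have W0: "AE w in M. W 0 w = 0" by (rule W_start)
  have mW: "W r \<in> borel_measurable M" if "r \<in> R" for r
    using measurable_W R that by auto
  have mW': "{w \<in> space M. W t w - W s w \<in> B} \<in> sets M"
  proof -
    have "(\<lambda>w. W t w - W s w) \<in> borel_measurable M" using measurable_W st by simp
    from measurable_sets[OF this B] show ?thesis by (simp add: vimage_def Int_def conj_commute)
  qed
  have mes2: "{w \<in> space M. \<forall>r\<in>R. W r w - W 0 w \<in> A r} \<in> sets M"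
  proof -
    have "{w \<in> space M. W r w - W 0 w \<in> A r} \<in> sets M" if "r \<in> R" for r
    proof -
      have "(\<lambda>w. W r w - W 0 w) \<in> borel_measurable M" using mW that measurable_W by simp
      from measurable_sets[OF this A[of r]] show ?thesis by (simp add: vimage_def Int_def conj_commute)
    qed
    then show ?thesis
      using R by (intro sets.sets_Collect_finite_All) auto
  qed
  \<comment> \<open>\<open>W 0 = 0\<close> holds only almost surely, so the event is first rewritten
    in terms of \<open>W r - W 0\<close>, which is what sums of increments can see; this changes it
    by a null set.\<close>
  have "prob ({w \<in> space M. \<forall>r\<in>R. W r w \<in> A r} \<inter> {w \<in> space M. W t w - W s w \<in> B})
      = prob ({w \<in> space M. \<forall>r\<in>R. W r w - W 0 w \<in> A r} \<inter> {w \<in> space M. W t w - W s w \<in> B})"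
    using W0 mes mes2 mW' by (intro finite_measure_eq_AE) auto
  also have "\<dots> = prob ((\<lambda>w. (restrict (\<lambda>i. U i w) {..<n}, restrict (\<lambda>i. U i w) {n})) -` (E \<times> E') \<inter> space M)"
    by (rule arg_cong[of _ _ prob]) (use rE rE' in auto)
  also have "\<dots> = prob ((\<lambda>w. restrict (\<lambda>i. U i w) {..<n}) -` E \<inter> space M) *
      prob ((\<lambda>w. restrict (\<lambda>i. U i w) {n}) -` E' \<inter> space M)"
    by (rule indep_varD[OF iv E E'])
  also have "(\<lambda>w. restrict (\<lambda>i. U i w) {..<n}) -` E \<inter> space M = {w \<in> space M. \<forall>r\<in>R. W r w - W 0 w \<in> A r}"
    using rE by auto
  also have "(\<lambda>w. restrict (\<lambda>i. U i w) {n}) -` E' \<inter> space M = {w \<in> space M. W t w - W s w \<in> B}"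
    using rE' by auto
  also have "prob {w \<in> space M. \<forall>r\<in>R. W r w - W 0 w \<in> A r} = prob {w \<in> space M. \<forall>r\<in>R. W r w \<in> A r}"
    using W0 mes mes2 by (intro finite_measure_eq_AE) auto
  finally show ?thesis .
qed

text \<open>The product rule on cylinders and on preimages under the increment extends to the
  generated sigma-algebras, both generators being stable under intersection; the null sets among the
  cylinders satisfy it trivially. The variables \<open>\<phi>\<close> and
  \<open>g (W t w - W s w)\<close> generate smaller sigma-algebras.\<close>

lemma indep_var_increment:
  fixes \<phi> g :: "_ \<Rightarrow> real"
  assumes st: "0 \<le> s" "s < t" and \<phi>: "\<phi> \<in> borel_measurable (\<F> s)" and g: "g \<in> borel_measurable borel"
  shows "indep_var borel \<phi> borel (\<lambda>w. g (W t w - W s w))"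
proof -
  define \<G> where "\<G> = {(\<lambda>w. W t w - W s w) -` B \<inter> space M | B. B \<in> sets borel}"
  have mW: "(\<lambda>w. W t w - W s w) \<in> borel_measurable M" using measurable_W st by simp
  have "indep_set (cylinders s) \<G>"
  proof (rule indep_setI)
    show "cylinders s \<subseteq> events" by (rule cylinders_sets)
    show G: "\<G> \<subseteq> events" unfolding \<G>_def using mW by (auto intro: measurable_sets)
    fix a b assume a: "a \<in> cylinders s" and b: "b \<in> \<G>"
    show "prob (a \<inter> b) = prob a * prob b"
    proof (cases "a \<in> null_sets M")
      case True
      then have "a \<inter> b \<in> null_sets M" using b G by (auto intro: null_set_Int2)
      then show ?thesis using True by (simp add: measure_eq_0_null_sets)
    next
      case False
      with a obtain R A where a': "a = {w \<in> space M. \<forall>r\<in>R. W r w \<in> A r}" "finite R" "R \<subseteq> {0..s}"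
        "\<forall>r. A r \<in> sets borel" unfolding cylinders_def by blast
      from b obtain B where B: "B \<in> sets borel" "b = {w \<in> space M. W t w - W s w \<in> B}"
        unfolding \<G>_def by (auto simp: vimage_def Int_def conj_commute)
      show ?thesis unfolding a' B
        by (rule prob_cylinder_increment[OF st a'(2,3) _ B(1)]) (use a' in auto)
    qed
  qed
  moreover have "Int_stable \<G>" unfolding \<G>_def Int_stable_def
  proof safe
    fix B B' :: "(real ^ 'k) set" assume "B \<in> sets borel" "B' \<in> sets borel"
    then show "\<exists>C. (\<lambda>w. W t w - W s w) -` B \<inter> space M \<inter> ((\<lambda>w. W t w - W s w) -` B' \<inter> space M)
       = (\<lambda>w. W t w - W s w) -` C \<inter> space M \<and> C \<in> sets borel"
      by (intro exI[of _ "B \<inter> B'"]) auto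
  qed
  ultimately have "indep_set (sigma_sets (space M) (cylinders s)) (sigma_sets (space M) \<G>)"
    using Int_stable_cylinders by (intro indep_set_sigma_sets)
  then have ind: "indep_set (sets (\<F> s)) (sigma_sets (space M) \<G>)"
    using sets_filtration_cylinders st by simp
  have "sigma_sets (space M) {\<phi> -` A \<inter> space M |A. A \<in> sets borel} \<subseteq> sets (\<F> s)"
  proof -
    have "{\<phi> -` A \<inter> space (\<F> s) |A. A \<in> sets borel} \<subseteq> sets (\<F> s)"
      using measurable_sets[OF \<phi>] by auto
    from sets.sigma_sets_subset[OF this] show ?thesis by simp
  qed
  moreover have "sigma_sets (space M) {(\<lambda>w. g (W t w - W s w)) -` A \<inter> space M |A. A \<in> sets borel}
      \<subseteq> sigma_sets (space M) \<G>"
  proof (rule sigma_sets_mono', safe)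
    fix A :: "real set" assume "A \<in> sets borel"
    then have "g -` A \<in> sets borel" using measurable_sets[OF g, of A] by simp
    then show "(\<lambda>w. g (W t w - W s w)) -` A \<inter> space M \<in> \<G>"
      unfolding \<G>_def by (auto intro!: exI[of _ "g -` A"])
  qed
  ultimately have "indep_set (sigma_sets (space M) {\<phi> -` A \<inter> space M |A. A \<in> sets borel})
      (sigma_sets (space M) {(\<lambda>w. g (W t w - W s w)) -` A \<inter> space M |A. A \<in> sets borel})"
    unfolding indep_set_def by (intro indep_sets_mono_sets[OF ind[unfolded indep_set_def]]) (simp split: bool.split)
  then show ?thesis
    unfolding indep_var_eq using \<phi> g mW measurable_compose[OF mW g]
    by (auto intro: measurable_filtration_M)
qed

text \<open>Diagonal products are second moments of a normal density; off the diagonal the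
  components are independent and centred.\<close>

lemma increment_moments:
  assumes st: "0 \<le> s" "s < t"
  shows "integrable M (\<lambda>w. (W t w - W s w) $ i)" "expectation (\<lambda>w. (W t w - W s w) $ i) = 0"
    "integrable M (\<lambda>w. (W t w - W s w) $ i * (W t w - W s w) $ j)"
    "expectation (\<lambda>w. (W t w - W s w) $ i * (W t w - W s w) $ j) = (if i = j then t - s else 0)"
proof -
  have sig: "0 < sqrt (t - s)" using st by simp
  have I1: "integrable M (\<lambda>w. (W t w - W s w) $ i)" for i
    using distributed_integrable[OF W_normal[OF st, of i], of "\<lambda>x. x"]
      integrable_normal_moment_nz_1[OF sig, of 0] by (simp add: normal_density_nonneg)
  have E1: "expectation (\<lambda>w. (W t w - W s w) $ i) = 0" for i
    using distributed_integral[OF W_normal[OF st, of i], of "\<lambda>x. x"]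
      integral_normal_moment_nz_1[OF sig, of 0] by (simp add: normal_density_nonneg)
  have I2: "integrable M (\<lambda>w. ((W t w - W s w) $ i)\<^sup>2)"
    using distributed_integrable[OF W_normal[OF st, of i], of "\<lambda>x. x\<^sup>2"]
      integrable_normal_moment[OF sig, of 0 2] by (simp add: normal_density_nonneg)
  have E2: "expectation (\<lambda>w. ((W t w - W s w) $ i)\<^sup>2) = t - s"
    using distributed_integral[OF W_normal[OF st, of i], of "\<lambda>x. x\<^sup>2"]
      integral_normal_moment_even[OF sig, of 0 1] st by (simp add: normal_density_nonneg)
  show "integrable M (\<lambda>w. (W t w - W s w) $ i)" "expectation (\<lambda>w. (W t w - W s w) $ i) = 0"
    by fact+
  have "integrable M (\<lambda>w. (W t w - W s w) $ i * (W t w - W s w) $ j) \<and>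
    expectation (\<lambda>w. (W t w - W s w) $ i * (W t w - W s w) $ j) = (if i = j then t - s else 0)"
  proof (cases "i = j")
    case True
    then show ?thesis using I2 E2 by (simp add: power2_eq_square)
  next
    case False
    have "indep_var borel (\<lambda>w. (W t w - W s w) $ i) borel (\<lambda>w. (W t w - W s w) $ j)"
    proof -
      have "indep_var borel ((\<lambda>f. f i) \<circ> (\<lambda>w. restrict (\<lambda>i. (W t w - W s w) $ i) {i}))
          borel ((\<lambda>f. f j) \<circ> (\<lambda>w. restrict (\<lambda>i. (W t w - W s w) $ i) {j}))"
        by (intro indep_var_compose[OF indep_var_restrict[OF W_indep_components[OF st]]]) (use False in auto)
      then show ?thesis by (simp add: comp_def)
    qed
    from indep_var_integrable[OF this I1 I1] indep_var_lebesgue_integral[OF this I1 I1]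
    show ?thesis using False E1 by simp
  qed
  then show "integrable M (\<lambda>w. (W t w - W s w) $ i * (W t w - W s w) $ j)"
    "expectation (\<lambda>w. (W t w - W s w) $ i * (W t w - W s w) $ j) = (if i = j then t - s else 0)"
    by auto
qed

text \<open>Conditional mean and covariance of an increment given \<open>\<F> s\<close>, in weak
  form: a weight known at time \<open>s\<close> factors out by independence.\<close>

lemma increment_orthogonal:
  assumes st: "0 \<le> s" "s < t" and \<phi>: "\<phi> \<in> borel_measurable (\<F> s)" "integrable M \<phi>"
  shows "integrable M (\<lambda>w. \<phi> w * (W t w - W s w) $ i)"
    "expectation (\<lambda>w. \<phi> w * (W t w - W s w) $ i) = 0"
    "integrable M (\<lambda>w. \<phi> w * ((W t w - W s w) $ i * (W t w - W s w) $ j))"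
    "expectation (\<lambda>w. \<phi> w * ((W t w - W s w) $ i * (W t w - W s w) $ j))
       = (if i = j then (t - s) * expectation \<phi> else 0)"
proof -
  note m = increment_moments[OF st]
  have iv1: "indep_var borel \<phi> borel (\<lambda>w. (W t w - W s w) $ i)"
    using indep_var_increment[OF st \<phi>(1), of "\<lambda>x. x $ i"] by simp
  have iv2: "indep_var borel \<phi> borel (\<lambda>w. (W t w - W s w) $ i * (W t w - W s w) $ j)"
    using indep_var_increment[OF st \<phi>(1), of "\<lambda>x. x $ i * x $ j"] by simp
  show "integrable M (\<lambda>w. \<phi> w * (W t w - W s w) $ i)"
    by (rule indep_var_integrable[OF iv1 \<phi>(2) m(1)])
  show "expectation (\<lambda>w. \<phi> w * (W t w - W s w) $ i) = 0"
    using indep_var_lebesgue_integral[OF iv1 \<phi>(2) m(1)] m(2) by simp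
  show "integrable M (\<lambda>w. \<phi> w * ((W t w - W s w) $ i * (W t w - W s w) $ j))"
    by (rule indep_var_integrable[OF iv2 \<phi>(2) m(3)])
  show "expectation (\<lambda>w. \<phi> w * ((W t w - W s w) $ i * (W t w - W s w) $ j))
       = (if i = j then (t - s) * expectation \<phi> else 0)"
    using indep_var_lebesgue_integral[OF iv2 \<phi>(2) m(3)] m(4) by simp
qed

end

section \<open>Convergence to zero in probability\<close>

lemma LIMSEQ_squeeze_zero:
  fixes f g :: "nat \<Rightarrow> real"
  assumes "\<And>j. f j \<le> g j" "g \<longlonglongrightarrow> 0" "\<And>j. 0 \<le> f j"
  shows "f \<longlonglongrightarrow> 0"
  by (rule tendsto_sandwich[OF always_eventually always_eventually tendsto_const assms(2)]) (use assms in auto)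

text \<open>Convergence in probability through the metric
  \<open>expectation (\<lambda>w. min 1 \<bar>f w\<bar>)\<close>. It reduces the notion to the
  convergence of a single real sequence, so that domination and addition become inequalities between
  expectations and diagonal sequences are easy to choose.\<close>

definition (in prob_space) tends_in_prob0 :: "(nat \<Rightarrow> 'a \<Rightarrow> real) \<Rightarrow> bool" where
  "tends_in_prob0 f \<longleftrightarrow> (\<forall>j. f j \<in> borel_measurable M) \<and>
     (\<lambda>j. expectation (\<lambda>w. min 1 \<bar>f j w\<bar>)) \<longlonglongrightarrow> 0"

context prob_space
begin

lemma integrable_min_one: "f \<in> borel_measurable M \<Longrightarrow> integrable M (\<lambda>w. min 1 \<bar>f w :: real\<bar>)"
  by (rule integrable_const_bound[of _ 1]) auto

text \<open>Markov's inequality for the truncated variable; \<open>\<epsilon> \<le> 1\<close>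
  ensures that the truncation does not hide the event. With the converse estimate that follows, the
  metric describes the usual convergence in probability.\<close>

lemma prob_greater_le_expectation_min:
  fixes f :: "'a \<Rightarrow> real"
  assumes f: "f \<in> borel_measurable M" and "0 < \<epsilon>" "\<epsilon> \<le> 1"
  shows "prob {w \<in> space M. \<epsilon> < \<bar>f w\<bar>} \<le> expectation (\<lambda>w. min 1 \<bar>f w\<bar>) / \<epsilon>"
proof -
  have "prob {w \<in> space M. \<epsilon> < \<bar>f w\<bar>} \<le> prob {w \<in> space M. \<epsilon> \<le> min 1 \<bar>f w\<bar>}"
    using f assms by (intro finite_measure_mono) auto
  also have "\<dots> \<le> expectation (\<lambda>w. min 1 \<bar>f w\<bar>) / \<epsilon>"
    by (rule integral_Markov_inequality_measure[OF integrable_min_one[OF f], where A="{}"]) (use assms in auto)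
  finally show ?thesis .
qed

lemma expectation_min_le_prob_greater:
  fixes f :: "'a \<Rightarrow> real"
  assumes f: "f \<in> borel_measurable M" and "0 < \<epsilon>"
  shows "expectation (\<lambda>w. min 1 \<bar>f w\<bar>) \<le> \<epsilon> + prob {w \<in> space M. \<epsilon> < \<bar>f w\<bar>}"
proof -
  have "expectation (\<lambda>w. min 1 \<bar>f w\<bar>) \<le> expectation (\<lambda>w. \<epsilon> + indicator {w \<in> space M. \<epsilon> < \<bar>f w\<bar>} w)"
    using f assms
    by (intro integral_mono integrable_min_one Bochner_Integration.integrable_add integrable_real_indicator)
      (auto simp: indicator_def emeasure_eq_measure)
  also have "\<dots> = \<epsilon> + prob {w \<in> space M. \<epsilon> < \<bar>f w\<bar>}"
    using f by (subst Bochner_Integration.integral_add) (auto simp: emeasure_eq_measure prob_space)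
  finally show ?thesis .
qed

lemma tends_in_prob0I:
  assumes "\<And>j. f j \<in> borel_measurable M"
    and lim: "\<And>\<epsilon>. 0 < \<epsilon> \<Longrightarrow> (\<lambda>j. prob {w \<in> space M. \<epsilon> < \<bar>f j w\<bar>}) \<longlonglongrightarrow> 0"
  shows "tends_in_prob0 f"
proof -
  have "(\<lambda>j. expectation (\<lambda>w. min 1 \<bar>f j w\<bar>)) \<longlonglongrightarrow> 0"
  proof (rule order_tendstoI)
    fix a :: real assume "0 < a"
    then have "eventually (\<lambda>j. prob {w \<in> space M. a / 2 < \<bar>f j w\<bar>} < a / 2) sequentially"
      using order_tendstoD(2)[OF lim[of "a / 2"], of "a / 2"] by simp
    then show "eventually (\<lambda>j. expectation (\<lambda>w. min 1 \<bar>f j w\<bar>) < a) sequentially"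
    proof eventually_elim
      case (elim j)
      with expectation_min_le_prob_greater[OF assms(1)[of j], of "a / 2"] \<open>0 < a\<close> show ?case by simp
    qed
  next
    fix a :: real assume "a < 0"
    then have "a < expectation (\<lambda>w. min 1 \<bar>f j w\<bar>)" for j
      by (rule less_le_trans) simp
    then show "eventually (\<lambda>j. a < expectation (\<lambda>w. min 1 \<bar>f j w\<bar>)) sequentially" by simp
  qed
  with assms(1) show ?thesis unfolding tends_in_prob0_def by auto
qed

lemma tends_in_prob0_dominated:
  assumes f: "tends_in_prob0 f" and h: "\<And>j. h j \<in> borel_measurable M"
    and le: "\<And>j. AE w in M. \<bar>h j w\<bar> \<le> C * \<bar>f j w\<bar>"
  shows "tends_in_prob0 h"
proof -
  \<comment> \<open>At least \<open>1\<close>, so that the factor can be pulled out of the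
    truncation: \<open>min 1 (K * x) \<le> K * min 1 x\<close> for \<open>0 \<le> x\<close>.\<close>
  define K where "K = max 1 C"
  have fm: "f j \<in> borel_measurable M" for j using f by (auto simp: tends_in_prob0_def)
  have "expectation (\<lambda>w. min 1 \<bar>h j w\<bar>) \<le> K * expectation (\<lambda>w. min 1 \<bar>f j w\<bar>)" for j
  proof -
    have "AE w in M. min 1 \<bar>h j w\<bar> \<le> K * min 1 \<bar>f j w\<bar>"
      using le[of j]
    proof eventually_elim
      case (elim w)
      then have "\<bar>h j w\<bar> \<le> K * \<bar>f j w\<bar>"
        using mult_right_mono[of C K "\<bar>f j w\<bar>"] by (auto simp: K_def)
      moreover have "1 \<le> K" by (simp add: K_def)
      ultimately show ?case by (auto simp: min_def)
    qed
    then have "expectation (\<lambda>w. min 1 \<bar>h j w\<bar>) \<le> expectation (\<lambda>w. K * min 1 \<bar>f j w\<bar>)"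
      using h fm by (intro integral_mono_AE integrable_min_one integrable_mult_right) auto
    then show ?thesis by simp
  qed
  moreover have "(\<lambda>j. K * expectation (\<lambda>w. min 1 \<bar>f j w\<bar>)) \<longlonglongrightarrow> 0"
    using f unfolding tends_in_prob0_def by (auto intro: tendsto_mult_right_zero)
  ultimately have "(\<lambda>j. expectation (\<lambda>w. min 1 \<bar>h j w\<bar>)) \<longlonglongrightarrow> 0"
    by (rule LIMSEQ_squeeze_zero) simp
  with h show ?thesis unfolding tends_in_prob0_def by auto
qed

lemma tends_in_prob0_add:
  assumes f: "tends_in_prob0 f" and g: "tends_in_prob0 g"
  shows "tends_in_prob0 (\<lambda>j w. \<bar>f j w\<bar> + \<bar>g j w\<bar>)"
proof -
  have m: "f j \<in> borel_measurable M" "g j \<in> borel_measurable M" for j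
    using f g by (auto simp: tends_in_prob0_def)
  have "expectation (\<lambda>w. min 1 \<bar>\<bar>f j w\<bar> + \<bar>g j w\<bar>\<bar>)
      \<le> expectation (\<lambda>w. min 1 \<bar>f j w\<bar>) + expectation (\<lambda>w. min 1 \<bar>g j w\<bar>)" for j
  proof -
    have "expectation (\<lambda>w. min 1 \<bar>\<bar>f j w\<bar> + \<bar>g j w\<bar>\<bar>)
        \<le> expectation (\<lambda>w. min 1 \<bar>f j w\<bar> + min 1 \<bar>g j w\<bar>)"
      using m by (intro integral_mono integrable_min_one Bochner_Integration.integrable_add) auto
    then show ?thesis
      using m by (subst (asm) Bochner_Integration.integral_add) (auto intro: integrable_min_one)
  qed
  moreover have "(\<lambda>j. expectation (\<lambda>w. min 1 \<bar>f j w\<bar>) + expectation (\<lambda>w. min 1 \<bar>g j w\<bar>)) \<longlonglongrightarrow> 0"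
    using f g unfolding tends_in_prob0_def by (auto intro!: tendsto_add_zero)
  ultimately have "(\<lambda>j. expectation (\<lambda>w. min 1 \<bar>\<bar>f j w\<bar> + \<bar>g j w\<bar>\<bar>)) \<longlonglongrightarrow> 0"
    by (rule LIMSEQ_squeeze_zero) simp
  with m show ?thesis unfolding tends_in_prob0_def by auto
qed

lemma tends_in_prob0_sum:
  assumes "finite A" "\<And>k. k \<in> A \<Longrightarrow> tends_in_prob0 (f k)"
  shows "tends_in_prob0 (\<lambda>j w. \<Sum>k\<in>A. \<bar>f k j w\<bar>)"
  using assms
proof (induction A rule: finite_induct)
  case empty
  then show ?case by (simp add: tends_in_prob0_def)
next
  case (insert k A)
  from tends_in_prob0_add[OF insert.prems[of k] insert.IH] insert show ?case
    by (simp add: abs_of_nonneg sum_nonneg)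
qed

lemma tends_in_prob0_add_dominated:
  assumes "tends_in_prob0 f" "tends_in_prob0 g" "\<And>j. h j \<in> borel_measurable M"
    and "\<And>j. AE w in M. \<bar>h j w\<bar> \<le> C * (\<bar>f j w\<bar> + \<bar>g j w\<bar>)"
  shows "tends_in_prob0 h"
  by (rule tends_in_prob0_dominated[OF tends_in_prob0_add[OF assms(1,2)] assms(3), where C=C])
    (use assms(4) in simp)

lemma tends_in_prob0_pointwise:
  assumes m: "\<And>j. f j \<in> borel_measurable M" and lim: "AE w in M. (\<lambda>j. f j w) \<longlonglongrightarrow> 0"
  shows "tends_in_prob0 f"
proof -
  have "(\<lambda>j. expectation (\<lambda>w. min 1 \<bar>f j w\<bar>)) \<longlonglongrightarrow> expectation (\<lambda>w. 0)"
  proof (rule integral_dominated_convergence[where w="\<lambda>_. 1"])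
    show "AE w in M. (\<lambda>j. min 1 \<bar>f j w\<bar>) \<longlonglongrightarrow> 0"
      using lim
    proof eventually_elim
      case (elim w)
      then show ?case using tendsto_min[OF tendsto_const[of 1] tendsto_rabs[OF elim]] by simp
    qed
  qed (use m in auto)
  with m show ?thesis unfolding tends_in_prob0_def by simp
qed

text \<open>Under a uniform bound a variable is at most a constant times its truncation, so
  convergence in probability becomes convergence in mean. This is the gain from truncating simple
  integrands.\<close>

lemma tends_in_prob0_bounded:
  assumes f: "tends_in_prob0 f" and C: "\<And>j. AE w in M. \<bar>f j w\<bar> \<le> C"
  shows "(\<lambda>j. expectation (\<lambda>w. \<bar>f j w\<bar>)) \<longlonglongrightarrow> 0"
proof -
  define K where "K = max 1 C"
  have fm: "f j \<in> borel_measurable M" for j using f by (auto simp: tends_in_prob0_def)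
  have "expectation (\<lambda>w. \<bar>f j w\<bar>) \<le> K * expectation (\<lambda>w. min 1 \<bar>f j w\<bar>)" for j
  proof -
    have "AE w in M. \<bar>f j w\<bar> \<le> K * min 1 \<bar>f j w\<bar>"
      using C[of j]
    proof eventually_elim
      case (elim w)
      have "\<bar>f j w\<bar> \<le> K * \<bar>f j w\<bar>" using mult_right_mono[of 1 K "\<bar>f j w\<bar>"] by (auto simp: K_def)
      moreover have "\<bar>f j w\<bar> \<le> K" using elim by (simp add: K_def)
      ultimately show ?case by (auto simp: min_def)
    qed
    then have "expectation (\<lambda>w. \<bar>f j w\<bar>) \<le> expectation (\<lambda>w. K * min 1 \<bar>f j w\<bar>)"
      using fm C[of j]
      by (intro integral_mono_AE integrable_min_one integrable_mult_right integrable_const_bound[of _ C]) auto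
    then show ?thesis by simp
  qed
  moreover have "(\<lambda>j. K * expectation (\<lambda>w. min 1 \<bar>f j w\<bar>)) \<longlonglongrightarrow> 0"
    using f unfolding tends_in_prob0_def by (auto intro: tendsto_mult_right_zero)
  ultimately show ?thesis
    by (rule LIMSEQ_squeeze_zero) simp
qed

lemma tends_in_prob0_AE_subseq:
  assumes f: "tends_in_prob0 f"
  obtains r where "strict_mono r" "AE w in M. (\<lambda>j. f (r j) w) \<longlonglongrightarrow> 0"
proof -
  have fm: "f j \<in> borel_measurable M" for j using f by (auto simp: tends_in_prob0_def)
  have "\<exists>r::nat\<Rightarrow>nat. strict_mono r \<and> (AE w in M. (\<lambda>j. min 1 \<bar>f (r j) w\<bar>) \<longlonglongrightarrow> 0)"
    using f fm by (intro tendsto_L1_AE_subseq integrable_min_one) (auto simp: tends_in_prob0_def)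
  then obtain r :: "nat \<Rightarrow> nat" where r: "strict_mono r" "AE w in M. (\<lambda>j. min 1 \<bar>f (r j) w\<bar>) \<longlonglongrightarrow> 0"
    by blast
  have "AE w in M. (\<lambda>j. f (r j) w) \<longlonglongrightarrow> 0"
    using r(2)
  proof eventually_elim
    case (elim w)
    \<comment> \<open>From some index on the truncation at \<open>1\<close> is inactive, so the
      limit of the truncated variables is that of the variables themselves.\<close>
    have ev: "eventually (\<lambda>j. min 1 \<bar>f (r j) w\<bar> < 1) sequentially"
      using order_tendstoD(2)[OF elim, of 1] by simp
    have "(\<lambda>j. \<bar>f (r j) w\<bar>) \<longlonglongrightarrow> 0"
      by (rule Lim_transform_eventually[OF elim]) (use ev in eventually_elim, auto)
    then show ?case by (rule tendsto_rabs_zero_cancel)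
  qed
  with r(1) show ?thesis by (rule that)
qed

end

section \<open>Simple processes\<close>

text \<open>A grid is a monotone sequence of which only the nodes up to the given index count.
  Repeated nodes, that is empty cells, are allowed, so that cutting a grid off at some time gives a
  grid again.\<close>

definition grid_refines :: "(nat \<Rightarrow> real) \<Rightarrow> nat \<Rightarrow> (nat \<Rightarrow> real) \<Rightarrow> nat \<Rightarrow> bool" where
  "grid_refines p m q n \<longleftrightarrow> mono p \<and> 0 \<le> p 0 \<and> q ` {..n} \<subseteq> p ` {..m}"

lemma grid_locate:
  fixes q :: "nat \<Rightarrow> real"
  assumes "s \<in> {q 0<..q n}"
  obtains i where "i < n" "s \<in> {q i<..q (Suc i)}"
  using assms
proof (induction n arbitrary: thesis)
  case (Suc n)
  show ?case
  proof (cases "s \<le> q n")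
    case True
    show ?thesis
    proof (rule Suc.IH)
      show thesis if "i < n" "s \<in> {q i<..q (Suc i)}" for i using that Suc.prems(1)[of i] by simp
    qed (use True Suc.prems in auto)
  next
    case False
    then show ?thesis using Suc.prems by (intro Suc.prems(1)[of n]) auto
  qed
qed auto

lemma grid_locate_unique:
  fixes q :: "nat \<Rightarrow> real"
  assumes "mono q" "s \<in> {q i<..q (Suc i)}" "s \<in> {q j<..q (Suc j)}"
  shows "i = j"
proof (rule ccontr)
  assume "i \<noteq> j"
  then have "Suc i \<le> j \<or> Suc j \<le> i" by linarith
  then have "q (Suc i) \<le> q j \<or> q (Suc j) \<le> q i" using monoD[OF assms(1)] by blast
  then show False using assms by auto
qed

lemma common_grid:
  fixes q q' :: "nat \<Rightarrow> real"
  assumes "mono q" "0 \<le> q 0" "mono q'" "0 \<le> q' 0" "finite A" "A \<subseteq> {0..}"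
  obtains p m where "grid_refines p m q n" "grid_refines p m q' n'" "A \<subseteq> p ` {..m}"
proof -
  have "finite (q ` {..n} \<union> q' ` {..n'} \<union> A)" "q ` {..n} \<union> q' ` {..n'} \<union> A \<noteq> {}" using assms by auto
  then obtain p :: "nat \<Rightarrow> real" and m where p: "mono p" "p ` {..m} = q ` {..n} \<union> q' ` {..n'} \<union> A"
    by (rule finite_set_as_grid)
  have "p 0 \<in> q ` {..n} \<union> q' ` {..n'} \<union> A" unfolding p(2)[symmetric] by auto
  then have "0 \<le> p 0"
  proof (elim UnE imageE)
    fix i assume "p 0 = q i" then show ?thesis using assms(2) monoD[OF assms(1), of 0 i] by simp
  next
    fix i assume "p 0 = q' i" then show ?thesis using assms(4) monoD[OF assms(3), of 0 i] by simp
  qed (use assms(6) in auto)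
  with p show ?thesis by (intro that[of p m]) (auto simp: grid_refines_def)
qed

lemma grid_refines_ends:
  assumes "grid_refines p m q n"
  shows "p 0 \<le> q 0" "q n \<le> p m"
proof -
  have "q 0 \<in> p ` {..m}" "q n \<in> p ` {..m}" using assms by (auto simp: grid_refines_def)
  then show "p 0 \<le> q 0" "q n \<le> p m" using assms by (auto simp: grid_refines_def mono_def)
qed

lemma grid_refines_cell:
  assumes "grid_refines p m q n" "k \<le> n" "p i < q k"
  shows "p (Suc i) \<le> q k"
proof -
  have "q k \<in> p ` {..m}" and p: "mono p" using assms by (auto simp: grid_refines_def)
  then obtain l where l: "q k = p l" by auto
  then have "i < l" using assms monoD[OF p, of l i] by force
  then show ?thesis using monoD[OF p, of "Suc i" l] l by auto
qed

text \<open>Telescoping of \<open>f\<close> composed with the projection onto \<open>[q k, q (k+1)]\<close>.\<close>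

lemma grid_refines_telescope:
  fixes f :: "real \<Rightarrow> 'b::real_vector"
  assumes r: "grid_refines p m q n" and "k < n" and q: "mono q"
  shows "(\<Sum>i<m. indicator {q k<..q (Suc k)} (p (Suc i)) *\<^sub>R (f (p (Suc i)) - f (p i)))
     = f (q (Suc k)) - f (q k)"
proof -
  define g where "g x = f (max (q k) (min (q (Suc k)) x))" for x
  have p: "mono p" using r by (auto simp: grid_refines_def)
  have qk: "q k \<le> q (Suc k)" using q by (simp add: monoD)
  have "indicator {q k<..q (Suc k)} (p (Suc i)) *\<^sub>R (f (p (Suc i)) - f (p i)) = g (p (Suc i)) - g (p i)" for i
  proof -
    have pi: "p i \<le> p (Suc i)" using p by (simp add: monoD)
    consider "p (Suc i) \<le> q k" | "q (Suc k) \<le> p i" | "q k \<le> p i" "p (Suc i) \<le> q (Suc k)" "q k < p (Suc i)"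
      using grid_refines_cell[OF r, of k i] grid_refines_cell[OF r, of "Suc k" i] \<open>k < n\<close> by fastforce
    then show ?thesis
    proof cases
      case 1 then show ?thesis using pi qk by (simp add: g_def)
    next
      case 2
      show ?thesis
      proof (cases "p (Suc i) \<le> q (Suc k)")
        case True
        then have "p (Suc i) = p i" using 2 pi by simp
        then show ?thesis by simp
      next
        case False
        then show ?thesis using 2 pi qk by (simp add: g_def)
      qed
    next
      case 3 then show ?thesis using pi qk by (simp add: g_def)
    qed
  qed
  then have "(\<Sum>i<m. indicator {q k<..q (Suc k)} (p (Suc i)) *\<^sub>R (f (p (Suc i)) - f (p i))) = g (p m) - g (p 0)"
    using sum_lessThan_telescope[of "\<lambda>i. g (p i)" m] by simp
  moreover have "p 0 \<le> q k" using grid_refines_ends(1)[OF r] monoD[OF q, of 0 k] by simp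
  moreover have "q (Suc k) \<le> p m" using grid_refines_ends(2)[OF r] monoD[OF q, of "Suc k" n] \<open>k < n\<close> by simp
  ultimately show ?thesis using qk by (simp add: g_def)
qed

section \<open>Step processes and their elementary integrals\<close>

context wiener_process
begin

text \<open>A left-continuous step process whose value on a cell is read off at the right end and is
  known at the left end. The coefficients are values of the process itself rather than separate data
  as in \<open>simple_integrand_data\<close>, so that differences, products and truncations of
  processes need no bookkeeping of coefficients. Only cells of positive length are
  constrained.\<close>

definition simple_on :: "(nat \<Rightarrow> real) \<Rightarrow> nat \<Rightarrow> (real \<Rightarrow> 'w \<Rightarrow> 'b::euclidean_space) \<Rightarrow> bool" where
  "simple_on q n S \<longleftrightarrow> 0 \<le> q 0 \<and> mono q \<and>
     (\<forall>i<n. q i < q (Suc i) \<longrightarrow> S (q (Suc i)) \<in> borel_measurable (\<F> (q i)) \<and>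
        bounded (S (q (Suc i)) ` space M) \<and>
        (\<forall>s\<in>{q i<..q (Suc i)}. \<forall>w\<in>space M. S s w = S (q (Suc i)) w)) \<and>
     (\<forall>s. s \<notin> {q 0<..q n} \<longrightarrow> (\<forall>w\<in>space M. S s w = 0))"

definition simple_process :: "(real \<Rightarrow> 'w \<Rightarrow> 'b::euclidean_space) \<Rightarrow> bool" where
  "simple_process S \<longleftrightarrow> (\<exists>q n. simple_on q n S)"

definition grid_integral :: "(nat \<Rightarrow> real) \<Rightarrow> nat \<Rightarrow> (real \<Rightarrow> 'w \<Rightarrow> real ^ 'k ^ 'n) \<Rightarrow> 'w \<Rightarrow> real ^ 'n" where
  "grid_integral q n S w = (\<Sum>i<n. S (q (Suc i)) w *v (W (q (Suc i)) w - W (q i) w))"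

text \<open>A relation rather than a function, because a step process fits many grids;
  \<open>grid_integral_unique\<close> makes the value independent of the choice.\<close>

definition has_simple_integral :: "(real \<Rightarrow> 'w \<Rightarrow> real ^ 'k ^ 'n) \<Rightarrow> ('w \<Rightarrow> real ^ 'n) \<Rightarrow> bool" where
  "has_simple_integral S J \<longleftrightarrow> (\<exists>q n. simple_on q n S \<and> (\<forall>w\<in>space M. J w = grid_integral q n S w))"

lemma simple_onD:
  assumes "simple_on q n S"
  shows "0 \<le> q 0" "mono q"
    "\<And>i. i < n \<Longrightarrow> q i < q (Suc i) \<Longrightarrow> S (q (Suc i)) \<in> borel_measurable (\<F> (q i))"
    "\<And>i. i < n \<Longrightarrow> q i < q (Suc i) \<Longrightarrow> bounded (S (q (Suc i)) ` space M)"
    "\<And>i s w. i < n \<Longrightarrow> s \<in> {q i<..q (Suc i)} \<Longrightarrow> w \<in> space M \<Longrightarrow> S s w = S (q (Suc i)) w"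
    "\<And>s w. s \<notin> {q 0<..q n} \<Longrightarrow> w \<in> space M \<Longrightarrow> S s w = 0"
proof -
  have A: "0 \<le> q 0" "mono q"
    and B: "\<And>i. i < n \<Longrightarrow> q i < q (Suc i) \<Longrightarrow> S (q (Suc i)) \<in> borel_measurable (\<F> (q i)) \<and>
        bounded (S (q (Suc i)) ` space M) \<and>
        (\<forall>s\<in>{q i<..q (Suc i)}. \<forall>w\<in>space M. S s w = S (q (Suc i)) w)"
    and C: "\<And>s. s \<notin> {q 0<..q n} \<Longrightarrow> \<forall>w\<in>space M. S s w = 0"
    using assms unfolding simple_on_def by blast+
  show "0 \<le> q 0" "mono q" by fact+
  fix i
  show "i < n \<Longrightarrow> q i < q (Suc i) \<Longrightarrow> S (q (Suc i)) \<in> borel_measurable (\<F> (q i))" using B by blast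
  show "i < n \<Longrightarrow> q i < q (Suc i) \<Longrightarrow> bounded (S (q (Suc i)) ` space M)" using B by blast
  show "S s w = S (q (Suc i)) w" if "i < n" "s \<in> {q i<..q (Suc i)}" "w \<in> space M" for s w
  proof -
    have "q i < q (Suc i)" using that by auto
    then show ?thesis using B[OF that(1)] that by blast
  qed
  show "\<And>s w. s \<notin> {q 0<..q n} \<Longrightarrow> w \<in> space M \<Longrightarrow> S s w = 0" using C by blast
qed

lemma simple_on_refine:
  assumes S: "simple_on q n S" and r: "grid_refines p m q n"
  shows "simple_on p m S"
  unfolding simple_on_def
proof (intro conjI allI impI ballI)
  note D = simple_onD[OF S]
  show "0 \<le> p 0" and p: "mono p" using r by (auto simp: grid_refines_def)
  \<comment> \<open>A cell of the refinement cannot straddle a node of \<open>q\<close>: it lies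
    inside one cell of \<open>q\<close>, or outside \<open>{q 0<..q n}\<close>, where
    \<open>S\<close> vanishes.\<close>
  have cell: "(\<exists>k<n. q k \<le> p i \<and> p (Suc i) \<le> q (Suc k) \<and> q k < q (Suc k)) \<or>
      (\<forall>s\<in>{p i<..p (Suc i)}. s \<notin> {q 0<..q n})" if "p i < p (Suc i)" for i
  proof (cases "p (Suc i) \<in> {q 0<..q n}")
    case True
    then obtain k where k: "k < n" "p (Suc i) \<in> {q k<..q (Suc k)}" by (rule grid_locate)
    then have "q k \<le> p i" using grid_refines_cell[OF r, of k i] by fastforce
    then show ?thesis using k by auto
  next
    case False
    then have "p (Suc i) \<le> q 0 \<or> q n \<le> p i" using grid_refines_cell[OF r, of n i] by fastforce
    then show ?thesis by auto
  qed
  {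
    fix i assume i: "p i < p (Suc i)"
    show "S (p (Suc i)) \<in> borel_measurable (\<F> (p i))"
      using cell[OF i]
    proof
      assume "\<exists>k<n. q k \<le> p i \<and> p (Suc i) \<le> q (Suc k) \<and> q k < q (Suc k)"
      then obtain k where k: "k < n" "q k \<le> p i" "p (Suc i) \<le> q (Suc k)" "q k < q (Suc k)" by blast
      have "S (q (Suc k)) \<in> borel_measurable (\<F> (p i))"
        by (rule measurable_filtration_mono[OF D(3)]) (use k in auto)
      moreover have "S (p (Suc i)) w = S (q (Suc k)) w" if "w \<in> space M" for w
        using D(5)[OF k(1), of "p (Suc i)" w] k i that by auto
      ultimately show ?thesis by (subst measurable_cong[where g="S (q (Suc k))"]) auto
    next
      assume "\<forall>s\<in>{p i<..p (Suc i)}. s \<notin> {q 0<..q n}"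
      then have "S (p (Suc i)) w = 0" if "w \<in> space M" for w using D(6) i that by auto
      then show ?thesis by (subst measurable_cong) auto
    qed
    show "bounded (S (p (Suc i)) ` space M)"
      using cell[OF i]
    proof
      assume "\<exists>k<n. q k \<le> p i \<and> p (Suc i) \<le> q (Suc k) \<and> q k < q (Suc k)"
      then obtain k where k: "k < n" "q k \<le> p i" "p (Suc i) \<le> q (Suc k)" "q k < q (Suc k)" by blast
      have "S (p (Suc i)) w = S (q (Suc k)) w" if "w \<in> space M" for w
        using D(5)[OF k(1), of "p (Suc i)" w] k i that by auto
      then show ?thesis using D(4)[of k] k by (simp cong: image_cong)
    next
      assume "\<forall>s\<in>{p i<..p (Suc i)}. s \<notin> {q 0<..q n}"
      then have "S (p (Suc i)) w = 0" if "w \<in> space M" for w using D(6) i that by auto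
      then have "S (p (Suc i)) ` space M \<subseteq> {0}" by auto
      then show ?thesis using bounded_subset[of "{0}"] by simp
    qed
    fix s w assume s: "s \<in> {p i<..p (Suc i)}" and w: "w \<in> space M"
    show "S s w = S (p (Suc i)) w"
      using cell[OF i]
    proof
      assume "\<exists>k<n. q k \<le> p i \<and> p (Suc i) \<le> q (Suc k) \<and> q k < q (Suc k)"
      then obtain k where k: "k < n" "q k \<le> p i" "p (Suc i) \<le> q (Suc k)" by blast
      show ?thesis using D(5)[OF k(1), of s w] D(5)[OF k(1), of "p (Suc i)" w] k i s w by auto
    next
      assume "\<forall>s\<in>{p i<..p (Suc i)}. s \<notin> {q 0<..q n}"
      then show ?thesis using D(6)[of s w] D(6)[of "p (Suc i)" w] s i w by auto
    qed
  }
  fix s w assume "s \<notin> {p 0<..p m}" "w \<in> space M"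
  then show "S s w = 0" using D(6)[of s w] grid_refines_ends[OF r] by auto
qed

lemma simple_on_eq_sum:
  assumes S: "simple_on q n S" and w: "w \<in> space M"
  shows "S s w = (\<Sum>k<n. indicator {q k<..q (Suc k)} s *\<^sub>R S (q (Suc k)) w)"
proof (cases "s \<in> {q 0<..q n}")
  case True
  note D = simple_onD[OF S]
  from True obtain i where i: "i < n" "s \<in> {q i<..q (Suc i)}" by (rule grid_locate)
  have "(\<Sum>k<n. indicator {q k<..q (Suc k)} s *\<^sub>R S (q (Suc k)) w)
      = (\<Sum>k<n. if k = i then S (q (Suc i)) w else 0)"
  proof (rule sum.cong[OF refl])
    fix k
    show "indicator {q k<..q (Suc k)} s *\<^sub>R S (q (Suc k)) w = (if k = i then S (q (Suc i)) w else 0)"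
    proof (cases "k = i")
      case False
      then have "s \<notin> {q k<..q (Suc k)}" using grid_locate_unique[OF D(2) i(2)] by blast
      then show ?thesis using False by simp
    qed (use i(2) in simp)
  qed
  then show ?thesis using i D(5)[OF i w] by simp
next
  case False
  note D = simple_onD[OF S]
  have "s \<notin> {q k<..q (Suc k)}" if "k < n" for k
    using False monoD[OF D(2), of 0 k] monoD[OF D(2), of "Suc k" n] that by auto
  then have "(\<Sum>k<n. indicator {q k<..q (Suc k)} s *\<^sub>R S (q (Suc k)) w) = 0"
    by (intro sum.neutral) auto
  then show ?thesis using D(6)[OF False w] by simp
qed

text \<open>Each value of \<open>S\<close> on a fine cell is written as a sum over the coarse cells
  with indicators. After exchanging the sums, the increments of \<open>W\<close> inside one coarse
  cell telescope.\<close>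

lemma grid_integral_refine:
  assumes S: "simple_on q n S" and r: "grid_refines p m q n" and w: "w \<in> space M"
  shows "grid_integral p m S w = grid_integral q n S w"
proof -
  note D = simple_onD[OF S]
  have "grid_integral p m S w = (\<Sum>i<m. \<Sum>k<n. S (q (Suc k)) w *v
      (indicator {q k<..q (Suc k)} (p (Suc i)) *\<^sub>R (W (p (Suc i)) w - W (p i) w)))"
    unfolding grid_integral_def
  proof (rule sum.cong[OF refl])
    fix i
    have "S (p (Suc i)) w *v x = (\<Sum>k<n. S (q (Suc k)) w *v (indicator {q k<..q (Suc k)} (p (Suc i)) *\<^sub>R x))" for x
    proof -
      have "S (p (Suc i)) w *v x = (\<Sum>k<n. indicator {q k<..q (Suc k)} (p (Suc i)) *\<^sub>R S (q (Suc k)) w) *v x"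
        using simple_on_eq_sum[OF S w, of "p (Suc i)"] by simp
      also have "\<dots> = (\<Sum>k<n. (indicator {q k<..q (Suc k)} (p (Suc i)) *\<^sub>R S (q (Suc k)) w) *v x)"
        by (induction n) (simp_all add: matrix_vector_mult_add_rdistrib)
      also have "\<dots> = (\<Sum>k<n. S (q (Suc k)) w *v (indicator {q k<..q (Suc k)} (p (Suc i)) *\<^sub>R x))"
        by (intro sum.cong refl) (auto simp: indicator_def)
      finally show ?thesis .
    qed
    then show "S (p (Suc i)) w *v (W (p (Suc i)) w - W (p i) w) = (\<Sum>k<n. S (q (Suc k)) w *v
      (indicator {q k<..q (Suc k)} (p (Suc i)) *\<^sub>R (W (p (Suc i)) w - W (p i) w)))" .
  qed
  also have "\<dots> = (\<Sum>k<n. S (q (Suc k)) w *v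
      (\<Sum>i<m. indicator {q k<..q (Suc k)} (p (Suc i)) *\<^sub>R (W (p (Suc i)) w - W (p i) w)))"
    by (subst sum.swap) (simp only: linear_sum[OF matrix_vector_mul_linear])
  also have "\<dots> = grid_integral q n S w"
    unfolding grid_integral_def
    by (intro sum.cong refl arg_cong2[of _ _ _ _ matrix_vector_mult])
      (simp only: lessThan_iff grid_refines_telescope[OF r _ D(2), where f="\<lambda>s. W s w"])
  finally show ?thesis .
qed

lemma grid_integral_unique:
  assumes S: "simple_on q n S" "simple_on q' n' S" and w: "w \<in> space M"
  shows "grid_integral q n S w = grid_integral q' n' S w"
proof -
  obtain p m where "grid_refines p m q n" "grid_refines p m q' n'" "{} \<subseteq> p ` {..m}"
    using common_grid[OF simple_onD(2,1)[OF S(1)] simple_onD(2,1)[OF S(2)], of "{}" n n'] by auto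
  then show ?thesis using grid_integral_refine[OF S(1) _ w] grid_integral_refine[OF S(2) _ w] by metis
qed

lemma has_simple_integral_on:
  "has_simple_integral S J \<Longrightarrow> simple_on q n S \<Longrightarrow> w \<in> space M \<Longrightarrow> J w = grid_integral q n S w"
  unfolding has_simple_integral_def using grid_integral_unique by metis

lemma simple_process_common_grid:
  assumes "simple_process S" "simple_process S'" "finite A" "A \<subseteq> {0..}"
  obtains q n where "simple_on q n S" "simple_on q n S'" "A \<subseteq> q ` {..n}"
proof -
  from assms obtain q n q' n' where S: "simple_on q n S" and S': "simple_on q' n' S'"
    by (auto simp: simple_process_def)
  obtain p m where "grid_refines p m q n" "grid_refines p m q' n'" "A \<subseteq> p ` {..m}"
    using common_grid[OF simple_onD(2,1)[OF S] simple_onD(2,1)[OF S'] assms(3,4)] by blast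
  then show ?thesis
    by (intro that[of p m] simple_on_refine[OF S] simple_on_refine[OF S'])
qed

lemma has_simple_integral_simple: "has_simple_integral S J \<Longrightarrow> simple_process S"
  by (auto simp: has_simple_integral_def simple_process_def)

lemma simple_process_has_integral:
  assumes "simple_process S"
  obtains J where "has_simple_integral S J"
  using assms by (auto simp: has_simple_integral_def simple_process_def)

text \<open>One closure property for differences, for restriction in time (a product with a scalar
  step process) and for truncation. Continuity keeps the coefficients measurable and bounded, and
  \<open>f 0 0 = 0\<close> keeps the process zero outside its grid.\<close>

lemma simple_process_map2:
  fixes f :: "'b::euclidean_space \<Rightarrow> 'c::euclidean_space \<Rightarrow> 'd::euclidean_space"
  assumes S: "simple_process S" and S': "simple_process S'"
    and f: "continuous_on UNIV (\<lambda>(x, y). f x y)" and f0: "f 0 0 = 0"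
  shows "simple_process (\<lambda>s w. f (S s w) (S' s w))"
proof -
  obtain q n where q: "simple_on q n S" "simple_on q n S'"
    using simple_process_common_grid[OF S S', of "{}"] by auto
  note D = simple_onD[OF q(1)] and D' = simple_onD[OF q(2)]
  have "simple_on q n (\<lambda>s w. f (S s w) (S' s w))"
    unfolding simple_on_def
  proof (intro conjI allI impI ballI)
    fix i assume i: "i < n" "q i < q (Suc i)"
    have "(\<lambda>w. (S (q (Suc i)) w, S' (q (Suc i)) w)) \<in> borel_measurable (\<F> (q i))"
      using D(3)[OF i] D'(3)[OF i] by measurable
    from measurable_compose[OF this borel_measurable_continuous_onI[OF f]]
    show "(\<lambda>w. f (S (q (Suc i)) w) (S' (q (Suc i)) w)) \<in> borel_measurable (\<F> (q i))" by simp
    let ?B = "closure (S (q (Suc i)) ` space M \<times> S' (q (Suc i)) ` space M)"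
    have "compact ?B" using D(4)[OF i] D'(4)[OF i] by (simp add: bounded_Times compact_closure)
    then have "bounded ((\<lambda>(x, y). f x y) ` ?B)"
      using f by (intro compact_imp_bounded compact_continuous_image) (auto intro: continuous_on_subset)
    moreover have "(\<lambda>w. f (S (q (Suc i)) w) (S' (q (Suc i)) w)) ` space M \<subseteq> (\<lambda>(x, y). f x y) ` ?B"
    proof safe
      fix w assume "w \<in> space M"
      then have "(S (q (Suc i)) w, S' (q (Suc i)) w) \<in> ?B" 
        by (intro subsetD[OF closure_subset]) simp
      then show "f (S (q (Suc i)) w) (S' (q (Suc i)) w) \<in> (\<lambda>(x, y). f x y) ` ?B" by force
    qed
    ultimately show "bounded ((\<lambda>w. f (S (q (Suc i)) w) (S' (q (Suc i)) w)) ` space M)"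
      by (rule bounded_subset)
    fix s w assume "s \<in> {q i<..q (Suc i)}" "w \<in> space M"
    then show "f (S s w) (S' s w) = f (S (q (Suc i)) w) (S' (q (Suc i)) w)"
      using D(5)[OF i(1), of s w] D'(5)[OF i(1), of s w] by simp
  next
    fix s w assume "s \<notin> {q 0<..q n}" "w \<in> space M"
    then show "f (S s w) (S' s w) = 0" using D(6)[of s w] D'(6)[of s w] f0 by simp
  qed (fact D(1), fact D(2))
  then show ?thesis by (auto simp: simple_process_def)
qed

lemma simple_process_diff:
  "simple_process S \<Longrightarrow> simple_process S' \<Longrightarrow> simple_process (\<lambda>s w. S s w - S' s w)"
  by (rule simple_process_map2) (auto simp: case_prod_beta intro!: continuous_intros)

lemma simple_process_scaleR:
  "simple_process S \<Longrightarrow> simple_process S' \<Longrightarrow> simple_process (\<lambda>s w. S s w *\<^sub>R S' s w)"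
  by (rule simple_process_map2) (auto simp: case_prod_beta intro!: continuous_intros)

lemma simple_process_map:
  assumes "simple_process S" "continuous_on UNIV f" "f 0 = 0"
  shows "simple_process (\<lambda>s w. f (S s w))"
proof -
  have "continuous_on UNIV (\<lambda>(x, y). f x)"
    unfolding case_prod_beta
    by (rule continuous_on_compose2[OF assms(2) continuous_on_fst[OF continuous_on_id]]) auto
  from simple_process_map2[OF assms(1) assms(1) this] assms(3) show ?thesis by simp
qed

lemma has_simple_integral_diff:
  assumes S: "has_simple_integral S J" and S': "has_simple_integral S' J'"
  shows "has_simple_integral (\<lambda>s w. S s w - S' s w) (\<lambda>w. J w - J' w)"
proof -
  let ?D = "\<lambda>s w. S s w - S' s w"
  have "simple_process ?D"
    using S S' by (intro simple_process_diff) (auto dest: has_simple_integral_simple)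
  then obtain q0 n0 where D: "simple_on q0 n0 ?D" by (auto simp: simple_process_def)
  have "q0 ` {..n0} \<subseteq> {0..}"
  proof (rule image_subsetI)
    fix i show "q0 i \<in> {0..}" using simple_onD(1)[OF D] monoD[OF simple_onD(2)[OF D], of 0 i] by simp
  qed
  \<comment> \<open>The nodes of a grid for the difference are adjoined, so that one grid serves
    \<open>S\<close>, \<open>S'\<close> and the difference.\<close>
  then obtain q n where q: "simple_on q n S" "simple_on q n S'" "q0 ` {..n0} \<subseteq> q ` {..n}"
    using simple_process_common_grid[OF has_simple_integral_simple[OF S] has_simple_integral_simple[OF S'],
      of "q0 ` {..n0}"] by auto
  have r: "grid_refines q n q0 n0"
    using q simple_onD(1,2)[OF q(1)] by (auto simp: grid_refines_def)
  have "J w - J' w = grid_integral q n ?D w" if "w \<in> space M" for w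
    using has_simple_integral_on[OF S q(1) that] has_simple_integral_on[OF S' q(2) that]
    by (simp add: grid_integral_def sum_subtractf matrix_vector_mult_diff_rdistrib)
  then show ?thesis
    unfolding has_simple_integral_def using simple_on_refine[OF D r] by blast
qed

text \<open>The comparison is made on a single path. It is applied where the index of a grid time
  depends on \<open>w\<close>, so that two processes agree along that path only.\<close>

lemma has_simple_integral_path_cong:
  assumes S: "has_simple_integral S J" and S': "has_simple_integral S' J'"
    and w: "w \<in> space M" and eq: "\<And>s. S s w = S' s w"
  shows "J w = J' w"
proof -
  obtain q n where q: "simple_on q n S" "simple_on q n S'"
    using simple_process_common_grid[of S S' "{}"] S S' by (auto dest: has_simple_integral_simple)
  show ?thesis
    using has_simple_integral_on[OF S q(1) w] has_simple_integral_on[OF S' q(2) w] eq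
    by (simp add: grid_integral_def)
qed

end

section \<open>The Ito isometry for simple processes\<close>

lemma integrable_mult_of_squares:
  fixes f g :: "'a \<Rightarrow> real"
  assumes "f \<in> borel_measurable M" "g \<in> borel_measurable M"
    and "integrable M (\<lambda>w. (f w)\<^sup>2)" "integrable M (\<lambda>w. (g w)\<^sup>2)"
  shows "integrable M (\<lambda>w. f w * g w)"
proof (rule Bochner_Integration.integrable_bound)
  show "integrable M (\<lambda>w. (f w)\<^sup>2 + (g w)\<^sup>2)" using assms by simp
  show "AE w in M. norm (f w * g w) \<le> norm ((f w)\<^sup>2 + (g w)\<^sup>2)"
  proof (rule AE_I2)
    fix w
    have "2 * (\<bar>f w\<bar> * \<bar>g w\<bar>) \<le> (f w)\<^sup>2 + (g w)\<^sup>2"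
      using sum_squares_bound[of "\<bar>f w\<bar>" "\<bar>g w\<bar>"] by (simp add: mult.assoc)
    moreover have "0 \<le> \<bar>f w\<bar> * \<bar>g w\<bar>" by simp
    ultimately have "\<bar>f w\<bar> * \<bar>g w\<bar> \<le> (f w)\<^sup>2 + (g w)\<^sup>2" by linarith
    then show "norm (f w * g w) \<le> norm ((f w)\<^sup>2 + (g w)\<^sup>2)" by (simp add: abs_mult)
  qed
qed (use assms in simp)

lemma integrable_mult_bounded:
  fixes f g :: "'a \<Rightarrow> real"
  assumes "integrable M f" "g \<in> borel_measurable M" "\<And>w. w \<in> space M \<Longrightarrow> \<bar>g w\<bar> \<le> K"
  shows "integrable M (\<lambda>w. g w * f w)"
proof (rule Bochner_Integration.integrable_bound)
  show "integrable M (\<lambda>w. K * f w)" using assms by simp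
  show "AE w in M. norm (g w * f w) \<le> norm (K * f w)"
    using assms(3) by (intro AE_I2) (auto simp: abs_mult intro!: mult_mono order_trans[OF assms(3) abs_ge_self])
qed (use assms in simp)

lemma (in prob_space) integrable_of_square:
  fixes f :: "'a \<Rightarrow> real"
  assumes "f \<in> borel_measurable M" "integrable M (\<lambda>w. (f w)\<^sup>2)"
  shows "integrable M f"
  using integrable_mult_of_squares[of f M "\<lambda>_. 1"] assms by simp

lemma norm_matrix_square: "(norm (A :: real ^ 'k ^ 'n))\<^sup>2 = (\<Sum>a\<in>UNIV. A $ a \<bullet> A $ a)"
  by (simp add: power2_norm_eq_inner inner_vec_def)

lemma norm_vec_square: "(norm (x :: real ^ 'n))\<^sup>2 = (\<Sum>a\<in>UNIV. (x $ a)\<^sup>2)"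
  unfolding power2_norm_eq_inner inner_vec_def by (simp add: power2_eq_square)

lemma borel_measurable_vecI:
  fixes f :: "'a \<Rightarrow> real ^ 'n"
  assumes "\<And>a. (\<lambda>w. f w $ a) \<in> borel_measurable N"
  shows "f \<in> borel_measurable N"
proof (subst borel_measurable_euclidean_space, rule ballI)
  fix i :: "real ^ 'n" assume "i \<in> Basis"
  then obtain a where "i = axis a 1" by (auto simp: Basis_vec_def)
  then show "(\<lambda>w. f w \<bullet> i) \<in> borel_measurable N" using assms by (simp add: inner_axis)
qed

section \<open>Conditional moments of elementary integrals\<close>

context wiener_process
begin

lemma increment_inner_mean:
  fixes \<eta> :: "'w \<Rightarrow> real ^ 'k"
  assumes st: "0 \<le> s" "s < t" and \<phi>: "\<phi> \<in> borel_measurable (\<F> s)" "integrable M \<phi>"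
    and \<eta>: "\<eta> \<in> borel_measurable (\<F> s)" "\<And>w. w \<in> space M \<Longrightarrow> norm (\<eta> w) \<le> K"
  shows "integrable M (\<lambda>w. \<phi> w * (\<eta> w \<bullet> (W t w - W s w)))"
    "expectation (\<lambda>w. \<phi> w * (\<eta> w \<bullet> (W t w - W s w))) = 0"
proof -
  have eq: "\<phi> w * (\<eta> w \<bullet> (W t w - W s w)) = (\<Sum>c\<in>UNIV. \<eta> w $ c * \<phi> w * (W t w - W s w) $ c)" for w
    by (simp add: inner_vec_def sum_distrib_left algebra_simps)
  have m: "(\<lambda>w. \<eta> w $ c * \<phi> w) \<in> borel_measurable (\<F> s)" for c
    using \<phi> \<eta> by (intro borel_measurable_times measurable_compose[OF \<eta>(1)]) auto
  have i: "integrable M (\<lambda>w. \<eta> w $ c * \<phi> w)" for c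
    using measurable_filtration_M[OF \<eta>(1)]
    by (intro integrable_mult_bounded[OF \<phi>(2), of _ K] measurable_compose[OF measurable_filtration_M[OF \<eta>(1)]])
      (auto intro: order_trans[OF component_le_norm_cart \<eta>(2)])
  show "integrable M (\<lambda>w. \<phi> w * (\<eta> w \<bullet> (W t w - W s w)))"
    unfolding eq by (intro Bochner_Integration.integrable_sum increment_orthogonal[OF st m i])
  show "expectation (\<lambda>w. \<phi> w * (\<eta> w \<bullet> (W t w - W s w))) = 0"
    unfolding eq
    by (subst Bochner_Integration.integral_sum) (simp_all only: increment_orthogonal[OF st m i] sum.neutral_const)
qed

text \<open>Expanding both inner products gives a double sum over components. Distinct components of
  the increment are uncorrelated, which leaves the diagonal: the inner product of the coefficients
  times the length of the interval.\<close>

lemma increment_inner_covariance: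
  fixes \<eta> \<eta>' :: "'w \<Rightarrow> real ^ 'k"
  assumes st: "0 \<le> s" "s < t" and \<phi>: "\<phi> \<in> borel_measurable (\<F> s)" "\<And>w. w \<in> space M \<Longrightarrow> \<bar>\<phi> w\<bar> \<le> L"
    and \<eta>: "\<eta> \<in> borel_measurable (\<F> s)" "\<And>w. w \<in> space M \<Longrightarrow> norm (\<eta> w) \<le> K"
    and \<eta>': "\<eta>' \<in> borel_measurable (\<F> s)" "\<And>w. w \<in> space M \<Longrightarrow> norm (\<eta>' w) \<le> K'"
  shows "integrable M (\<lambda>w. \<phi> w * ((\<eta> w \<bullet> (W t w - W s w)) * (\<eta>' w \<bullet> (W t w - W s w))))"
    "expectation (\<lambda>w. \<phi> w * ((\<eta> w \<bullet> (W t w - W s w)) * (\<eta>' w \<bullet> (W t w - W s w))))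
       = expectation (\<lambda>w. \<phi> w * ((\<eta> w \<bullet> \<eta>' w) * (t - s)))"
proof -
  have eq: "\<phi> w * ((\<eta> w \<bullet> (W t w - W s w)) * (\<eta>' w \<bullet> (W t w - W s w)))
    = (\<Sum>c\<in>UNIV. \<Sum>d\<in>UNIV. (\<phi> w * (\<eta> w $ c * \<eta>' w $ d)) * ((W t w - W s w) $ c * (W t w - W s w) $ d))" for w
    unfolding inner_vec_def inner_real_def sum_product
    unfolding sum_distrib_left
    by (intro sum.cong refl) (simp add: mult_ac)
  have mM: "(\<lambda>w. \<eta> w $ c) \<in> borel_measurable (\<F> s)" "(\<lambda>w. \<eta>' w $ c) \<in> borel_measurable (\<F> s)" for c
    by (auto intro: measurable_compose[OF \<eta>(1)] measurable_compose[OF \<eta>'(1)])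
  have m: "(\<lambda>w. \<phi> w * (\<eta> w $ c * \<eta>' w $ d)) \<in> borel_measurable (\<F> s)" for c d
    using \<phi> mM by (intro borel_measurable_times) auto
  have i: "integrable M (\<lambda>w. \<phi> w * (\<eta> w $ c * \<eta>' w $ d))" for c d
  proof (rule integrable_const_bound)
    show "AE w in M. norm (\<phi> w * (\<eta> w $ c * \<eta>' w $ d)) \<le> L * (K * K')"
    proof (rule AE_I2)
      fix w assume w: "w \<in> space M"
      have "\<bar>\<eta> w $ c\<bar> \<le> K" "\<bar>\<eta>' w $ d\<bar> \<le> K'"
        using order_trans[OF component_le_norm_cart \<eta>(2)[OF w]] order_trans[OF component_le_norm_cart \<eta>'(2)[OF w]] by auto
      then have le: "\<bar>\<eta> w $ c\<bar> * \<bar>\<eta>' w $ d\<bar> \<le> K * K'" by (intro mult_mono) auto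
      show "norm (\<phi> w * (\<eta> w $ c * \<eta>' w $ d)) \<le> L * (K * K')"
        using mult_mono[OF \<phi>(2)[OF w] le order_trans[OF abs_ge_zero \<phi>(2)[OF w]]] by (simp add: abs_mult)
    qed
  qed (rule measurable_filtration_M[OF m])
  note o = increment_orthogonal[OF st m i]
  show "integrable M (\<lambda>w. \<phi> w * ((\<eta> w \<bullet> (W t w - W s w)) * (\<eta>' w \<bullet> (W t w - W s w))))"
    unfolding eq by (intro Bochner_Integration.integrable_sum o)
  have "expectation (\<lambda>w. \<phi> w * ((\<eta> w \<bullet> (W t w - W s w)) * (\<eta>' w \<bullet> (W t w - W s w))))
     = (\<Sum>c\<in>UNIV. \<Sum>d\<in>UNIV. expectation (\<lambda>w. (\<phi> w * (\<eta> w $ c * \<eta>' w $ d)) * ((W t w - W s w) $ c * (W t w - W s w) $ d)))"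
    unfolding eq
    by (subst Bochner_Integration.integral_sum, intro Bochner_Integration.integrable_sum o)
      (intro sum.cong refl Bochner_Integration.integral_sum o)
  also have "\<dots> = (\<Sum>c\<in>UNIV. expectation (\<lambda>w. (t - s) * (\<phi> w * (\<eta> w $ c * \<eta>' w $ c))))"
    unfolding o by (simp add: sum.delta)
  also have "\<dots> = expectation (\<lambda>w. \<Sum>c\<in>UNIV. (t - s) * (\<phi> w * (\<eta> w $ c * \<eta>' w $ c)))"
    by (intro Bochner_Integration.integral_sum[symmetric] integrable_mult_right i)
  also have "(\<lambda>w. \<Sum>c\<in>UNIV. (t - s) * (\<phi> w * (\<eta> w $ c * \<eta>' w $ c))) = (\<lambda>w. \<phi> w * ((\<eta> w \<bullet> \<eta>' w) * (t - s)))"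
    by (simp add: inner_vec_def sum_distrib_left sum_distrib_right mult_ac fun_eq_iff)
  finally show "expectation (\<lambda>w. \<phi> w * ((\<eta> w \<bullet> (W t w - W s w)) * (\<eta>' w \<bullet> (W t w - W s w))))
       = expectation (\<lambda>w. \<phi> w * ((\<eta> w \<bullet> \<eta>' w) * (t - s)))" .
qed

lemma increment_inner_square_integrable:
  fixes \<eta> :: "'w \<Rightarrow> real ^ 'k"
  assumes st: "0 \<le> s" "s < t"
    and \<eta>: "\<eta> \<in> borel_measurable (\<F> s)" "\<And>w. w \<in> space M \<Longrightarrow> norm (\<eta> w) \<le> K"
  shows "integrable M (\<lambda>w. (\<eta> w \<bullet> (W t w - W s w))\<^sup>2)"
  using increment_inner_covariance(1)[OF st, of "\<lambda>_. 1" 1, OF _ _ \<eta> \<eta>]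
  by (simp add: power2_eq_square)

lemma W_measurable_filtration: "0 \<le> s \<Longrightarrow> W s \<in> borel_measurable (\<F> s)"
proof (rule measurableI)
  fix A :: "(real ^ 'k) set" assume "0 \<le> s" "A \<in> sets borel"
  then show "W s -` A \<inter> space (\<F> s) \<in> sets (\<F> s)"
    unfolding sets_wiener_filtration space_wiener_filtration
    by (intro sigma_sets.Basic UnI1 CollectI exI[of _ s] exI[of _ A]) auto
qed simp

text \<open>\<open>\<psi>\<close> is only known at time \<open>s\<close>, so the summands before time \<open>s\<close> have to vanish.\<close>

lemma grid_sum_covariance:
  fixes \<eta> \<eta>' :: "nat \<Rightarrow> 'w \<Rightarrow> real ^ 'k" and q :: "nat \<Rightarrow> real"
  assumes q: "mono q" "0 \<le> q 0"
    and \<eta>: "\<And>i. i < n \<Longrightarrow> q i < q (Suc i) \<Longrightarrow> \<eta> i \<in> borel_measurable (\<F> (q i))"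
      "\<And>i. i < n \<Longrightarrow> q i < q (Suc i) \<Longrightarrow> bounded (\<eta> i ` space M)"
      "\<And>i. i < n \<Longrightarrow> q i < q (Suc i) \<Longrightarrow> s \<le> q i \<or> (\<forall>w\<in>space M. \<eta> i w = 0)"
    and \<eta>': "\<And>i. i < n \<Longrightarrow> q i < q (Suc i) \<Longrightarrow> \<eta>' i \<in> borel_measurable (\<F> (q i))"
      "\<And>i. i < n \<Longrightarrow> q i < q (Suc i) \<Longrightarrow> bounded (\<eta>' i ` space M)"
      "\<And>i. i < n \<Longrightarrow> q i < q (Suc i) \<Longrightarrow> s \<le> q i \<or> (\<forall>w\<in>space M. \<eta>' i w = 0)"
    and \<psi>: "\<psi> \<in> borel_measurable (\<F> s)" "\<And>w. w \<in> space M \<Longrightarrow> \<bar>\<psi> w\<bar> \<le> L"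
  defines "J \<equiv> \<lambda>k w. \<Sum>i<k. \<eta> i w \<bullet> (W (q (Suc i)) w - W (q i) w)"
    and "J' \<equiv> \<lambda>k w. \<Sum>i<k. \<eta>' i w \<bullet> (W (q (Suc i)) w - W (q i) w)"
  shows "k \<le> n \<Longrightarrow> J k \<in> borel_measurable (\<F> (q k)) \<and> J' k \<in> borel_measurable (\<F> (q k)) \<and>
     integrable M (\<lambda>w. (J k w)\<^sup>2) \<and> integrable M (\<lambda>w. (J' k w)\<^sup>2) \<and>
     expectation (\<lambda>w. \<psi> w * J k w) = 0 \<and>
     integrable M (\<lambda>w. \<Sum>i<k. (\<eta> i w \<bullet> \<eta>' i w) * (q (Suc i) - q i)) \<and>
     expectation (\<lambda>w. \<psi> w * (J k w * J' k w))
       = expectation (\<lambda>w. \<psi> w * (\<Sum>i<k. (\<eta> i w \<bullet> \<eta>' i w) * (q (Suc i) - q i)))"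
proof (induction k)
  case 0
  show ?case by (simp add: J_def J'_def)
next
  case (Suc k)
  have q0: "0 \<le> q k" using q monoD[OF q(1), of 0 k] by simp
  have qs: "q k \<le> q (Suc k)" using q by (simp add: monoD)
  have IH: "J k \<in> borel_measurable (\<F> (q k))" "J' k \<in> borel_measurable (\<F> (q k))"
     "integrable M (\<lambda>w. (J k w)\<^sup>2)" "integrable M (\<lambda>w. (J' k w)\<^sup>2)"
     "expectation (\<lambda>w. \<psi> w * J k w) = 0"
     "integrable M (\<lambda>w. \<Sum>i<k. (\<eta> i w \<bullet> \<eta>' i w) * (q (Suc i) - q i))"
     "expectation (\<lambda>w. \<psi> w * (J k w * J' k w))
       = expectation (\<lambda>w. \<psi> w * (\<Sum>i<k. (\<eta> i w \<bullet> \<eta>' i w) * (q (Suc i) - q i)))"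
    using Suc by auto
  show ?case
  proof (cases "q k = q (Suc k)")
    case True
    then show ?thesis using IH by (simp add: J_def J'_def)
  next
    case False
    then have lt: "q k < q (Suc k)" using qs by simp
    have kn: "k < n" using Suc by simp
    define e where "e w = \<eta> k w \<bullet> (W (q (Suc k)) w - W (q k) w)" for w
    define e' where "e' w = \<eta>' k w \<bullet> (W (q (Suc k)) w - W (q k) w)" for w
    obtain K where K: "\<And>w. w \<in> space M \<Longrightarrow> norm (\<eta> k w) \<le> K"
      using \<eta>(2)[OF kn lt] by (auto simp: bounded_iff)
    obtain K' where K': "\<And>w. w \<in> space M \<Longrightarrow> norm (\<eta>' k w) \<le> K'"
      using \<eta>'(2)[OF kn lt] by (auto simp: bounded_iff)
    have JS: "J (Suc k) = (\<lambda>w. J k w + e w)" "J' (Suc k) = (\<lambda>w. J' k w + e' w)"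
      by (simp_all add: J_def J'_def e_def e'_def)
    have me: "e \<in> borel_measurable (\<F> (q (Suc k)))" "e' \<in> borel_measurable (\<F> (q (Suc k)))"
      unfolding e_def[abs_def] e'_def[abs_def]
      using \<eta>(1)[OF kn lt] \<eta>'(1)[OF kn lt] lt q0
      by (auto intro!: borel_measurable_inner borel_measurable_diff W_measurable_filtration
          intro: measurable_filtration_mono)
    have mJ: "J k \<in> borel_measurable (\<F> (q (Suc k)))" "J' k \<in> borel_measurable (\<F> (q (Suc k)))"
      using IH(1,2) lt by (auto intro: measurable_filtration_mono)
    note mM = measurable_filtration_M
    have ie: "integrable M (\<lambda>w. (e w)\<^sup>2)" "integrable M (\<lambda>w. (e' w)\<^sup>2)"
      unfolding e_def e'_def
      by (intro increment_inner_square_integrable[OF q0 lt \<eta>(1)[OF kn lt] K]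
          increment_inner_square_integrable[OF q0 lt \<eta>'(1)[OF kn lt] K'], assumption)+
    have iJe: "integrable M (\<lambda>w. J k w * e w)" "integrable M (\<lambda>w. J' k w * e' w)"
       "integrable M (\<lambda>w. J k w * e' w)" "integrable M (\<lambda>w. e w * J' k w)" "integrable M (\<lambda>w. e w * e' w)"
       "integrable M (\<lambda>w. J k w * J' k w)"
      by (intro integrable_mult_of_squares IH ie mM[OF me(1)] mM[OF me(2)] mM[OF mJ(1)] mM[OF mJ(2)])+
    have \<psi>M: "\<psi> \<in> borel_measurable M" using \<psi>(1) by (rule mM)
    note ib = integrable_mult_bounded[OF _ \<psi>M \<psi>(2)]
    have ip: "integrable M (\<lambda>w. (\<eta> k w \<bullet> \<eta>' k w) * (q (Suc k) - q k))"
    proof -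
      have "integrable M (\<lambda>w. \<eta> k w \<bullet> \<eta>' k w)"
      proof (rule integrable_const_bound)
        show "AE w in M. norm (\<eta> k w \<bullet> \<eta>' k w) \<le> K * K'"
        proof (rule AE_I2)
          fix w assume w: "w \<in> space M"
          have "norm (\<eta> k w \<bullet> \<eta>' k w) \<le> norm (\<eta> k w) * norm (\<eta>' k w)" by (simp add: Cauchy_Schwarz_ineq2)
          also have "\<dots> \<le> K * K'" using K[OF w] K'[OF w] by (intro mult_mono) (auto intro: order_trans[OF norm_ge_zero])
          finally show "norm (\<eta> k w \<bullet> \<eta>' k w) \<le> K * K'" .
        qed
      qed (use mM[OF \<eta>(1)[OF kn lt]] mM[OF \<eta>'(1)[OF kn lt]] in simp)
      then show ?thesis by simp
    qed
    \<comment> \<open>If the cell begins at \<open>s\<close> or later, the weight times the past sum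
      is known at its left end, so the new increment is orthogonal to it and only the product of the
      two new terms survives. If the cell begins earlier, its coefficients vanish.\<close>
    have zero: "expectation (\<lambda>w. \<psi> w * e w) = 0 \<and> expectation (\<lambda>w. \<psi> w * (J k w * e' w)) = 0 \<and>
        expectation (\<lambda>w. \<psi> w * (e w * J' k w)) = 0 \<and>
        expectation (\<lambda>w. \<psi> w * (e w * e' w)) = expectation (\<lambda>w. \<psi> w * ((\<eta> k w \<bullet> \<eta>' k w) * (q (Suc k) - q k)))"
    proof (cases "s \<le> q k")
      case True
      have \<psi>q: "\<psi> \<in> borel_measurable (\<F> (q k))" using \<psi>(1) True by (rule measurable_filtration_mono)
      have i: "integrable M \<psi>" using \<psi>M \<psi>(2) by (intro integrable_const_bound[of _ L]) auto
      have "integrable M (J k)" "integrable M (J' k)"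
        by (rule integrable_of_square[OF mM[OF IH(1)] IH(3)], rule integrable_of_square[OF mM[OF IH(2)] IH(4)])
      then have i2: "integrable M (\<lambda>w. \<psi> w * J k w)" "integrable M (\<lambda>w. \<psi> w * J' k w)" by (auto intro: ib)
      have m2: "(\<lambda>w. \<psi> w * J k w) \<in> borel_measurable (\<F> (q k))" "(\<lambda>w. \<psi> w * J' k w) \<in> borel_measurable (\<F> (q k))"
        using \<psi>q IH(1,2) by auto
      have "expectation (\<lambda>w. \<psi> w * e w) = 0" unfolding e_def
        by (rule increment_inner_mean[OF q0 lt \<psi>q i \<eta>(1)[OF kn lt] K])
      moreover have "expectation (\<lambda>w. (\<psi> w * J k w) * e' w) = 0" unfolding e'_def
        by (rule increment_inner_mean[OF q0 lt m2(1) i2(1) \<eta>'(1)[OF kn lt] K'])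
      moreover have "expectation (\<lambda>w. (\<psi> w * J' k w) * e w) = 0" unfolding e_def
        by (rule increment_inner_mean[OF q0 lt m2(2) i2(2) \<eta>(1)[OF kn lt] K])
      moreover have "expectation (\<lambda>w. \<psi> w * (e w * e' w)) = expectation (\<lambda>w. \<psi> w * ((\<eta> k w \<bullet> \<eta>' k w) * (q (Suc k) - q k)))"
        unfolding e_def e'_def
        by (rule increment_inner_covariance[OF q0 lt \<psi>q \<psi>(2) \<eta>(1)[OF kn lt] K \<eta>'(1)[OF kn lt] K'])
      ultimately show ?thesis by (simp add: mult_ac)
    next
      case False
      then have "\<And>w. w \<in> space M \<Longrightarrow> \<eta> k w = 0" "\<And>w. w \<in> space M \<Longrightarrow> \<eta>' k w = 0"
        using \<eta>(3)[OF kn lt] \<eta>'(3)[OF kn lt] by auto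
      then show ?thesis unfolding e_def e'_def by (simp cong: Bochner_Integration.integral_cong)
    qed
    have "integrable M (J k)" "integrable M e"
      by (rule integrable_of_square[OF mM[OF IH(1)] IH(3)], rule integrable_of_square[OF mM[OF me(1)] ie(1)])
    then have c1: "expectation (\<lambda>w. \<psi> w * J (Suc k) w) = 0"
      unfolding JS using zero IH(5) ib[of "J k"] ib[of e] by (simp add: distrib_left)
    have "(\<lambda>w. (J (Suc k) w)\<^sup>2) = (\<lambda>w. (J k w)\<^sup>2 + (e w)\<^sup>2 + 2 * (J k w * e w))"
      "(\<lambda>w. (J' (Suc k) w)\<^sup>2) = (\<lambda>w. (J' k w)\<^sup>2 + (e' w)\<^sup>2 + 2 * (J' k w * e' w))"
      unfolding JS by (simp_all add: power2_sum mult_ac)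
    then have c2: "integrable M (\<lambda>w. (J (Suc k) w)\<^sup>2)" "integrable M (\<lambda>w. (J' (Suc k) w)\<^sup>2)"
      using IH(3,4) ie iJe by simp_all
    have "(\<lambda>w. \<psi> w * (J (Suc k) w * J' (Suc k) w))
       = (\<lambda>w. \<psi> w * (J k w * J' k w) + \<psi> w * (J k w * e' w) + \<psi> w * (e w * J' k w) + \<psi> w * (e w * e' w))"
      unfolding JS by (simp add: algebra_simps)
    then have "expectation (\<lambda>w. \<psi> w * (J (Suc k) w * J' (Suc k) w))
       = expectation (\<lambda>w. \<psi> w * (J k w * J' k w)) + expectation (\<lambda>w. \<psi> w * (e w * e' w))"
      using ib[OF iJe(6)] ib[OF iJe(3)] ib[OF iJe(4)] ib[OF iJe(5)] zero by simp
    also have "\<dots> = expectation (\<lambda>w. \<psi> w * (\<Sum>i<k. (\<eta> i w \<bullet> \<eta>' i w) * (q (Suc i) - q i)))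
        + expectation (\<lambda>w. \<psi> w * ((\<eta> k w \<bullet> \<eta>' k w) * (q (Suc k) - q k)))"
      using IH(7) zero by simp
    also have "\<dots> = expectation (\<lambda>w. \<psi> w * (\<Sum>i<Suc k. (\<eta> i w \<bullet> \<eta>' i w) * (q (Suc i) - q i)))"
      using ib[OF IH(6)] ib[OF ip] by (simp add: distrib_left)
    finally have c3: "expectation (\<lambda>w. \<psi> w * (J (Suc k) w * J' (Suc k) w))
      = expectation (\<lambda>w. \<psi> w * (\<Sum>i<Suc k. (\<eta> i w \<bullet> \<eta>' i w) * (q (Suc i) - q i)))" .
    have c4: "integrable M (\<lambda>w. \<Sum>i<Suc k. (\<eta> i w \<bullet> \<eta>' i w) * (q (Suc i) - q i))"
      using IH(6) ip by simp
    have c5: "J (Suc k) \<in> borel_measurable (\<F> (q (Suc k)))" "J' (Suc k) \<in> borel_measurable (\<F> (q (Suc k)))"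
      unfolding JS using mJ me by auto
    show ?thesis using c1 c2 c3 c4 c5 by blast
  qed
qed

text \<open>Stated for any \<open>g\<close> with \<open>g 0 = 0\<close>, since squared norms as well
  as products of matrix rows have to be integrated along a path; \<open>g 0 = 0\<close> takes care
  of the times outside the grid.\<close>

lemma simple_on_path_integral:
  fixes S :: "real \<Rightarrow> 'w \<Rightarrow> 'b::euclidean_space" and g :: "'b \<Rightarrow> real"
  assumes S: "simple_on q n S" and w: "w \<in> space M" and g: "g 0 = 0"
  shows "has_bochner_integral lborel (\<lambda>s. g (S s w)) (\<Sum>i<n. g (S (q (Suc i)) w) * (q (Suc i) - q i))"
proof -
  note D = simple_onD[OF S]
  have eq: "g (S s w) = (\<Sum>k<n. indicator {q k<..q (Suc k)} s *\<^sub>R g (S (q (Suc k)) w))" for s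
  proof (cases "s \<in> {q 0<..q n}")
    case True
    then obtain i where i: "i < n" "s \<in> {q i<..q (Suc i)}" by (rule grid_locate)
    have "(\<Sum>k<n. indicator {q k<..q (Suc k)} s *\<^sub>R g (S (q (Suc k)) w))
        = (\<Sum>k<n. if k = i then g (S (q (Suc i)) w) else 0)"
    proof (rule sum.cong[OF refl])
      fix k
      show "indicator {q k<..q (Suc k)} s *\<^sub>R g (S (q (Suc k)) w) = (if k = i then g (S (q (Suc i)) w) else 0)"
      proof (cases "k = i")
        case False
        then have "s \<notin> {q k<..q (Suc k)}" using grid_locate_unique[OF D(2) i(2)] by blast
        then show ?thesis using False by simp
      qed (use i(2) in simp)
    qed
    then show ?thesis using i D(5)[OF i w] by simp
  next
    case False
    have "s \<notin> {q k<..q (Suc k)}" if "k < n" for k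
      using False monoD[OF D(2), of 0 k] monoD[OF D(2), of "Suc k" n] that by auto
    then have "(\<Sum>k<n. indicator {q k<..q (Suc k)} s *\<^sub>R g (S (q (Suc k)) w)) = 0"
      by (intro sum.neutral) auto
    then show ?thesis using D(6)[OF False w] g by simp
  qed
  have "has_bochner_integral lborel (\<lambda>s. \<Sum>k<n. indicator {q k<..q (Suc k)} s *\<^sub>R g (S (q (Suc k)) w))
      (\<Sum>k<n. (q (Suc k) - q k) *\<^sub>R g (S (q (Suc k)) w))"
  proof (rule has_bochner_integral_sum)
    fix k
    have "q k \<le> q (Suc k)" using D(2) by (simp add: monoD)
    then have "measure lborel {q k<..q (Suc k)} = q (Suc k) - q k" "emeasure lborel {q k<..q (Suc k)} < \<infinity>"
      by auto
    then show "has_bochner_integral lborel (\<lambda>s. indicator {q k<..q (Suc k)} s *\<^sub>R g (S (q (Suc k)) w))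
      ((q (Suc k) - q k) *\<^sub>R g (S (q (Suc k)) w))"
      by (intro has_bochner_integral_scaleR_left)
        (use has_bochner_integral_real_indicator[of "{q k<..q (Suc k)}" lborel] in simp)
  qed
  then show ?thesis unfolding eq[symmetric] by (simp add: mult.commute)
qed

lemma grid_integral_component:
  "grid_integral q n S w $ a = (\<Sum>i<n. S (q (Suc i)) w $ a \<bullet> (W (q (Suc i)) w - W (q i) w))"
  by (simp add: grid_integral_def matrix_vector_mul_component)

lemma simple_on_row:
  fixes S :: "real \<Rightarrow> 'w \<Rightarrow> real ^ 'k ^ 'n"
  assumes S: "simple_on q n S" and i: "i < n" "q i < q (Suc i)"
  shows "(\<lambda>w. S (q (Suc i)) w $ a) \<in> borel_measurable (\<F> (q i))"
    "bounded ((\<lambda>w. S (q (Suc i)) w $ a) ` space M)"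
proof -
  note D = simple_onD[OF S]
  show "(\<lambda>w. S (q (Suc i)) w $ a) \<in> borel_measurable (\<F> (q i))"
    by (rule measurable_compose[OF D(3)[OF i]]) (intro borel_measurable_continuous_onI continuous_intros)
  obtain K where "\<And>w. w \<in> space M \<Longrightarrow> norm (S (q (Suc i)) w) \<le> K"
    using D(4)[OF i] by (auto simp: bounded_iff)
  then show "bounded ((\<lambda>w. S (q (Suc i)) w $ a) ` space M)"
    unfolding bounded_iff using order_trans[OF Finite_Cartesian_Product.norm_nth_le] by blast
qed

text \<open>The Ito isometry for pairs of components, conditional on \<open>\<F> s\<close> in weak
  form. Instead of integrating from \<open>s\<close> on, the integrand is required to vanish up to
  \<open>s\<close>.\<close>

lemma has_simple_integral_covariance:
  assumes S: "has_simple_integral S J" and s: "0 \<le> s"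
    and zero: "\<And>r w. r \<le> s \<Longrightarrow> w \<in> space M \<Longrightarrow> S r w = 0"
    and \<psi>: "\<psi> \<in> borel_measurable (\<F> s)" "\<And>w. w \<in> space M \<Longrightarrow> \<bar>\<psi> w\<bar> \<le> L"
  shows "J \<in> borel_measurable M" "integrable M (\<lambda>w. (J w $ a)\<^sup>2)"
    "expectation (\<lambda>w. \<psi> w * J w $ a) = 0"
    "integrable M (\<lambda>w. \<integral>r. S r w $ a \<bullet> S r w $ b \<partial>lborel)"
    "expectation (\<lambda>w. \<psi> w * (J w $ a * J w $ b))
       = expectation (\<lambda>w. \<psi> w * (\<integral>r. S r w $ a \<bullet> S r w $ b \<partial>lborel))"
proof -
  have sp: "simple_process S" by (rule has_simple_integral_simple[OF S])
  obtain q n where q: "simple_on q n S" "{s} \<subseteq> q ` {..n}"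
    using simple_process_common_grid[OF sp sp, of "{s}"] s by auto
  note D = simple_onD[OF q(1)]
  obtain j where j: "s = q j" using q(2) by auto
  \<comment> \<open>\<open>s\<close> is a node, so a cell that begins before \<open>s\<close> also
    ends by \<open>s\<close>; there the integrand is zero by assumption.\<close>
  have z: "s \<le> q i \<or> (\<forall>w\<in>space M. S (q (Suc i)) w $ c = 0)" for i c
  proof (cases "s \<le> q i")
    case False
    then have "i < j" using monoD[OF D(2), of j i] j by force
    then have "q (Suc i) \<le> s" using monoD[OF D(2), of "Suc i" j] j by simp
    then show ?thesis using zero by simp
  qed simp
  have Jw: "J w $ c = (\<Sum>i<n. S (q (Suc i)) w $ c \<bullet> (W (q (Suc i)) w - W (q i) w))" if "w \<in> space M" for w c
    using has_simple_integral_on[OF S q(1) that] by (simp add: grid_integral_component)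
  have Iw: "(\<integral>r. S r w $ a \<bullet> S r w $ b \<partial>lborel)
      = (\<Sum>i<n. S (q (Suc i)) w $ a \<bullet> S (q (Suc i)) w $ b * (q (Suc i) - q i))" if "w \<in> space M" for w
    using simple_on_path_integral[OF q(1) that, of "\<lambda>A. A $ a \<bullet> A $ b"]
    by (simp add: has_bochner_integral_integral_eq)
  have G: "(\<lambda>w. \<Sum>i<n. S (q (Suc i)) w $ a \<bullet> (W (q (Suc i)) w - W (q i) w)) \<in> borel_measurable (\<F> (q n)) \<and>
    (\<lambda>w. \<Sum>i<n. S (q (Suc i)) w $ b \<bullet> (W (q (Suc i)) w - W (q i) w)) \<in> borel_measurable (\<F> (q n)) \<and>
    integrable M (\<lambda>w. (\<Sum>i<n. S (q (Suc i)) w $ a \<bullet> (W (q (Suc i)) w - W (q i) w))\<^sup>2) \<and>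
    integrable M (\<lambda>w. (\<Sum>i<n. S (q (Suc i)) w $ b \<bullet> (W (q (Suc i)) w - W (q i) w))\<^sup>2) \<and>
    expectation (\<lambda>w. \<psi> w * (\<Sum>i<n. S (q (Suc i)) w $ a \<bullet> (W (q (Suc i)) w - W (q i) w))) = 0 \<and>
    integrable M (\<lambda>w. \<Sum>i<n. S (q (Suc i)) w $ a \<bullet> S (q (Suc i)) w $ b * (q (Suc i) - q i)) \<and>
    expectation (\<lambda>w. \<psi> w * ((\<Sum>i<n. S (q (Suc i)) w $ a \<bullet> (W (q (Suc i)) w - W (q i) w)) *
        (\<Sum>i<n. S (q (Suc i)) w $ b \<bullet> (W (q (Suc i)) w - W (q i) w))))
      = expectation (\<lambda>w. \<psi> w * (\<Sum>i<n. S (q (Suc i)) w $ a \<bullet> S (q (Suc i)) w $ b * (q (Suc i) - q i)))" for a b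
    by (rule grid_sum_covariance[where \<eta> = "\<lambda>i w. S (q (Suc i)) w $ a" and \<eta>' = "\<lambda>i w. S (q (Suc i)) w $ b"
        and s = s and L = L and n = n, OF D(2,1)])
      (use simple_on_row[OF q(1)] z \<psi> in blast)+
  have G': "(\<lambda>w. \<Sum>i<n. S (q (Suc i)) w $ c \<bullet> (W (q (Suc i)) w - W (q i) w)) \<in> borel_measurable (\<F> (q n))"
    "integrable M (\<lambda>w. (\<Sum>i<n. S (q (Suc i)) w $ c \<bullet> (W (q (Suc i)) w - W (q i) w))\<^sup>2)"
    "expectation (\<lambda>w. \<psi> w * (\<Sum>i<n. S (q (Suc i)) w $ c \<bullet> (W (q (Suc i)) w - W (q i) w))) = 0" for c
    using G[of c c] by auto
  have "(\<lambda>w. J w $ c) \<in> borel_measurable M" for c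
    using measurable_filtration_M[OF G'(1)[of c]] by (subst measurable_cong[OF Jw])
  then show "J \<in> borel_measurable M"
    by (rule borel_measurable_vecI)
  show "integrable M (\<lambda>w. (J w $ a)\<^sup>2)"
    using G'(2)[of a] by (subst Bochner_Integration.integrable_cong[OF refl]) (auto simp: Jw)
  show "expectation (\<lambda>w. \<psi> w * J w $ a) = 0"
    using G'(3)[of a] by (subst Bochner_Integration.integral_cong[OF refl]) (auto simp: Jw)
  show "integrable M (\<lambda>w. \<integral>r. S r w $ a \<bullet> S r w $ b \<partial>lborel)"
    using G[of a b] by (subst Bochner_Integration.integrable_cong[OF refl]) (auto simp: Iw)
  have "expectation (\<lambda>w. \<psi> w * (J w $ a * J w $ b)) = expectation (\<lambda>w. \<psi> w *
     ((\<Sum>i<n. S (q (Suc i)) w $ a \<bullet> (W (q (Suc i)) w - W (q i) w)) *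
      (\<Sum>i<n. S (q (Suc i)) w $ b \<bullet> (W (q (Suc i)) w - W (q i) w))))"
    by (intro Bochner_Integration.integral_cong refl) (simp add: Jw)
  also have "\<dots> = expectation (\<lambda>w. \<psi> w * (\<Sum>i<n. S (q (Suc i)) w $ a \<bullet> S (q (Suc i)) w $ b * (q (Suc i) - q i)))"
    using G[of a b] by blast
  also have "\<dots> = expectation (\<lambda>w. \<psi> w * (\<integral>r. S r w $ a \<bullet> S r w $ b \<partial>lborel))"
    by (intro Bochner_Integration.integral_cong refl) (simp add: Iw)
  finally show "expectation (\<lambda>w. \<psi> w * (J w $ a * J w $ b))
       = expectation (\<lambda>w. \<psi> w * (\<integral>r. S r w $ a \<bullet> S r w $ b \<partial>lborel))" .
qed

lemma simple_process_zero:
  assumes "simple_process S" "r \<le> 0" "w \<in> space M" shows "S r w = 0"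
proof -
  obtain q n where "simple_on q n S" using assms by (auto simp: simple_process_def)
  note D = simple_onD[OF this]
  show ?thesis using D(6)[of r w] D(1) assms by auto
qed

lemma simple_process_square_integral:
  fixes S :: "real \<Rightarrow> 'w \<Rightarrow> 'b::euclidean_space"
  assumes "simple_process S"
  shows "w \<in> space M \<Longrightarrow> integrable lborel (\<lambda>r. (norm (S r w))\<^sup>2)"
    "(\<lambda>w. \<integral>r. (norm (S r w))\<^sup>2 \<partial>lborel) \<in> borel_measurable M"
proof -
  obtain q n where q: "simple_on q n S" using assms by (auto simp: simple_process_def)
  note D = simple_onD[OF q]
  have h: "has_bochner_integral lborel (\<lambda>r. (norm (S r w))\<^sup>2)
      (\<Sum>i<n. (norm (S (q (Suc i)) w))\<^sup>2 * (q (Suc i) - q i))" if "w \<in> space M" for w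
    by (rule simple_on_path_integral[OF q that, of "\<lambda>x. (norm x)\<^sup>2"]) simp
  then show "w \<in> space M \<Longrightarrow> integrable lborel (\<lambda>r. (norm (S r w))\<^sup>2)" by (rule integrable.intros)
  have "(\<lambda>w. (norm (S (q (Suc i)) w))\<^sup>2 * (q (Suc i) - q i)) \<in> borel_measurable M" if "i < n" for i
  proof (cases "q i < q (Suc i)")
    case True
    then show ?thesis using measurable_filtration_M[OF D(3)[OF that True]] by measurable
  next
    case False
    then have "q (Suc i) = q i" using monoD[OF D(2), of i "Suc i"] by simp
    then show ?thesis by simp
  qed
  then show "(\<lambda>w. \<integral>r. (norm (S r w))\<^sup>2 \<partial>lborel) \<in> borel_measurable M"
    by (subst measurable_cong[OF has_bochner_integral_integral_eq[OF h]]) auto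
qed

text \<open>The conditional isometry at time \<open>0\<close> with weight \<open>1\<close>, summed
  over the diagonal: the squared norm of a matrix is the sum of the squared norms of its
  rows.\<close>

lemma has_simple_integral_isometry:
  assumes S: "has_simple_integral S J"
  shows "J \<in> borel_measurable M" "integrable M (\<lambda>w. (norm (J w))\<^sup>2)"
    "expectation (\<lambda>w. (norm (J w))\<^sup>2) = expectation (\<lambda>w. \<integral>r. (norm (S r w))\<^sup>2 \<partial>lborel)"
proof -
  have sp: "simple_process S" by (rule has_simple_integral_simple[OF S])
  obtain q n where q: "simple_on q n S" using sp by (auto simp: simple_process_def)
  note C = has_simple_integral_covariance[OF S order_refl simple_process_zero[OF sp], of "\<lambda>_. 1" 1, simplified]
  show "J \<in> borel_measurable M" by (rule C)
  show "integrable M (\<lambda>w. (norm (J w))\<^sup>2)"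
    unfolding norm_vec_square by (intro Bochner_Integration.integrable_sum C)
  have ii: "integrable lborel (\<lambda>r. S r w $ a \<bullet> S r w $ a)" if "w \<in> space M" for w a
    using simple_on_path_integral[OF q that, of "\<lambda>A. A $ a \<bullet> A $ a"] by (auto intro: integrable.intros)
  have "expectation (\<lambda>w. (norm (J w))\<^sup>2) = (\<Sum>a\<in>UNIV. expectation (\<lambda>w. (J w $ a)\<^sup>2))"
    unfolding norm_vec_square by (intro Bochner_Integration.integral_sum C)
  also have "\<dots> = (\<Sum>a\<in>UNIV. expectation (\<lambda>w. \<integral>r. S r w $ a \<bullet> S r w $ a \<partial>lborel))"
    by (simp add: C power2_eq_square)
  also have "\<dots> = expectation (\<lambda>w. \<Sum>a\<in>UNIV. \<integral>r. S r w $ a \<bullet> S r w $ a \<partial>lborel)"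
    by (intro Bochner_Integration.integral_sum[symmetric] C)
  also have "\<dots> = expectation (\<lambda>w. \<integral>r. (norm (S r w))\<^sup>2 \<partial>lborel)"
    unfolding norm_matrix_square
    by (intro Bochner_Integration.integral_cong refl Bochner_Integration.integral_sum[symmetric] ii)
  finally show "expectation (\<lambda>w. (norm (J w))\<^sup>2) = expectation (\<lambda>w. \<integral>r. (norm (S r w))\<^sup>2 \<partial>lborel)" .
qed

text \<open>The integrand is switched off just before its accumulated square exceeds \<open>\<delta>\<close>; this is known
  at the left end of each grid interval.\<close>

lemma has_simple_integral_prob_bound:
  assumes S: "has_simple_integral S J" and \<epsilon>: "0 < \<epsilon>" and \<delta>: "0 < \<delta>"
  shows "prob {w \<in> space M. \<epsilon> < norm (J w)}
    \<le> prob {w \<in> space M. \<delta> < (\<integral>r. (norm (S r w))\<^sup>2 \<partial>lborel)} + \<delta> / \<epsilon>\<^sup>2"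
proof -
  have sp: "simple_process S" by (rule has_simple_integral_simple[OF S])
  obtain q n where q: "simple_on q n S" using sp by (auto simp: simple_process_def)
  note D = simple_onD[OF q]
  define x where "x i w = (norm (S (q (Suc i)) w))\<^sup>2 * (q (Suc i) - q i)" for i w
  \<comment> \<open>The sum includes cell \<open>i\<close> itself: the coefficient on that cell is
    already known at its left end, and counting it keeps the retained total from overshooting
    \<open>\<delta>\<close>.\<close>
  define V where "V i w = (\<Sum>k<Suc i. x k w)" for i w
  define ch where "ch i w = (if V i w \<le> \<delta> then 1 else 0 :: real)" for i w
  define J' where "J' w = (\<chi> a. \<Sum>i<n. (ch i w *\<^sub>R S (q (Suc i)) w $ a) \<bullet> (W (q (Suc i)) w - W (q i) w))" for w
  have x0: "0 \<le> x i w" for i w using monoD[OF D(2), of i "Suc i"] by (simp add: x_def)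
  have Iw: "(\<integral>r. (norm (S r w))\<^sup>2 \<partial>lborel) = (\<Sum>i<n. x i w)" if "w \<in> space M" for w
    using simple_on_path_integral[OF q that, of "\<lambda>x. (norm x)\<^sup>2"]
    by (simp add: has_bochner_integral_integral_eq x_def)
  have mx: "x k \<in> borel_measurable (\<F> (q i))" if "k < n" "k \<le> i" for k i
  proof (cases "q k < q (Suc k)")
    case True
    have "S (q (Suc k)) \<in> borel_measurable (\<F> (q i))"
      using D(3)[OF that(1) True] monoD[OF D(2) that(2)] by (rule measurable_filtration_mono)
    then show ?thesis unfolding x_def[abs_def] by measurable
  next
    case False
    then have "q (Suc k) = q k" using monoD[OF D(2), of k "Suc k"] by simp
    then show ?thesis by (simp add: x_def[abs_def])
  qed
  have mch: "ch i \<in> borel_measurable (\<F> (q i))" if "i < n" for i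
  proof -
    have "V i \<in> borel_measurable (\<F> (q i))" unfolding V_def[abs_def]
      using that by (intro borel_measurable_sum mx) auto
    then show ?thesis unfolding ch_def[abs_def] by measurable
  qed
  have \<eta>: "(\<lambda>w. ch i w *\<^sub>R S (q (Suc i)) w $ a) \<in> borel_measurable (\<F> (q i))"
    "bounded ((\<lambda>w. ch i w *\<^sub>R S (q (Suc i)) w $ a) ` space M)"
    if "i < n" "q i < q (Suc i)" for i a
  proof -
    note i = that
    show "(\<lambda>w. ch i w *\<^sub>R S (q (Suc i)) w $ a) \<in> borel_measurable (\<F> (q i))"
      by (rule borel_measurable_scaleR[OF mch[OF that(1)] simple_on_row(1)[OF q that]])
    obtain K where K: "\<And>w. w \<in> space M \<Longrightarrow> norm (S (q (Suc i)) w $ a) \<le> K"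
      using simple_on_row(2)[OF q i, of a] by (auto simp: bounded_iff)
    have "norm (ch i w *\<^sub>R S (q (Suc i)) w $ a) \<le> K" if "w \<in> space M" for w
      using K[OF that] order_trans[OF norm_ge_zero K[OF that]] by (auto simp: ch_def)
    then show "bounded ((\<lambda>w. ch i w *\<^sub>R S (q (Suc i)) w $ a) ` space M)" by (auto simp: bounded_iff)
  qed
  have z: "0 \<le> q i \<or> (\<forall>w\<in>space M. ch i w *\<^sub>R S (q (Suc i)) w $ a = 0)" for i a
    using D(1) monoD[OF D(2), of 0 i] by simp
  have G: "(\<lambda>w. \<Sum>i<n. (ch i w *\<^sub>R S (q (Suc i)) w $ a) \<bullet> (W (q (Suc i)) w - W (q i) w)) \<in> borel_measurable M \<and>
    integrable M (\<lambda>w. (\<Sum>i<n. (ch i w *\<^sub>R S (q (Suc i)) w $ a) \<bullet> (W (q (Suc i)) w - W (q i) w))\<^sup>2) \<and>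
    integrable M (\<lambda>w. \<Sum>i<n. ((ch i w *\<^sub>R S (q (Suc i)) w $ a) \<bullet> (ch i w *\<^sub>R S (q (Suc i)) w $ a)) * (q (Suc i) - q i)) \<and>
    expectation (\<lambda>w. (\<Sum>i<n. (ch i w *\<^sub>R S (q (Suc i)) w $ a) \<bullet> (W (q (Suc i)) w - W (q i) w))\<^sup>2)
     = expectation (\<lambda>w. \<Sum>i<n. ((ch i w *\<^sub>R S (q (Suc i)) w $ a) \<bullet> (ch i w *\<^sub>R S (q (Suc i)) w $ a)) * (q (Suc i) - q i))" for a
  proof -
    note grid_sum_covariance[where \<eta> = "\<lambda>i w. ch i w *\<^sub>R S (q (Suc i)) w $ a"
        and \<eta>' = "\<lambda>i w. ch i w *\<^sub>R S (q (Suc i)) w $ a" and \<psi> = "\<lambda>_. 1"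
        and s = 0 and L = 1 and n = n and k = n, OF D(2,1)]
    note G = this[OF \<eta> z \<eta> z]
    then show ?thesis
      using measurable_filtration_M[of "\<lambda>w. \<Sum>i<n. (ch i w *\<^sub>R S (q (Suc i)) w $ a) \<bullet> (W (q (Suc i)) w - W (q i) w)" "q n"]
      unfolding power2_eq_square by simp
  qed
  note Gs = G[THEN conjunct2, THEN conjunct2, THEN conjunct1]
  have mJ': "J' \<in> borel_measurable M"
    unfolding J'_def[abs_def] by (rule borel_measurable_vecI) (use G in simp)
  have iJ': "integrable M (\<lambda>w. (norm (J' w))\<^sup>2)"
    unfolding norm_vec_square J'_def using G by simp
  \<comment> \<open>The second inequality carries the induction: if cell \<open>k\<close> is
    retained, the retained total is at most the full total \<open>V k w\<close> and hence at most
    \<open>\<delta>\<close>; otherwise nothing is added.\<close>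
  have step: "(\<Sum>i<k. ch i w * x i w) \<le> \<delta> \<and> (\<Sum>i<k. ch i w * x i w) \<le> (\<Sum>i<k. x i w)" for k w
  proof (induction k)
    case (Suc k)
    then show ?case using x0[of k w] by (auto simp: ch_def V_def)
  qed (use \<delta> in simp)
  have "expectation (\<lambda>w. (norm (J' w))\<^sup>2) = (\<Sum>a\<in>UNIV. expectation (\<lambda>w. \<Sum>i<n. ((ch i w *\<^sub>R S (q (Suc i)) w $ a) \<bullet> (ch i w *\<^sub>R S (q (Suc i)) w $ a)) * (q (Suc i) - q i)))"
    unfolding norm_vec_square J'_def using G by simp
  also have "\<dots> = expectation (\<lambda>w. \<Sum>a\<in>UNIV. \<Sum>i<n. ((ch i w *\<^sub>R S (q (Suc i)) w $ a) \<bullet> (ch i w *\<^sub>R S (q (Suc i)) w $ a)) * (q (Suc i) - q i))"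
    by (intro Bochner_Integration.integral_sum[symmetric] Gs)
  also have "\<dots> \<le> expectation (\<lambda>w. \<delta>)"
  proof (rule integral_mono)
    show "integrable M (\<lambda>w. \<Sum>a\<in>UNIV. \<Sum>i<n. ((ch i w *\<^sub>R S (q (Suc i)) w $ a) \<bullet> (ch i w *\<^sub>R S (q (Suc i)) w $ a)) * (q (Suc i) - q i))"
      by (intro Bochner_Integration.integrable_sum Gs)
    fix w
    have "(\<Sum>a\<in>UNIV. \<Sum>i<n. ((ch i w *\<^sub>R S (q (Suc i)) w $ a) \<bullet> (ch i w *\<^sub>R S (q (Suc i)) w $ a)) * (q (Suc i) - q i))
       = (\<Sum>i<n. ch i w * x i w)"
      by (subst sum.swap, intro sum.cong refl)
        (auto simp: x_def norm_matrix_square ch_def sum_distrib_right)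
    then show "(\<Sum>a\<in>UNIV. \<Sum>i<n. ((ch i w *\<^sub>R S (q (Suc i)) w $ a) \<bullet> (ch i w *\<^sub>R S (q (Suc i)) w $ a)) * (q (Suc i) - q i)) \<le> \<delta>"
      using step[of w n] by simp
  qed simp
  also have "\<dots> = \<delta>" by (simp add: prob_space)
  finally have EJ': "expectation (\<lambda>w. (norm (J' w))\<^sup>2) \<le> \<delta>" .
  have mJ: "J \<in> borel_measurable M" by (rule has_simple_integral_isometry[OF S])
  have mI: "(\<lambda>w. \<integral>r. (norm (S r w))\<^sup>2 \<partial>lborel) \<in> borel_measurable M"
    by (rule simple_process_square_integral[OF sp])
  \<comment> \<open>On a path whose total energy is at most \<open>\<delta>\<close> nothing is
    switched off. There \<open>J'\<close> replaces \<open>J\<close>, and Markov's inequality applies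
    to its square, whose mean is at most \<open>\<delta>\<close>.\<close>
  have JJ': "J w = J' w" if "w \<in> space M" "\<not> \<delta> < (\<integral>r. (norm (S r w))\<^sup>2 \<partial>lborel)" for w
  proof -
    have "V i w \<le> \<delta>" if "i < n" for i
    proof -
      have "V i w \<le> (\<Sum>i<n. x i w)"
        unfolding V_def using that x0 by (intro sum_mono2) auto
      then show ?thesis using \<open>\<not> _\<close> Iw[OF \<open>w \<in> space M\<close>] by simp
    qed
    then show ?thesis
      using has_simple_integral_on[OF S q that(1)]
      by (simp add: vec_eq_iff J'_def grid_integral_component ch_def)
  qed
  have "prob {w \<in> space M. \<epsilon> < norm (J w)}
     \<le> prob ({w \<in> space M. \<delta> < (\<integral>r. (norm (S r w))\<^sup>2 \<partial>lborel)} \<union> {w \<in> space M. \<epsilon>\<^sup>2 \<le> (norm (J' w))\<^sup>2})"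
  proof (rule finite_measure_mono)
    show "{w \<in> space M. \<epsilon> < norm (J w)}
      \<subseteq> {w \<in> space M. \<delta> < (\<integral>r. (norm (S r w))\<^sup>2 \<partial>lborel)} \<union> {w \<in> space M. \<epsilon>\<^sup>2 \<le> (norm (J' w))\<^sup>2}"
    proof
      fix w assume w: "w \<in> {w \<in> space M. \<epsilon> < norm (J w)}"
      show "w \<in> {w \<in> space M. \<delta> < (\<integral>r. (norm (S r w))\<^sup>2 \<partial>lborel)} \<union> {w \<in> space M. \<epsilon>\<^sup>2 \<le> (norm (J' w))\<^sup>2}"
        using w JJ'[of w] \<epsilon> by (cases "\<delta> < (\<integral>r. (norm (S r w))\<^sup>2 \<partial>lborel)") (auto intro!: power_mono)
    qed
  qed (use mJ' mI in auto)
  also have "\<dots> \<le> prob {w \<in> space M. \<delta> < (\<integral>r. (norm (S r w))\<^sup>2 \<partial>lborel)} + prob {w \<in> space M. \<epsilon>\<^sup>2 \<le> (norm (J' w))\<^sup>2}"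
    using mJ' mI by (intro measure_Un_le) auto
  also have "prob {w \<in> space M. \<epsilon>\<^sup>2 \<le> (norm (J' w))\<^sup>2} \<le> expectation (\<lambda>w. (norm (J' w))\<^sup>2) / \<epsilon>\<^sup>2"
    by (rule integral_Markov_inequality_measure[OF iJ', where A="{}"]) (use \<epsilon> in auto)
  also have "\<dots> \<le> \<delta> / \<epsilon>\<^sup>2" using EJ' by (intro divide_right_mono) auto
  finally show ?thesis by simp
qed

text \<open>The preceding estimate involves the energy only through a probability, so the elementary
  integral is continuous for convergence in probability. This is what makes a limit independent of
  the approximating sequence.\<close>

lemma tends_in_prob0_simple_integral:
  assumes S: "\<And>j. has_simple_integral (S j) (J j)"
    and lim: "tends_in_prob0 (\<lambda>j w. \<integral>r. (norm (S j r w))\<^sup>2 \<partial>lborel)"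
  shows "tends_in_prob0 (\<lambda>j w. norm (J j w))"
proof (rule tends_in_prob0I)
  show mJ: "(\<lambda>w. norm (J j w)) \<in> borel_measurable M" for j
    using has_simple_integral_isometry(1)[OF S[of j]] by measurable
  fix \<epsilon> :: real assume \<epsilon>: "0 < \<epsilon>"
  let ?I = "\<lambda>j w. \<integral>r. (norm (S j r w))\<^sup>2 \<partial>lborel"
  have mI: "?I j \<in> borel_measurable M" for j
    using lim by (auto simp: tends_in_prob0_def)
  show "(\<lambda>j. prob {w \<in> space M. \<epsilon> < \<bar>norm (J j w)\<bar>}) \<longlonglongrightarrow> 0"
  proof (rule order_tendstoI)
    fix a :: real assume a: "0 < a"
    \<comment> \<open>Half of \<open>a\<close> is reserved for the term
      \<open>\<delta> / \<epsilon>\<^sup>2\<close>; the cap \<open>1\<close> is what Markov's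
      inequality for truncated variables requires.\<close>
    define \<delta> where "\<delta> = min 1 (a / 2 * \<epsilon>\<^sup>2)"
    have \<delta>: "0 < \<delta>" "\<delta> \<le> 1" using a \<epsilon> by (auto simp: \<delta>_def)
    have "\<delta> / \<epsilon>\<^sup>2 \<le> a / 2" using \<epsilon> by (simp add: \<delta>_def pos_divide_le_eq)
    moreover have "eventually (\<lambda>j. expectation (\<lambda>w. min 1 \<bar>?I j w\<bar>) < \<delta> * (a / 2)) sequentially"
      by (rule order_tendstoD(2)[where y = 0]) (use lim a \<delta> in \<open>auto simp: tends_in_prob0_def\<close>)
    ultimately show "eventually (\<lambda>j. prob {w \<in> space M. \<epsilon> < \<bar>norm (J j w)\<bar>} < a) sequentially"
    proof (elim eventually_mono)
      fix j assume *: "expectation (\<lambda>w. min 1 \<bar>?I j w\<bar>) < \<delta> * (a / 2)" "\<delta> / \<epsilon>\<^sup>2 \<le> a / 2"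
      have "prob {w \<in> space M. \<epsilon> < \<bar>norm (J j w)\<bar>} \<le> prob {w \<in> space M. \<delta> < ?I j w} + \<delta> / \<epsilon>\<^sup>2"
        using has_simple_integral_prob_bound[OF S \<epsilon> \<delta>(1), of j] by simp
      moreover have "prob {w \<in> space M. \<delta> < ?I j w} = prob {w \<in> space M. \<delta> < \<bar>?I j w\<bar>}"
        by (intro arg_cong[of _ _ prob] Collect_cong conj_cong refl) simp
      moreover have "\<dots> \<le> expectation (\<lambda>w. min 1 \<bar>?I j w\<bar>) / \<delta>"
        by (rule prob_greater_le_expectation_min[OF mI \<delta>])
      moreover have "\<dots> < a / 2" using *(1) \<delta> by (simp add: pos_divide_less_eq mult.commute)
      ultimately show "prob {w \<in> space M. \<epsilon> < \<bar>norm (J j w)\<bar>} < a" using *(2) by linarith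
    qed
  next
    fix a :: real assume "a < 0"
    then show "eventually (\<lambda>j. a < prob {w \<in> space M. \<epsilon> < \<bar>norm (J j w)\<bar>}) sequentially"
      by (intro always_eventually allI) (rule less_le_trans, auto)
  qed
qed

end

section \<open>Dynkin's formula\<close>

lemma norm_matrix_vector_mult_le: "norm ((A :: real ^ 'm ^ 'n) *v x) \<le> norm A * norm x"
proof (rule power2_le_imp_le)
  have "(norm (A *v x))\<^sup>2 = (\<Sum>a\<in>UNIV. (A $ a \<bullet> x)\<^sup>2)"
    by (simp add: norm_vec_square matrix_vector_mul_component)
  also have "\<dots> \<le> (\<Sum>a\<in>UNIV. (norm (A $ a))\<^sup>2 * (norm x)\<^sup>2)"
    by (intro sum_mono) (metis Cauchy_Schwarz_ineq power2_norm_eq_inner)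
  also have "\<dots> = (norm A * norm x)\<^sup>2"
    unfolding power_mult_distrib power2_norm_eq_inner[of A] inner_vec_def[of A]
    by (simp add: sum_distrib_right power2_norm_eq_inner)
  finally show "(norm (A *v x))\<^sup>2 \<le> (norm A * norm x)\<^sup>2" .
qed simp

lemma abs_quadratic_form_le: "\<bar>x \<bullet> ((A :: real ^ 'n ^ 'n) *v y)\<bar> \<le> norm A * (norm x * norm y)"
proof -
  have "\<bar>x \<bullet> (A *v y)\<bar> \<le> norm x * norm (A *v y)" by (rule Cauchy_Schwarz_ineq2)
  also have "\<dots> \<le> norm x * (norm A * norm y)"
    by (intro mult_left_mono norm_matrix_vector_mult_le norm_ge_zero)
  finally show ?thesis by (simp add: mult_ac)
qed

lemma continuous_on_matrix_vector_mult [continuous_intros]: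
  fixes f :: "'a::topological_space \<Rightarrow> real ^ 'm ^ 'n" and g :: "'a \<Rightarrow> real ^ 'm"
  assumes "continuous_on S f" "continuous_on S g"
  shows "continuous_on S (\<lambda>x. f x *v g x)"
  unfolding matrix_vector_mult_def using assms
  by (intro continuous_on_vec_lambda continuous_intros)

text \<open>No integrability of \<open>f\<close> is assumed, so the equivalence of integrability
  comes first: adding or removing the single point \<open>a\<close> changes the function by an
  integrable one. If neither side is integrable, both integrals are \<open>0\<close> by
  convention.\<close>

lemma set_integral_Ioc_Icc:
  fixes f :: "real \<Rightarrow> 'b::{banach, second_countable_topology}"
  shows "set_integrable lborel {a<..b} f \<longleftrightarrow> set_integrable lborel {a..b} f"
    "(LINT r:{a<..b}|lborel. f r) = (LINT r:{a..b}|lborel. f r)"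
proof -
  have ae: "AE r in lborel. indicator {a<..b} r *\<^sub>R f r = indicator {a..b} r *\<^sub>R f r"
    using AE_lborel_singleton[of a] by eventually_elim (auto simp: indicator_def)
  have eq: "(\<lambda>r. indicator {a..b} r *\<^sub>R f r)
      = (\<lambda>r. indicator {a<..b} r *\<^sub>R f r + indicator ({a} \<inter> {a..b}) r *\<^sub>R f a)"
    "(\<lambda>r. indicator {a<..b} r *\<^sub>R f r)
      = (\<lambda>r. indicator {a..b} r *\<^sub>R f r - indicator ({a} \<inter> {a..b}) r *\<^sub>R f a)"
    by (auto simp: fun_eq_iff indicator_def)
  have i: "integrable lborel (\<lambda>r. indicator ({a} \<inter> {a..b}) r *\<^sub>R f a)"
    by (intro integrable_scaleR_left) (auto intro!: integrable_real_indicator emeasure_bounded_finite)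
  show s: "set_integrable lborel {a<..b} f \<longleftrightarrow> set_integrable lborel {a..b} f"
  proof
    assume "set_integrable lborel {a<..b} f"
    then show "set_integrable lborel {a..b} f"
      unfolding set_integrable_def eq(1) by (intro Bochner_Integration.integrable_add i)
  next
    assume "set_integrable lborel {a..b} f"
    then show "set_integrable lborel {a<..b} f"
      unfolding set_integrable_def eq(2) by (intro Bochner_Integration.integrable_diff i)
  qed
  show "(LINT r:{a<..b}|lborel. f r) = (LINT r:{a..b}|lborel. f r)"
  proof (cases "set_integrable lborel {a<..b} f")
    case True
    then show ?thesis using s ae unfolding set_lebesgue_integral_def set_integrable_def
      by (intro integral_cong_AE) auto
  next
    case False
    then show ?thesis using s unfolding set_lebesgue_integral_def set_integrable_def
      by (simp add: not_integrable_integral_eq)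
  qed
qed

lemma set_integral_Ioc_FTC:
  fixes f :: "real \<Rightarrow> real"
  assumes "a \<le> b" and d: "\<And>x. x \<in> {a..b} \<Longrightarrow> (g has_real_derivative f x) (at x within {a..b})"
    and f: "continuous_on {a..b} f"
  shows "(LINT r:{a<..b}|lborel. f r) = g b - g a"
proof -
  have "has_bochner_integral lborel (\<lambda>x. indicator {a..b} x *\<^sub>R f x) (g b - g a)"
    using assms by (intro has_bochner_integral_FTC_Icc) (auto simp: has_real_derivative_iff_has_vector_derivative)
  then show ?thesis
    unfolding set_integral_Ioc_Icc(2) unfolding set_lebesgue_integral_def
    by (rule has_bochner_integral_integral_eq)
qed

lemma norm_set_integral_Ioc_le:
  fixes f :: "real \<Rightarrow> 'b::{banach, second_countable_topology}"
  assumes "a \<le> b" "\<And>r. r \<in> {a<..b} \<Longrightarrow> norm (f r) \<le> B" "0 \<le> B"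
  shows "norm (LINT r:{a<..b}|lborel. f r) \<le> B * (b - a)"
proof (cases "set_integrable lborel {a<..b} f")
  case True
  have "norm (LINT r:{a<..b}|lborel. f r) \<le> (LINT r:{a<..b}|lborel. norm (f r))"
    by (rule set_integral_norm_bound[OF True])
  also have "\<dots> \<le> (LINT r:{a<..b}|lborel. B)"
  proof (rule set_integral_mono)
    show "set_integrable lborel {a<..b} (\<lambda>r. norm (f r))" using True by (rule set_integrable_norm)
    show "set_integrable lborel {a<..b} (\<lambda>r. B)" using \<open>a \<le> b\<close> by (simp add: set_integrable_def)
  qed (use assms in auto)
  also have "\<dots> = B * (b - a)" using \<open>a \<le> b\<close> by (simp add: set_lebesgue_integral_def)
  finally show ?thesis .
next
  case False
  then show ?thesis using assms
    by (simp add: set_lebesgue_integral_def set_integrable_def not_integrable_integral_eq)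
qed

lemma set_integrable_Ioc_bounded:
  fixes f :: "real \<Rightarrow> 'b::{banach, second_countable_topology}"
  assumes "f \<in> borel_measurable lborel" "\<And>r. r \<in> {a<..b} \<Longrightarrow> norm (f r) \<le> B"
  shows "set_integrable lborel {a<..b} f"
  unfolding set_integrable_def
proof (rule Bochner_Integration.integrable_bound)
  show "integrable lborel (\<lambda>r. indicator {a<..b} r *\<^sub>R B)"
    by (cases "a \<le> b") (auto intro!: integrable_scaleR_left integrable_real_indicator)
  show "AE r in lborel. norm (indicator {a<..b} r *\<^sub>R f r) \<le> norm (indicator {a<..b} r *\<^sub>R B)"
    using assms(2) by (intro AE_I2) (auto simp: indicator_def intro: order_trans[OF _ abs_ge_self])
qed (use assms in auto)

text \<open>A bounded continuous process \<open>Y\<close> with bounded drift \<open>\<beta>\<close> and quadratic covariation density \<open>C\<close>,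
  described by the martingale properties of \<open>Y t - Y s - \<integral> \<beta>\<close> only.\<close>

locale bounded_ito_process = prob_space M for M :: "'w measure" +
  fixes F :: "real \<Rightarrow> 'w measure" and T R B :: real
    and Y :: "real \<Rightarrow> 'w \<Rightarrow> real ^ 'n" and \<beta> :: "real \<Rightarrow> 'w \<Rightarrow> real ^ 'n"
    and C :: "real \<Rightarrow> 'w \<Rightarrow> real ^ 'n ^ 'n" and noise :: "real \<Rightarrow> real \<Rightarrow> 'w \<Rightarrow> real ^ 'n"
  assumes T_pos: "0 < T"
    and F_sub: "subalgebra M (F t)"
    and F_mono: "0 \<le> s \<Longrightarrow> s \<le> t \<Longrightarrow> sets (F s) \<subseteq> sets (F t)"
    and Y_adapted: "t \<in> {0..T} \<Longrightarrow> Y t \<in> borel_measurable (F t)"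
    and Y_continuous: "w \<in> space M \<Longrightarrow> continuous_on {0..T} (\<lambda>t. Y t w)"
    and Y_bound: "t \<in> {0..T} \<Longrightarrow> w \<in> space M \<Longrightarrow> norm (Y t w) \<le> R"
    and \<beta>_measurable: "(\<lambda>(w, r). \<beta> r w) \<in> borel_measurable (M \<Otimes>\<^sub>M lborel)"
    and \<beta>_bound: "w \<in> space M \<Longrightarrow> norm (\<beta> r w) \<le> B"
    and C_measurable: "(\<lambda>(w, r). C r w) \<in> borel_measurable (M \<Otimes>\<^sub>M lborel)"
    and C_bound: "w \<in> space M \<Longrightarrow> norm (C r w) \<le> B"
    and noise_def: "noise s t w = Y t w - Y s w - (LINT r:{s<..t}|lborel. \<beta> r w)"
    and noise_mean: "0 \<le> s \<Longrightarrow> s \<le> t \<Longrightarrow> t \<le> T \<Longrightarrow> \<psi> \<in> borel_measurable (F s) \<Longrightarrow>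
       (\<And>w. w \<in> space M \<Longrightarrow> \<bar>\<psi> w\<bar> \<le> L) \<Longrightarrow> expectation (\<lambda>w. \<psi> w * noise s t w $ a) = 0"
    and noise_covariance: "0 \<le> s \<Longrightarrow> s \<le> t \<Longrightarrow> t \<le> T \<Longrightarrow> \<psi> \<in> borel_measurable (F s) \<Longrightarrow>
       (\<And>w. w \<in> space M \<Longrightarrow> \<bar>\<psi> w\<bar> \<le> L) \<Longrightarrow>
       expectation (\<lambda>w. \<psi> w * (noise s t w $ a * noise s t w $ c))
         = expectation (\<lambda>w. \<psi> w * (LINT r:{s<..t}|lborel. C r w $ a $ c))"
begin

abbreviation drift :: "real \<Rightarrow> real \<Rightarrow> 'w \<Rightarrow> real ^ 'n" where
  "drift s t w \<equiv> LINT r:{s<..t}|lborel. \<beta> r w"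

lemma B_nonneg: "0 \<le> B"
  using \<beta>_bound[of "SOME w. w \<in> space M" 0] not_empty norm_ge_zero order_trans some_in_eq by metis

lemma F_measurable_mono: "f \<in> borel_measurable (F s) \<Longrightarrow> 0 \<le> s \<Longrightarrow> s \<le> t \<Longrightarrow> f \<in> borel_measurable (F t)"
  using F_mono F_sub by (auto simp: measurable_def subalgebra_def)

lemma F_measurable_M: "f \<in> borel_measurable (F s) \<Longrightarrow> f \<in> borel_measurable M"
  by (rule measurable_from_subalg[OF F_sub])

lemma Y_measurable: "t \<in> {0..T} \<Longrightarrow> Y t \<in> borel_measurable M"
  by (rule F_measurable_M[OF Y_adapted])

lemma path_measurable:
  "w \<in> space M \<Longrightarrow> (\<lambda>r. \<beta> r w) \<in> borel_measurable lborel"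
  "w \<in> space M \<Longrightarrow> (\<lambda>r. C r w) \<in> borel_measurable lborel"
  using measurable_Pair2[OF \<beta>_measurable] measurable_Pair2[OF C_measurable] by auto

lemma path_integral_measurable:
  fixes f :: "'w \<Rightarrow> real \<Rightarrow> 'b::{banach, second_countable_topology}"
  assumes "(\<lambda>(w, r). f w r) \<in> borel_measurable (M \<Otimes>\<^sub>M lborel)"
  shows "(\<lambda>w. LINT r:{s<..t}|lborel. f w r) \<in> borel_measurable M"
  unfolding set_lebesgue_integral_def
proof (rule lborel.borel_measurable_lebesgue_integral)
  have "(\<lambda>x. indicator {s<..t} (snd x) *\<^sub>R f (fst x) (snd x)) \<in> borel_measurable (M \<Otimes>\<^sub>M lborel)"
    using assms by (intro borel_measurable_scaleR) (auto simp: case_prod_beta)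
  then show "(\<lambda>(w, r). indicator {s<..t} r *\<^sub>R f w r) \<in> borel_measurable (M \<Otimes>\<^sub>M lborel)"
    by (simp add: case_prod_beta)
qed

lemma drift_measurable: "drift s t \<in> borel_measurable M"
  using path_integral_measurable[OF \<beta>_measurable] by simp

lemma drift_bound: "w \<in> space M \<Longrightarrow> s \<le> t \<Longrightarrow> norm (drift s t w) \<le> B * (t - s)"
  by (intro norm_set_integral_Ioc_le \<beta>_bound B_nonneg)

lemma noise_measurable: "s \<in> {0..T} \<Longrightarrow> t \<in> {0..T} \<Longrightarrow> noise s t \<in> borel_measurable M"
  unfolding noise_def[abs_def] using Y_measurable drift_measurable by auto

lemma noise_bound:
  assumes "s \<in> {0..T}" "t \<in> {0..T}" "s \<le> t" "w \<in> space M"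
  shows "norm (noise s t w) \<le> 2 * R + B * T"
proof -
  have "norm (noise s t w) \<le> norm (Y t w) + norm (Y s w) + norm (drift s t w)"
    unfolding noise_def by (intro order_trans[OF norm_triangle_ineq4] add_mono norm_triangle_ineq4 order_refl)
  also have "\<dots> \<le> R + R + B * (t - s)"
    using assms by (intro add_mono Y_bound drift_bound) auto
  also have "B * (t - s) \<le> B * T" using assms B_nonneg by (intro mult_left_mono) auto
  finally show ?thesis by simp
qed

lemma integrable_bounded: "f \<in> borel_measurable M \<Longrightarrow> (\<And>w. w \<in> space M \<Longrightarrow> norm (f w :: real) \<le> L) \<Longrightarrow> integrable M f"
  by (rule integrable_const_bound[of _ L]) auto

text \<open>Growth rates per unit of time. \<open>KQ\<close> is for the mean square of the noise: a
  sum of \<open>CARD('n)\<close> diagonal entries of \<open>C\<close>, each at most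
  \<open>B\<close>. \<open>KY\<close> in the next line is for the mean square of the increments of
  \<open>Y\<close>: twice the noise part plus twice the square of the drift, which is at most
  \<open>B\<^sup>2 * T * (t - s)\<close>.\<close>

definition "KQ = real CARD('n) * B"
definition "KY = 2 * KQ + 2 * B\<^sup>2 * T"

lemma expectation_noise_square_le:
  assumes st: "0 \<le> s" "s \<le> t" "t \<le> T"
    and \<psi>: "\<psi> \<in> borel_measurable (F s)" "\<And>w. w \<in> space M \<Longrightarrow> 0 \<le> \<psi> w" "\<And>w. w \<in> space M \<Longrightarrow> \<psi> w \<le> L"
  shows "expectation (\<lambda>w. \<psi> w * (norm (noise s t w))\<^sup>2) \<le> KQ * (t - s) * expectation \<psi>"
proof -
  have \<psi>M: "\<psi> \<in> borel_measurable M" using \<psi>(1) by (rule F_measurable_M)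
  have ab: "\<bar>\<psi> w\<bar> \<le> L" if "w \<in> space M" for w using \<psi>(2,3) that by auto
  have i\<psi>: "integrable M \<psi>" using \<psi>M ab by (intro integrable_bounded[of _ L]) auto
  have s: "s \<in> {0..T}" "t \<in> {0..T}" using st by auto
  have iZ: "integrable M (\<lambda>w. \<psi> w * (noise s t w $ a * noise s t w $ a))" for a
  proof (rule integrable_mult_bounded[OF _ \<psi>M ab])
    show "integrable M (\<lambda>w. noise s t w $ a * noise s t w $ a)"
    proof (rule integrable_bounded)
      show "(\<lambda>w. noise s t w $ a * noise s t w $ a) \<in> borel_measurable M"
        using noise_measurable[OF s] by (intro borel_measurable_times; rule measurable_compose) auto
      fix w assume w: "w \<in> space M"
      have "\<bar>noise s t w $ a\<bar> \<le> 2 * R + B * T"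
        using order_trans[OF component_le_norm_cart noise_bound[OF s st(2) w]] by simp
      then have "\<bar>noise s t w $ a\<bar> * \<bar>noise s t w $ a\<bar> \<le> (2 * R + B * T) * (2 * R + B * T)"
        by (intro mult_mono) auto
      then show "norm (noise s t w $ a * noise s t w $ a) \<le> (2 * R + B * T) * (2 * R + B * T)"
        by (simp add: abs_mult)
    qed
  qed
  have "expectation (\<lambda>w. \<psi> w * (norm (noise s t w))\<^sup>2)
      = expectation (\<lambda>w. \<Sum>a\<in>UNIV. \<psi> w * (noise s t w $ a * noise s t w $ a))"
    unfolding norm_vec_square by (simp add: sum_distrib_left power2_eq_square)
  also have "\<dots> = (\<Sum>a\<in>UNIV. expectation (\<lambda>w. \<psi> w * (noise s t w $ a * noise s t w $ a)))"
    by (rule Bochner_Integration.integral_sum[OF iZ])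
  also have "\<dots> = (\<Sum>a\<in>UNIV. expectation (\<lambda>w. \<psi> w * (LINT r:{s<..t}|lborel. C r w $ a $ a)))"
    by (simp add: noise_covariance[OF st \<psi>(1) ab])
  also have "\<dots> \<le> (\<Sum>a\<in>(UNIV :: 'n set). expectation (\<lambda>w. \<psi> w * (B * (t - s))))"
  proof (intro sum_mono integral_mono_AE')
    fix a :: 'n
    have "(LINT r:{s<..t}|lborel. C r w $ a $ a) \<le> B * (t - s)" if w: "w \<in> space M" for w
    proof -
      have "norm (C r w $ a $ a) \<le> B" for r
        using C_bound[OF w, of r] Finite_Cartesian_Product.norm_nth_le[of "C r w" a]
          Finite_Cartesian_Product.norm_nth_le[of "C r w $ a" a] by simp
      then have "norm (LINT r:{s<..t}|lborel. C r w $ a $ a) \<le> B * (t - s)"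
        using st B_nonneg by (intro norm_set_integral_Ioc_le) auto
      then show ?thesis by simp
    qed
    then show "AE w in M. \<psi> w * (LINT r:{s<..t}|lborel. C r w $ a $ a) \<le> \<psi> w * (B * (t - s))"
      using \<psi>(2) by (intro AE_I2 mult_left_mono) auto
    show "AE w in M. 0 \<le> \<psi> w * (B * (t - s))" using \<psi>(2) B_nonneg st by (intro AE_I2) auto
  qed (use i\<psi> in auto)
  also have "\<dots> = KQ * (t - s) * expectation \<psi>" by (simp add: KQ_def mult_ac)
  finally show ?thesis .
qed

lemma norm_increment_square_le:
  assumes "s \<le> t" "w \<in> space M" "t - s \<le> T"
  shows "(norm (Y t w - Y s w))\<^sup>2 \<le> 2 * (norm (noise s t w))\<^sup>2 + 2 * B\<^sup>2 * T * (t - s)"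
proof -
  have "norm (Y t w - Y s w) \<le> norm (noise s t w) + norm (drift s t w)"
    using norm_triangle_ineq[of "noise s t w" "drift s t w"] by (simp add: noise_def)
  then have "(norm (Y t w - Y s w))\<^sup>2 \<le> (norm (noise s t w) + norm (drift s t w))\<^sup>2" by (intro power_mono) auto
  also have "\<dots> \<le> 2 * (norm (noise s t w))\<^sup>2 + 2 * (norm (drift s t w))\<^sup>2"
    using sum_squares_bound[of "norm (noise s t w)" "norm (drift s t w)"] by (simp add: power2_sum)
  also have "(norm (drift s t w))\<^sup>2 \<le> (B * (t - s))\<^sup>2"
    using drift_bound[OF assms(2,1)] by (intro power_mono) auto
  also have "\<dots> = B\<^sup>2 * ((t - s) * (t - s))" by (simp add: power2_eq_square)
  also have "\<dots> \<le> B\<^sup>2 * (T * (t - s))" using assms by (intro mult_left_mono mult_right_mono) auto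
  finally show ?thesis by simp
qed

text \<open>The weight makes this a bound on the conditional second moment. The cross terms in the
  squared quadratic variation use it with the sum over the earlier cells as weight.\<close>

lemma expectation_increment_square_le:
  assumes st: "0 \<le> s" "s \<le> t" "t \<le> T"
    and \<psi>: "\<psi> \<in> borel_measurable (F s)" "\<And>w. w \<in> space M \<Longrightarrow> 0 \<le> \<psi> w" "\<And>w. w \<in> space M \<Longrightarrow> \<psi> w \<le> L"
  shows "expectation (\<lambda>w. \<psi> w * (norm (Y t w - Y s w))\<^sup>2) \<le> KY * (t - s) * expectation \<psi>"
proof -
  have s: "s \<in> {0..T}" "t \<in> {0..T}" using st by auto
  have \<psi>M: "\<psi> \<in> borel_measurable M" using \<psi>(1) by (rule F_measurable_M)
  have ab: "\<bar>\<psi> w\<bar> \<le> L" if "w \<in> space M" for w using \<psi>(2,3) that by auto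
  have i\<psi>: "integrable M \<psi>" using \<psi>M ab by (intro integrable_bounded[of _ L]) auto
  have iZ: "integrable M (\<lambda>w. \<psi> w * (norm (noise s t w))\<^sup>2)"
  proof (rule integrable_mult_bounded[OF _ \<psi>M ab])
    show "integrable M (\<lambda>w. (norm (noise s t w))\<^sup>2)"
      using noise_measurable[OF s] noise_bound[OF s st(2)]
      by (intro integrable_bounded[of _ "(2 * R + B * T)\<^sup>2"]) (auto intro!: power_mono)
  qed
  have "expectation (\<lambda>w. \<psi> w * (norm (Y t w - Y s w))\<^sup>2)
    \<le> expectation (\<lambda>w. 2 * (\<psi> w * (norm (noise s t w))\<^sup>2) + (2 * B\<^sup>2 * T * (t - s)) * \<psi> w)"
  proof (rule integral_mono_AE')
    show "integrable M (\<lambda>w. 2 * (\<psi> w * (norm (noise s t w))\<^sup>2) + (2 * B\<^sup>2 * T * (t - s)) * \<psi> w)"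
      using iZ i\<psi> by (intro Bochner_Integration.integrable_add integrable_mult_right)
    show "AE w in M. \<psi> w * (norm (Y t w - Y s w))\<^sup>2
      \<le> 2 * (\<psi> w * (norm (noise s t w))\<^sup>2) + (2 * B\<^sup>2 * T * (t - s)) * \<psi> w"
    proof (rule AE_I2)
      fix w assume w: "w \<in> space M"
      have "\<psi> w * (norm (Y t w - Y s w))\<^sup>2 \<le> \<psi> w * (2 * (norm (noise s t w))\<^sup>2 + 2 * B\<^sup>2 * T * (t - s))"
        using norm_increment_square_le[OF st(2) w] st \<psi>(2)[OF w] by (intro mult_left_mono) auto
      then show "\<psi> w * (norm (Y t w - Y s w))\<^sup>2
        \<le> 2 * (\<psi> w * (norm (noise s t w))\<^sup>2) + (2 * B\<^sup>2 * T * (t - s)) * \<psi> w"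
        by (simp add: algebra_simps)
    qed
    show "AE w in M. 0 \<le> 2 * (\<psi> w * (norm (noise s t w))\<^sup>2) + (2 * B\<^sup>2 * T * (t - s)) * \<psi> w"
      using \<psi>(2) T_pos st by (intro AE_I2 add_nonneg_nonneg mult_nonneg_nonneg) auto
  qed
  also have "\<dots> = 2 * expectation (\<lambda>w. \<psi> w * (norm (noise s t w))\<^sup>2) + (2 * B\<^sup>2 * T * (t - s)) * expectation \<psi>"
    using iZ i\<psi> by (subst Bochner_Integration.integral_add) auto
  also have "\<dots> \<le> 2 * (KQ * (t - s) * expectation \<psi>) + (2 * B\<^sup>2 * T * (t - s)) * expectation \<psi>"
    using expectation_noise_square_le[OF st \<psi>] by simp
  also have "\<dots> = KY * (t - s) * expectation \<psi>" by (simp add: KY_def algebra_simps)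
  finally show ?thesis .
qed

section \<open>Quadratic variation along equidistant grids\<close>

abbreviation grid :: "nat \<Rightarrow> nat \<Rightarrow> real" where
  "grid N i \<equiv> real i * (T / real N)"

lemma grid_in: "i \<le> N \<Longrightarrow> 0 < N \<Longrightarrow> grid N i \<in> {0..T}"
  using T_pos by (simp add: divide_le_eq mult_right_mono)

lemma grid_step: "grid N (Suc i) - grid N i = T / real N"
  by (simp add: algebra_simps add_divide_distrib)

lemma grid_mono: "i \<le> j \<Longrightarrow> grid N i \<le> grid N j"
  using T_pos by (intro mult_right_mono) auto

lemma grid_le: "grid N i \<le> grid N (Suc i)"
  using T_pos by (intro mult_right_mono) auto

definition quad :: "nat \<Rightarrow> nat \<Rightarrow> 'w \<Rightarrow> real" where
  "quad N i w = (norm (Y (grid N (Suc i)) w - Y (grid N i) w))\<^sup>2"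

lemma quad_measurable_F: "i < N \<Longrightarrow> quad N i \<in> borel_measurable (F (grid N (Suc i)))"
proof -
  assume i: "i < N"
  have "Y (grid N i) \<in> borel_measurable (F (grid N (Suc i)))"
    using grid_in[of i N] i grid_le[of i N] by (intro F_measurable_mono[OF Y_adapted]) auto
  moreover have "Y (grid N (Suc i)) \<in> borel_measurable (F (grid N (Suc i)))"
    using grid_in[of "Suc i" N] i by (intro Y_adapted) auto
  ultimately show ?thesis unfolding quad_def[abs_def] by measurable
qed

lemma quad_measurable: "i < N \<Longrightarrow> quad N i \<in> borel_measurable M"
  by (rule F_measurable_M[OF quad_measurable_F])

lemma quad_nonneg: "0 \<le> quad N i w" by (simp add: quad_def)

lemma quad_bound: "i < N \<Longrightarrow> w \<in> space M \<Longrightarrow> quad N i w \<le> 4 * R\<^sup>2"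
proof -
  assume i: "i < N" and w: "w \<in> space M"
  have "norm (Y (grid N (Suc i)) w - Y (grid N i) w) \<le> R + R"
    using i w grid_in[of i N] grid_in[of "Suc i" N]
    by (intro order_trans[OF norm_triangle_ineq4] add_mono Y_bound) auto
  then have "quad N i w \<le> (R + R)\<^sup>2" unfolding quad_def by (intro power_mono) auto
  then show ?thesis by (simp add: power2_eq_square)
qed

lemma expectation_quad_le: "i < N \<Longrightarrow> expectation (quad N i) \<le> KY * (T / N)"
proof -
  assume i: "i < N"
  have "expectation (\<lambda>w. 1 * (norm (Y (grid N (Suc i)) w - Y (grid N i) w))\<^sup>2)
      \<le> KY * (grid N (Suc i) - grid N i) * expectation (\<lambda>w. 1)"
    using grid_in[of i N] grid_in[of "Suc i" N] i grid_le[of i N]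
    by (intro expectation_increment_square_le[of _ _ _ 1]) auto
  then show ?thesis unfolding grid_step by (simp add: quad_def[abs_def] prob_space)
qed

lemma KY_nonneg: "0 \<le> KY"
  using B_nonneg T_pos by (simp add: KY_def KQ_def)

text \<open>Boundedness of \<open>Y\<close> controls the second moment of its quadratic variation; this replaces fourth
  moments of stochastic integrals.\<close>

lemma expectation_sum_quad_square_le:
  assumes "k \<le> N" "0 < N"
  shows "expectation (\<lambda>w. (\<Sum>i<k. quad N i w)\<^sup>2) \<le> real k * ((2 * KY * T + 4 * R\<^sup>2) * (KY * (T / N))) \<and>
    expectation (\<lambda>w. \<Sum>i<k. quad N i w) \<le> real k * (KY * (T / N))"
  using \<open>k \<le> N\<close>
proof (induction k)
  case (Suc k)
  then have k: "k < N" by simp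
  let ?S = "\<lambda>k w. \<Sum>i<k. quad N i w"
  have Smeas: "?S k \<in> borel_measurable M" if "k \<le> N" for k
    using that by (intro borel_measurable_sum quad_measurable) auto
  have Sb: "?S k w \<in> {0..real N * (4 * R\<^sup>2)}" if "k \<le> N" "w \<in> space M" for k w
  proof -
    have "?S k w \<le> (\<Sum>i<k. 4 * R\<^sup>2)" using that by (intro sum_mono quad_bound) auto
    also have "\<dots> \<le> real N * (4 * R\<^sup>2)" using that by (auto intro!: mult_right_mono)
    finally show ?thesis by (auto intro!: sum_nonneg quad_nonneg)
  qed
  have iS: "integrable M (?S k)"
    using Sb[of k] k Smeas by (intro integrable_bounded[of _ "real N * (4 * R\<^sup>2)"]) auto
  have iq: "integrable M (quad N k)"
    using quad_bound[OF k] quad_nonneg quad_measurable[OF k] by (intro integrable_bounded[of _ "4 * R\<^sup>2"]) auto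
  have iqq: "integrable M (\<lambda>w. (quad N k w)\<^sup>2)"
    using quad_measurable[OF k] power_mono[OF quad_bound[OF k] quad_nonneg]
    by (intro integrable_bounded[of _ "(4 * R\<^sup>2)\<^sup>2"]) (simp_all only: real_norm_def abs_power2 borel_measurable_power)
  have iSq: "integrable M (\<lambda>w. ?S k w * quad N k w)"
    using Sb[of k] k Smeas by (intro integrable_mult_bounded[OF iq, of _ "real N * (4 * R\<^sup>2)"]) auto
  have iSS: "integrable M (\<lambda>w. (?S k w)\<^sup>2)"
    using Sb[of k] k Smeas by (intro integrable_bounded[of _ "(real N * (4 * R\<^sup>2))\<^sup>2"]) (auto intro!: power_mono)
  have IH: "expectation (\<lambda>w. (?S k w)\<^sup>2) \<le> real k * ((2 * KY * T + 4 * R\<^sup>2) * (KY * (T / N)))"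
    "expectation (?S k) \<le> real k * (KY * (T / N))"
    using Suc by auto
  have first: "expectation (?S (Suc k)) \<le> real (Suc k) * (KY * (T / N))"
  proof -
    have "expectation (?S (Suc k)) = expectation (?S k) + expectation (quad N k)" using iS iq by simp
    also have "\<dots> \<le> real k * (KY * (T / N)) + KY * (T / N)" by (intro add_mono IH(2) expectation_quad_le[OF k])
    also have "\<dots> = real (Suc k) * (KY * (T / N))" by (simp add: add_divide_distrib algebra_simps)
    finally show ?thesis .
  qed
  have SF: "?S k \<in> borel_measurable (F (grid N k))"
  proof (intro borel_measurable_sum)
    fix i assume "i \<in> {..<k}"
    then show "quad N i \<in> borel_measurable (F (grid N k))"
      using k grid_mono[of 0 "Suc i" N] grid_mono[of "Suc i" k N]
      by (intro F_measurable_mono[OF quad_measurable_F]) (simp_all only: lessThan_iff, simp_all)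
  qed
  \<comment> \<open>The sum over the earlier cells is nonnegative, bounded and known when cell
    \<open>k\<close> begins, so it can be the weight in
    \<open>expectation_increment_square_le\<close>; its own mean is at most
    \<open>KY * T\<close>.\<close>
  have cross: "expectation (\<lambda>w. ?S k w * quad N k w) \<le> (KY * T) * (KY * (T / N))"
  proof -
    have "expectation (\<lambda>w. ?S k w * quad N k w) \<le> KY * (T / N) * expectation (?S k)"
    proof -
      have "expectation (\<lambda>w. ?S k w * (norm (Y (grid N (Suc k)) w - Y (grid N k) w))\<^sup>2)
          \<le> KY * (grid N (Suc k) - grid N k) * expectation (?S k)"
        using grid_in[of k N] grid_in[of "Suc k" N] k grid_le[of k N] SF Sb[of k]
        by (intro expectation_increment_square_le[of _ _ _ "real N * (4 * R\<^sup>2)"]) auto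
      then show ?thesis by (simp only: grid_step quad_def)
    qed
    also have "\<dots> \<le> KY * (T / N) * (real k * (KY * (T / N)))"
      using IH(2) k KY_nonneg T_pos by (intro mult_left_mono) auto
    also have "\<dots> \<le> KY * (T / N) * (real N * (KY * (T / N)))"
      using k KY_nonneg T_pos by (intro mult_left_mono mult_right_mono) auto
    also have "\<dots> = (KY * T) * (KY * (T / N))" using k by simp
    finally show ?thesis .
  qed
  \<comment> \<open>One of the two factors is bounded by \<open>4 * R\<^sup>2\<close>, since
    \<open>Y\<close> moves inside a ball of radius \<open>R\<close>.\<close>
  have qq: "expectation (\<lambda>w. (quad N k w)\<^sup>2) \<le> 4 * R\<^sup>2 * (KY * (T / N))"
  proof -
    have "expectation (\<lambda>w. (quad N k w)\<^sup>2) \<le> expectation (\<lambda>w. 4 * R\<^sup>2 * quad N k w)"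
      using iqq iq quad_bound[OF k] quad_nonneg
      by (intro integral_mono) (auto simp: power2_eq_square[of "quad N k _"] intro!: mult_right_mono)
    also have "\<dots> = 4 * R\<^sup>2 * expectation (quad N k)" by simp
    also have "\<dots> \<le> 4 * R\<^sup>2 * (KY * (T / N))" by (intro mult_left_mono expectation_quad_le[OF k]) simp
    finally show ?thesis .
  qed
  have "expectation (\<lambda>w. (?S (Suc k) w)\<^sup>2) = expectation (\<lambda>w. (?S k w)\<^sup>2 + 2 * (?S k w * quad N k w) + (quad N k w)\<^sup>2)"
    by (simp add: power2_sum algebra_simps)
  also have "\<dots> = expectation (\<lambda>w. (?S k w)\<^sup>2) + 2 * expectation (\<lambda>w. ?S k w * quad N k w) + expectation (\<lambda>w. (quad N k w)\<^sup>2)"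
    using iSS iSq iqq by simp
  also have "\<dots> \<le> real k * ((2 * KY * T + 4 * R\<^sup>2) * (KY * (T / N))) + 2 * ((KY * T) * (KY * (T / N))) + 4 * R\<^sup>2 * (KY * (T / N))"
    using IH(1) k cross qq by (intro add_mono mult_left_mono) auto
  also have "\<dots> = real (Suc k) * ((2 * KY * T + 4 * R\<^sup>2) * (KY * (T / N)))" by (simp add: algebra_simps add_divide_distrib)
  finally show ?case using first by blast
qed simp

text \<open>The sum of squares is at most the largest \<open>quad\<close> times the sum of all of
  them. The maximum tends to zero by uniform continuity of the path, the sum is bounded in mean
  square uniformly in \<open>N\<close>, and Young's inequality with parameter \<open>\<eta>\<close>
  separates the two factors.\<close>

lemma expectation_sum_quad_squares_tendsto:
  "(\<lambda>N. expectation (\<lambda>w. \<Sum>i<N. (quad N i w)\<^sup>2)) \<longlonglongrightarrow> 0"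
proof -
  \<comment> \<open>The bound of \<open>expectation_sum_quad_square_le\<close> at
    \<open>k = N\<close>, where the number of cells cancels against their length.\<close>
  define D where "D = (2 * KY * T + 4 * R\<^sup>2) * (KY * T)"
  have D: "0 \<le> D" using KY_nonneg T_pos by (simp add: D_def)
  define m where "m N w = Max ((\<lambda>i. quad N i w) ` {..<N})" for N w
  have m_bound: "0 \<le> m N w" "m N w \<le> 4 * R\<^sup>2" "\<And>i. i < N \<Longrightarrow> quad N i w \<le> m N w"
    if "0 < N" "w \<in> space M" for N w
  proof -
    have ne: "(\<lambda>i. quad N i w) ` {..<N} \<noteq> {}" using that by auto
    show "\<And>i. i < N \<Longrightarrow> quad N i w \<le> m N w" unfolding m_def by (intro Max_ge) auto
    from this[of 0] show "0 \<le> m N w" using quad_nonneg[of N 0 w] that by simp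
    show "m N w \<le> 4 * R\<^sup>2" unfolding m_def using ne quad_bound that by (subst Max_le_iff) auto
  qed
  have m_meas: "m N \<in> borel_measurable M" for N
    unfolding m_def[abs_def] by (intro borel_measurable_Max quad_measurable) auto
  have m_lim: "(\<lambda>N. m (Suc N) w) \<longlonglongrightarrow> 0" if w: "w \<in> space M" for w
  proof (rule LIMSEQ_I)
    fix e :: real assume e: "0 < e"
    have "uniformly_continuous_on {0..T} (\<lambda>t. Y t w)"
      using Y_continuous[OF w] by (intro compact_uniformly_continuous) auto
    then obtain d where d: "0 < d" "\<And>x y. x \<in> {0..T} \<Longrightarrow> y \<in> {0..T} \<Longrightarrow> dist y x < d \<Longrightarrow> dist (Y y w) (Y x w) < sqrt e"
      using e unfolding uniformly_continuous_on_def by (metis real_sqrt_gt_zero)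
    obtain N0 :: nat where N0: "T / d < real N0" using reals_Archimedean2 by blast
    have "norm (m (Suc N) w - 0) < e" if "N0 \<le> N" for N
    proof -
      have "T / d < real (Suc N)" using N0 that by linarith
      then have h: "T / real (Suc N) < d" using d(1) by (simp add: field_simps)
      have "quad (Suc N) i w < e" if i: "i < Suc N" for i
      proof -
        have "dist (grid (Suc N) (Suc i)) (grid (Suc N) i) < d"
          using h grid_step[of i "Suc N"] T_pos by (simp add: dist_real_def)
        then have "norm (Y (grid (Suc N) (Suc i)) w - Y (grid (Suc N) i) w) < sqrt e"
          using d(2) grid_in[of i "Suc N"] grid_in[of "Suc i" "Suc N"] i by (simp add: dist_norm)
        then have "quad (Suc N) i w < (sqrt e)\<^sup>2" unfolding quad_def by (intro power_strict_mono) auto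
        then show ?thesis using e by simp
      qed
      then have "m (Suc N) w < e" unfolding m_def by (subst Max_less_iff) auto
      then show ?thesis using m_bound(1)[of "Suc N" w] w by simp
    qed
    then show "\<exists>no. \<forall>N\<ge>no. norm (m (Suc N) w - 0) < e" by blast
  qed
  have mm: "(\<lambda>N. expectation (\<lambda>w. (m (Suc N) w)\<^sup>2)) \<longlonglongrightarrow> expectation (\<lambda>w. 0)"
  proof (rule integral_dominated_convergence[where w="\<lambda>_. (4 * R\<^sup>2)\<^sup>2"])
    show "AE w in M. (\<lambda>N. (m (Suc N) w)\<^sup>2) \<longlonglongrightarrow> 0"
      using m_lim tendsto_power[of _ 0 _ 2] by (intro AE_I2) fastforce
    show "AE w in M. norm ((m (Suc N) w)\<^sup>2) \<le> (4 * R\<^sup>2)\<^sup>2" for N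
      using power_mono[OF m_bound(2,1)[of "Suc N"]] by (intro AE_I2) (simp only: real_norm_def abs_power2 zero_less_Suc)
  qed (use m_meas in auto)
  let ?P = "\<lambda>N w. \<Sum>i<N. (quad N i w)\<^sup>2"
  let ?S = "\<lambda>N w. \<Sum>i<N. quad N i w"
  have le: "expectation (?P (Suc N)) \<le> expectation (\<lambda>w. (m (Suc N) w)\<^sup>2) / (2 * \<eta>) + \<eta> / 2 * D"
    if \<eta>: "0 < \<eta>" for \<eta> N
  proof -
    let ?N = "Suc N"
    have im: "integrable M (\<lambda>w. (m ?N w)\<^sup>2)"
      using m_meas power_mono[OF m_bound(2,1)[of ?N]]
      by (intro integrable_bounded[of _ "(4 * R\<^sup>2)\<^sup>2"]) (simp_all only: real_norm_def abs_power2 borel_measurable_power zero_less_Suc)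
    have S: "0 \<le> ?S ?N w" "?S ?N w \<le> real ?N * (4 * R\<^sup>2)" if "w \<in> space M" for w
    proof -
      show "0 \<le> ?S ?N w" by (intro sum_nonneg quad_nonneg)
      have "?S ?N w \<le> (\<Sum>i<?N. 4 * R\<^sup>2)" using that by (intro sum_mono quad_bound) auto
      then show "?S ?N w \<le> real ?N * (4 * R\<^sup>2)" by simp
    qed
    have iS: "integrable M (\<lambda>w. (?S ?N w)\<^sup>2)"
      using S by (intro integrable_bounded[of _ "(real ?N * (4 * R\<^sup>2))\<^sup>2"] borel_measurable_power
        borel_measurable_sum quad_measurable) (auto simp del: sum.lessThan_Suc intro!: power_mono)
    have "expectation (?P ?N) \<le> expectation (\<lambda>w. (m ?N w)\<^sup>2 / (2 * \<eta>) + \<eta> / 2 * (?S ?N w)\<^sup>2)"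
    proof (rule integral_mono_AE')
      show "integrable M (\<lambda>w. (m ?N w)\<^sup>2 / (2 * \<eta>) + \<eta> / 2 * (?S ?N w)\<^sup>2)"
        using im iS by (intro Bochner_Integration.integrable_add integrable_mult_right) auto
      show "AE w in M. ?P ?N w \<le> (m ?N w)\<^sup>2 / (2 * \<eta>) + \<eta> / 2 * (?S ?N w)\<^sup>2"
      proof (rule AE_I2)
        fix w assume w: "w \<in> space M"
        have "?P ?N w \<le> (\<Sum>i<?N. m ?N w * quad ?N i w)"
          using m_bound(3)[of ?N w] w quad_nonneg unfolding power2_eq_square
          by (intro sum_mono mult_right_mono) auto
        also have "\<dots> = m ?N w * ?S ?N w" by (simp add: sum_distrib_left del: sum.lessThan_Suc)
        also have "\<dots> \<le> (m ?N w)\<^sup>2 / (2 * \<eta>) + \<eta> / 2 * (?S ?N w)\<^sup>2"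
        proof -
          have "2 * \<eta> * (m ?N w * ?S ?N w) \<le> (m ?N w)\<^sup>2 + (\<eta> * ?S ?N w)\<^sup>2"
            using sum_squares_bound[of "m ?N w" "\<eta> * ?S ?N w"] by (simp add: mult_ac del: sum.lessThan_Suc)
          then show ?thesis using \<eta> by (simp add: field_simps power2_eq_square del: sum.lessThan_Suc)
        qed
        finally show "?P ?N w \<le> (m ?N w)\<^sup>2 / (2 * \<eta>) + \<eta> / 2 * (?S ?N w)\<^sup>2" .
      qed
      show "AE w in M. 0 \<le> (m ?N w)\<^sup>2 / (2 * \<eta>) + \<eta> / 2 * (?S ?N w)\<^sup>2"
        using \<eta> by (intro AE_I2) simp
    qed
    also have "\<dots> = expectation (\<lambda>w. (m ?N w)\<^sup>2) / (2 * \<eta>) + \<eta> / 2 * expectation (\<lambda>w. (?S ?N w)\<^sup>2)"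
      using im iS by (subst Bochner_Integration.integral_add) (auto simp del: sum.lessThan_Suc)
    also have "expectation (\<lambda>w. (?S ?N w)\<^sup>2) \<le> D"
      using expectation_sum_quad_square_le[of ?N ?N] by (simp add: D_def del: sum.lessThan_Suc)
    finally show ?thesis using \<eta> by (simp add: mult_left_mono)
  qed
  have "(\<lambda>N. expectation (?P (Suc N))) \<longlonglongrightarrow> 0"
  proof (rule order_tendstoI)
    fix a :: real assume a: "0 < a"
    define \<eta> where "\<eta> = a / (D + 1)"
    have \<eta>: "0 < \<eta>" using a D by (simp add: \<eta>_def)
    have "\<eta> / 2 * D \<le> a / 2" using D a by (simp add: \<eta>_def field_simps)
    have "(\<lambda>N. expectation (\<lambda>w. (m (Suc N) w)\<^sup>2)) \<longlonglongrightarrow> 0" using mm by simp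
    then have "eventually (\<lambda>N. expectation (\<lambda>w. (m (Suc N) w)\<^sup>2) < \<eta> * a) sequentially"
      by (rule order_tendstoD(2)) (use \<eta> a in simp)
    then show "eventually (\<lambda>N. expectation (?P (Suc N)) < a) sequentially"
    proof eventually_elim
      case (elim N)
      have "expectation (\<lambda>w. (m (Suc N) w)\<^sup>2) / (2 * \<eta>) < a / 2" using elim \<eta> by (simp add: field_simps)
      then show ?case using le[OF \<eta>, of N] \<open>\<eta> / 2 * D \<le> a / 2\<close> by linarith
    qed
  next
    fix a :: real assume "a < 0"
    moreover have "0 \<le> expectation (?P (Suc N))" for N
      by (intro Bochner_Integration.integral_nonneg sum_nonneg) simp
    ultimately show "eventually (\<lambda>N. a < expectation (?P (Suc N))) sequentially"
      by (intro always_eventually allI) (rule less_le_trans)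
  qed
  then show ?thesis by (subst (asm) filterlim_sequentially_Suc)
qed

end

section \<open>Taylor expansion with a uniform remainder\<close>

lemma C12_continuous:
  assumes "C12_with_derivatives T u ut ux uxx"
  shows "continuous_on ({0..T} \<times> UNIV) (\<lambda>(t, x). u t x)" "continuous_on ({0..T} \<times> UNIV) (\<lambda>(t, x). ut t x)"
    "continuous_on ({0..T} \<times> UNIV) (\<lambda>(t, x). ux t x)" "continuous_on ({0..T} \<times> UNIV) (\<lambda>(t, x). uxx t x)"
  using assms unfolding C12_with_derivatives_def by blast+

lemma C12_bounded:
  fixes u :: "real \<Rightarrow> real ^ 'n \<Rightarrow> real"
  assumes u: "C12_with_derivatives T u ut ux uxx"
  obtains K where "0 \<le> K" "\<And>t x. t \<in> {0..T} \<Longrightarrow> x \<in> cball 0 R \<Longrightarrow>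
    \<bar>u t x\<bar> \<le> K \<and> \<bar>ut t x\<bar> \<le> K \<and> norm (ux t x) \<le> K \<and> norm (uxx t x) \<le> K"
proof -
  let ?S = "{0..T} \<times> cball 0 R :: (real \<times> (real ^ 'n)) set"
  have bd: "bounded ((\<lambda>(t, x). f t x) ` ?S)" if "continuous_on ({0..T} \<times> UNIV) (\<lambda>(t, x). f t x)"
    for f :: "real \<Rightarrow> real ^ 'n \<Rightarrow> 'c::real_normed_vector"
    by (intro compact_imp_bounded compact_continuous_image compact_Times continuous_on_subset[OF that]) auto
  note c = C12_continuous[OF u]
  obtain K1 where K1: "\<And>t x. t \<in> {0..T} \<Longrightarrow> x \<in> cball 0 R \<Longrightarrow> norm (u t x) \<le> K1"
    using bd[OF c(1)] unfolding bounded_iff by fastforce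
  obtain K2 where K2: "\<And>t x. t \<in> {0..T} \<Longrightarrow> x \<in> cball 0 R \<Longrightarrow> norm (ut t x) \<le> K2"
    using bd[OF c(2)] unfolding bounded_iff by fastforce
  obtain K3 where K3: "\<And>t x. t \<in> {0..T} \<Longrightarrow> x \<in> cball 0 R \<Longrightarrow> norm (ux t x) \<le> K3"
    using bd[OF c(3)] unfolding bounded_iff by fastforce
  obtain K4 where K4: "\<And>t x. t \<in> {0..T} \<Longrightarrow> x \<in> cball 0 R \<Longrightarrow> norm (uxx t x) \<le> K4"
    using bd[OF c(4)] unfolding bounded_iff by fastforce
  define K where "K = \<bar>K1\<bar> + \<bar>K2\<bar> + \<bar>K3\<bar> + \<bar>K4\<bar>"
  show ?thesis
  proof (rule that[of K])
    show "0 \<le> K" by (simp add: K_def)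
    fix t x assume "t \<in> {0..T}" "x \<in> cball (0 :: real ^ 'n) R"
    from K1[OF this] K2[OF this] K3[OF this] K4[OF this]
    show "\<bar>u t x\<bar> \<le> K \<and> \<bar>ut t x\<bar> \<le> K \<and> norm (ux t x) \<le> K \<and> norm (uxx t x) \<le> K"
      unfolding K_def real_norm_def by linarith
  qed
qed

text \<open>The one-dimensional Maclaurin formula of order two for
  \<open>u t (x + r *\<^sub>R (y - x))\<close> as a function of \<open>r\<close> between
  \<open>0\<close> and \<open>1\<close>.\<close>

lemma C12_taylor:
  fixes u :: "real \<Rightarrow> real ^ 'n \<Rightarrow> real"
  assumes u: "C12_with_derivatives T u ut ux uxx" and t: "t \<in> {0..T}"
  shows "\<exists>z\<in>closed_segment x y. u t y = u t x + ux t x \<bullet> (y - x) + 1 / 2 * ((y - x) \<bullet> (uxx t z *v (y - x)))"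
proof -
  let ?d = "y - x"
  have d1: "(u t has_derivative (\<lambda>h. ux t z \<bullet> h)) (at z)"
    and d2: "(ux t has_derivative (\<lambda>h. uxx t z *v h)) (at z)" for z
    using u t unfolding C12_with_derivatives_def by blast+
  have p: "((\<lambda>r. x + r *\<^sub>R ?d) has_derivative (\<lambda>h. h *\<^sub>R ?d)) (at r)" for r :: real
    by (auto intro!: derivative_eq_intros)
  have g1: "((\<lambda>r. u t (x + r *\<^sub>R ?d)) has_real_derivative ux t (x + r *\<^sub>R ?d) \<bullet> ?d) (at r)" for r
    using has_derivative_compose[OF p[of r] d1[of "x + r *\<^sub>R ?d"]]
    unfolding has_field_derivative_def by (simp add: mult.commute[of _ "_ \<bullet> _"] mult_commute_abs)
  have g2: "((\<lambda>r. ux t (x + r *\<^sub>R ?d) \<bullet> ?d) has_real_derivative (?d \<bullet> (uxx t (x + r *\<^sub>R ?d) *v ?d))) (at r)" for r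
    using has_derivative_inner_left[OF has_derivative_compose[OF p[of r] d2[of "x + r *\<^sub>R ?d"]], of ?d]
    unfolding has_field_derivative_def
    by (simp add: matrix_vector_mult_scaleR inner_commute mult_commute_abs)
  define diff where "diff m = (if m = 0 then (\<lambda>r. u t (x + r *\<^sub>R ?d))
    else if m = 1 then (\<lambda>r. ux t (x + r *\<^sub>R ?d) \<bullet> ?d) else (\<lambda>r. ?d \<bullet> (uxx t (x + r *\<^sub>R ?d) *v ?d)))" for m :: nat
  have "\<exists>r>0. r < 1 \<and> diff 0 1 = (\<Sum>m<2. (diff m 0 / fact m) * 1 ^ m) + (diff 2 r / fact 2) * 1 ^ 2"
  proof (rule Maclaurin)
    show "\<forall>m r. m < 2 \<and> 0 \<le> r \<and> r \<le> 1 \<longrightarrow> DERIV (diff m) r :> diff (Suc m) r"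
    proof (intro allI impI)
      fix m :: nat and r :: real assume "m < 2 \<and> 0 \<le> r \<and> r \<le> 1"
      then have "m = 0 \<or> m = 1" by auto
      then show "DERIV (diff m) r :> diff (Suc m) r" using g1[of r] g2[of r] by (auto simp: diff_def)
    qed
  qed auto
  then obtain r where r: "0 < r" "r < 1"
    "diff 0 1 = (\<Sum>m<2. (diff m 0 / fact m) * 1 ^ m) + (diff 2 r / fact 2) * 1 ^ 2" by blast
  have "x + r *\<^sub>R ?d \<in> closed_segment x y"
    unfolding closed_segment_def using r by (intro CollectI exI[of _ r]) (simp add: algebra_simps)
  moreover have "u t y = u t x + ux t x \<bullet> ?d + 1 / 2 * (?d \<bullet> (uxx t (x + r *\<^sub>R ?d) *v ?d))"
    using r(3) by (simp add: diff_def numeral_2_eq_2)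
  ultimately show ?thesis by blast
qed

text \<open>For nearby points the Hessian at the intermediate point is
  \<open>\<epsilon>\<close>-close, by uniform continuity on a compact set. For points at distance at
  least \<open>\<delta>\<close> the crude bound is paid for by a fourth power, whence
  \<open>c = K / \<delta>\<^sup>2\<close>. Fourth powers are negligible along fine grids by
  \<open>expectation_sum_quad_squares_tendsto\<close>.\<close>

lemma C12_remainder:
  fixes u :: "real \<Rightarrow> real ^ 'n \<Rightarrow> real"
  assumes u: "C12_with_derivatives T u ut ux uxx" and e: "0 < \<epsilon>"
  obtains c where "0 \<le> c" "\<And>t x y. t \<in> {0..T} \<Longrightarrow> x \<in> cball 0 R \<Longrightarrow> y \<in> cball 0 R \<Longrightarrow>
    \<bar>u t y - u t x - ux t x \<bullet> (y - x) - 1 / 2 * ((y - x) \<bullet> (uxx t x *v (y - x)))\<bar>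
      \<le> \<epsilon> * (norm (y - x))\<^sup>2 + c * ((norm (y - x))\<^sup>2)\<^sup>2"
proof -
  obtain K where K: "0 \<le> K" "\<And>t x. t \<in> {0..T} \<Longrightarrow> x \<in> cball 0 R \<Longrightarrow>
    \<bar>u t x\<bar> \<le> K \<and> \<bar>ut t x\<bar> \<le> K \<and> norm (ux t x) \<le> K \<and> norm (uxx t x) \<le> K"
    using C12_bounded[OF u, of R] by metis
  let ?S = "{0..T} \<times> cball 0 R :: (real \<times> (real ^ 'n)) set"
  have "continuous_on ({0..T} \<times> UNIV) (\<lambda>(t, x). uxx t x)"
    using u unfolding C12_with_derivatives_def by blast
  then have "uniformly_continuous_on ?S (\<lambda>(t, x). uxx t x)"
    by (intro compact_uniformly_continuous compact_Times continuous_on_subset[where t="?S"]) auto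
  then obtain \<delta> where \<delta>: "0 < \<delta>"
    "\<And>p p'. p \<in> ?S \<Longrightarrow> p' \<in> ?S \<Longrightarrow> dist p' p < \<delta> \<Longrightarrow> dist ((\<lambda>(t, x). uxx t x) p') ((\<lambda>(t, x). uxx t x) p) < \<epsilon>"
    using e unfolding uniformly_continuous_on_def by blast
  define c where "c = K / \<delta>\<^sup>2"
  show ?thesis
  proof (rule that[of c])
    show "0 \<le> c" using K by (simp add: c_def)
    fix t and x y :: "real ^ 'n" assume t: "t \<in> {0..T}" and x: "x \<in> cball 0 R" and y: "y \<in> cball 0 R"
    let ?d = "y - x"
    obtain z where z: "z \<in> closed_segment x y"
      "u t y = u t x + ux t x \<bullet> ?d + 1 / 2 * (?d \<bullet> (uxx t z *v ?d))"
      using C12_taylor[OF u t] by blast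
    have zR: "z \<in> cball 0 R"
      using z(1) x y closed_segment_subset[OF x y convex_cball] by blast
    have zx: "norm (z - x) \<le> norm ?d"
      using z(1) by (metis dist_in_closed_segment dist_norm norm_minus_commute)
    have "u t y - u t x - ux t x \<bullet> ?d - 1 / 2 * (?d \<bullet> (uxx t x *v ?d))
        = 1 / 2 * (?d \<bullet> ((uxx t z - uxx t x) *v ?d))"
      unfolding z(2) by (simp add: matrix_vector_mult_diff_rdistrib inner_diff_right algebra_simps)
    then have "\<bar>u t y - u t x - ux t x \<bullet> ?d - 1 / 2 * (?d \<bullet> (uxx t x *v ?d))\<bar>
        = 1 / 2 * \<bar>?d \<bullet> ((uxx t z - uxx t x) *v ?d)\<bar>" by (simp only: abs_mult)
    also have "\<dots> \<le> 1 / 2 * (norm (uxx t z - uxx t x) * (norm ?d)\<^sup>2)"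
      using abs_quadratic_form_le[of ?d "uxx t z - uxx t x" ?d] by (simp add: power2_eq_square)
    finally have le: "\<bar>u t y - u t x - ux t x \<bullet> ?d - 1 / 2 * (?d \<bullet> (uxx t x *v ?d))\<bar>
      \<le> 1 / 2 * (norm (uxx t z - uxx t x) * (norm ?d)\<^sup>2)" .
    show "\<bar>u t y - u t x - ux t x \<bullet> ?d - 1 / 2 * (?d \<bullet> (uxx t x *v ?d))\<bar>
      \<le> \<epsilon> * (norm ?d)\<^sup>2 + c * ((norm ?d)\<^sup>2)\<^sup>2"
    proof (cases "norm ?d < \<delta>")
      case True
      have "norm (uxx t z - uxx t x) \<le> \<epsilon>"
        using \<delta>(2)[of "(t, x)" "(t, z)"] t x zR zx True by (simp add: dist_Pair_Pair dist_norm)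
      then have "norm (uxx t z - uxx t x) * (norm ?d)\<^sup>2 \<le> \<epsilon> * (norm ?d)\<^sup>2" by (intro mult_right_mono) auto
      moreover have "0 \<le> c * ((norm ?d)\<^sup>2)\<^sup>2" using \<open>0 \<le> c\<close> by simp
      moreover have "0 \<le> \<epsilon> * (norm ?d)\<^sup>2" using e by simp
      ultimately show ?thesis using le by linarith
    next
      case False
      have "norm (uxx t z - uxx t x) \<le> 2 * K"
        using norm_triangle_ineq4[of "uxx t z" "uxx t x"] K(2)[OF t zR] K(2)[OF t x] by linarith
      then have "norm (uxx t z - uxx t x) * (norm ?d)\<^sup>2 \<le> 2 * K * (norm ?d)\<^sup>2" by (intro mult_right_mono) auto
      then have "\<bar>u t y - u t x - ux t x \<bullet> ?d - 1 / 2 * (?d \<bullet> (uxx t x *v ?d))\<bar> \<le> K * (norm ?d)\<^sup>2"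
        using le by linarith
      also have "\<dots> \<le> c * ((norm ?d)\<^sup>2)\<^sup>2"
      proof -
        have "\<delta>\<^sup>2 \<le> (norm ?d)\<^sup>2" using False \<delta>(1) by (intro power_mono) auto
        then have "K * (norm ?d)\<^sup>2 * \<delta>\<^sup>2 \<le> K * (norm ?d)\<^sup>2 * (norm ?d)\<^sup>2"
          using K(1) by (intro mult_left_mono) auto
        then show ?thesis using \<delta>(1) by (simp add: c_def field_simps power2_eq_square)
      qed
      also have "\<dots> \<le> \<epsilon> * (norm ?d)\<^sup>2 + c * ((norm ?d)\<^sup>2)\<^sup>2" using e by simp
      finally show ?thesis .
    qed
  qed
qed

lemma continuous_on_snd_of_product:
  assumes "continuous_on (S \<times> UNIV) (\<lambda>(t, x). f t x)" "t \<in> S"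
  shows "continuous_on UNIV (f t)"
proof -
  have "continuous_on UNIV (\<lambda>x. (\<lambda>(t, x). f t x) (t, x))"
    by (rule continuous_on_compose2[OF assms(1)]) (auto intro!: continuous_intros assms(2))
  then show ?thesis by simp
qed

lemma C12_continuous_space:
  fixes u :: "real \<Rightarrow> real ^ 'n \<Rightarrow> real"
  assumes "C12_with_derivatives T u ut ux uxx" "t \<in> {0..T}"
  shows "continuous_on UNIV (u t)" "continuous_on UNIV (ut t)" "continuous_on UNIV (ux t)" "continuous_on UNIV (uxx t)"
  by (intro continuous_on_snd_of_product[OF C12_continuous(1)[OF assms(1)] assms(2)]
    continuous_on_snd_of_product[OF C12_continuous(2)[OF assms(1)] assms(2)]
    continuous_on_snd_of_product[OF C12_continuous(3)[OF assms(1)] assms(2)]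
    continuous_on_snd_of_product[OF C12_continuous(4)[OF assms(1)] assms(2)])+

lemma continuous_on_fst_of_product:
  assumes "continuous_on (S \<times> UNIV) (\<lambda>(t, x). f t x)"
  shows "continuous_on S (\<lambda>t. f t x)"
proof -
  have "continuous_on S (\<lambda>t. (\<lambda>(t, x). f t x) (t, x))"
    by (rule continuous_on_compose2[OF assms(1)]) (auto intro!: continuous_intros)
  then show ?thesis by simp
qed

text \<open>The bound holds everywhere on the space, so the class is closed under continuous
  operations, and the integrability of every term of the Taylor expansion follows from its
  syntax.\<close>

definition (in prob_space) bounded_rv :: "('a \<Rightarrow> 'b::euclidean_space) \<Rightarrow> bool" where
  "bounded_rv f \<longleftrightarrow> f \<in> borel_measurable M \<and> (\<exists>L. \<forall>w\<in>space M. norm (f w) \<le> L)"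

section \<open>Closure properties of bounded random variables\<close>

context prob_space
begin

lemma bounded_rvI: "f \<in> borel_measurable M \<Longrightarrow> (\<And>w. w \<in> space M \<Longrightarrow> norm (f w) \<le> L) \<Longrightarrow> bounded_rv f"
  by (auto simp: bounded_rv_def)

lemma bounded_rv_cong: "(\<And>w. w \<in> space M \<Longrightarrow> f w = g w) \<Longrightarrow> bounded_rv g \<Longrightarrow> bounded_rv f"
  unfolding bounded_rv_def by (simp cong: measurable_cong ball_cong)

lemma bounded_rv_integrable: "bounded_rv f \<Longrightarrow> integrable M f"
  by (auto simp: bounded_rv_def intro!: integrable_const_bound)

lemma bounded_rv_continuous2:
  fixes f :: "'a \<Rightarrow> 'b::euclidean_space" and g :: "'a \<Rightarrow> 'c::euclidean_space"
    and h :: "'b \<Rightarrow> 'c \<Rightarrow> 'd::euclidean_space"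
  assumes f: "bounded_rv f" and g: "bounded_rv g" and h: "continuous_on UNIV (\<lambda>(x, y). h x y)"
  shows "bounded_rv (\<lambda>w. h (f w) (g w))"
proof -
  obtain L1 L2 where L: "\<And>w. w \<in> space M \<Longrightarrow> norm (f w) \<le> L1" "\<And>w. w \<in> space M \<Longrightarrow> norm (g w) \<le> L2"
    using f g by (auto simp: bounded_rv_def)
  have "bounded ((\<lambda>(x, y). h x y) ` (cball 0 L1 \<times> cball 0 L2))"
    by (intro compact_imp_bounded compact_continuous_image compact_Times continuous_on_subset[OF h]) auto
  then obtain L where L': "\<And>x y. norm x \<le> L1 \<Longrightarrow> norm y \<le> L2 \<Longrightarrow> norm (h x y) \<le> L"
    unfolding bounded_iff by fastforce
  have "(\<lambda>w. (f w, g w)) \<in> borel_measurable M" using f g by (auto simp: bounded_rv_def)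
  from measurable_compose[OF this borel_measurable_continuous_onI[OF h]] L L'
  show ?thesis by (intro bounded_rvI[of _ L]) auto
qed

lemma bounded_rv_continuous:
  assumes f: "bounded_rv f" and h: "continuous_on UNIV h"
  shows "bounded_rv (\<lambda>w. h (f w))"
proof -
  have "continuous_on UNIV (\<lambda>(x, y :: real). h x)"
    unfolding case_prod_beta by (rule continuous_on_compose2[OF h continuous_on_fst[OF continuous_on_id]]) auto
  from bounded_rv_continuous2[OF f _ this, of "\<lambda>_. 0"] show ?thesis by (auto simp: bounded_rv_def)
qed

lemma bounded_rv_const: "bounded_rv (\<lambda>w. c)"
  by (auto simp: bounded_rv_def)

lemma bounded_rv_add: "bounded_rv f \<Longrightarrow> bounded_rv g \<Longrightarrow> bounded_rv (\<lambda>w. f w + g w)"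
  by (rule bounded_rv_continuous2) (auto intro!: continuous_intros simp: case_prod_beta)

lemma bounded_rv_diff: "bounded_rv f \<Longrightarrow> bounded_rv g \<Longrightarrow> bounded_rv (\<lambda>w. f w - g w)"
  by (rule bounded_rv_continuous2) (auto intro!: continuous_intros simp: case_prod_beta)

lemma bounded_rv_inner: "bounded_rv f \<Longrightarrow> bounded_rv g \<Longrightarrow> bounded_rv (\<lambda>w. f w \<bullet> g w)"
  by (rule bounded_rv_continuous2) (auto intro!: continuous_intros simp: case_prod_beta)

lemma bounded_rv_mult: "bounded_rv f \<Longrightarrow> bounded_rv g \<Longrightarrow> bounded_rv (\<lambda>w. f w * g w :: real)"
  by (rule bounded_rv_continuous2) (auto intro!: continuous_intros simp: case_prod_beta)

lemma bounded_rv_matrix_vector_mult: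
  "bounded_rv Q \<Longrightarrow> bounded_rv x \<Longrightarrow> bounded_rv (\<lambda>w. (Q w :: real ^ 'm ^ 'n) *v x w)"
  by (rule bounded_rv_continuous2) (auto intro!: continuous_intros simp: case_prod_beta)

lemma bounded_rv_component: "bounded_rv x \<Longrightarrow> bounded_rv (\<lambda>w. (x w :: real ^ 'n) $ a)"
  by (rule bounded_rv_continuous) (auto intro!: continuous_intros)

lemma bounded_rv_entry: "bounded_rv Q \<Longrightarrow> bounded_rv (\<lambda>w. (Q w :: real ^ 'm ^ 'n) $ a $ c)"
  by (rule bounded_rv_continuous) (auto intro!: continuous_intros)

lemma bounded_rv_norm: "bounded_rv f \<Longrightarrow> bounded_rv (\<lambda>w. norm (f w))"
  by (rule bounded_rv_continuous) (auto intro!: continuous_intros)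

lemma bounded_rv_abs: "bounded_rv f \<Longrightarrow> bounded_rv (\<lambda>w. \<bar>f w :: real\<bar>)"
  by (rule bounded_rv_continuous) (auto intro!: continuous_intros)

lemma bounded_rv_square: "bounded_rv f \<Longrightarrow> bounded_rv (\<lambda>w. (f w :: real)\<^sup>2)"
  by (rule bounded_rv_continuous) (auto intro!: continuous_intros)

lemmas bounded_rv_intros = bounded_rv_const bounded_rv_add bounded_rv_diff bounded_rv_inner bounded_rv_mult
  bounded_rv_matrix_vector_mult bounded_rv_entry bounded_rv_component bounded_rv_norm bounded_rv_abs bounded_rv_square

end

section \<open>From one Taylor step to Dynkin's formula\<close>

context bounded_ito_process
begin

lemma bounded_rv_Y: "t \<in> {0..T} \<Longrightarrow> bounded_rv (Y t)"
  by (rule bounded_rvI[OF Y_measurable Y_bound])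

lemma bounded_rv_drift: "s \<le> t \<Longrightarrow> bounded_rv (drift s t)"
  by (rule bounded_rvI[OF drift_measurable drift_bound])

lemma bounded_rv_noise: "s \<in> {0..T} \<Longrightarrow> t \<in> {0..T} \<Longrightarrow> s \<le> t \<Longrightarrow> bounded_rv (noise s t)"
  by (rule bounded_rvI[OF noise_measurable noise_bound])

abbreviation covar :: "real \<Rightarrow> real \<Rightarrow> 'w \<Rightarrow> real ^ 'n ^ 'n" where
  "covar s t w \<equiv> LINT r:{s<..t}|lborel. C r w"

lemma bounded_rv_covar: "s \<le> t \<Longrightarrow> bounded_rv (covar s t)"
  by (rule bounded_rvI[OF path_integral_measurable[OF C_measurable]])
    (rule norm_set_integral_Ioc_le[OF _ C_bound B_nonneg])

lemma C_integrable: "w \<in> space M \<Longrightarrow> set_integrable lborel {s<..t} (\<lambda>r. C r w)"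
  by (rule set_integrable_Ioc_bounded[OF path_measurable(2) C_bound])

lemma \<beta>_integrable: "w \<in> space M \<Longrightarrow> set_integrable lborel {s<..t} (\<lambda>r. \<beta> r w)"
  by (rule set_integrable_Ioc_bounded[OF path_measurable(1) \<beta>_bound])

lemma covar_component:
  assumes "w \<in> space M" shows "covar s t w $ a $ c = (LINT r:{s<..t}|lborel. C r w $ a $ c)"
proof -
  have bl: "bounded_linear (\<lambda>A :: real ^ 'n ^ 'n. A $ a $ c)"
    by (intro bounded_linear_compose[OF bounded_linear_vec_nth bounded_linear_vec_nth])
  from integral_bounded_linear[OF bl C_integrable[OF assms, unfolded set_integrable_def]]
  show ?thesis by (simp add: set_lebesgue_integral_def)
qed

lemma expectation_gradient_noise:
  assumes st: "0 \<le> s" "s \<le> t" "t \<le> T" and p: "p \<in> borel_measurable (F s)" "bounded_rv p"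
  shows "expectation (\<lambda>w. p w \<bullet> noise s t w) = 0"
proof -
  have s: "s \<in> {0..T}" "t \<in> {0..T}" using st by auto
  obtain L where L: "\<And>w. w \<in> space M \<Longrightarrow> norm (p w) \<le> L" using p(2) by (auto simp: bounded_rv_def)
  have "expectation (\<lambda>w. p w \<bullet> noise s t w) = (\<Sum>a\<in>UNIV. expectation (\<lambda>w. p w $ a * noise s t w $ a))"
    unfolding inner_vec_def inner_real_def
    by (intro Bochner_Integration.integral_sum bounded_rv_integrable bounded_rv_intros p(2) bounded_rv_noise s st)
  also have "\<dots> = 0"
  proof (intro sum.neutral ballI)
    fix a
    show "expectation (\<lambda>w. p w $ a * noise s t w $ a) = 0"
      by (rule noise_mean[OF st, of _ L])
        (auto intro: measurable_compose[OF p(1)] order_trans[OF component_le_norm_cart L])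
  qed
  finally show ?thesis .
qed

text \<open>The inner product of matrices is the entrywise one, so the right-hand side is the
  contraction of second derivatives with the covariance that Ito's formula contains. It comes from
  the covariance property applied to each entry of \<open>Q\<close> as a weight.\<close>

lemma expectation_quadratic_noise:
  assumes st: "0 \<le> s" "s \<le> t" "t \<le> T" and Q: "Q \<in> borel_measurable (F s)" "bounded_rv Q"
  shows "expectation (\<lambda>w. noise s t w \<bullet> (Q w *v noise s t w)) = expectation (\<lambda>w. Q w \<bullet> covar s t w)"
proof -
  have s: "s \<in> {0..T}" "t \<in> {0..T}" using st by auto
  obtain L where L: "\<And>w. w \<in> space M \<Longrightarrow> norm (Q w) \<le> L" using Q(2) by (auto simp: bounded_rv_def)
  have L': "\<bar>Q w $ a $ c\<bar> \<le> L" if "w \<in> space M" for w a c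
    using L[OF that] Finite_Cartesian_Product.norm_nth_le[of "Q w" a]
      Finite_Cartesian_Product.norm_nth_le[of "Q w $ a" c] by simp
  have mQ: "(\<lambda>w. Q w $ a $ c) \<in> borel_measurable (F s)" for a c
    by (rule measurable_compose[OF Q(1)]) (intro borel_measurable_continuous_onI continuous_intros)
  have eq: "x \<bullet> (A *v x) = (\<Sum>a\<in>UNIV. \<Sum>c\<in>UNIV. A $ a $ c * (x $ a * x $ c))" for x :: "real ^ 'n" and A :: "real ^ 'n ^ 'n"
    unfolding inner_vec_def matrix_vector_mult_def by (simp add: sum_distrib_left mult_ac)
  have eq': "A \<bullet> A' = (\<Sum>a\<in>UNIV. \<Sum>c\<in>UNIV. A $ a $ c * A' $ a $ c)" for A A' :: "real ^ 'n ^ 'n"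
    by (simp add: inner_vec_def)
  note i = bounded_rv_integrable bounded_rv_intros Q(2) bounded_rv_noise bounded_rv_covar s st
  have "expectation (\<lambda>w. noise s t w \<bullet> (Q w *v noise s t w))
     = (\<Sum>a\<in>UNIV. \<Sum>c\<in>UNIV. expectation (\<lambda>w. Q w $ a $ c * (noise s t w $ a * noise s t w $ c)))"
    unfolding eq
    by (subst Bochner_Integration.integral_sum, intro Bochner_Integration.integrable_sum i)
      (intro sum.cong refl Bochner_Integration.integral_sum i)
  also have "\<dots> = (\<Sum>a\<in>UNIV. \<Sum>c\<in>UNIV. expectation (\<lambda>w. Q w $ a $ c * covar s t w $ a $ c))"
  proof (intro sum.cong refl)
    fix a c
    have "expectation (\<lambda>w. Q w $ a $ c * (noise s t w $ a * noise s t w $ c))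
      = expectation (\<lambda>w. Q w $ a $ c * (LINT r:{s<..t}|lborel. C r w $ a $ c))"
      by (rule noise_covariance[OF st mQ L'])
    also have "\<dots> = expectation (\<lambda>w. Q w $ a $ c * covar s t w $ a $ c)"
      by (intro Bochner_Integration.integral_cong refl) (simp add: covar_component)
    finally show "expectation (\<lambda>w. Q w $ a $ c * (noise s t w $ a * noise s t w $ c))
      = expectation (\<lambda>w. Q w $ a $ c * covar s t w $ a $ c)" .
  qed
  also have "\<dots> = expectation (\<lambda>w. Q w \<bullet> covar s t w)"
    unfolding eq'
    by (subst Bochner_Integration.integral_sum, intro Bochner_Integration.integrable_sum i)
      (intro sum.cong refl Bochner_Integration.integral_sum[symmetric] i)
  finally show ?thesis .
qed

lemma bounded_rv_space_function:
  assumes "continuous_on UNIV h" "t \<in> {0..T}" shows "bounded_rv (\<lambda>w. h (Y t w))"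
  by (rule bounded_rv_continuous[OF bounded_rv_Y[OF assms(2)] assms(1)])

text \<open>A step is split into a move in space at time \<open>s\<close> and a move in time at the
  position \<open>Y t w\<close>. Hence \<open>ut\<close> is taken at the new position, where the
  fundamental theorem of calculus makes its integral exact, and \<open>ux\<close>,
  \<open>uxx\<close> at the old time and position, where they are known at time
  \<open>s\<close>.\<close>

lemma step_integral:
  fixes u :: "real \<Rightarrow> real ^ 'n \<Rightarrow> real"
  assumes u: "C12_with_derivatives T u ut ux uxx" and st: "0 \<le> s" "s \<le> t" "t \<le> T" and w: "w \<in> space M"
  shows "set_integrable lborel {s<..t}
      (\<lambda>r. ut r (Y t w) + ux s (Y s w) \<bullet> \<beta> r w + 1 / 2 * (uxx s (Y s w) \<bullet> C r w))"
    "(LINT r:{s<..t}|lborel. ut r (Y t w) + ux s (Y s w) \<bullet> \<beta> r w + 1 / 2 * (uxx s (Y s w) \<bullet> C r w))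
      = (u t (Y t w) - u s (Y t w)) + ux s (Y s w) \<bullet> drift s t w + 1 / 2 * (uxx s (Y s w) \<bullet> covar s t w)"
proof -
    have ut: "continuous_on {0..T} (\<lambda>r. ut r (Y t w))"
      by (rule continuous_on_fst_of_product[OF C12_continuous(2)[OF u]])
    then have ut': "continuous_on {s..t} (\<lambda>r. ut r (Y t w))" by (rule continuous_on_subset) (use st in auto)
    have i1: "set_integrable lborel {s<..t} (\<lambda>r. ut r (Y t w))"
      unfolding set_integral_Ioc_Icc by (rule borel_integrable_atLeastAtMost'[OF ut'])
    have i2: "set_integrable lborel {s<..t} (\<lambda>r. ux s (Y s w) \<bullet> \<beta> r w)"
      using integrable_bounded_linear[OF bounded_linear_inner_right \<beta>_integrable[OF w, unfolded set_integrable_def], of "ux s (Y s w)"]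
      by (simp add: set_integrable_def)
    have i3: "set_integrable lborel {s<..t} (\<lambda>r. 1 / 2 * (uxx s (Y s w) \<bullet> C r w))"
      using integrable_bounded_linear[OF bounded_linear_inner_right C_integrable[OF w, unfolded set_integrable_def], of "uxx s (Y s w)"]
      by (intro set_integrable_mult_right) (simp add: set_integrable_def)
    have e1: "(LINT r:{s<..t}|lborel. ut r (Y t w)) = u t (Y t w) - u s (Y t w)"
    proof (rule set_integral_Ioc_FTC[OF st(2) _ ut'])
      fix r assume "r \<in> {s..t}"
      then have "((\<lambda>r. u r (Y t w)) has_real_derivative ut r (Y t w)) (at r within {0..T})"
        using u st unfolding C12_with_derivatives_def by auto
      then show "((\<lambda>r. u r (Y t w)) has_real_derivative ut r (Y t w)) (at r within {s..t})"
        by (rule DERIV_subset) (use st in auto)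
    qed
    have e2: "(LINT r:{s<..t}|lborel. ux s (Y s w) \<bullet> \<beta> r w) = ux s (Y s w) \<bullet> drift s t w"
      using integral_bounded_linear[OF bounded_linear_inner_right \<beta>_integrable[OF w, unfolded set_integrable_def], of "ux s (Y s w)"]
      by (simp add: set_lebesgue_integral_def)
    have e3: "(LINT r:{s<..t}|lborel. uxx s (Y s w) \<bullet> C r w) = uxx s (Y s w) \<bullet> covar s t w"
      using integral_bounded_linear[OF bounded_linear_inner_right C_integrable[OF w, unfolded set_integrable_def], of "uxx s (Y s w)"]
      by (simp add: set_lebesgue_integral_def)
    note i12 = set_integral_add(1)[OF i1 i2]
    show "set_integrable lborel {s<..t}
        (\<lambda>r. ut r (Y t w) + ux s (Y s w) \<bullet> \<beta> r w + 1 / 2 * (uxx s (Y s w) \<bullet> C r w))"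
      by (rule set_integral_add(1)[OF i12 i3])
    show "(LINT r:{s<..t}|lborel. ut r (Y t w) + ux s (Y s w) \<bullet> \<beta> r w + 1 / 2 * (uxx s (Y s w) \<bullet> C r w))
      = (u t (Y t w) - u s (Y t w)) + ux s (Y s w) \<bullet> drift s t w + 1 / 2 * (uxx s (Y s w) \<bullet> covar s t w)"
      unfolding set_integral_add(2)[OF i12 i3] set_integral_add(2)[OF i1 i2]
      by (simp only: e1 e2 e3 set_integral_mult_right)
qed

lemma bounded_rv_step_integral:
  fixes u :: "real \<Rightarrow> real ^ 'n \<Rightarrow> real"
  assumes u: "C12_with_derivatives T u ut ux uxx" and st: "0 \<le> s" "s \<le> t" "t \<le> T"
  shows "bounded_rv (\<lambda>w. LINT r:{s<..t}|lborel. ut r (Y t w) + ux s (Y s w) \<bullet> \<beta> r w + 1 / 2 * (uxx s (Y s w) \<bullet> C r w))"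
proof -
  have s: "s \<in> {0..T}" "t \<in> {0..T}" using st by auto
  note cs = C12_continuous_space[OF u s(1)] C12_continuous_space[OF u s(2)]
  have b: "bounded_rv (\<lambda>w. (u t (Y t w) - u s (Y t w)) + ux s (Y s w) \<bullet> drift s t w + 1 / 2 * (uxx s (Y s w) \<bullet> covar s t w))"
    by (intro bounded_rv_intros bounded_rv_space_function cs s bounded_rv_drift bounded_rv_covar st)
  show ?thesis
    by (rule bounded_rv_cong[OF step_integral(2)[OF u st] b])
qed

text \<open>Two parts of the change of \<open>u\<close> have mean zero: the gradient against the
  noise, and the Hessian form of the noise minus its contraction with the covariance. There remain
  the Taylor remainder \<open>rem\<close> and half of \<open>cross\<close>, the effect of replacing
  the increment by its noise in the quadratic form.\<close>

lemma Taylor_step_error: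
  fixes u :: "real \<Rightarrow> real ^ 'n \<Rightarrow> real"
  assumes u: "C12_with_derivatives T u ut ux uxx" and st: "0 \<le> s" "s \<le> t" "t \<le> T"
    and K: "0 \<le> K" "\<And>t x. t \<in> {0..T} \<Longrightarrow> x \<in> cball 0 R \<Longrightarrow> norm (uxx t x) \<le> K"
    and e: "0 < \<epsilon>" and c: "\<And>t x y. t \<in> {0..T} \<Longrightarrow> x \<in> cball 0 R \<Longrightarrow> y \<in> cball 0 R \<Longrightarrow>
    \<bar>u t y - u t x - ux t x \<bullet> (y - x) - 1 / 2 * ((y - x) \<bullet> (uxx t x *v (y - x)))\<bar>
      \<le> \<epsilon> * (norm (y - x))\<^sup>2 + c * ((norm (y - x))\<^sup>2)\<^sup>2"
  defines "q \<equiv> \<lambda>w. (norm (Y t w - Y s w))\<^sup>2"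
  shows "\<bar>expectation (\<lambda>w. u t (Y t w)) - expectation (\<lambda>w. u s (Y s w))
     - expectation (\<lambda>w. LINT r:{s<..t}|lborel. ut r (Y t w) + ux s (Y s w) \<bullet> \<beta> r w + 1 / 2 * (uxx s (Y s w) \<bullet> C r w))\<bar>
    \<le> \<epsilon> * expectation q + c * expectation (\<lambda>w. (q w)\<^sup>2)
      + 1 / 2 * (K * (\<epsilon> * (KQ * (t - s)) + (1 / \<epsilon> + 1) * (B * (t - s))\<^sup>2))"
proof -
  have s: "s \<in> {0..T}" "t \<in> {0..T}" using st by auto
  define p where "p w = ux s (Y s w)" for w
  define Q where "Q w = uxx s (Y s w)" for w
  define \<Delta> where "\<Delta> w = Y t w - Y s w" for w
  let ?Z = "noise s t" and ?D = "drift s t"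
  define rem where "rem w = u s (Y t w) - u s (Y s w) - p w \<bullet> \<Delta> w - 1 / 2 * (\<Delta> w \<bullet> (Q w *v \<Delta> w))" for w
  define cross where "cross w = \<Delta> w \<bullet> (Q w *v \<Delta> w) - ?Z w \<bullet> (Q w *v ?Z w)" for w
  define I where "I w = (LINT r:{s<..t}|lborel. ut r (Y t w) + ux s (Y s w) \<bullet> \<beta> r w + 1 / 2 * (uxx s (Y s w) \<bullet> C r w))" for w
  have Yd: "\<Delta> w = ?Z w + ?D w" for w by (simp add: \<Delta>_def noise_def)
  have I: "I w = (u t (Y t w) - u s (Y t w)) + p w \<bullet> ?D w + 1 / 2 * (Q w \<bullet> covar s t w)" if w: "w \<in> space M" for w
    unfolding I_def p_def Q_def by (rule step_integral(2)[OF u st w])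
  note cs = C12_continuous_space[OF u s(1)] C12_continuous_space[OF u s(2)]
  have bp: "bounded_rv p" and bQ: "bounded_rv Q"
    unfolding p_def[abs_def] Q_def[abs_def] by (intro bounded_rv_space_function cs s)+
  have bu: "bounded_rv (\<lambda>w. u s (Y s w))" "bounded_rv (\<lambda>w. u s (Y t w))" "bounded_rv (\<lambda>w. u t (Y t w))"
    by (intro bounded_rv_space_function cs s)+
  have b\<Delta>: "bounded_rv \<Delta>" unfolding \<Delta>_def[abs_def] by (intro bounded_rv_intros bounded_rv_Y s)
  have bZ: "bounded_rv ?Z" and bD: "bounded_rv ?D" and bC: "bounded_rv (covar s t)"
    by (rule bounded_rv_noise[OF s st(2)], rule bounded_rv_drift[OF st(2)], rule bounded_rv_covar[OF st(2)])
  have mp: "p \<in> borel_measurable (F s)" "Q \<in> borel_measurable (F s)"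
    unfolding p_def[abs_def] Q_def[abs_def]
    by (rule measurable_compose[OF Y_adapted[OF s(1)] borel_measurable_continuous_onI[OF cs(3)]],
        rule measurable_compose[OF Y_adapted[OF s(1)] borel_measurable_continuous_onI[OF cs(4)]])
  have br: "bounded_rv rem" "bounded_rv cross" "bounded_rv q"
    unfolding rem_def[abs_def] cross_def[abs_def] q_def
    by (intro bounded_rv_intros bu bp bQ b\<Delta> bZ bounded_rv_Y s)+
  have path: "u t (Y t w) - u s (Y s w) - I w = rem w + 1 / 2 * cross w
      + p w \<bullet> ?Z w + 1 / 2 * (?Z w \<bullet> (Q w *v ?Z w) - Q w \<bullet> covar s t w)" if "w \<in> space M" for w
  proof -
    have "p w \<bullet> \<Delta> w = p w \<bullet> ?Z w + p w \<bullet> ?D w" by (simp add: Yd inner_add_right)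
    then show ?thesis unfolding I[OF that] rem_def cross_def by (simp add: algebra_simps)
  qed
  have bI: "bounded_rv I" unfolding I_def[abs_def] by (rule bounded_rv_step_integral[OF u st])
  note i = bounded_rv_integrable bounded_rv_intros bu bp bQ bD bC bI br bZ
  have "expectation (\<lambda>w. u t (Y t w)) - expectation (\<lambda>w. u s (Y s w)) - expectation I
     = expectation (\<lambda>w. u t (Y t w) - u s (Y s w) - I w)"
  proof -
    have "integrable M (\<lambda>w. u t (Y t w))" "integrable M (\<lambda>w. u s (Y s w))" "integrable M I" by (intro i)+
    then show ?thesis by simp
  qed
  also have "\<dots> = expectation (\<lambda>w. (rem w + 1 / 2 * cross w)
      + (p w \<bullet> ?Z w + 1 / 2 * (?Z w \<bullet> (Q w *v ?Z w) - Q w \<bullet> covar s t w)))"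
    by (intro Bochner_Integration.integral_cong refl) (simp add: path)
  also have "\<dots> = expectation (\<lambda>w. rem w + 1 / 2 * cross w)"
  proof -
    have "integrable M (\<lambda>w. rem w + 1 / 2 * cross w)" "integrable M (\<lambda>w. p w \<bullet> ?Z w)"
      "integrable M (\<lambda>w. ?Z w \<bullet> (Q w *v ?Z w))" "integrable M (\<lambda>w. Q w \<bullet> covar s t w)"
      by (intro i)+
    then show ?thesis
      by (simp add: expectation_gradient_noise[OF st mp(1) bp] expectation_quadratic_noise[OF st mp(2) bQ])
  qed
  finally have E: "expectation (\<lambda>w. u t (Y t w)) - expectation (\<lambda>w. u s (Y s w)) - expectation I
     = expectation (\<lambda>w. rem w + 1 / 2 * cross w)" .
  let ?b = "\<lambda>w. \<epsilon> * q w + c * (q w)\<^sup>2 + 1 / 2 * (K * (\<epsilon> * (norm (?Z w))\<^sup>2 + (1 / \<epsilon> + 1) * (B * (t - s))\<^sup>2))"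
  have le: "\<bar>rem w + 1 / 2 * cross w\<bar> \<le> ?b w" if w: "w \<in> space M" for w
  proof -
    have YR: "Y s w \<in> cball 0 R" "Y t w \<in> cball 0 R" using Y_bound s w by auto
    have r: "\<bar>rem w\<bar> \<le> \<epsilon> * q w + c * (q w)\<^sup>2"
      using c[OF s(1) YR] by (simp add: rem_def p_def Q_def \<Delta>_def q_def)
    define z d where "z = norm (?Z w)" and "d = norm (?D w)"
    have nQ: "norm (Q w) \<le> K" using K(2)[OF s(1) YR(1)] by (simp add: Q_def)
    have qf: "\<bar>x \<bullet> (Q w *v y)\<bar> \<le> K * (norm x * norm y)" for x y
      by (rule order_trans[OF abs_quadratic_form_le]) (intro mult_right_mono nQ mult_nonneg_nonneg norm_ge_zero)
    have "cross w = ?Z w \<bullet> (Q w *v ?D w) + ?D w \<bullet> (Q w *v ?Z w) + ?D w \<bullet> (Q w *v ?D w)"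
      by (simp add: cross_def Yd matrix_vector_right_distrib inner_add_left inner_add_right)
    then have "\<bar>cross w\<bar> \<le> K * (z * d) + K * (d * z) + K * (d * d)"
      using qf[of "?Z w" "?D w"] qf[of "?D w" "?Z w"] qf[of "?D w" "?D w"] unfolding z_def d_def by linarith
    also have "\<dots> = K * (2 * (z * d) + d\<^sup>2)" by (simp add: algebra_simps power2_eq_square)
    also have "\<dots> \<le> K * (\<epsilon> * z\<^sup>2 + (1 / \<epsilon> + 1) * (B * (t - s))\<^sup>2)"
    proof (intro mult_left_mono K)
      \<comment> \<open>Young's inequality puts the small factor on the noise, whose mean square is
        of order \<open>t - s\<close>. The drift pays with \<open>1 / \<epsilon>\<close>, but its
        square is of order \<open>(t - s)\<^sup>2\<close> and disappears after summation over a fine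
        grid.\<close>
      have "2 * (\<epsilon> * (z * d)) \<le> (\<epsilon> * z)\<^sup>2 + d\<^sup>2"
        using sum_squares_bound[of "\<epsilon> * z" d] by (simp add: mult_ac)
      then have "2 * (z * d) \<le> \<epsilon> * z\<^sup>2 + d\<^sup>2 / \<epsilon>" using e by (simp add: field_simps power2_eq_square)
      then have "2 * (z * d) + d\<^sup>2 \<le> \<epsilon> * z\<^sup>2 + (1 / \<epsilon> + 1) * d\<^sup>2" by (simp add: algebra_simps)
      also have "d\<^sup>2 \<le> (B * (t - s))\<^sup>2" unfolding d_def using drift_bound[OF w st(2)] by (intro power_mono) auto
      finally show "2 * (z * d) + d\<^sup>2 \<le> \<epsilon> * z\<^sup>2 + (1 / \<epsilon> + 1) * (B * (t - s))\<^sup>2" using e by (simp add: mult_left_mono)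
    qed
    finally show ?thesis using r unfolding z_def by linarith
  qed
  have int: "integrable M (\<lambda>w. (norm (?Z w))\<^sup>2)" "integrable M q" "integrable M (\<lambda>w. (q w)\<^sup>2)" by (intro i)+
  have "\<bar>expectation (\<lambda>w. rem w + 1 / 2 * cross w)\<bar> \<le> expectation (\<lambda>w. \<bar>rem w + 1 / 2 * cross w\<bar>)"
    by (rule integral_abs_bound)
  also have "\<dots> \<le> expectation ?b"
    using le by (intro integral_mono bounded_rv_integrable bounded_rv_intros br bZ)
  also have "\<dots> = \<epsilon> * expectation q + c * expectation (\<lambda>w. (q w)\<^sup>2)
      + 1 / 2 * (K * (\<epsilon> * expectation (\<lambda>w. (norm (?Z w))\<^sup>2) + (1 / \<epsilon> + 1) * (B * (t - s))\<^sup>2))"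
    using int by (simp add: prob_space)
  also have "expectation (\<lambda>w. (norm (?Z w))\<^sup>2) \<le> KQ * (t - s)"
    using expectation_noise_square_le[OF st, of "\<lambda>_. 1" 1] by (simp add: prob_space)
  finally show ?thesis unfolding E[unfolded I_def, symmetric] using K(1) e by (simp add: mult_left_mono)
qed

theorem dynkin_formula:
  fixes u :: "real \<Rightarrow> real ^ 'n \<Rightarrow> real"
  assumes u: "C12_with_derivatives T u ut ux uxx"
  defines "g \<equiv> \<lambda>r w. ut r (Y r w) + ux r (Y r w) \<bullet> \<beta> r w + 1 / 2 * (uxx r (Y r w) \<bullet> C r w)"
  shows "expectation (\<lambda>w. u T (Y T w)) = expectation (\<lambda>w. u 0 (Y 0 w)) + expectation (\<lambda>w. LINT r:{0<..T}|lborel. g r w)"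
    and "integrable M (\<lambda>w. LINT r:{0<..T}|lborel. g r w)"
    and "w \<in> space M \<Longrightarrow> set_integrable lborel {0<..T} (\<lambda>r. g r w)"
proof -
  obtain K where K: "0 \<le> K" "\<And>t x. t \<in> {0..T} \<Longrightarrow> x \<in> cball 0 R \<Longrightarrow>
    \<bar>u t x\<bar> \<le> K \<and> \<bar>ut t x\<bar> \<le> K \<and> norm (ux t x) \<le> K \<and> norm (uxx t x) \<le> K"
    using C12_bounded[OF u, of R] by metis
  define K' where "K' = K + K * B + 1 / 2 * (K * B)"
  have K'0: "0 \<le> K'" using K(1) B_nonneg by (simp add: K'_def)
  define tm where "tm N i r w = ut r (Y (grid N (Suc i)) w) + ux (grid N i) (Y (grid N i) w) \<bullet> \<beta> r w
      + 1 / 2 * (uxx (grid N i) (Y (grid N i) w) \<bullet> C r w)" for N i r w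
  \<comment> \<open>The integrand \<open>g\<close> with position and coefficients frozen on each
    cell, while \<open>\<beta>\<close> and \<open>C\<close> keep running: these are merely
    measurable in time, so convergence to \<open>g\<close> may use continuity of the coefficients
    and of \<open>Y\<close> only.\<close>
  define gN where "gN N r w = (\<Sum>i<N. indicator {grid N i<..grid N (Suc i)} r *\<^sub>R tm N i r w)" for N r w
  have cellT: "0 \<le> grid N i" "grid N i \<le> grid N (Suc i)" "grid N (Suc i) \<le> T" if "i < N" for N i
    using grid_in[of i N] grid_in[of "Suc i" N] grid_le[of i N] that by auto
  have bnd: "\<bar>a + p \<bullet> \<beta> r w + 1 / 2 * (Q \<bullet> C r w)\<bar> \<le> K'"
    if "w \<in> space M" "\<bar>a\<bar> \<le> K" "norm p \<le> K" "norm Q \<le> K" for a p Q r w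
  proof -
    have "\<bar>p \<bullet> \<beta> r w\<bar> \<le> K * B"
      using Cauchy_Schwarz_ineq2[of p "\<beta> r w"] mult_mono[OF that(3) \<beta>_bound[OF that(1)]] K(1)
      by (meson norm_ge_zero order_trans)
    moreover have "\<bar>Q \<bullet> C r w\<bar> \<le> K * B"
      using Cauchy_Schwarz_ineq2[of Q "C r w"] mult_mono[OF that(4) C_bound[OF that(1)]] K(1)
      by (meson norm_ge_zero order_trans)
    ultimately show ?thesis using that(2) unfolding K'_def by linarith
  qed
  have gN_cell: "gN N r w = tm N i r w" if "i < N" "r \<in> {grid N i<..grid N (Suc i)}" for N i r w
  proof -
    have "gN N r w = (\<Sum>k<N. if k = i then tm N i r w else 0)"
      unfolding gN_def
    proof (rule sum.cong[OF refl])
      fix k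
      show "indicator {grid N k<..grid N (Suc k)} r *\<^sub>R tm N k r w = (if k = i then tm N i r w else 0)"
      proof (cases "k = i")
        case False
        then have "r \<notin> {grid N k<..grid N (Suc k)}"
          using grid_locate_unique[of "grid N", OF _ that(2), of k] grid_mono[of _ _ N] by (auto simp: mono_def)
        then show ?thesis using False by simp
      qed (use that in simp)
    qed
    then show ?thesis using that by simp
  qed
  have gN_out: "gN N r w = 0" if "r \<notin> {0<..T}" for N r w
  proof -
    have "r \<notin> {grid N i<..grid N (Suc i)}" if "i < N" for i
      using cellT[OF that] \<open>r \<notin> _\<close> by auto
    then show ?thesis unfolding gN_def by (intro sum.neutral) auto
  qed
  have gN_locate: "\<exists>i<Suc N. r \<in> {grid (Suc N) i<..grid (Suc N) (Suc i)}" if "r \<in> {0<..T}" for N r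
  proof -
    have "r \<in> {grid (Suc N) 0<..grid (Suc N) (Suc N)}" using that by simp
    then show ?thesis by (rule grid_locate) blast
  qed
  have gN_int: "integrable lborel (\<lambda>r. gN N r w)"
    "(\<integral>r. gN N r w \<partial>lborel) = (\<Sum>i<N. LINT r:{grid N i<..grid N (Suc i)}|lborel. tm N i r w)"
    if "w \<in> space M" for N w
  proof -
    have i: "integrable lborel (\<lambda>r. indicator {grid N i<..grid N (Suc i)} r *\<^sub>R tm N i r w)" if "i \<in> {..<N}" for i
      using step_integral(1)[OF u cellT \<open>w \<in> space M\<close>, of i N] that unfolding tm_def set_integrable_def by simp
    show "integrable lborel (\<lambda>r. gN N r w)"
      unfolding gN_def by (intro Bochner_Integration.integrable_sum i)
    show "(\<integral>r. gN N r w \<partial>lborel) = (\<Sum>i<N. LINT r:{grid N i<..grid N (Suc i)}|lborel. tm N i r w)"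
      unfolding gN_def set_lebesgue_integral_def by (intro Bochner_Integration.integral_sum i)
  qed
  have gN_le: "\<bar>gN (Suc N) r w\<bar> \<le> indicator {0<..T} r * K'" if w: "w \<in> space M" for N r w
  proof (cases "r \<in> {0<..T}")
    case True
    then obtain i where i: "i < Suc N" "r \<in> {grid (Suc N) i<..grid (Suc N) (Suc i)}" using gN_locate by blast
    have g: "grid (Suc N) i \<in> {0..T}" "grid (Suc N) (Suc i) \<in> {0..T}" "r \<in> {0..T}"
      using cellT[OF i(1)] True by auto
    have "\<bar>tm (Suc N) i r w\<bar> \<le> K'"
      unfolding tm_def using K(2)[OF g(3), of "Y (grid (Suc N) (Suc i)) w"] K(2)[OF g(1), of "Y (grid (Suc N) i) w"]
        Y_bound[OF g(1) w] Y_bound[OF g(2) w] by (intro bnd w) auto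
    then show ?thesis using True gN_cell[OF i] by simp
  next
    case False
    then show ?thesis by (simp add: gN_out)
  qed
  have gN_lim: "(\<lambda>N. gN (Suc N) r w) \<longlonglongrightarrow> indicator {0<..T} r *\<^sub>R g r w" if w: "w \<in> space M" for r w
  proof (cases "r \<in> {0<..T}")
    case True
    then have "\<forall>N. \<exists>i<Suc N. r \<in> {grid (Suc N) i<..grid (Suc N) (Suc i)}" using gN_locate by blast
    then obtain \<iota> where \<iota>: "\<And>N. \<iota> N < Suc N" "\<And>N. r \<in> {grid (Suc N) (\<iota> N)<..grid (Suc N) (Suc (\<iota> N))}" by metis
    define lo where "lo N = grid (Suc N) (\<iota> N)" for N
    define up where "up N = grid (Suc N) (Suc (\<iota> N))" for N
    have g: "lo N \<in> {0..T}" "up N \<in> {0..T}" for N using cellT[OF \<iota>(1)[of N]] by (auto simp: lo_def up_def)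
    have r: "r \<in> {0..T}" using True by auto
    have st: "lo N < r" "r \<le> up N" "up N - lo N = T / real (Suc N)" for N
      using \<iota>(2)[of N] grid_step[of "\<iota> N" "Suc N"] by (auto simp: lo_def up_def)
    have h: "(\<lambda>N. T / real (Suc N)) \<longlonglongrightarrow> 0"
      using tendsto_mult_right_zero[OF LIMSEQ_inverse_real_of_nat, of T] by (simp add: divide_inverse)
    have "(\<lambda>N. r - lo N) \<longlonglongrightarrow> 0"
    proof (rule LIMSEQ_squeeze_zero[OF _ h])
      show "r - lo N \<le> T / real (Suc N)" for N using st(2)[of N] st(3)[of N] by linarith
    qed (use st in \<open>simp add: less_imp_le\<close>)
    from tendsto_diff[OF tendsto_const[of r] this] have lo: "lo \<longlonglongrightarrow> r" by simp
    have "(\<lambda>N. up N - r) \<longlonglongrightarrow> 0"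
    proof (rule LIMSEQ_squeeze_zero[OF _ h])
      show "up N - r \<le> T / real (Suc N)" for N using st(1)[of N] st(3)[of N] by linarith
    qed (use st in simp)
    from tendsto_add[OF tendsto_const[of r] this] have up: "up \<longlonglongrightarrow> r" by simp
    have Yl: "(\<lambda>N. Y (lo N) w) \<longlonglongrightarrow> Y r w" "(\<lambda>N. Y (up N) w) \<longlonglongrightarrow> Y r w"
      using g by (auto intro!: continuous_on_tendsto_compose[OF Y_continuous[OF w]] lo up r)
    have c1: "(\<lambda>N. ut r (Y (up N) w)) \<longlonglongrightarrow> ut r (Y r w)"
      by (rule continuous_on_tendsto_compose[OF C12_continuous_space(2)[OF u r] Yl(2)]) auto
    have j: "(\<lambda>N. (lo N, Y (lo N) w)) \<longlonglongrightarrow> (r, Y r w)" by (intro tendsto_Pair lo Yl)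
    have c2: "(\<lambda>N. ux (lo N) (Y (lo N) w)) \<longlonglongrightarrow> ux r (Y r w)"
      using continuous_on_tendsto_compose[OF C12_continuous(3)[OF u] j] g r by simp
    have c3: "(\<lambda>N. uxx (lo N) (Y (lo N) w)) \<longlonglongrightarrow> uxx r (Y r w)"
      using continuous_on_tendsto_compose[OF C12_continuous(4)[OF u] j] g r by simp
    have "(\<lambda>N. ut r (Y (up N) w) + ux (lo N) (Y (lo N) w) \<bullet> \<beta> r w + 1 / 2 * (uxx (lo N) (Y (lo N) w) \<bullet> C r w)) \<longlonglongrightarrow> g r w"
      unfolding g_def by (intro tendsto_intros c1 c2 c3)
    moreover have "gN (Suc N) r w = ut r (Y (up N) w) + ux (lo N) (Y (lo N) w) \<bullet> \<beta> r w + 1 / 2 * (uxx (lo N) (Y (lo N) w) \<bullet> C r w)" for N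
      unfolding gN_cell[OF \<iota>(1)[of N] \<iota>(2)[of N]] tm_def lo_def up_def ..
    ultimately show ?thesis using True by simp
  qed (simp add: gN_out)
  have gN_meas: "(\<lambda>r. gN N r w) \<in> borel_measurable lborel" if "w \<in> space M" for N w
    using gN_int(1)[OF that] by (rule borel_measurable_integrable)
  have bint: "integrable lborel (\<lambda>r. indicator {0<..T} r * K')"
    using T_pos by (intro integrable_mult_left integrable_real_indicator) auto
  have g_meas: "(\<lambda>r. indicator {0<..T} r *\<^sub>R g r w) \<in> borel_measurable lborel" if "w \<in> space M" for w
    by (rule borel_measurable_LIMSEQ_real[OF gN_lim[OF that] gN_meas[OF that]])
  have inner: "integrable lborel (\<lambda>r. indicator {0<..T} r *\<^sub>R g r w)"
    "(\<lambda>N. \<integral>r. gN (Suc N) r w \<partial>lborel) \<longlonglongrightarrow> (LINT r:{0<..T}|lborel. g r w)" if w: "w \<in> space M" for w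
  proof -
    have 1: "AE r in lborel. (\<lambda>N. gN (Suc N) r w) \<longlonglongrightarrow> indicator {0<..T} r *\<^sub>R g r w"
      by (intro AE_I2 gN_lim w)
    have 2: "AE r in lborel. norm (gN (Suc N) r w) \<le> indicator {0<..T} r * K'" for N
      using gN_le[OF w] by (intro AE_I2) simp
    show "integrable lborel (\<lambda>r. indicator {0<..T} r *\<^sub>R g r w)"
      by (rule integrable_dominated_convergence[OF g_meas[OF w] gN_meas[OF w] bint 1 2])
    show "(\<lambda>N. \<integral>r. gN (Suc N) r w \<partial>lborel) \<longlonglongrightarrow> (LINT r:{0<..T}|lborel. g r w)"
      unfolding set_lebesgue_integral_def
      by (rule integral_dominated_convergence[OF g_meas[OF w] gN_meas[OF w] bint 1 2])
  qed
  then show "w \<in> space M \<Longrightarrow> set_integrable lborel {0<..T} (\<lambda>r. g r w)" by (simp add: set_integrable_def)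
  define J where "J N i w = (LINT r:{grid N i<..grid N (Suc i)}|lborel. tm N i r w)" for N i w
  have bJ: "bounded_rv (J N i)" if "i < N" for N i
    unfolding J_def[abs_def] tm_def by (rule bounded_rv_step_integral[OF u cellT[OF that]])
  have Smeas: "(\<lambda>w. \<Sum>i<N. J N i w) \<in> borel_measurable M" for N
    using bJ by (intro borel_measurable_sum) (auto simp: bounded_rv_def)
  have Slim: "(\<lambda>N. \<Sum>i<Suc N. J (Suc N) i w) \<longlonglongrightarrow> (LINT r:{0<..T}|lborel. g r w)" if "w \<in> space M" for w
    using inner(2)[OF that] unfolding gN_int(2)[OF that] J_def .
  \<comment> \<open>Measurability in \<open>w\<close> is inherited from the step sums, of which the
    integral is the pointwise limit.\<close>
  have G_meas: "(\<lambda>w. LINT r:{0<..T}|lborel. g r w) \<in> borel_measurable M"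
    by (rule borel_measurable_LIMSEQ_real[OF Slim Smeas])
  have Sle: "norm (\<Sum>i<Suc N. J (Suc N) i w) \<le> K' * T" if w: "w \<in> space M" for N w
  proof -
    have "norm (\<integral>r. gN (Suc N) r w \<partial>lborel) \<le> (\<integral>r. indicator {0<..T} r * K' \<partial>lborel)"
      using gN_le[OF w]
      by (intro order_trans[OF integral_norm_bound] integral_mono integrable_norm gN_int(1)[OF w] bint) simp
    also have "\<dots> = K' * T" using T_pos by simp
    finally show ?thesis unfolding gN_int(2)[OF w] J_def .
  qed
  show "integrable M (\<lambda>w. LINT r:{0<..T}|lborel. g r w)"
  proof (rule integrable_const_bound[OF _ G_meas])
    show "AE w in M. norm (LINT r:{0<..T}|lborel. g r w) \<le> K' * T"
    proof (rule AE_I2)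
      fix w assume w: "w \<in> space M"
      show "norm (LINT r:{0<..T}|lborel. g r w) \<le> K' * T"
        by (rule LIMSEQ_le_const2[OF tendsto_norm[OF Slim[OF w]]]) (intro exI[of _ 0] allI impI Sle[OF w])
    qed
  qed
  have outer: "(\<lambda>N. expectation (\<lambda>w. \<Sum>i<Suc N. J (Suc N) i w)) \<longlonglongrightarrow> expectation (\<lambda>w. LINT r:{0<..T}|lborel. g r w)"
  proof (rule integral_dominated_convergence[where w="\<lambda>_. K' * T"])
    show "AE w in M. (\<lambda>N. \<Sum>i<Suc N. J (Suc N) i w) \<longlonglongrightarrow> (LINT r:{0<..T}|lborel. g r w)"
      by (intro AE_I2 Slim)
    show "AE w in M. norm (\<Sum>i<Suc N. J (Suc N) i w) \<le> K' * T" for N by (intro AE_I2 Sle)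
  qed (use Smeas G_meas in \<open>simp_all del: sum.lessThan_Suc\<close>)
  define L where "L = expectation (\<lambda>w. u T (Y T w)) - expectation (\<lambda>w. u 0 (Y 0 w))"
  define G where "G = expectation (\<lambda>w. LINT r:{0<..T}|lborel. g r w)"
  \<comment> \<open>What the terms with factor \<open>\<epsilon>\<close> add up to over all cells:
    \<open>KY * T\<close> from the Taylor remainder, the rest from the mixed terms of noise and
    drift.\<close>
  define c0 where "c0 = KY * T + 1 / 2 * (K * (KQ * T))"
  have c0: "0 \<le> c0" using KY_nonneg T_pos K(1) B_nonneg by (simp add: c0_def KQ_def)
  have main: "\<bar>L - G\<bar> \<le> \<epsilon> * c0" if e: "0 < \<epsilon>" for \<epsilon>
  proof -
    obtain c where c: "0 \<le> c" "\<And>t x y. t \<in> {0..T} \<Longrightarrow> x \<in> cball 0 R \<Longrightarrow> y \<in> cball 0 R \<Longrightarrow>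
      \<bar>u t y - u t x - ux t x \<bullet> (y - x) - 1 / 2 * ((y - x) \<bullet> (uxx t x *v (y - x)))\<bar>
      \<le> \<epsilon> * (norm (y - x))\<^sup>2 + c * ((norm (y - x))\<^sup>2)\<^sup>2"
      using C12_remainder[OF u e, of R] by metis
    let ?U = "\<lambda>N i. expectation (\<lambda>w. u (grid N i) (Y (grid N i) w))"
    have step: "\<bar>?U N (Suc i) - ?U N i - expectation (J N i)\<bar> \<le> \<epsilon> * (KY * (T / N)) + c * expectation (\<lambda>w. (quad N i w)\<^sup>2)
      + 1 / 2 * (K * (\<epsilon> * (KQ * (T / N)) + (1 / \<epsilon> + 1) * (B * (T / N))\<^sup>2))" if "i < N" for N i
    proof -
      have "\<bar>?U N (Suc i) - ?U N i - expectation (J N i)\<bar> \<le> \<epsilon> * expectation (quad N i) + c * expectation (\<lambda>w. (quad N i w)\<^sup>2)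
      + 1 / 2 * (K * (\<epsilon> * (KQ * (grid N (Suc i) - grid N i)) + (1 / \<epsilon> + 1) * (B * (grid N (Suc i) - grid N i))\<^sup>2))"
        unfolding J_def[abs_def] tm_def quad_def[abs_def]
        by (rule Taylor_step_error[OF u cellT[OF that] K(1) _ e c(2)]) (use K(2) in auto)
      also have "\<epsilon> * expectation (quad N i) \<le> \<epsilon> * (KY * (T / N))"
        using expectation_quad_le[OF that] e by (intro mult_left_mono) auto
      finally show ?thesis by (simp only: grid_step)
    qed
    \<comment> \<open>For fixed \<open>\<epsilon>\<close> everything but
      \<open>\<epsilon> * c0\<close> vanishes as \<open>N\<close> grows: \<open>c\<close> and
      \<open>1 / \<epsilon>\<close> may be large, but they multiply the sum of the squares of
      \<open>quad\<close> and the cell length.\<close>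
    have bound: "\<bar>L - expectation (\<lambda>w. \<Sum>i<N. J N i w)\<bar> \<le> \<epsilon> * c0 + c * expectation (\<lambda>w. \<Sum>i<N. (quad N i w)\<^sup>2)
       + 1 / 2 * (K * ((1 / \<epsilon> + 1) * (B\<^sup>2 * T))) * (T / N)" if N: "0 < N" for N
    proof -
      have "(\<Sum>i<N. ?U N (Suc i) - ?U N i) = ?U N N - ?U N 0" by (rule sum_lessThan_telescope)
      then have L: "L = (\<Sum>i<N. ?U N (Suc i) - ?U N i)" using N by (simp add: L_def)
      have J: "expectation (\<lambda>w. \<Sum>i<N. J N i w) = (\<Sum>i<N. expectation (J N i))"
        by (rule Bochner_Integration.integral_sum) (use bJ bounded_rv_integrable in auto)
      have q: "expectation (\<lambda>w. \<Sum>i<N. (quad N i w)\<^sup>2) = (\<Sum>i<N. expectation (\<lambda>w. (quad N i w)\<^sup>2))"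
      proof (rule Bochner_Integration.integral_sum)
        fix i assume "i \<in> {..<N}"
        then have "bounded_rv (quad N i)" unfolding quad_def[abs_def]
          using grid_in[of i N] grid_in[of "Suc i" N] N by (intro bounded_rv_intros bounded_rv_Y) auto
        then show "integrable M (\<lambda>w. (quad N i w)\<^sup>2)" by (intro bounded_rv_integrable bounded_rv_square)
      qed
      have "\<bar>L - expectation (\<lambda>w. \<Sum>i<N. J N i w)\<bar> = \<bar>\<Sum>i<N. ?U N (Suc i) - ?U N i - expectation (J N i)\<bar>"
        unfolding L J by (simp only: sum_subtractf)
      also have "\<dots> \<le> (\<Sum>i<N. \<epsilon> * (KY * (T / N)) + c * expectation (\<lambda>w. (quad N i w)\<^sup>2)
      + 1 / 2 * (K * (\<epsilon> * (KQ * (T / N)) + (1 / \<epsilon> + 1) * (B * (T / N))\<^sup>2)))"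
        by (intro order_trans[OF sum_abs] sum_mono step) auto
      also have "\<dots> = real N * (\<epsilon> * (KY * (T / N))) + c * expectation (\<lambda>w. \<Sum>i<N. (quad N i w)\<^sup>2)
      + real N * (1 / 2 * (K * (\<epsilon> * (KQ * (T / N)) + (1 / \<epsilon> + 1) * (B * (T / N))\<^sup>2)))"
        unfolding q by (simp only: sum.distrib sum_distrib_left sum_constant card_lessThan)
      also have "\<dots> = \<epsilon> * c0 + c * expectation (\<lambda>w. \<Sum>i<N. (quad N i w)\<^sup>2)
       + 1 / 2 * (K * ((1 / \<epsilon> + 1) * (B\<^sup>2 * T))) * (T / N)"
      proof -
        have alg: "n * (\<epsilon> * (KY * X)) + P + n * (1 / 2 * (K * (\<epsilon> * (KQ * X) + d * (B * X)\<^sup>2)))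
          = \<epsilon> * (KY * (n * X) + 1 / 2 * (K * (KQ * (n * X)))) + P + 1 / 2 * (K * (d * (B\<^sup>2 * (n * X)))) * X"
          for n X P d :: real by (simp add: algebra_simps power2_eq_square)
        have "real N * (T / N) = T" using N by simp
        from alg[of "real N" "T / N" _ "1 / \<epsilon> + 1", unfolded this]
        show ?thesis unfolding c0_def .
      qed
      finally show ?thesis .
    qed
    have hlim: "(\<lambda>N. T / real (Suc N)) \<longlonglongrightarrow> 0"
      using tendsto_mult_right_zero[OF LIMSEQ_inverse_real_of_nat, of T] by (simp add: divide_inverse)
    have qlim: "(\<lambda>N. expectation (\<lambda>w. \<Sum>i<Suc N. (quad (Suc N) i w)\<^sup>2)) \<longlonglongrightarrow> 0"
      using expectation_sum_quad_squares_tendsto by (rule LIMSEQ_Suc)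
    have lim1: "(\<lambda>N. \<epsilon> * c0 + c * expectation (\<lambda>w. \<Sum>i<Suc N. (quad (Suc N) i w)\<^sup>2)
       + 1 / 2 * (K * ((1 / \<epsilon> + 1) * (B\<^sup>2 * T))) * (T / real (Suc N))) \<longlonglongrightarrow> \<epsilon> * c0 + c * 0 + 1 / 2 * (K * ((1 / \<epsilon> + 1) * (B\<^sup>2 * T))) * 0"
      by (intro tendsto_add tendsto_const tendsto_mult hlim qlim)
    have lim2: "(\<lambda>N. \<bar>L - expectation (\<lambda>w. \<Sum>i<Suc N. J (Suc N) i w)\<bar>) \<longlonglongrightarrow> \<bar>L - G\<bar>"
      unfolding G_def by (intro tendsto_rabs tendsto_diff tendsto_const outer)
    have "\<bar>L - G\<bar> \<le> \<epsilon> * c0 + c * 0 + 1 / 2 * (K * ((1 / \<epsilon> + 1) * (B\<^sup>2 * T))) * 0"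
      by (rule LIMSEQ_le[OF lim2 lim1]) (intro exI[of _ 0] allI impI bound zero_less_Suc)
    then show ?thesis by simp
  qed
  have "\<bar>L - G\<bar> \<le> 0"
  proof (rule field_le_epsilon)
    fix e :: real assume e: "0 < e"
    have "\<bar>L - G\<bar> \<le> e / (c0 + 1) * c0" using main[of "e / (c0 + 1)"] e c0 by simp
    also have "\<dots> \<le> e" using e c0 by (simp add: field_simps)
    finally show "\<bar>L - G\<bar> \<le> 0 + e" by simp
  qed
  then show "expectation (\<lambda>w. u T (Y T w)) = expectation (\<lambda>w. u 0 (Y 0 w)) + expectation (\<lambda>w. LINT r:{0<..T}|lborel. g r w)"
    by (simp add: L_def G_def)
qed

end

section \<open>Ito integrals as limits in probability\<close>

text \<open>Joint measurability as a limit of time discretizations by rounding down; each of them is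
  glued from countably many measurable maps, and continuity of the paths gives the limit.\<close>

lemma measurable_continuous_process:
  fixes f :: "real \<Rightarrow> 'a \<Rightarrow> 'b::euclidean_space"
  assumes m: "\<And>r. f r \<in> borel_measurable M" and c: "\<And>w. w \<in> space M \<Longrightarrow> continuous_on UNIV (\<lambda>r. f r w)"
  shows "(\<lambda>(w, r). f r w) \<in> borel_measurable (M \<Otimes>\<^sub>M lborel)"
proof (rule borel_measurable_LIMSEQ_metric)
  fix n
  have "(\<lambda>x. f (of_int \<lfloor>snd x * real (Suc n)\<rfloor> / real (Suc n)) (fst x)) \<in> borel_measurable (M \<Otimes>\<^sub>M lborel)"
  proof (rule measurable_compose_countable[where f="\<lambda>i x. f (of_int i / real (Suc n)) (fst x)"
        and g="\<lambda>x. \<lfloor>snd x * real (Suc n)\<rfloor>"])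
    show "(\<lambda>x. f (of_int i / real (Suc n)) (fst x)) \<in> borel_measurable (M \<Otimes>\<^sub>M lborel)" for i
      by (rule measurable_compose[OF measurable_fst m])
    have "(\<lambda>x. snd x * real (Suc n)) \<in> borel_measurable (M \<Otimes>\<^sub>M lborel)"
      using measurable_snd[of M lborel] by (intro borel_measurable_times) (auto simp: measurable_lborel1)
    then show "(\<lambda>x. \<lfloor>snd x * real (Suc n)\<rfloor>) \<in> measurable (M \<Otimes>\<^sub>M lborel) (count_space UNIV)"
      by (rule measurable_compose[OF _ measurable_real_floor])
  qed
  then show "(\<lambda>(w, r). f (of_int \<lfloor>r * real (Suc n)\<rfloor> / real (Suc n)) w) \<in> borel_measurable (M \<Otimes>\<^sub>M lborel)"
    by (simp add: case_prod_beta)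
next
  fix x :: "'a \<times> real" assume "x \<in> space (M \<Otimes>\<^sub>M lborel)"
  then obtain w r where x: "x = (w, r)" "w \<in> space M" by (auto simp: space_pair_measure)
  have "(\<lambda>n. of_int \<lfloor>r * real (Suc n)\<rfloor> / real (Suc n)) \<longlonglongrightarrow> r"
  proof -
    have "(\<lambda>n. r - of_int \<lfloor>r * real (Suc n)\<rfloor> / real (Suc n)) \<longlonglongrightarrow> 0"
    proof (rule LIMSEQ_squeeze_zero[OF _ LIMSEQ_inverse_real_of_nat])
      fix n
      have "of_int \<lfloor>r * real (Suc n)\<rfloor> \<le> r * real (Suc n)" "r * real (Suc n) - 1 \<le> of_int \<lfloor>r * real (Suc n)\<rfloor>" by linarith+
      moreover have "r - of_int \<lfloor>r * real (Suc n)\<rfloor> / real (Suc n)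
          = (r * real (Suc n) - of_int \<lfloor>r * real (Suc n)\<rfloor>) / real (Suc n)"
        by (simp add: diff_divide_distrib)
      ultimately show "r - of_int \<lfloor>r * real (Suc n)\<rfloor> / real (Suc n) \<le> inverse (real (Suc n))"
        "0 \<le> r - of_int \<lfloor>r * real (Suc n)\<rfloor> / real (Suc n)"
        by (simp_all only: inverse_eq_divide divide_right_mono of_nat_0_le_iff zero_le_divide_iff diff_ge_0_iff_ge diff_le_eq add.commute) (simp add: divide_right_mono)
    qed
    from tendsto_diff[OF tendsto_const[of r] this] show ?thesis by simp
  qed
  then show "(\<lambda>n. case x of (w, r) \<Rightarrow> f (of_int \<lfloor>r * real (Suc n)\<rfloor> / real (Suc n)) w) \<longlonglongrightarrow> (case x of (w, r) \<Rightarrow> f r w)"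
    unfolding x using continuous_on_tendsto_compose[OF c[OF x(2)]] by simp
qed

lemma norm_diff_square_le:
  fixes x y z :: "'a::real_inner"
  shows "(norm (x - y))\<^sup>2 \<le> 2 * (norm (x - z))\<^sup>2 + 2 * (norm (z - y))\<^sup>2"
proof -
  have "(norm (x - y))\<^sup>2 \<le> (norm (x - z) + norm (z - y))\<^sup>2"
    using norm_triangle_ineq[of "x - z" "z - y"] by (intro power_mono) auto
  also have "\<dots> \<le> 2 * (norm (x - z))\<^sup>2 + 2 * (norm (z - y))\<^sup>2"
    using sum_squares_bound[of "norm (x - z)" "norm (z - y)"] by (simp add: power2_sum)
  finally show ?thesis .
qed

section \<open>Energy of integrands and limits of simple integrals\<close>

context wiener_process
begin

text \<open>Bounds and supports may vary from path to path, as they do for a coefficient along a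
  solution that is not yet confined to a ball. The energy is then finite on each path, but need not
  be integrable over \<open>M\<close>, which is enough for convergence in probability.\<close>

definition path_regular :: "(real \<Rightarrow> 'w \<Rightarrow> 'b::euclidean_space) \<Rightarrow> bool" where
  "path_regular H \<longleftrightarrow> (\<lambda>(w, r). H r w) \<in> borel_measurable (M \<Otimes>\<^sub>M lborel) \<and>
     (\<forall>w\<in>space M. \<exists>K t. \<forall>r. norm (H r w) \<le> K * indicator {0<..t} r)"

definition path_energy :: "(real \<Rightarrow> 'w \<Rightarrow> 'b::euclidean_space) \<Rightarrow> 'w \<Rightarrow> real" where
  "path_energy H w = (\<integral>r. (norm (H r w))\<^sup>2 \<partial>lborel)"

lemma path_regular_dominated:
  fixes H :: "real \<Rightarrow> 'w \<Rightarrow> 'b::euclidean_space" and H' :: "real \<Rightarrow> 'w \<Rightarrow> 'c::euclidean_space"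
  assumes H: "path_regular H" and m: "(\<lambda>(w, r). H' r w) \<in> borel_measurable (M \<Otimes>\<^sub>M lborel)"
    and le: "\<And>r w. w \<in> space M \<Longrightarrow> norm (H' r w) \<le> norm (H r w)"
  shows "path_regular H'"
  using H m order_trans[OF le] unfolding path_regular_def by meson

lemma path_regular_diff:
  assumes H: "path_regular H" and G: "path_regular G"
  shows "path_regular (\<lambda>r w. H r w - G r w)"
  unfolding path_regular_def
proof (intro conjI ballI)
  show "(\<lambda>(w, r). H r w - G r w) \<in> borel_measurable (M \<Otimes>\<^sub>M lborel)"
    using H G borel_measurable_diff unfolding path_regular_def case_prod_beta by blast
  fix w assume w: "w \<in> space M"
  obtain K t where K: "\<And>r. norm (H r w) \<le> K * indicator {0<..t} r" using H w unfolding path_regular_def by blast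
  obtain K' t' where K': "\<And>r. norm (G r w) \<le> K' * indicator {0<..t'} r" using G w unfolding path_regular_def by blast
  have "norm (H r w - G r w) \<le> (\<bar>K\<bar> + \<bar>K'\<bar>) * indicator {0<..max t t'} r" for r
  proof -
    have "norm (H r w - G r w) \<le> K * indicator {0<..t} r + K' * indicator {0<..t'} r"
      using norm_triangle_ineq4[of "H r w" "G r w"] K[of r] K'[of r] by linarith
    also have "\<dots> \<le> (\<bar>K\<bar> + \<bar>K'\<bar>) * indicator {0<..max t t'} r" by (auto simp: indicator_def)
    finally show ?thesis .
  qed
  then show "\<exists>K t. \<forall>r. norm (H r w - G r w) \<le> K * indicator {0<..t} r" by blast
qed

lemma path_regular_path_measurable:
  "path_regular H \<Longrightarrow> w \<in> space M \<Longrightarrow> (\<lambda>r. H r w) \<in> borel_measurable lborel"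
  unfolding path_regular_def using measurable_Pair2[of "\<lambda>(w, r). H r w" M lborel borel w] by auto

lemma path_regular_integrable:
  assumes H: "path_regular H" and w: "w \<in> space M"
  shows "integrable lborel (\<lambda>r. (norm (H r w))\<^sup>2)"
proof -
  obtain K t where K: "\<And>r. norm (H r w) \<le> K * indicator {0<..t} r" using H w unfolding path_regular_def by blast
  have m: "(\<lambda>r. H r w) \<in> borel_measurable lborel" by (rule path_regular_path_measurable[OF H w])
  have "integrable lborel (\<lambda>r. K\<^sup>2 * indicator {0<..t} r)"
    by (cases "0 \<le> t") (auto intro!: integrable_mult_right integrable_real_indicator)
  then show ?thesis
  proof (rule Bochner_Integration.integrable_bound)
    show "AE r in lborel. norm ((norm (H r w))\<^sup>2) \<le> norm (K\<^sup>2 * indicator {0<..t} r)"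
    proof (rule AE_I2)
      fix r
      have "(norm (H r w))\<^sup>2 \<le> (K * indicator {0<..t} r)\<^sup>2" using K[of r] by (intro power_mono) auto
      then show "norm ((norm (H r w))\<^sup>2) \<le> norm (K\<^sup>2 * indicator {0<..t} r)"
        by (auto simp: indicator_def power_mult_distrib split: if_splits)
    qed
  qed (use m in measurable)
qed

lemma path_energy_measurable:
  assumes H: "path_regular H" shows "path_energy H \<in> borel_measurable M"
  unfolding path_energy_def[abs_def]
proof (rule lborel.borel_measurable_lebesgue_integral)
  have "(\<lambda>x. (norm ((\<lambda>(w, r). H r w) x))\<^sup>2) \<in> borel_measurable (M \<Otimes>\<^sub>M lborel)"
    using H unfolding path_regular_def by (intro borel_measurable_power borel_measurable_norm) auto
  then show "(\<lambda>(w, r). (norm (H r w))\<^sup>2) \<in> borel_measurable (M \<Otimes>\<^sub>M lborel)" by (simp add: case_prod_beta)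
qed

lemma path_energy_nonneg: "0 \<le> path_energy H w"
  unfolding path_energy_def by (rule Bochner_Integration.integral_nonneg) simp

lemma path_energy_mono:
  assumes "path_regular H" "path_regular G" "w \<in> space M" "\<And>r. norm (H r w) \<le> norm (G r w)"
  shows "path_energy H w \<le> path_energy G w"
  unfolding path_energy_def using assms
  by (intro integral_mono path_regular_integrable power_mono) auto

text \<open>The triangle inequality through the intermediate \<open>E\<close>, in squared form with
  the factor \<open>2\<close>, which avoids square roots.\<close>

lemma path_energy_diff_le:
  assumes "path_regular H" "path_regular G" "path_regular E" "w \<in> space M"
  shows "path_energy (\<lambda>r w. H r w - G r w) w
     \<le> 2 * path_energy (\<lambda>r w. H r w - E r w) w + 2 * path_energy (\<lambda>r w. E r w - G r w) w"
proof -
  have i: "integrable lborel (\<lambda>r. (norm (H r w - G r w))\<^sup>2)" "integrable lborel (\<lambda>r. (norm (H r w - E r w))\<^sup>2)"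
    "integrable lborel (\<lambda>r. (norm (E r w - G r w))\<^sup>2)"
    using assms by (auto intro!: path_regular_integrable path_regular_diff)
  have "path_energy (\<lambda>r w. H r w - G r w) w
     \<le> (\<integral>r. 2 * (norm (H r w - E r w))\<^sup>2 + 2 * (norm (E r w - G r w))\<^sup>2 \<partial>lborel)"
    unfolding path_energy_def using i by (intro integral_mono norm_diff_square_le) auto
  also have "\<dots> = 2 * path_energy (\<lambda>r w. H r w - E r w) w + 2 * path_energy (\<lambda>r w. E r w - G r w) w"
    unfolding path_energy_def using i by simp
  finally show ?thesis .
qed

lemma path_energy_bounded:
  assumes H: "path_regular H" and w: "w \<in> space M" and st: "s \<le> t"
    and K: "\<And>r. norm (H r w) \<le> K * indicator {s<..t} r"
  shows "path_energy H w \<le> K\<^sup>2 * (t - s)"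
proof -
  have "path_energy H w \<le> (\<integral>r. K\<^sup>2 * indicator {s<..t} r \<partial>lborel)"
    unfolding path_energy_def
  proof (rule integral_mono[OF path_regular_integrable[OF H w]])
    show "integrable lborel (\<lambda>r. K\<^sup>2 * indicator {s<..t} r)"
      using st by (auto intro!: integrable_mult_right integrable_real_indicator)
    fix r
    have "(norm (H r w))\<^sup>2 \<le> (K * indicator {s<..t} r)\<^sup>2" using K[of r] by (intro power_mono) auto
    then show "(norm (H r w))\<^sup>2 \<le> K\<^sup>2 * indicator {s<..t} r"
      by (auto simp: indicator_def power_mult_distrib split: if_splits)
  qed
  then show ?thesis using st by simp
qed

lemma simple_process_path_regular:
  assumes "simple_process S" shows "path_regular S"
proof -
  obtain q n where q: "simple_on q n S" using assms by (auto simp: simple_process_def)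
  note D = simple_onD[OF q]
  have "(\<lambda>x. \<Sum>k<n. indicator {q k<..q (Suc k)} (snd x) *\<^sub>R S (q (Suc k)) (fst x)) \<in> borel_measurable (M \<Otimes>\<^sub>M lborel)"
  proof (intro borel_measurable_sum)
    fix k assume k: "k \<in> {..<n}"
    show "(\<lambda>x. indicator {q k<..q (Suc k)} (snd x) *\<^sub>R S (q (Suc k)) (fst x)) \<in> borel_measurable (M \<Otimes>\<^sub>M lborel)"
    proof (cases "q k < q (Suc k)")
      case True
      have "S (q (Suc k)) \<in> borel_measurable M" using measurable_filtration_M[OF D(3)[OF _ True]] k by simp
      then show ?thesis by measurable
    next
      case False
      then show ?thesis by simp
    qed
  qed
  moreover have "(case x of (w, r) \<Rightarrow> S r w) = (\<Sum>k<n. indicator {q k<..q (Suc k)} (snd x) *\<^sub>R S (q (Suc k)) (fst x))"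
    if "x \<in> space (M \<Otimes>\<^sub>M lborel)" for x
    using that simple_on_eq_sum[OF q, of "fst x" "snd x"] by (auto simp: space_pair_measure)
  ultimately have m: "(\<lambda>(w, r). S r w) \<in> borel_measurable (M \<Otimes>\<^sub>M lborel)"
    by (subst measurable_cong) auto
  have "\<exists>K t. \<forall>r. norm (S r w) \<le> K * indicator {0<..t} r" if w: "w \<in> space M" for w
  proof (intro exI allI)
    fix r
    show "norm (S r w) \<le> (\<Sum>k<n. norm (S (q (Suc k)) w)) * indicator {0<..q n} r"
    proof (cases "r \<in> {q 0<..q n}")
      case True
      have "norm (S r w) \<le> (\<Sum>k<n. norm (indicator {q k<..q (Suc k)} r *\<^sub>R S (q (Suc k)) w))"
        unfolding simple_on_eq_sum[OF q w, of r] by (rule norm_sum)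
      also have "\<dots> \<le> (\<Sum>k<n. norm (S (q (Suc k)) w))"
        by (intro sum_mono) (auto simp: indicator_def)
      finally show ?thesis using True D(1) by simp
    next
      case False
      then show ?thesis using D(6)[OF False w] by (simp add: sum_nonneg)
    qed
  qed
  with m show ?thesis unfolding path_regular_def by blast
qed

lemma expectation_path_energy:
  assumes "has_simple_integral S J"
  shows "expectation (\<lambda>w. (norm (J w))\<^sup>2) = expectation (path_energy S)"
  using has_simple_integral_isometry(3)[OF assms] by (simp add: path_energy_def[abs_def])

text \<open>The horizon sits in the integrand as an indicator, so integrals over different intervals
  are integrals of different integrands and can be subtracted. Approximation is measured by the
  energy over the whole line.\<close>

definition ito_limit :: "(real \<Rightarrow> 'w \<Rightarrow> real ^ 'k ^ 'n) \<Rightarrow> ('w \<Rightarrow> real ^ 'n) \<Rightarrow> bool" where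
  "ito_limit H Z \<longleftrightarrow> path_regular H \<and> Z \<in> borel_measurable M \<and>
     (\<exists>S J. (\<forall>j. has_simple_integral (S j) (J j)) \<and>
        tends_in_prob0 (\<lambda>j. path_energy (\<lambda>r w. S j r w - H r w)) \<and>
        tends_in_prob0 (\<lambda>j w. norm (J j w - Z w)))"

lemma has_simple_integral_measurable: "has_simple_integral S J \<Longrightarrow> J \<in> borel_measurable M"
  by (rule has_simple_integral_isometry(1))

lemma tends_in_prob0_energy_mono:
  assumes lim: "tends_in_prob0 (\<lambda>j. path_energy (H j))" and "\<And>j. path_regular (H j)" "\<And>j. path_regular (G j)"
    and "\<And>j r w. w \<in> space M \<Longrightarrow> norm (G j r w) \<le> norm (H j r w)"
  shows "tends_in_prob0 (\<lambda>j. path_energy (G j))"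
  by (rule tends_in_prob0_dominated[OF lim, where C=1])
    (use assms in \<open>auto intro!: path_energy_measurable path_energy_mono AE_I2 simp: path_energy_nonneg\<close>)

text \<open>The difference of the two integrals is the integral of the difference of the integrands,
  whose energy is controlled by the two energy distances to \<open>H\<close>; continuity in
  probability does the rest.\<close>

lemma simple_integrals_same_limit:
  assumes S: "\<And>j. has_simple_integral (S j) (J j)" and S': "\<And>j. has_simple_integral (S' j) (J' j)"
    and H: "path_regular H"
    and l: "tends_in_prob0 (\<lambda>j. path_energy (\<lambda>r w. S j r w - H r w))"
    and l': "tends_in_prob0 (\<lambda>j. path_energy (\<lambda>r w. S' j r w - H r w))"
    and Z: "Z \<in> borel_measurable M" "tends_in_prob0 (\<lambda>j w. norm (J j w - Z w))"
  shows "tends_in_prob0 (\<lambda>j w. norm (J' j w - Z w))"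
proof -
  have r: "path_regular (S j)" "path_regular (S' j)" for j
    using S S' by (auto intro!: simple_process_path_regular has_simple_integral_simple)
  have "tends_in_prob0 (\<lambda>j. path_energy (\<lambda>r w. S j r w - S' j r w))"
  proof (rule tends_in_prob0_add_dominated[OF l l', where C=2])
    show "path_energy (\<lambda>r w. S j r w - S' j r w) \<in> borel_measurable M" for j
      by (intro path_energy_measurable path_regular_diff r)
    show "AE w in M. \<bar>path_energy (\<lambda>r w. S j r w - S' j r w) w\<bar> \<le> 2 * (\<bar>path_energy (\<lambda>r w. S j r w - H r w) w\<bar>
        + \<bar>path_energy (\<lambda>r w. S' j r w - H r w) w\<bar>)" for j
    proof (rule AE_I2)
      fix w assume "w \<in> space M"
      moreover have "path_energy (\<lambda>r w. H r w - S' j r w) w = path_energy (\<lambda>r w. S' j r w - H r w) w"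
        by (simp add: path_energy_def norm_minus_commute)
      ultimately show "\<bar>path_energy (\<lambda>r w. S j r w - S' j r w) w\<bar> \<le> 2 * (\<bar>path_energy (\<lambda>r w. S j r w - H r w) w\<bar>
        + \<bar>path_energy (\<lambda>r w. S' j r w - H r w) w\<bar>)"
        using path_energy_diff_le[OF r(1)[of j] r(2)[of j] H, of w] by (simp add: path_energy_nonneg)
    qed
  qed
  then have A: "tends_in_prob0 (\<lambda>j w. norm (J j w - J' j w))"
    by (intro tends_in_prob0_simple_integral[OF has_simple_integral_diff[OF S S']])
      (simp add: path_energy_def[abs_def])
  show ?thesis
  proof (rule tends_in_prob0_add_dominated[OF A Z(2), where C=1])
    show "(\<lambda>w. norm (J' j w - Z w)) \<in> borel_measurable M" for j
      using has_simple_integral_measurable[OF S'] Z(1) by measurable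
    show "AE w in M. \<bar>norm (J' j w - Z w)\<bar> \<le> 1 * (\<bar>norm (J j w - J' j w)\<bar> + \<bar>norm (J j w - Z w)\<bar>)" for j
    proof (rule AE_I2)
      fix w
      show "\<bar>norm (J' j w - Z w)\<bar> \<le> 1 * (\<bar>norm (J j w - J' j w)\<bar> + \<bar>norm (J j w - Z w)\<bar>)"
        using norm_triangle_ineq[of "J' j w - J j w" "J j w - Z w"] by (simp add: norm_minus_commute)
    qed
  qed
qed

text \<open>Any simple integrands that approximate \<open>H\<close> may be used to compute the
  integral. This permits truncating them, cutting them off in time and multiplying them by the
  indicator of a random interval.\<close>

lemma ito_limit_unique_approx:
  assumes "ito_limit H Z" and S': "\<And>j. has_simple_integral (S' j) (J' j)"
    and l': "tends_in_prob0 (\<lambda>j. path_energy (\<lambda>r w. S' j r w - H r w))"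
  shows "tends_in_prob0 (\<lambda>j w. norm (J' j w - Z w))"
  using assms(1) simple_integrals_same_limit[OF _ S' _ _ l'] unfolding ito_limit_def by blast

lemma ito_limit_diff:
  assumes H: "ito_limit H Z" and G: "ito_limit G V"
  shows "ito_limit (\<lambda>r w. H r w - G r w) (\<lambda>w. Z w - V w)"
proof -
  obtain S J where S: "\<And>j. has_simple_integral (S j) (J j)"
    "tends_in_prob0 (\<lambda>j. path_energy (\<lambda>r w. S j r w - H r w))" "tends_in_prob0 (\<lambda>j w. norm (J j w - Z w))"
    using H unfolding ito_limit_def by blast
  obtain S' J' where S': "\<And>j. has_simple_integral (S' j) (J' j)"
    "tends_in_prob0 (\<lambda>j. path_energy (\<lambda>r w. S' j r w - G r w))" "tends_in_prob0 (\<lambda>j w. norm (J' j w - V w))"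
    using G unfolding ito_limit_def by blast
  have rH: "path_regular H" "path_regular G" and mZ: "Z \<in> borel_measurable M" "V \<in> borel_measurable M"
    using H G by (auto simp: ito_limit_def)
  have r: "path_regular (S j)" "path_regular (S' j)" for j
    using S(1) S'(1) by (auto intro!: simple_process_path_regular has_simple_integral_simple)
  have D: "has_simple_integral (\<lambda>r w. S j r w - S' j r w) (\<lambda>w. J j w - J' j w)" for j
    by (rule has_simple_integral_diff[OF S(1) S'(1)])
  have "tends_in_prob0 (\<lambda>j. path_energy (\<lambda>r w. (S j r w - S' j r w) - (H r w - G r w)))"
  proof (rule tends_in_prob0_add_dominated[OF S(2) S'(2), where C=2])
    show "path_energy (\<lambda>r w. (S j r w - S' j r w) - (H r w - G r w)) \<in> borel_measurable M" for j
      by (intro path_energy_measurable path_regular_diff r rH)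
    show "AE w in M. \<bar>path_energy (\<lambda>r w. (S j r w - S' j r w) - (H r w - G r w)) w\<bar>
      \<le> 2 * (\<bar>path_energy (\<lambda>r w. S j r w - H r w) w\<bar> + \<bar>path_energy (\<lambda>r w. S' j r w - G r w) w\<bar>)" for j
    proof (rule AE_I2)
      fix w assume w: "w \<in> space M"
      \<comment> \<open>The zero process as intermediate point turns the squared triangle inequality
        into one for the difference of two errors.\<close>
      let ?O = "\<lambda>(r :: real) (w :: 'w). 0 :: real ^ 'k ^ 'n"
      have O: "path_regular ?O" by (auto simp: path_regular_def intro!: exI[of _ 0])
      have "path_energy (\<lambda>r w. (S j r w - H r w) - (S' j r w - G r w)) w
        \<le> 2 * path_energy (\<lambda>r w. (S j r w - H r w) - ?O r w) w + 2 * path_energy (\<lambda>r w. ?O r w - (S' j r w - G r w)) w"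
        by (rule path_energy_diff_le) (intro path_regular_diff r rH O w)+
      moreover have "path_energy (\<lambda>r w. ?O r w - (S' j r w - G r w)) w = path_energy (\<lambda>r w. S' j r w - G r w) w"
        by (simp add: path_energy_def norm_minus_commute)
      ultimately show "\<bar>path_energy (\<lambda>r w. (S j r w - S' j r w) - (H r w - G r w)) w\<bar>
        \<le> 2 * (\<bar>path_energy (\<lambda>r w. S j r w - H r w) w\<bar> + \<bar>path_energy (\<lambda>r w. S' j r w - G r w) w\<bar>)"
        by (simp add: path_energy_nonneg algebra_simps)
    qed
  qed
  moreover have "tends_in_prob0 (\<lambda>j w. norm ((J j w - J' j w) - (Z w - V w)))"
  proof (rule tends_in_prob0_add_dominated[OF S(3) S'(3), where C=1])
    show "(\<lambda>w. norm ((J j w - J' j w) - (Z w - V w))) \<in> borel_measurable M" for j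
      using has_simple_integral_measurable[OF S(1)] has_simple_integral_measurable[OF S'(1)] mZ by measurable
    show "AE w in M. \<bar>norm ((J j w - J' j w) - (Z w - V w))\<bar> \<le> 1 * (\<bar>norm (J j w - Z w)\<bar> + \<bar>norm (J' j w - V w)\<bar>)" for j
    proof (rule AE_I2)
      fix w
      have "norm ((J j w - J' j w) - (Z w - V w)) \<le> norm (J j w - Z w) + norm (J' j w - V w)"
        using norm_triangle_ineq4[of "J j w - Z w" "J' j w - V w"] by (simp add: algebra_simps)
      then show "\<bar>norm ((J j w - J' j w) - (Z w - V w))\<bar> \<le> 1 * (\<bar>norm (J j w - Z w)\<bar> + \<bar>norm (J' j w - V w)\<bar>)"
        by simp
    qed
  qed
  ultimately show ?thesis
    unfolding ito_limit_def using rH mZ D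
    by (intro conjI path_regular_diff borel_measurable_diff
      exI[of _ "\<lambda>j r w. S j r w - S' j r w"] exI[of _ "\<lambda>j w. J j w - J' j w"]) auto
qed

lemma simple_process_time_indicator:
  assumes "0 \<le> s"
  shows "simple_process (\<lambda>r (w :: 'w). indicator {s<..t} r :: real)"
proof (cases "s \<le> t")
  case True
  define q where "q i = (if i = 0 then s else t)" for i :: nat
  have "mono q" using True by (auto simp: mono_def q_def)
  then have "simple_on q 1 (\<lambda>r (w :: 'w). indicator {s<..t} r :: real)"
    unfolding simple_on_def using assms by (auto simp: q_def image_constant_conv)
  then show ?thesis by (auto simp: simple_process_def)
next
  case False
  then have "simple_on (\<lambda>_. 0) 1 (\<lambda>r (w :: 'w). indicator {s<..t} r :: real)"
    unfolding simple_on_def by (auto simp: mono_def)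
  then show ?thesis by (auto simp: simple_process_def)
qed

end

text \<open>The form in which Young's inequality delivers errors: the factor \<open>A e\<close> may
  blow up as \<open>e\<close> tends to zero, so \<open>j\<close> goes to infinity first.\<close>

lemma tendsto_zero_of_eps_bound:
  fixes x d :: "nat \<Rightarrow> real"
  assumes le: "\<And>j e. 0 < e \<Longrightarrow> \<bar>x j\<bar> \<le> A e * d j + e * C" and d: "d \<longlonglongrightarrow> 0"
  shows "x \<longlonglongrightarrow> 0"
proof (rule tendstoI)
  fix a :: real assume a: "0 < a"
  define e where "e = a / (2 * (\<bar>C\<bar> + 1))"
  have e: "0 < e" using a by (simp add: e_def)
  have "e * C \<le> e * (\<bar>C\<bar> + 1)" using e by (intro mult_left_mono) auto
  also have "\<dots> = a / 2"
  proof -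
    have "a / (2 * c) * c = a / 2" if "c \<noteq> 0" for c using that by simp
    from this[of "\<bar>C\<bar> + 1"] show ?thesis unfolding e_def by simp
  qed
  finally have eC: "e * C \<le> a / 2" .
  have "(\<lambda>j. A e * d j) \<longlonglongrightarrow> 0" using d by (rule tendsto_mult_right_zero)
  then have "eventually (\<lambda>j. A e * d j < a / 2) sequentially" by (rule order_tendstoD) (use a in simp)
  then show "eventually (\<lambda>j. dist (x j) 0 < a) sequentially"
  proof eventually_elim
    case (elim j)
    then show ?case using le[OF e, of j] eC by simp
  qed
qed

lemma le_eps_plus_square: "0 < e \<Longrightarrow> 0 \<le> x \<Longrightarrow> x \<le> e + x\<^sup>2 / (e :: real)"
proof (cases "x \<le> e")
  case False
  assume "0 < e" "0 \<le> x"
  with False have "x * e \<le> x * x" by (intro mult_left_mono) auto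
  then have "x \<le> x\<^sup>2 / e" using \<open>0 < e\<close> by (simp add: field_simps power2_eq_square)
  then show ?thesis using \<open>0 < e\<close> by simp
qed (simp add: add_increasing2)

section \<open>Bounded integrands: from convergence in probability to mean square\<close>

context wiener_process
begin

text \<open>Projecting the approximations onto the ball of radius \<open>K\<close> and cutting them
  off outside \<open>{s<..t}\<close> does not increase their distance to \<open>H\<close>. With a
  uniform bound the energies converge in mean, and the isometry transfers this to the
  integrals.\<close>

lemma ito_limit_bounded_approx:
  fixes H :: "real \<Rightarrow> 'w \<Rightarrow> real ^ 'k ^ 'n" and Z :: "'w \<Rightarrow> real ^ 'n"
  assumes HZ: "ito_limit H Z" and st: "0 \<le> s" "s \<le> t" and K: "0 \<le> K"
    and H: "\<And>r w. w \<in> space M \<Longrightarrow> norm (H r w) \<le> K * indicator {s<..t} r"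
  obtains S J where "\<And>j. has_simple_integral (S j) (J j)"
    "\<And>j r w. w \<in> space M \<Longrightarrow> norm (S j r w) \<le> K * indicator {s<..t} r"
    "(\<lambda>j. expectation (path_energy (\<lambda>r w. S j r w - H r w))) \<longlonglongrightarrow> 0"
    "integrable M (\<lambda>w. (norm (Z w))\<^sup>2)"
    "(\<lambda>j. expectation (\<lambda>w. (norm (J j w - Z w))\<^sup>2)) \<longlonglongrightarrow> 0"
proof -
  have rH: "path_regular H" and mZ: "Z \<in> borel_measurable M" using HZ by (auto simp: ito_limit_def)
  obtain S0 J0 where S0: "\<And>j. has_simple_integral (S0 j) (J0 j)"
    "tends_in_prob0 (\<lambda>j. path_energy (\<lambda>r w. S0 j r w - H r w))"
    using HZ unfolding ito_limit_def by blast
  \<comment> \<open>The metric projection onto the ball: it fixes the values of \<open>H\<close>,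
    and being nonexpansive and continuous it keeps the approximation and the simple form.\<close>
  define P where "P = closest_point (cball 0 K :: (real ^ 'k ^ 'n) set)"
  have ne: "convex (cball (0 :: real ^ 'k ^ 'n) K)" "closed (cball (0 :: real ^ 'k ^ 'n) K)" "cball (0 :: real ^ 'k ^ 'n) K \<noteq> {}"
    using K by auto
  have P_id: "P x = x" if "norm x \<le> K" for x unfolding P_def by (rule closest_point_self) (use that in simp)
  have P_le: "norm (P x) \<le> K" for x using closest_point_in_set[OF ne(2,3), of x] by (simp add: P_def)
  have P_lip: "norm (P x - P y) \<le> norm (x - y)" for x y
    using closest_point_lipschitz[OF ne, of x y] by (simp add: P_def dist_norm)
  have P_cont: "continuous_on UNIV P" unfolding P_def by (rule continuous_on_closest_point[OF ne])
  define S where "S j r w = indicator {s<..t} r *\<^sub>R P (S0 j r w)" for j r w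
  have sS: "simple_process (S j)" for j
    unfolding S_def[abs_def]
    by (rule simple_process_scaleR[OF simple_process_time_indicator[OF st(1)]
          simple_process_map[OF has_simple_integral_simple[OF S0(1)] P_cont]]) (use K P_id in simp)
  then have "\<forall>j. \<exists>J. has_simple_integral (S j) J" by (meson simple_process_has_integral)
  then obtain J where J: "\<And>j. has_simple_integral (S j) (J j)" by metis
  have S_le: "norm (S j r w) \<le> K * indicator {s<..t} r" for j r w
    using P_le by (auto simp: S_def indicator_def)
  have r0: "path_regular (S0 j)" "path_regular (S j)" for j
    using simple_process_path_regular[OF has_simple_integral_simple[OF S0(1)]] simple_process_path_regular[OF sS] by auto
  have e: "tends_in_prob0 (\<lambda>j. path_energy (\<lambda>r w. S j r w - H r w))"
  proof (rule tends_in_prob0_energy_mono[OF S0(2)])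
    fix j r w assume w: "w \<in> space M"
    show "norm (S j r w - H r w) \<le> norm (S0 j r w - H r w)"
    proof (cases "r \<in> {s<..t}")
      case True
      then have "P (H r w) = H r w" using H[OF w, of r] by (intro P_id) simp
      then show ?thesis using P_lip[of "S0 j r w" "H r w"] True by (simp add: S_def)
    next
      case False
      then show ?thesis using H[OF w, of r] by (simp add: S_def)
    qed
  qed (intro path_regular_diff r0 rH)+
  define a where "a j = expectation (path_energy (\<lambda>r w. S j r w - H r w))" for j
  have rSH: "path_regular (\<lambda>r w. S j r w - H r w)" for j by (intro path_regular_diff r0 rH)
  have e_le: "path_energy (\<lambda>r w. S j r w - H r w) w \<le> (2 * K)\<^sup>2 * (t - s)" if w: "w \<in> space M" for j w
  proof (rule path_energy_bounded[OF rSH w st(2)])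
    fix r
    show "norm (S j r w - H r w) \<le> 2 * K * indicator {s<..t} r"
      using norm_triangle_ineq4[of "S j r w" "H r w"] S_le[of j r w] H[OF w, of r] by simp
  qed
  have e_int: "integrable M (path_energy (\<lambda>r w. S j r w - H r w))" for j
    using e_le path_energy_nonneg path_energy_measurable[OF rSH]
    by (intro integrable_const_bound[of _ "(2 * K)\<^sup>2 * (t - s)"] AE_I2)
      (simp_all only: real_norm_def abs_of_nonneg[OF path_energy_nonneg])
  have a0: "a \<longlonglongrightarrow> 0"
    using tends_in_prob0_bounded[OF e, of "(2 * K)\<^sup>2 * (t - s)"] e_le
    by (simp add: a_def[abs_def] path_energy_nonneg abs_of_nonneg)
  have a_nonneg: "0 \<le> a j" for j unfolding a_def by (intro Bochner_Integration.integral_nonneg path_energy_nonneg)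
  have JZ: "tends_in_prob0 (\<lambda>j w. norm (J j w - Z w))"
    by (rule ito_limit_unique_approx[OF HZ J e])
  have mJ: "J j \<in> borel_measurable M" for j by (rule has_simple_integral_measurable[OF J])
  have iJJ: "integrable M (\<lambda>w. (norm (J j w - J l w))\<^sup>2)"
    "expectation (\<lambda>w. (norm (J j w - J l w))\<^sup>2) \<le> 2 * a j + 2 * a l" for j l
  proof -
    note D = has_simple_integral_diff[OF J J, of j l]
    show "integrable M (\<lambda>w. (norm (J j w - J l w))\<^sup>2)" by (rule has_simple_integral_isometry(2)[OF D])
    have rD: "path_regular (\<lambda>r w. S j r w - S l r w)" by (intro path_regular_diff r0)
    have le: "path_energy (\<lambda>r w. S j r w - S l r w) w
       \<le> 2 * path_energy (\<lambda>r w. S j r w - H r w) w + 2 * path_energy (\<lambda>r w. S l r w - H r w) w"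
      if "w \<in> space M" for w
    proof -
      have "path_energy (\<lambda>r w. H r w - S l r w) w = path_energy (\<lambda>r w. S l r w - H r w) w"
        by (simp add: path_energy_def norm_minus_commute)
      then show ?thesis using path_energy_diff_le[OF r0(2) r0(2) rH that, of j l] by simp
    qed
    have "expectation (\<lambda>w. (norm (J j w - J l w))\<^sup>2) = expectation (path_energy (\<lambda>r w. S j r w - S l r w))"
      by (rule expectation_path_energy[OF D])
    also have "\<dots> \<le> expectation (\<lambda>w. 2 * path_energy (\<lambda>r w. S j r w - H r w) w + 2 * path_energy (\<lambda>r w. S l r w - H r w) w)"
      using le e_int by (intro integral_mono_AE') (auto intro!: AE_I2 add_nonneg_nonneg simp: path_energy_nonneg)
    also have "\<dots> = 2 * a j + 2 * a l" using e_int by (simp add: a_def)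
    finally show "expectation (\<lambda>w. (norm (J j w - J l w))\<^sup>2) \<le> 2 * a j + 2 * a l" .
  qed
  obtain \<rho> where \<rho>: "strict_mono \<rho>" "AE w in M. (\<lambda>l. norm (J (\<rho> l) w - Z w)) \<longlonglongrightarrow> 0"
    by (rule tends_in_prob0_AE_subseq[OF JZ])
  \<comment> \<open>The isometry bounds the distance of \<open>J j\<close> to every other
    \<open>J l\<close>. Along an almost surely convergent subsequence Fatou's lemma carries the
    bound over to \<open>Z\<close>, which gives integrability and the mean square rate at
    once.\<close>
  have fatou: "(\<integral>\<^sup>+ w. ennreal ((norm (J j w - Z w))\<^sup>2) \<partial>M) \<le> ennreal (2 * a j)" for j
  proof -
    have "AE w in M. ennreal ((norm (J j w - Z w))\<^sup>2) = liminf (\<lambda>l. ennreal ((norm (J j w - J (\<rho> l) w))\<^sup>2))"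
      using \<rho>(2)
    proof eventually_elim
      case (elim w)
      then have "(\<lambda>l. J (\<rho> l) w) \<longlonglongrightarrow> Z w" by (simp add: tendsto_norm_zero_iff LIM_zero_iff)
      then have "(\<lambda>l. ennreal ((norm (J j w - J (\<rho> l) w))\<^sup>2)) \<longlonglongrightarrow> ennreal ((norm (J j w - Z w))\<^sup>2)"
        by (intro tendsto_intros)
      then show ?case using lim_imp_Liminf[OF sequentially_bot] by metis
    qed
    then have "(\<integral>\<^sup>+ w. ennreal ((norm (J j w - Z w))\<^sup>2) \<partial>M)
       = (\<integral>\<^sup>+ w. liminf (\<lambda>l. ennreal ((norm (J j w - J (\<rho> l) w))\<^sup>2)) \<partial>M)" by (rule nn_integral_cong_AE)
    also have "\<dots> \<le> liminf (\<lambda>l. \<integral>\<^sup>+ w. ennreal ((norm (J j w - J (\<rho> l) w))\<^sup>2) \<partial>M)"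
      by (rule nn_integral_liminf) (use mJ in measurable)
    also have "\<dots> \<le> liminf (\<lambda>l. ennreal (2 * a j + 2 * a (\<rho> l)))"
    proof (intro Liminf_mono always_eventually allI)
      fix l
      have "(\<integral>\<^sup>+ w. ennreal ((norm (J j w - J (\<rho> l) w))\<^sup>2) \<partial>M) = ennreal (expectation (\<lambda>w. (norm (J j w - J (\<rho> l) w))\<^sup>2))"
        by (rule nn_integral_eq_integral[OF iJJ(1)]) simp
      then show "(\<integral>\<^sup>+ w. ennreal ((norm (J j w - J (\<rho> l) w))\<^sup>2) \<partial>M) \<le> ennreal (2 * a j + 2 * a (\<rho> l))"
        using iJJ(2)[of j "\<rho> l"] by (simp add: ennreal_leI)
    qed
    also have "\<dots> = ennreal (2 * a j)"
    proof (rule lim_imp_Liminf[OF sequentially_bot])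
      have "(\<lambda>l. a (\<rho> l)) \<longlonglongrightarrow> 0" using LIMSEQ_subseq_LIMSEQ[OF a0 \<rho>(1)] by (simp add: comp_def)
      then have "(\<lambda>l. 2 * a j + 2 * a (\<rho> l)) \<longlonglongrightarrow> 2 * a j + 2 * 0" by (intro tendsto_intros)
      then show "(\<lambda>l. ennreal (2 * a j + 2 * a (\<rho> l))) \<longlonglongrightarrow> ennreal (2 * a j)" by (intro tendsto_ennrealI) simp
    qed
    finally show ?thesis .
  qed
  have iJZ: "integrable M (\<lambda>w. (norm (J j w - Z w))\<^sup>2)" for j
  proof (rule integrableI_bounded)
    show "(\<lambda>w. (norm (J j w - Z w))\<^sup>2) \<in> borel_measurable M" using mJ mZ by measurable
    show "(\<integral>\<^sup>+ w. ennreal (norm ((norm (J j w - Z w))\<^sup>2)) \<partial>M) < \<infinity>"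
      using fatou[of j] by (simp add: less_le_trans order_le_less_trans[OF fatou])
  qed
  have EJZ: "expectation (\<lambda>w. (norm (J j w - Z w))\<^sup>2) \<le> 2 * a j" for j
  proof -
    have "ennreal (expectation (\<lambda>w. (norm (J j w - Z w))\<^sup>2)) \<le> ennreal (2 * a j)"
      using fatou[of j] nn_integral_eq_integral[OF iJZ, of j] by simp
    then show ?thesis using a_nonneg[of j] by (simp add: ennreal_le_iff)
  qed
  show ?thesis
  proof (rule that[OF J S_le])
    show "(\<lambda>j. expectation (path_energy (\<lambda>r w. S j r w - H r w))) \<longlonglongrightarrow> 0" using a0 by (simp add: a_def[abs_def])
    have iJ: "integrable M (\<lambda>w. (norm (J 0 w))\<^sup>2)" by (rule has_simple_integral_isometry(2)[OF J])
    show "integrable M (\<lambda>w. (norm (Z w))\<^sup>2)"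
    proof (rule Bochner_Integration.integrable_bound)
      show "integrable M (\<lambda>w. 2 * (norm (J 0 w - Z w))\<^sup>2 + 2 * (norm (J 0 w))\<^sup>2)" using iJZ[of 0] iJ by simp
      show "AE w in M. norm ((norm (Z w))\<^sup>2) \<le> norm (2 * (norm (J 0 w - Z w))\<^sup>2 + 2 * (norm (J 0 w))\<^sup>2)"
      proof (rule AE_I2)
        fix w
        show "norm ((norm (Z w))\<^sup>2) \<le> norm (2 * (norm (J 0 w - Z w))\<^sup>2 + 2 * (norm (J 0 w))\<^sup>2)"
          using norm_diff_square_le[of "Z w" 0 "J 0 w"] by (simp add: norm_minus_commute)
      qed
    qed (use mZ in measurable)
    have "(\<lambda>j. 2 * a j) \<longlonglongrightarrow> 0" using a0 by (rule tendsto_mult_right_zero)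
    from LIMSEQ_squeeze_zero[OF EJZ this]
    show "(\<lambda>j. expectation (\<lambda>w. (norm (J j w - Z w))\<^sup>2)) \<longlonglongrightarrow> 0" by simp
  qed
qed

text \<open>The identities hold for the bounded simple approximations by the conditional isometry,
  and both sides are continuous in mean square. Each error is a multiple of a mean square distance
  plus an arbitrarily small constant, as in \<open>tendsto_zero_of_eps_bound\<close>.\<close>

lemma ito_limit_moments:
  fixes H :: "real \<Rightarrow> 'w \<Rightarrow> real ^ 'k ^ 'n" and Z :: "'w \<Rightarrow> real ^ 'n"
  assumes HZ: "ito_limit H Z" and st: "0 \<le> s" "s \<le> t" and K: "0 \<le> K"
    and H: "\<And>r w. w \<in> space M \<Longrightarrow> norm (H r w) \<le> K * indicator {s<..t} r"
    and \<psi>: "\<psi> \<in> borel_measurable (\<F> s)" "\<And>w. w \<in> space M \<Longrightarrow> \<bar>\<psi> w\<bar> \<le> L"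
  shows "expectation (\<lambda>w. \<psi> w * Z w $ a) = 0"
    "expectation (\<lambda>w. \<psi> w * (Z w $ a * Z w $ c))
       = expectation (\<lambda>w. \<psi> w * (\<integral>r. H r w $ a \<bullet> H r w $ c \<partial>lborel))"
proof -
  obtain S :: "nat \<Rightarrow> real \<Rightarrow> 'w \<Rightarrow> real ^ 'k ^ 'n" and J where J: "\<And>j. has_simple_integral (S j) (J j)"
    and S: "\<And>j r w. w \<in> space M \<Longrightarrow> norm (S j r w) \<le> K * indicator {s<..t} r"
    and eS: "(\<lambda>j. expectation (path_energy (\<lambda>r w. S j r w - H r w))) \<longlonglongrightarrow> 0"
    and Z2: "integrable M (\<lambda>w. (norm (Z w))\<^sup>2)"
    and d0: "(\<lambda>j. expectation (\<lambda>w. (norm (J j w - Z w))\<^sup>2)) \<longlonglongrightarrow> 0"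
    using ito_limit_bounded_approx[OF HZ st K H] by blast
  have rH: "path_regular H" and mZ: "Z \<in> borel_measurable M" using HZ by (auto simp: ito_limit_def)
  have L: "0 \<le> L" using \<psi>(2) not_empty abs_ge_zero order_trans by blast
  have \<psi>M: "\<psi> \<in> borel_measurable M" by (rule measurable_filtration_M[OF \<psi>(1)])
  note ib = integrable_mult_bounded[OF _ \<psi>M \<psi>(2)]
  have rS: "path_regular (S j)" for j
    using J by (auto intro!: simple_process_path_regular has_simple_integral_simple)
  have mJ: "J j \<in> borel_measurable M" for j by (rule has_simple_integral_measurable[OF J])
  \<comment> \<open>The bound by a multiple of the indicator of \<open>{s<..t}\<close> makes the
    approximations vanish up to \<open>s\<close>, which the conditional isometry demands.\<close>
  have zero: "S j r w = 0" if "r \<le> s" "w \<in> space M" for j r w using S[OF that(2), of j r] that by simp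
  note C = has_simple_integral_covariance[OF J st(1) zero \<psi>]
  have J2: "integrable M (\<lambda>w. (norm (J j w))\<^sup>2)" for j by (rule has_simple_integral_isometry(2)[OF J])
  have comp: "\<bar>x $ a\<bar> \<le> norm x" for x :: "real ^ 'n" and a by (rule component_le_norm_cart)
  have mcomp: "(\<lambda>w. V w $ a) \<in> borel_measurable M" if "V \<in> borel_measurable M" for V :: "'w \<Rightarrow> real ^ 'n" and a
    by (rule measurable_compose[OF that]) (intro borel_measurable_continuous_onI continuous_intros)
  have V2: "integrable M (\<lambda>w. (V w $ a)\<^sup>2)" if "V \<in> borel_measurable M" "integrable M (\<lambda>w. (norm (V w))\<^sup>2)"
    for V :: "'w \<Rightarrow> real ^ 'n" and a
  proof (rule Bochner_Integration.integrable_bound[OF that(2)])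
    show "AE w in M. norm ((V w $ a)\<^sup>2) \<le> norm ((norm (V w))\<^sup>2)"
    proof (rule AE_I2)
      fix w have "\<bar>V w $ a\<bar>\<^sup>2 \<le> (norm (V w))\<^sup>2" using comp by (intro power_mono) auto
      then show "norm ((V w $ a)\<^sup>2) \<le> norm ((norm (V w))\<^sup>2)" by simp
    qed
  qed (use mcomp[OF that(1)] in measurable)
  have prod: "integrable M (\<lambda>w. \<psi> w * (V w $ a * V w $ c))" "integrable M (\<lambda>w. \<psi> w * V w $ a)"
    if "V \<in> borel_measurable M" "integrable M (\<lambda>w. (norm (V w))\<^sup>2)" for V :: "'w \<Rightarrow> real ^ 'n" and a c
  proof -
    show "integrable M (\<lambda>w. \<psi> w * (V w $ a * V w $ c))"
      by (rule ib[OF integrable_mult_of_squares[OF mcomp[OF that(1)] mcomp[OF that(1)] V2[OF that] V2[OF that]]])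
    show "integrable M (\<lambda>w. \<psi> w * V w $ a)"
      by (rule ib[OF integrable_of_square[OF mcomp[OF that(1)] V2[OF that]]])
  qed
  have D2: "integrable M (\<lambda>w. (norm (J j w - Z w))\<^sup>2)" for j
  proof (rule Bochner_Integration.integrable_bound)
    show "integrable M (\<lambda>w. 2 * (norm (J j w))\<^sup>2 + 2 * (norm (Z w))\<^sup>2)" using J2 Z2 by simp
    show "AE w in M. norm ((norm (J j w - Z w))\<^sup>2) \<le> norm (2 * (norm (J j w))\<^sup>2 + 2 * (norm (Z w))\<^sup>2)"
      using norm_diff_square_le[of "J j _" "Z _" 0] by (intro AE_I2) simp
  qed (use mJ mZ in measurable)
  define d where "d j = expectation (\<lambda>w. (norm (J j w - Z w))\<^sup>2)" for j
  have "(\<lambda>j. expectation (\<lambda>w. \<psi> w * Z w $ a)) \<longlonglongrightarrow> 0"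
  proof (rule tendsto_zero_of_eps_bound[where A="\<lambda>e. L / e" and C=L and d=d])
    show "d \<longlonglongrightarrow> 0" using d0 by (simp add: d_def[abs_def])
    fix j and e :: real assume e: "0 < e"
    have "expectation (\<lambda>w. \<psi> w * Z w $ a) = expectation (\<lambda>w. \<psi> w * Z w $ a - \<psi> w * J j w $ a)"
      using C(3)[of j a] prod(2)[OF mZ Z2] prod(2)[OF mJ J2] by simp
    also have "\<bar>\<dots>\<bar> \<le> expectation (\<lambda>w. \<bar>\<psi> w * Z w $ a - \<psi> w * J j w $ a\<bar>)" by (rule integral_abs_bound)
    also have "\<dots> \<le> expectation (\<lambda>w. L / e * (norm (J j w - Z w))\<^sup>2 + e * L)"
    proof (rule integral_mono)
      show "integrable M (\<lambda>w. L / e * (norm (J j w - Z w))\<^sup>2 + e * L)" using D2 by simp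
      show "integrable M (\<lambda>w. \<bar>\<psi> w * Z w $ a - \<psi> w * J j w $ a\<bar>)"
        using prod(2)[OF mZ Z2] prod(2)[OF mJ J2] by simp
      fix w assume w: "w \<in> space M"
      have "\<bar>\<psi> w * Z w $ a - \<psi> w * J j w $ a\<bar> = \<bar>\<psi> w\<bar> * \<bar>(J j w - Z w) $ a\<bar>"
        by (simp add: abs_mult[symmetric] algebra_simps abs_minus_commute)
      also have "\<dots> \<le> L * norm (J j w - Z w)" by (rule mult_mono[OF \<psi>(2)[OF w] comp L abs_ge_zero])
      also have "\<dots> \<le> L * (e + (norm (J j w - Z w))\<^sup>2 / e)" using L le_eps_plus_square[OF e] by (intro mult_left_mono) auto
      also have "\<dots> = L / e * (norm (J j w - Z w))\<^sup>2 + e * L" by (simp add: algebra_simps)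
      finally show "\<bar>\<psi> w * Z w $ a - \<psi> w * J j w $ a\<bar> \<le> L / e * (norm (J j w - Z w))\<^sup>2 + e * L" .
    qed
    also have "\<dots> = L / e * d j + e * L" using D2 by (simp add: d_def prob_space)
    finally show "\<bar>expectation (\<lambda>w. \<psi> w * Z w $ a)\<bar> \<le> L / e * d j + e * L" .
  qed
  then show "expectation (\<lambda>w. \<psi> w * Z w $ a) = 0" by (simp add: LIMSEQ_const_iff)
  have x0: "(\<lambda>j. expectation (\<lambda>w. \<psi> w * (J j w $ a * J j w $ c)) - expectation (\<lambda>w. \<psi> w * (Z w $ a * Z w $ c))) \<longlonglongrightarrow> 0"
  proof (rule tendsto_zero_of_eps_bound[where A="\<lambda>e. L * (1 / e + 1)" and C="L * expectation (\<lambda>w. (norm (Z w))\<^sup>2)" and d=d])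
    show "d \<longlonglongrightarrow> 0" using d0 by (simp add: d_def[abs_def])
    fix j and e :: real assume e: "0 < e"
    note i = prod(1)[OF mJ[of j] J2, of a c] prod(1)[OF mZ Z2, of a c]
    have "expectation (\<lambda>w. \<psi> w * (J j w $ a * J j w $ c)) - expectation (\<lambda>w. \<psi> w * (Z w $ a * Z w $ c))
      = expectation (\<lambda>w. \<psi> w * (J j w $ a * J j w $ c) - \<psi> w * (Z w $ a * Z w $ c))"
      using i by simp
    also have "\<bar>\<dots>\<bar> \<le> expectation (\<lambda>w. \<bar>\<psi> w * (J j w $ a * J j w $ c) - \<psi> w * (Z w $ a * Z w $ c)\<bar>)"
      by (rule integral_abs_bound)
    also have "\<dots> \<le> expectation (\<lambda>w. L * (1 / e + 1) * (norm (J j w - Z w))\<^sup>2 + e * (L * (norm (Z w))\<^sup>2))"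
    proof (rule integral_mono)
      show "integrable M (\<lambda>w. L * (1 / e + 1) * (norm (J j w - Z w))\<^sup>2 + e * (L * (norm (Z w))\<^sup>2))" using D2 Z2 by simp
      show "integrable M (\<lambda>w. \<bar>\<psi> w * (J j w $ a * J j w $ c) - \<psi> w * (Z w $ a * Z w $ c)\<bar>)" using i by simp
      fix w assume w: "w \<in> space M"
      define z y where "z = norm (Z w)" and "y = norm (J j w - Z w)"
      \<comment> \<open>The product is expanded around \<open>Z\<close>, so that besides the mean
        square distance only the fixed second moment of \<open>Z\<close> enters.\<close>
      have "\<bar>J j w $ a * J j w $ c - Z w $ a * Z w $ c\<bar>
         = \<bar>(J j w - Z w) $ a * (J j w - Z w) $ c + (J j w - Z w) $ a * Z w $ c + Z w $ a * (J j w - Z w) $ c\<bar>"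
        by (simp add: algebra_simps)
      also have "\<dots> \<le> y * y + y * z + z * y"
      proof -
        have m: "\<bar>p $ a * q $ c\<bar> \<le> norm p * norm q" for p q :: "real ^ 'n"
          unfolding abs_mult by (intro mult_mono comp) auto
        show ?thesis using m[of "J j w - Z w" "J j w - Z w"] m[of "J j w - Z w" "Z w"] m[of "Z w" "J j w - Z w"]
          unfolding z_def y_def by linarith
      qed
      also have "\<dots> \<le> (1 / e + 1) * y\<^sup>2 + e * z\<^sup>2"
      proof -
        have "2 * (y * (e * z)) \<le> y\<^sup>2 + (e * z)\<^sup>2" using sum_squares_bound[of y "e * z"] by (simp add: mult.assoc)
        then have "2 * (y * z) \<le> y\<^sup>2 / e + e * z\<^sup>2" using e by (simp add: field_simps power2_eq_square)
        then show ?thesis by (simp add: algebra_simps power2_eq_square)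
      qed
      finally have "\<bar>J j w $ a * J j w $ c - Z w $ a * Z w $ c\<bar> \<le> (1 / e + 1) * y\<^sup>2 + e * z\<^sup>2" .
      then have "\<bar>\<psi> w\<bar> * \<bar>J j w $ a * J j w $ c - Z w $ a * Z w $ c\<bar> \<le> L * ((1 / e + 1) * y\<^sup>2 + e * z\<^sup>2)"
        using \<psi>(2)[OF w] L by (intro mult_mono) auto
      then show "\<bar>\<psi> w * (J j w $ a * J j w $ c) - \<psi> w * (Z w $ a * Z w $ c)\<bar>
        \<le> L * (1 / e + 1) * (norm (J j w - Z w))\<^sup>2 + e * (L * (norm (Z w))\<^sup>2)"
        unfolding z_def y_def abs_mult[symmetric] by (simp add: algebra_simps)
    qed
    also have "\<dots> = L * (1 / e + 1) * d j + e * (L * expectation (\<lambda>w. (norm (Z w))\<^sup>2))"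
      using D2 Z2 by (simp add: d_def)
    finally show "\<bar>expectation (\<lambda>w. \<psi> w * (J j w $ a * J j w $ c)) - expectation (\<lambda>w. \<psi> w * (Z w $ a * Z w $ c))\<bar>
      \<le> L * (1 / e + 1) * d j + e * (L * expectation (\<lambda>w. (norm (Z w))\<^sup>2))" .
  qed
  have rows: "\<bar>A $ a \<bullet> A' $ c\<bar> \<le> norm A * norm A'" for A A' :: "real ^ 'k ^ 'n"
    by (rule order_trans[OF Cauchy_Schwarz_ineq2])
      (intro mult_mono Finite_Cartesian_Product.norm_nth_le norm_ge_zero)
  have mrow: "(\<lambda>(w, r). G r w $ a \<bullet> G r w $ c) \<in> borel_measurable (M \<Otimes>\<^sub>M lborel)" if "path_regular G"
    for G :: "real \<Rightarrow> 'w \<Rightarrow> real ^ 'k ^ 'n"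
  proof -
    have "(\<lambda>A :: real ^ 'k ^ 'n. A $ a \<bullet> A $ c) \<in> borel_measurable borel"
      by (intro borel_measurable_continuous_onI continuous_intros)
    moreover have "(\<lambda>(w, r). G r w) \<in> borel_measurable (M \<Otimes>\<^sub>M lborel)"
      using that unfolding path_regular_def by simp
    ultimately have "(\<lambda>x. (\<lambda>A :: real ^ 'k ^ 'n. A $ a \<bullet> A $ c) ((\<lambda>(w, r). G r w) x)) \<in> borel_measurable (M \<Otimes>\<^sub>M lborel)"
      by (rule measurable_compose[rotated])
    then show ?thesis by (simp add: case_prod_beta)
  qed
  have irow: "integrable lborel (\<lambda>r. G r w $ a \<bullet> G r w $ c)" if G: "path_regular G" and w: "w \<in> space M"
    for G :: "real \<Rightarrow> 'w \<Rightarrow> real ^ 'k ^ 'n" and w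
  proof (rule Bochner_Integration.integrable_bound[OF path_regular_integrable[OF G w]])
    show "(\<lambda>r. G r w $ a \<bullet> G r w $ c) \<in> borel_measurable lborel" using measurable_Pair2[OF mrow[OF G] w] by simp
    show "AE r in lborel. norm (G r w $ a \<bullet> G r w $ c) \<le> norm ((norm (G r w))\<^sup>2)"
      using rows by (intro AE_I2) (simp add: power2_eq_square)
  qed
  have mI: "(\<lambda>w. \<integral>r. G r w $ a \<bullet> G r w $ c \<partial>lborel) \<in> borel_measurable M" if "path_regular G"
    for G :: "real \<Rightarrow> 'w \<Rightarrow> real ^ 'k ^ 'n"
    by (rule lborel.borel_measurable_lebesgue_integral[OF mrow[OF that]])
  have Ibound: "\<bar>\<integral>r. G r w $ a \<bullet> G r w $ c \<partial>lborel\<bar> \<le> K\<^sup>2 * (t - s)"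
    if G: "path_regular G" and w: "w \<in> space M" and "\<And>r. norm (G r w) \<le> K * indicator {s<..t} r"
    for G :: "real \<Rightarrow> 'w \<Rightarrow> real ^ 'k ^ 'n" and w
  proof -
    have "\<bar>\<integral>r. G r w $ a \<bullet> G r w $ c \<partial>lborel\<bar> \<le> (\<integral>r. \<bar>G r w $ a \<bullet> G r w $ c\<bar> \<partial>lborel)" by (rule integral_abs_bound)
    also have "\<dots> \<le> path_energy G w"
      unfolding path_energy_def using irow[OF G w] path_regular_integrable[OF G w] rows
      by (intro integral_mono) (auto simp: power2_eq_square)
    also have "\<dots> \<le> K\<^sup>2 * (t - s)" by (rule path_energy_bounded[OF G w st(2) that(3)])
    finally show ?thesis .
  qed
  have iI: "integrable M (\<lambda>w. \<psi> w * (\<integral>r. G r w $ a \<bullet> G r w $ c \<partial>lborel))"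
    if G: "path_regular G" and le: "\<And>r w. w \<in> space M \<Longrightarrow> norm (G r w) \<le> K * indicator {s<..t} r"
    for G :: "real \<Rightarrow> 'w \<Rightarrow> real ^ 'k ^ 'n"
    using mI[OF G] Ibound[OF G _ le] by (intro ib integrable_const_bound[of _ "K\<^sup>2 * (t - s)"] AE_I2) auto
  have rSH: "path_regular (\<lambda>r w. S j r w - H r w)" for j by (intro path_regular_diff rS rH)
  have iE: "integrable M (path_energy (\<lambda>r w. S j r w - H r w))" for j
  proof (rule integrable_const_bound[of _ "(2 * K)\<^sup>2 * (t - s)"])
    show "AE w in M. norm (path_energy (\<lambda>r w. S j r w - H r w) w) \<le> (2 * K)\<^sup>2 * (t - s)"
    proof (rule AE_I2)
      fix w assume w: "w \<in> space M"
      have "norm (S j r w - H r w) \<le> 2 * K * indicator {s<..t} r" for r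
        using norm_triangle_ineq4[of "S j r w" "H r w"] S[OF w, of j r] H[OF w, of r] by simp
      from path_energy_bounded[OF rSH w st(2) this]
      show "norm (path_energy (\<lambda>r w. S j r w - H r w) w) \<le> (2 * K)\<^sup>2 * (t - s)" by (simp add: path_energy_nonneg)
    qed
  qed (rule path_energy_measurable[OF rSH])
  have y0: "(\<lambda>j. expectation (\<lambda>w. \<psi> w * (\<integral>r. S j r w $ a \<bullet> S j r w $ c \<partial>lborel))
      - expectation (\<lambda>w. \<psi> w * (\<integral>r. H r w $ a \<bullet> H r w $ c \<partial>lborel))) \<longlonglongrightarrow> 0"
  proof (rule tendsto_zero_of_eps_bound[where A="\<lambda>e. L * (2 * K / e)" and C="L * (2 * K * (t - s))", OF _ eS])
    fix j and e :: real assume e: "0 < e"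
    let ?I = "\<lambda>G w. \<integral>r. G r w $ a \<bullet> G r w $ c \<partial>lborel"
    note i = iI[OF rS S, of j] iI[OF rH H]
    have le: "\<bar>?I (S j) w - ?I H w\<bar> \<le> 2 * K / e * path_energy (\<lambda>r w. S j r w - H r w) w + e * (2 * K * (t - s))"
      if w: "w \<in> space M" for w
    proof -
      have "?I (S j) w - ?I H w = (\<integral>r. S j r w $ a \<bullet> S j r w $ c - H r w $ a \<bullet> H r w $ c \<partial>lborel)"
        using irow[OF rS w] irow[OF rH w] by simp
      also have "\<bar>\<dots>\<bar> \<le> (\<integral>r. \<bar>S j r w $ a \<bullet> S j r w $ c - H r w $ a \<bullet> H r w $ c\<bar> \<partial>lborel)" by (rule integral_abs_bound)
      also have "\<dots> \<le> (\<integral>r. 2 * K / e * (norm (S j r w - H r w))\<^sup>2 + e * (2 * K * indicator {s<..t} r) \<partial>lborel)"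
      proof (rule integral_mono)
        show "integrable lborel (\<lambda>r. \<bar>S j r w $ a \<bullet> S j r w $ c - H r w $ a \<bullet> H r w $ c\<bar>)"
          using irow[OF rS w] irow[OF rH w] by simp
        show "integrable lborel (\<lambda>r. 2 * K / e * (norm (S j r w - H r w))\<^sup>2 + e * (2 * K * indicator {s<..t} r))"
          using path_regular_integrable[OF rSH w] st
          by (intro Bochner_Integration.integrable_add integrable_mult_right integrable_real_indicator) auto
        fix r
        let ?D = "S j r w - H r w"
        \<comment> \<open>Each summand contains the difference \<open>?D\<close> once, against a row
          bounded by \<open>K\<close>; hence the error is linear in \<open>?D\<close> and can be
          split by Young's inequality.\<close>
        have "S j r w $ a \<bullet> S j r w $ c - H r w $ a \<bullet> H r w $ c = ?D $ a \<bullet> S j r w $ c + H r w $ a \<bullet> ?D $ c"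
          by (simp add: inner_diff_left inner_diff_right)
        then have "\<bar>S j r w $ a \<bullet> S j r w $ c - H r w $ a \<bullet> H r w $ c\<bar> \<le> norm ?D * norm (S j r w) + norm (H r w) * norm ?D"
          using rows[of ?D "S j r w"] rows[of "H r w" ?D] by linarith
        also have "\<dots> \<le> norm ?D * (K * indicator {s<..t} r) + (K * indicator {s<..t} r) * norm ?D"
          using S[OF w, of j r] H[OF w, of r] by (intro add_mono mult_left_mono mult_right_mono) auto
        also have "\<dots> = 2 * K * indicator {s<..t} r * norm ?D" by simp
        also have "\<dots> \<le> 2 * K * indicator {s<..t} r * (e + (norm ?D)\<^sup>2 / e)"
          using K le_eps_plus_square[OF e] by (intro mult_left_mono) auto
        also have "\<dots> \<le> 2 * K / e * (norm ?D)\<^sup>2 + e * (2 * K * indicator {s<..t} r)"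
          using K e by (auto simp: indicator_def algebra_simps)
        finally show "\<bar>S j r w $ a \<bullet> S j r w $ c - H r w $ a \<bullet> H r w $ c\<bar>
          \<le> 2 * K / e * (norm ?D)\<^sup>2 + e * (2 * K * indicator {s<..t} r)" .
      qed
      also have "\<dots> = 2 * K / e * path_energy (\<lambda>r w. S j r w - H r w) w + e * (2 * K * (t - s))"
        using path_regular_integrable[OF rSH w] st
        by (subst Bochner_Integration.integral_add) (auto simp: path_energy_def intro!: integrable_mult_right integrable_real_indicator)
      finally show ?thesis .
    qed
    have "expectation (\<lambda>w. \<psi> w * ?I (S j) w) - expectation (\<lambda>w. \<psi> w * ?I H w)
       = expectation (\<lambda>w. \<psi> w * ?I (S j) w - \<psi> w * ?I H w)" using i by simp
    also have "\<bar>\<dots>\<bar> \<le> expectation (\<lambda>w. \<bar>\<psi> w * ?I (S j) w - \<psi> w * ?I H w\<bar>)" by (rule integral_abs_bound)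
    also have "\<dots> \<le> expectation (\<lambda>w. L * (2 * K / e) * path_energy (\<lambda>r w. S j r w - H r w) w + e * (L * (2 * K * (t - s))))"
    proof (rule integral_mono)
      show "integrable M (\<lambda>w. \<bar>\<psi> w * ?I (S j) w - \<psi> w * ?I H w\<bar>)" using i by simp
      show "integrable M (\<lambda>w. L * (2 * K / e) * path_energy (\<lambda>r w. S j r w - H r w) w + e * (L * (2 * K * (t - s))))"
        using iE by simp
      fix w assume w: "w \<in> space M"
      have "\<bar>\<psi> w\<bar> * \<bar>?I (S j) w - ?I H w\<bar> \<le> L * (2 * K / e * path_energy (\<lambda>r w. S j r w - H r w) w + e * (2 * K * (t - s)))"
        using \<psi>(2)[OF w] le[OF w] L by (intro mult_mono) auto
      then show "\<bar>\<psi> w * ?I (S j) w - \<psi> w * ?I H w\<bar>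
        \<le> L * (2 * K / e) * path_energy (\<lambda>r w. S j r w - H r w) w + e * (L * (2 * K * (t - s)))"
        unfolding abs_mult[symmetric] by (simp add: algebra_simps)
    qed
    also have "\<dots> = L * (2 * K / e) * expectation (path_energy (\<lambda>r w. S j r w - H r w)) + e * (L * (2 * K * (t - s)))"
      using iE by (simp add: prob_space)
    finally show "\<bar>expectation (\<lambda>w. \<psi> w * ?I (S j) w) - expectation (\<lambda>w. \<psi> w * ?I H w)\<bar>
      \<le> L * (2 * K / e) * expectation (path_energy (\<lambda>r w. S j r w - H r w)) + e * (L * (2 * K * (t - s)))" .
  qed
  from tendsto_diff[OF x0 y0]
  show "expectation (\<lambda>w. \<psi> w * (Z w $ a * Z w $ c))
       = expectation (\<lambda>w. \<psi> w * (\<integral>r. H r w $ a \<bullet> H r w $ c \<partial>lborel))"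
    using C(5)[of _ a c] by (simp add: LIMSEQ_const_iff)
qed

end

section \<open>Integrals in the sense of \<open>has_ito_integral\<close>\<close>

context wiener_process
begin

text \<open>Cutting the nodes of the data at \<open>t\<close> gives a grid again. Cells beyond
  \<open>t\<close> become empty, and a cell of positive length still begins at its original node, so
  its coefficient is known there.\<close>

lemma simple_ito_integral_has_simple_integral:
  fixes \<xi> :: "nat \<Rightarrow> 'w \<Rightarrow> real ^ 'k ^ 'n"
  assumes d: "simple_integrand_data M W N p \<xi>" and t: "0 \<le> t"
  shows "has_simple_integral (\<lambda>r w. indicator {0<..t} r *\<^sub>R simple_integrand N p \<xi> r w)
    (simple_ito_integral W N p \<xi> t)"
proof -
  have p: "0 \<le> p 0" "mono p"
    and \<xi>: "\<And>i. i < N \<Longrightarrow> \<xi> i \<in> borel_measurable (\<F> (p i))" "\<And>i. i < N \<Longrightarrow> bounded (\<xi> i ` space M)"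
    using d by (auto simp: simple_integrand_data_def)
  define q where "q i = min t (p i)" for i
  let ?S = "\<lambda>r w. indicator {0<..t} r *\<^sub>R simple_integrand N p \<xi> r w"
  have q: "mono q" "0 \<le> q 0" using p t by (auto simp: q_def mono_def min_le_iff_disj)
  have cell: "q i = p i \<and> (\<forall>r\<in>{q i<..q (Suc i)}. \<forall>w. ?S r w = \<xi> i w)" if "i < N" "q i < q (Suc i)" for i
  proof
    show qi: "q i = p i" using that by (auto simp: q_def min_def split: if_splits)
    show "\<forall>r\<in>{q i<..q (Suc i)}. \<forall>w. ?S r w = \<xi> i w"
    proof (intro ballI allI)
      fix r w assume r: "r \<in> {q i<..q (Suc i)}"
      then have r': "r \<in> {p i<..p (Suc i)}" "r \<le> t" using qi by (auto simp: q_def)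
      have "0 < r" using r' p monoD[OF p(2), of 0 i] by auto
      have "simple_integrand N p \<xi> r w = (\<Sum>k<N. if k = i then \<xi> i w else 0)"
        unfolding simple_integrand_def
      proof (rule sum.cong[OF refl])
        fix k
        show "indicator {p k<..p (Suc k)} r *\<^sub>R \<xi> k w = (if k = i then \<xi> i w else 0)"
        proof (cases "k = i")
          case False
          then have "r \<notin> {p k<..p (Suc k)}" using grid_locate_unique[OF p(2) r'(1)] by blast
          then show ?thesis using False by simp
        qed (use r' in simp)
      qed
      then show "?S r w = \<xi> i w" using \<open>0 < r\<close> r'(2) that by simp
    qed
  qed
  have on: "simple_on q N ?S"
    unfolding simple_on_def
  proof (intro conjI allI impI ballI)
    fix i assume i: "i < N" "q i < q (Suc i)"
    have e: "?S (q (Suc i)) w = \<xi> i w" for w using cell[OF i] i by auto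
    show "?S (q (Suc i)) \<in> borel_measurable (\<F> (q i))"
      using \<xi>(1)[OF i(1)] cell[OF i] unfolding e by simp
    show "bounded (?S (q (Suc i)) ` space M)" unfolding e by (rule \<xi>(2)[OF i(1)])
    fix s w assume "s \<in> {q i<..q (Suc i)}" "w \<in> space M"
    then show "?S s w = ?S (q (Suc i)) w" unfolding e using cell[OF i] by blast
  next
    fix s w assume s: "s \<notin> {q 0<..q N}" and "w \<in> space M"
    show "?S s w = 0"
    proof (cases "s \<in> {0<..t}")
      case True
      have "s \<notin> {p k<..p (Suc k)}" if "k < N" for k
        using s True monoD[OF p(2), of 0 k] monoD[OF p(2), of "Suc k" N] that by (auto simp: q_def min_def split: if_splits)
      then show ?thesis unfolding simple_integrand_def by (simp add: sum.neutral)
    qed simp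
  qed (use q in auto)
  have "simple_ito_integral W N p \<xi> t w = grid_integral q N ?S w" if "w \<in> space M" for w
    unfolding simple_ito_integral_def grid_integral_def
  proof (rule sum.cong[OF refl])
    fix i assume "i \<in> {..<N}"
    then have i: "i < N" by simp
    show "\<xi> i w *v (W (min t (p (Suc i))) w - W (min t (p i)) w) = ?S (q (Suc i)) w *v (W (q (Suc i)) w - W (q i) w)"
    proof (cases "q i < q (Suc i)")
      case True
      then show ?thesis using cell[OF i True] by (auto simp: q_def)
    next
      case False
      then have "q (Suc i) = q i" using monoD[OF q(1), of i "Suc i"] by simp
      then show ?thesis by (simp add: q_def)
    qed
  qed
  with on show ?thesis unfolding has_simple_integral_def by blast
qed

lemma has_ito_integral_imp_ito_limit:
  fixes H :: "real \<Rightarrow> 'w \<Rightarrow> real ^ 'k ^ 'n"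
  assumes I: "has_ito_integral M W H t Z" and t: "0 \<le> t"
    and r: "path_regular (\<lambda>r w. indicator {0<..t} r *\<^sub>R H r w)"
  shows "ito_limit (\<lambda>r w. indicator {0<..t} r *\<^sub>R H r w) Z"
proof -
  obtain N p \<xi> where d: "\<And>j. simple_integrand_data M W (N j) (p j) (\<xi> j)"
    and l1: "\<And>\<epsilon>. \<epsilon> > 0 \<Longrightarrow> (\<lambda>j. measure M {w \<in> space M. ennreal \<epsilon> <
        (\<integral>\<^sup>+ s \<in> {0..t}. ennreal ((norm (simple_integrand (N j) (p j) (\<xi> j) s w - H s w))\<^sup>2) \<partial>lborel)}) \<longlonglongrightarrow> 0"
    and l2: "\<And>\<epsilon>. \<epsilon> > 0 \<Longrightarrow> (\<lambda>j. measure M {w \<in> space M. \<epsilon> <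
        norm (simple_ito_integral W (N j) (p j) (\<xi> j) t w - Z w)}) \<longlonglongrightarrow> 0"
    using I unfolding has_ito_integral_def by blast
  have mZ: "Z \<in> borel_measurable M" using I by (simp add: has_ito_integral_def)
  let ?S = "\<lambda>j r w. indicator {0<..t} r *\<^sub>R simple_integrand (N j) (p j) (\<xi> j) r w"
  let ?H = "\<lambda>r w. indicator {0<..t} r *\<^sub>R H r w"
  have S: "has_simple_integral (?S j) (simple_ito_integral W (N j) (p j) (\<xi> j) t)" for j
    by (rule simple_ito_integral_has_simple_integral[OF d t])
  have rD: "path_regular (\<lambda>r w. ?S j r w - ?H r w)" for j
    by (intro path_regular_diff r simple_process_path_regular has_simple_integral_simple[OF S])
  \<comment> \<open>The point \<open>0\<close> is a null set and regular paths have finite energy,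
    so the extended integral in the definition equals the real number
    \<open>path_energy\<close>.\<close>
  have eq: "(\<integral>\<^sup>+ s \<in> {0..t}. ennreal ((norm (simple_integrand (N j) (p j) (\<xi> j) s w - H s w))\<^sup>2) \<partial>lborel)
     = ennreal (path_energy (\<lambda>r w. ?S j r w - ?H r w) w)" if w: "w \<in> space M" for j w
  proof -
    have "(\<integral>\<^sup>+ s \<in> {0..t}. ennreal ((norm (simple_integrand (N j) (p j) (\<xi> j) s w - H s w))\<^sup>2) \<partial>lborel)
      = (\<integral>\<^sup>+ s. ennreal ((norm (?S j s w - ?H s w))\<^sup>2) \<partial>lborel)"
      using AE_lborel_singleton[of 0]
      by (intro nn_integral_cong_AE, eventually_elim)
        (auto simp: indicator_def scaleR_diff_right[symmetric])
    also have "\<dots> = ennreal (path_energy (\<lambda>r w. ?S j r w - ?H r w) w)"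
      unfolding path_energy_def by (rule nn_integral_eq_integral[OF path_regular_integrable[OF rD w]]) simp
    finally show ?thesis .
  qed
  have "tends_in_prob0 (\<lambda>j. path_energy (\<lambda>r w. ?S j r w - ?H r w))"
  proof (rule tends_in_prob0I[OF path_energy_measurable[OF rD]])
    fix \<epsilon> :: real assume e: "0 < \<epsilon>"
    have "{w \<in> space M. \<epsilon> < \<bar>path_energy (\<lambda>r w. ?S j r w - ?H r w) w\<bar>} = {w \<in> space M. ennreal \<epsilon> <
        (\<integral>\<^sup>+ s \<in> {0..t}. ennreal ((norm (simple_integrand (N j) (p j) (\<xi> j) s w - H s w))\<^sup>2) \<partial>lborel)}" for j
      using e by (intro Collect_cong conj_cong refl) (simp add: eq ennreal_less_iff path_energy_nonneg)
    then show "(\<lambda>j. prob {w \<in> space M. \<epsilon> < \<bar>path_energy (\<lambda>r w. ?S j r w - ?H r w) w\<bar>}) \<longlonglongrightarrow> 0"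
      using l1[OF e] by simp
  qed
  moreover have "tends_in_prob0 (\<lambda>j w. norm (simple_ito_integral W (N j) (p j) (\<xi> j) t w - Z w))"
  proof (rule tends_in_prob0I)
    show "(\<lambda>w. norm (simple_ito_integral W (N j) (p j) (\<xi> j) t w - Z w)) \<in> borel_measurable M" for j
      using has_simple_integral_measurable[OF S] mZ by measurable
    fix \<epsilon> :: real assume "0 < \<epsilon>"
    from l2[OF this] show "(\<lambda>j. prob {w \<in> space M. \<epsilon> < \<bar>norm (simple_ito_integral W (N j) (p j) (\<xi> j) t w - Z w)\<bar>}) \<longlonglongrightarrow> 0"
      by simp
  qed
  ultimately show ?thesis
    unfolding ito_limit_def using r mZ S
    by (intro conjI exI[of _ ?S] exI[of _ "\<lambda>j. simple_ito_integral W (N j) (p j) (\<xi> j) t"] allI)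
qed

lemma ito_limit_cong_AE:
  assumes "ito_limit H Z" "AE w in M. Z w = V w" "V \<in> borel_measurable M"
  shows "ito_limit H V"
proof -
  obtain S J where S: "\<And>j. has_simple_integral (S j) (J j)"
    "tends_in_prob0 (\<lambda>j. path_energy (\<lambda>r w. S j r w - H r w))" "tends_in_prob0 (\<lambda>j w. norm (J j w - Z w))"
    and r: "path_regular H"
    using assms(1) unfolding ito_limit_def by blast
  have "tends_in_prob0 (\<lambda>j w. norm (J j w - V w))"
  proof (rule tends_in_prob0_dominated[OF S(3), where C=1])
    show "(\<lambda>w. norm (J j w - V w)) \<in> borel_measurable M" for j
      using has_simple_integral_measurable[OF S(1)] assms(3) by measurable
    show "AE w in M. \<bar>norm (J j w - V w)\<bar> \<le> 1 * \<bar>norm (J j w - Z w)\<bar>" for j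
      using assms(2) by eventually_elim simp
  qed
  with S r assms(3) show ?thesis unfolding ito_limit_def by blast
qed

lemma path_regular_integrable1:
  fixes H :: "real \<Rightarrow> 'w \<Rightarrow> 'b::euclidean_space"
  assumes H: "path_regular H" and w: "w \<in> space M"
  shows "integrable lborel (\<lambda>r. H r w)"
proof -
  obtain K t where K: "\<And>r. norm (H r w) \<le> K * indicator {0<..t} r" using H w unfolding path_regular_def by blast
  have "integrable lborel (\<lambda>r. K * indicator {0<..t} r)"
    by (cases "0 \<le> t") (auto intro!: integrable_mult_right integrable_real_indicator)
  then show ?thesis
  proof (rule Bochner_Integration.integrable_bound)
    show "AE r in lborel. norm (H r w) \<le> norm (K * indicator {0<..t} r)"
      using K by (intro AE_I2) (metis abs_ge_self order_trans real_norm_def)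
  qed (rule path_regular_path_measurable[OF H w])
qed

lemma path_integral_of_regular_measurable:
  fixes H :: "real \<Rightarrow> 'w \<Rightarrow> 'b::euclidean_space"
  assumes "path_regular H" shows "(\<lambda>w. \<integral>r. H r w \<partial>lborel) \<in> borel_measurable M"
  using assms lborel.borel_measurable_lebesgue_integral[of "\<lambda>w r. H r w" M] unfolding path_regular_def by simp

end

section \<open>Stopped solutions\<close>

text \<open>One localizing time \<open>\<tau>\<close> of the solution is fixed; the whole sequence
  of them returns only in the final theorem.\<close>

locale local_solution = wiener_process M W for M :: "'w measure" and W :: "real \<Rightarrow> 'w \<Rightarrow> real ^ 'k" +
  fixes b :: "real ^ 'n \<Rightarrow> real ^ 'n" and \<sigma> :: "real ^ 'n \<Rightarrow> real ^ 'k ^ 'n" and x0 :: "real ^ 'n"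
    and X :: "real \<Rightarrow> 'w \<Rightarrow> real ^ 'n" and \<zeta> :: "'w \<Rightarrow> ennreal" and \<tau> :: "'w \<Rightarrow> real"
  assumes b_continuous: "continuous_on UNIV b" and \<sigma>_continuous: "continuous_on UNIV \<sigma>"
    and X_start: "w \<in> space M \<Longrightarrow> X 0 w = x0"
    and X_continuous: "w \<in> space M \<Longrightarrow> continuous_on {t. 0 \<le> t \<and> ennreal t < \<zeta> w} (\<lambda>t. X t w)"
    and X_adapted: "0 \<le> t \<Longrightarrow> X t \<in> borel_measurable
        (restrict_space (wiener_filtration M W (ennreal t)) {w \<in> space M. ennreal t < \<zeta> w})"
    and \<zeta>_stopping: "stopping_time (wiener_filtration M W) \<zeta>"
    and \<tau>_stopping: "stopping_time (wiener_filtration M W) (\<lambda>w. ennreal (\<tau> w))"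
    and \<tau>_bounds: "w \<in> space M \<Longrightarrow> 0 \<le> \<tau> w" "w \<in> space M \<Longrightarrow> ennreal (\<tau> w) < \<zeta> w"
    and equation: "0 \<le> t \<Longrightarrow> \<exists>Z. has_ito_integral M W (\<lambda>s w. if s \<le> \<tau> w then \<sigma> (X s w) else 0) t Z \<and>
        (AE w in M. X (min t (\<tau> w)) w = x0 + (LINT s:{0..min t (\<tau> w)}|lborel. b (X s w)) + Z w)"
begin

text \<open>The stopping time property in complementary form: the events \<open>t < \<rho> w\<close>
  are those whose indicators build the approximations below, and on them the solution is still alive
  at time \<open>t\<close>.\<close>

definition admissible :: "('w \<Rightarrow> real) \<Rightarrow> bool" where
  "admissible \<rho> \<longleftrightarrow> (\<forall>w\<in>space M. 0 \<le> \<rho> w \<and> ennreal (\<rho> w) < \<zeta> w) \<and>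
     (\<forall>t\<ge>0. {w \<in> space M. t < \<rho> w} \<in> sets (\<F> t))"

definition stopped :: "('w \<Rightarrow> real) \<Rightarrow> real \<Rightarrow> 'w \<Rightarrow> real ^ 'n" where
  "stopped \<rho> t w = X (min t (\<rho> w)) w"

text \<open>Zero after \<open>\<rho>\<close>, so that integrating up to \<open>t\<close> amounts to
  integrating up to \<open>min t (\<rho> w)\<close>. Time \<open>0\<close> is excluded to match the
  half-open cells of simple integrands.\<close>

definition along :: "('w \<Rightarrow> real) \<Rightarrow> (real ^ 'n \<Rightarrow> 'b::euclidean_space) \<Rightarrow> real \<Rightarrow> 'w \<Rightarrow> 'b" where
  "along \<rho> f r w = (if 0 < r \<and> r \<le> \<rho> w then f (X r w) else 0)"

lemma admissible_\<tau>: "admissible \<tau>"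
  unfolding admissible_def
proof (intro conjI ballI allI impI \<tau>_bounds)
  fix t :: real assume t: "0 \<le> t"
  have "{w \<in> space M. ennreal t < ennreal (\<tau> w)} \<in> sets (\<F> t)"
    using stopping_timeD2[OF \<tau>_stopping, of "ennreal t"] by (simp add: pred_def)
  moreover have "{w \<in> space M. ennreal t < ennreal (\<tau> w)} = {w \<in> space M. t < \<tau> w}"
    using t by (auto simp: ennreal_less_iff)
  ultimately show "{w \<in> space M. t < \<tau> w} \<in> sets (\<F> t)" by simp
qed

lemma X_continuous_until:
  assumes "admissible \<rho>" "w \<in> space M" shows "continuous_on {0..\<rho> w} (\<lambda>t. X t w)"
proof (rule continuous_on_subset[OF X_continuous[OF assms(2)]], safe)
  fix t assume t: "t \<in> {0..\<rho> w}"
  then have "ennreal t \<le> ennreal (\<rho> w)" by (intro ennreal_leI) auto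
  also have "\<dots> < \<zeta> w" using assms by (auto simp: admissible_def)
  finally show "ennreal t < \<zeta> w" .
  show "0 \<le> t" using t by simp
qed

lemma stopped_continuous:
  assumes "admissible \<rho>" "w \<in> space M" shows "continuous_on {0..} (\<lambda>t. stopped \<rho> t w)"
  unfolding stopped_def
  by (rule continuous_on_compose2[OF X_continuous_until[OF assms]])
    (use assms in \<open>auto intro!: continuous_intros simp: admissible_def\<close>)

text \<open>Values of \<open>X\<close> are known only before the lifetime. Hence the stopped value
  is approximated by the value at the last node strictly before \<open>\<rho>\<close>, where the
  solution is still alive, and path continuity up to \<open>\<rho>\<close> gives the limit.\<close>

lemma stopped_measurable:
  assumes \<rho>: "admissible \<rho>" and t: "0 \<le> t"
  shows "stopped \<rho> t \<in> borel_measurable (\<F> t)"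
proof -
  have pos: "0 \<le> \<rho> w" if "w \<in> space M" for w using \<rho> that by (simp add: admissible_def)
  \<comment> \<open>Adaptedness speaks only of the trace on \<open>ennreal s < \<zeta> w\<close>;
    this holds wherever \<open>s < \<rho> w\<close>, and the indicator removes the rest.\<close>
  have Xm: "(\<lambda>w. indicator {w \<in> space M. s < \<rho> w} w *\<^sub>R X s w) \<in> borel_measurable (\<F> s)" if s: "0 \<le> s" for s
  proof -
    let ?\<Omega> = "{w \<in> space M. ennreal s < \<zeta> w}"
    have O: "?\<Omega> \<in> sets (\<F> s)" using stopping_timeD2[OF \<zeta>_stopping, of "ennreal s"] by (simp add: pred_def)
    have "(\<lambda>w. indicator ?\<Omega> w *\<^sub>R X s w) \<in> borel_measurable (\<F> s)"
      using X_adapted[OF s] O by (subst (asm) borel_measurable_restrict_space_iff) (auto simp: Int_absorb2)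
    moreover have "(indicator {w \<in> space M. s < \<rho> w} :: 'w \<Rightarrow> real) \<in> borel_measurable (\<F> s)"
      using \<rho> s by (intro borel_measurable_indicator) (auto simp: admissible_def)
    ultimately have "(\<lambda>w. (indicator {w \<in> space M. s < \<rho> w} w :: real) *\<^sub>R (indicator ?\<Omega> w *\<^sub>R X s w)) \<in> borel_measurable (\<F> s)"
      by (rule borel_measurable_scaleR[rotated])
    moreover have "(indicator {w \<in> space M. s < \<rho> w} w :: real) *\<^sub>R (indicator ?\<Omega> w *\<^sub>R X s w)
       = indicator {w \<in> space M. s < \<rho> w} w *\<^sub>R X s w" for w
    proof (cases "w \<in> space M \<and> s < \<rho> w")
      case True
      then have "ennreal s \<le> ennreal (\<rho> w)" by (intro ennreal_leI) simp
      also have "\<dots> < \<zeta> w" using \<rho> True by (simp add: admissible_def)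
      finally show ?thesis using True by simp
    qed auto
    ultimately show ?thesis by (simp only:)
  qed
  define g where "g N k = real k * (t / real N)" for N k :: nat
  have g: "0 \<le> g N k" "k \<le> N \<Longrightarrow> g N k \<le> t" for N k
  proof -
    show "0 \<le> g N k" using t by (simp add: g_def)
    assume "k \<le> N"
    then have "real k * (t / real N) \<le> real N * (t / real N)" using t by (intro mult_right_mono) auto
    then show "g N k \<le> t" using t by (cases "N = 0") (auto simp: g_def)
  qed
  have gm: "mono (g N)" for N using t by (auto simp: g_def mono_def intro!: mult_right_mono divide_right_mono)
  \<comment> \<open>At each \<open>w\<close> exactly one contribution survives: the current value if
    \<open>t < \<rho> w\<close>, the starting point if \<open>\<rho> w = 0\<close>, and otherwise
    the value at the left end of the cell that contains \<open>\<rho> w\<close>.\<close>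
  define f where "f N w = indicator {w \<in> space M. t < \<rho> w} w *\<^sub>R X t w + (1 - indicator {w \<in> space M. 0 < \<rho> w} w) *\<^sub>R x0
     + (\<Sum>k<N. (1 - indicator {w \<in> space M. g N (Suc k) < \<rho> w} w) *\<^sub>R (indicator {w \<in> space M. g N k < \<rho> w} w *\<^sub>R X (g N k) w))"
    for N w
  have ind: "(indicator {w \<in> space M. s < \<rho> w} :: 'w \<Rightarrow> real) \<in> borel_measurable (\<F> t)" if "0 \<le> s" "s \<le> t" for s
    using \<rho> that sets_wiener_filtration_mono[OF that(2)] by (intro borel_measurable_indicator) (auto simp: admissible_def)
  have fm: "f (Suc n) \<in> borel_measurable (\<F> t)" for n
  proof -
    have 1: "(\<lambda>w. (1 - indicator {w \<in> space M. g (Suc n) (Suc k) < \<rho> w} w) *\<^sub>R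
        (indicator {w \<in> space M. g (Suc n) k < \<rho> w} w *\<^sub>R X (g (Suc n) k) w)) \<in> borel_measurable (\<F> t)"
      if "k \<in> {..<Suc n}" for k
    proof (rule borel_measurable_scaleR)
      show "(\<lambda>w. 1 - indicator {w \<in> space M. g (Suc n) (Suc k) < \<rho> w} w :: real) \<in> borel_measurable (\<F> t)"
        using that by (intro borel_measurable_diff borel_measurable_const ind g) auto
      show "(\<lambda>w. indicator {w \<in> space M. g (Suc n) k < \<rho> w} w *\<^sub>R X (g (Suc n) k) w) \<in> borel_measurable (\<F> t)"
        by (rule measurable_filtration_mono[OF Xm[OF g(1)] g(2)]) (use that in simp)
    qed
    have 2: "(\<lambda>w. (1 - indicator {w \<in> space M. 0 < \<rho> w} w :: real) *\<^sub>R x0) \<in> borel_measurable (\<F> t)"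
      using t by (intro borel_measurable_scaleR borel_measurable_diff borel_measurable_const ind) auto
    show ?thesis
      unfolding f_def[abs_def]
      by (rule borel_measurable_add[OF borel_measurable_add[OF Xm[OF t] 2] borel_measurable_sum[OF 1]])
  qed
  have "(\<lambda>n. f (Suc n) w) \<longlonglongrightarrow> stopped \<rho> t w" if w: "w \<in> space M" for w
  proof -
    consider "t < \<rho> w" | "\<rho> w = 0" | "0 < \<rho> w" "\<rho> w \<le> t" using pos[OF w] by linarith
    then show ?thesis
    proof cases
      case 1
      have "g (Suc n) (Suc k) < \<rho> w" if "k < Suc n" for n k
        using g(2)[of "Suc k" "Suc n"] that 1 by linarith
      then have "f (Suc n) w = X t w" for n using 1 w t by (simp add: f_def sum.neutral)
      then show ?thesis using 1 by (simp add: stopped_def)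
    next
      case 2
      have "\<not> g (Suc n) k < \<rho> w" for n k using g(1)[of "Suc n" k] 2 by simp
      then have "f (Suc n) w = x0" for n using 2 w t by (simp add: f_def)
      then show ?thesis using 2 t X_start[OF w] by (simp add: stopped_def)
    next
      case 3
      have "\<exists>k<Suc n. \<rho> w \<in> {g (Suc n) k<..g (Suc n) (Suc k)}" for n
      proof -
        have "\<rho> w \<in> {g (Suc n) 0<..g (Suc n) (Suc n)}" using 3 by (simp add: g_def)
        then show ?thesis by (rule grid_locate) blast
      qed
      then obtain \<iota> where \<iota>: "\<And>n. \<iota> n < Suc n" "\<And>n. \<rho> w \<in> {g (Suc n) (\<iota> n)<..g (Suc n) (Suc (\<iota> n))}" by metis
      have fX: "f (Suc n) w = X (g (Suc n) (\<iota> n)) w" for n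
      proof -
        have "(1 - indicator {w \<in> space M. g (Suc n) (Suc k) < \<rho> w} w) *\<^sub>R (indicator {w \<in> space M. g (Suc n) k < \<rho> w} w *\<^sub>R X (g (Suc n) k) w)
          = (if k = \<iota> n then X (g (Suc n) (\<iota> n)) w else 0)" for k
        proof (cases "k = \<iota> n")
          case True
          then show ?thesis using \<iota>(2)[of n] w by simp
        next
          case False
          then have "\<rho> w \<notin> {g (Suc n) k<..g (Suc n) (Suc k)}" using grid_locate_unique[OF gm \<iota>(2)[of n]] by blast
          then show ?thesis using False w by auto
        qed
        then show ?thesis using 3 w \<iota>(1)[of n] by (simp add: f_def del: sum.lessThan_Suc)
      qed
      have h: "(\<lambda>n. t / real (Suc n)) \<longlonglongrightarrow> 0"
        using tendsto_mult_right_zero[OF LIMSEQ_inverse_real_of_nat, of t] by (simp add: divide_inverse)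
      have "(\<lambda>n. \<rho> w - g (Suc n) (\<iota> n)) \<longlonglongrightarrow> 0"
      proof (rule LIMSEQ_squeeze_zero[OF _ h])
        fix n
        have "g (Suc n) (Suc (\<iota> n)) - g (Suc n) (\<iota> n) = t / real (Suc n)" by (simp add: g_def algebra_simps add_divide_distrib)
        then show "\<rho> w - g (Suc n) (\<iota> n) \<le> t / real (Suc n)" "0 \<le> \<rho> w - g (Suc n) (\<iota> n)" using \<iota>(2)[of n] by auto
      qed
      from tendsto_diff[OF tendsto_const[of "\<rho> w"] this] have lim: "(\<lambda>n. g (Suc n) (\<iota> n)) \<longlonglongrightarrow> \<rho> w" by simp
      have "(\<lambda>n. X (g (Suc n) (\<iota> n)) w) \<longlonglongrightarrow> X (\<rho> w) w"
      proof (rule continuous_on_tendsto_compose[OF X_continuous_until[OF \<rho> w] lim])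
        show "\<rho> w \<in> {0..\<rho> w}" using pos[OF w] by simp
        show "\<forall>\<^sub>F n in sequentially. g (Suc n) (\<iota> n) \<in> {0..\<rho> w}"
          using \<iota>(2) g(1) by (intro always_eventually allI) (auto simp: less_imp_le)
      qed
      then show ?thesis unfolding fX using 3 by (simp add: stopped_def)
    qed
  qed
  then show ?thesis by (intro borel_measurable_LIMSEQ_metric[OF fm]) auto
qed

lemma admissible_measurable: "admissible \<rho> \<Longrightarrow> \<rho> \<in> borel_measurable M"
proof (rule borel_measurableI_greater)
  fix y assume \<rho>: "admissible \<rho>"
  show "{x \<in> space M. y < \<rho> x} \<in> sets M"
  proof (cases "0 \<le> y")
    case True
    then show ?thesis using \<rho> sets_wiener_filtration_subset by (auto simp: admissible_def)
  next
    case False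
    have "{x \<in> space M. y < \<rho> x} = space M"
    proof safe
      fix x assume "x \<in> space M"
      then have "0 \<le> \<rho> x" using \<rho> by (simp add: admissible_def)
      then show "y < \<rho> x" using False by simp
    qed
    then show ?thesis by simp
  qed
qed

lemma along_measurable:
  fixes f :: "real ^ 'n \<Rightarrow> 'b::euclidean_space"
  assumes \<rho>: "admissible \<rho>" and f: "continuous_on UNIV f"
  shows "(\<lambda>(w, r). along \<rho> f r w) \<in> borel_measurable (M \<Otimes>\<^sub>M lborel)"
proof -
  \<comment> \<open>Extended constantly to negative times, since joint measurability was shown for
    processes on the whole line.\<close>
  have "(\<lambda>(w, r). stopped \<rho> (max 0 r) w) \<in> borel_measurable (M \<Otimes>\<^sub>M lborel)"
  proof (rule measurable_continuous_process[of "\<lambda>r. stopped \<rho> (max 0 r)"])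
    show "stopped \<rho> (max 0 r) \<in> borel_measurable M" for r
      by (rule measurable_filtration_M[OF stopped_measurable[OF \<rho>]]) simp
    show "continuous_on UNIV (\<lambda>r. stopped \<rho> (max 0 r) w)" if "w \<in> space M" for w
      by (rule continuous_on_compose2[OF stopped_continuous[OF \<rho> that]]) (auto intro!: continuous_intros)
  qed
  from measurable_compose[OF this borel_measurable_continuous_onI[OF f]]
  have m: "(\<lambda>x. f (stopped \<rho> (max 0 (snd x)) (fst x))) \<in> borel_measurable (M \<Otimes>\<^sub>M lborel)"
    by (simp add: case_prod_beta)
  have [measurable]: "\<rho> \<in> borel_measurable M" by (rule admissible_measurable[OF \<rho>])
  have "(\<lambda>x. if 0 < snd x \<and> snd x \<le> \<rho> (fst x) then f (stopped \<rho> (max 0 (snd x)) (fst x)) else 0) \<in> borel_measurable (M \<Otimes>\<^sub>M lborel)"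
    using m by measurable
  moreover have "(\<lambda>(w, r). along \<rho> f r w) = (\<lambda>x. if 0 < snd x \<and> snd x \<le> \<rho> (fst x) then f (stopped \<rho> (max 0 (snd x)) (fst x)) else 0)"
    by (auto simp: fun_eq_iff along_def stopped_def min_absorb1)
  ultimately show ?thesis by simp
qed

lemma along_path_bounded:
  fixes f :: "real ^ 'n \<Rightarrow> 'b::euclidean_space"
  assumes \<rho>: "admissible \<rho>" and f: "continuous_on UNIV f" and w: "w \<in> space M"
  obtains K where "0 \<le> K" "\<And>r. norm (along \<rho> f r w) \<le> K"
proof -
  have "compact ((\<lambda>r. f (X r w)) ` {0..\<rho> w})"
    by (intro compact_continuous_image continuous_on_compose2[OF f X_continuous_until[OF \<rho> w]]) auto
  then obtain K where K: "\<And>r. r \<in> {0..\<rho> w} \<Longrightarrow> norm (f (X r w)) \<le> K"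
    using compact_imp_bounded bounded_iff by (metis image_eqI)
  show ?thesis
    by (rule that[of "\<bar>K\<bar>"]) (auto simp: along_def intro: order_trans[OF K abs_ge_self])
qed

lemma along_path_regular:
  fixes f :: "real ^ 'n \<Rightarrow> 'b::euclidean_space"
  assumes \<rho>: "admissible \<rho>" and f: "continuous_on UNIV f"
  shows "path_regular (\<lambda>r w. indicator {0<..t} r *\<^sub>R along \<rho> f r w)"
  unfolding path_regular_def
proof (intro conjI ballI)
  show "(\<lambda>(w, r). indicator {0<..t} r *\<^sub>R along \<rho> f r w) \<in> borel_measurable (M \<Otimes>\<^sub>M lborel)"
    using along_measurable[OF \<rho> f] unfolding case_prod_beta by (intro borel_measurable_scaleR) auto
  fix w assume "w \<in> space M"
  then obtain K where K: "0 \<le> K" "\<And>r. norm (along \<rho> f r w) \<le> K" using along_path_bounded[OF \<rho> f] by metis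
  show "\<exists>K t'. \<forall>r. norm (indicator {0<..t} r *\<^sub>R along \<rho> f r w) \<le> K * indicator {0<..t'} r"
    using K by (intro exI[of _ K] exI[of _ t]) (auto simp: indicator_def)
qed

text \<open>The stochastic integral of the stopped solution, recovered pathwise as what the equation
  leaves after starting point and drift; no version has to be chosen at each time.\<close>

definition noise_part :: "('w \<Rightarrow> real) \<Rightarrow> real \<Rightarrow> 'w \<Rightarrow> real ^ 'n" where
  "noise_part \<rho> t w = stopped \<rho> t w - x0 - (\<integral>r. indicator {0<..t} r *\<^sub>R along \<rho> b r w \<partial>lborel)"

lemma noise_part_measurable: "admissible \<rho> \<Longrightarrow> 0 \<le> t \<Longrightarrow> noise_part \<rho> t \<in> borel_measurable M"
  unfolding noise_part_def[abs_def]
  by (intro borel_measurable_diff borel_measurable_const measurable_filtration_M[OF stopped_measurable]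
    path_integral_of_regular_measurable along_path_regular b_continuous)

lemma ito_limit_until_\<tau>:
  assumes t: "0 \<le> t"
  shows "ito_limit (\<lambda>r w. indicator {0<..t} r *\<^sub>R along \<tau> \<sigma> r w) (noise_part \<tau> t)"
proof -
  obtain Z where Z: "has_ito_integral M W (\<lambda>s w. if s \<le> \<tau> w then \<sigma> (X s w) else 0) t Z"
    "AE w in M. X (min t (\<tau> w)) w = x0 + (LINT s:{0..min t (\<tau> w)}|lborel. b (X s w)) + Z w"
    using equation[OF t] by blast
  have eq: "(\<lambda>r w. indicator {0<..t} r *\<^sub>R (if r \<le> \<tau> w then \<sigma> (X r w) else 0)) = (\<lambda>r w. indicator {0<..t} r *\<^sub>R along \<tau> \<sigma> r w)"
    by (auto simp: fun_eq_iff along_def indicator_def)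
  have L: "ito_limit (\<lambda>r w. indicator {0<..t} r *\<^sub>R along \<tau> \<sigma> r w) Z"
    using has_ito_integral_imp_ito_limit[OF Z(1) t] along_path_regular[OF admissible_\<tau> \<sigma>_continuous] unfolding eq by blast
  have d: "(LINT s:{0..min t (\<tau> w)}|lborel. b (X s w)) = (\<integral>r. indicator {0<..t} r *\<^sub>R along \<tau> b r w \<partial>lborel)" for w
    unfolding set_integral_Ioc_Icc(2)[symmetric] unfolding set_lebesgue_integral_def
    by (intro Bochner_Integration.integral_cong refl) (auto simp: along_def indicator_def)
  show ?thesis
  proof (rule ito_limit_cong_AE[OF L _ noise_part_measurable[OF admissible_\<tau> t]])
    show "AE w in M. Z w = noise_part \<tau> t w"
      using Z(2) by eventually_elim (simp add: noise_part_def stopped_def d)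
  qed
qed

end

text \<open>A stopping time \<open>\<theta>\<close> before \<open>\<tau>\<close> up to which the
  path stays in a fixed ball, so that all coefficients along it are uniformly bounded; the exit time
  will take its place.\<close>

locale stopped_solution = local_solution M W b \<sigma> x0 X \<zeta> \<tau>
  for M :: "'w measure" and W :: "real \<Rightarrow> 'w \<Rightarrow> real ^ 'k"
    and b :: "real ^ 'n \<Rightarrow> real ^ 'n" and \<sigma> :: "real ^ 'n \<Rightarrow> real ^ 'k ^ 'n" and x0 X \<zeta> \<tau> +
  fixes \<theta> :: "'w \<Rightarrow> real" and R :: real
  assumes \<theta>_bounds: "w \<in> space M \<Longrightarrow> 0 \<le> \<theta> w" "w \<in> space M \<Longrightarrow> \<theta> w \<le> \<tau> w"
    and \<theta>_stopping: "0 \<le> t \<Longrightarrow> {w \<in> space M. t < \<theta> w} \<in> sets (wiener_filtration M W (ennreal t))"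
    and X_bound: "w \<in> space M \<Longrightarrow> r \<in> {0..\<theta> w} \<Longrightarrow> norm (X r w) \<le> R"
begin

lemma admissible_\<theta>: "admissible \<theta>"
  unfolding admissible_def
proof (intro conjI ballI allI impI \<theta>_bounds \<theta>_stopping)
  fix w assume w: "w \<in> space M"
  then have "ennreal (\<theta> w) \<le> ennreal (\<tau> w)" using \<theta>_bounds by (intro ennreal_leI) auto
  then show "ennreal (\<theta> w) < \<zeta> w" using \<tau>_bounds(2)[OF w] by (rule le_less_trans)
qed

end

lemma integral_indicator_Ioc_diff:
  fixes f :: "real \<Rightarrow> 'b::euclidean_space"
  assumes st: "0 \<le> s" "s \<le> t" and i: "integrable lborel (\<lambda>r. indicator {0<..s} r *\<^sub>R f r)"
    "integrable lborel (\<lambda>r. indicator {0<..t} r *\<^sub>R f r)"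
  shows "(\<integral>r. indicator {0<..t} r *\<^sub>R f r \<partial>lborel) - (\<integral>r. indicator {0<..s} r *\<^sub>R f r \<partial>lborel)
     = (LINT r:{s<..t}|lborel. f r)"
proof -
  have "indicator {0<..t} r *\<^sub>R f r - indicator {0<..s} r *\<^sub>R f r = indicator {s<..t} r *\<^sub>R f r" for r
    using st by (auto simp: indicator_def)
  then show ?thesis using Bochner_Integration.integral_diff[OF i(2,1)] by (simp add: set_lebesgue_integral_def)
qed

section \<open>Stochastic integrals up to a stopping time\<close>

context stopped_solution
begin

lemma min_time_\<tau>: "w \<in> space M \<Longrightarrow> min (min t (\<theta> w)) (\<tau> w) = min t (\<theta> w)"
  using \<theta>_bounds(2)[of w] by auto

text \<open>The integrals of \<open>\<sigma>(X)\<close> are only known at deterministic times. We stop at the next time of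
  a grid after \<open>\<theta>\<close>, where everything is a finite combination of such integrals, and refine the grid.\<close>

lemma ito_limit_until_\<theta>:
  assumes t: "0 \<le> t"
  shows "ito_limit (\<lambda>r w. indicator {0<..t} r *\<^sub>R along \<theta> \<sigma> r w) (noise_part \<theta> t)"
proof (cases "t = 0")
  \<comment> \<open>Both integrals are over an empty interval; the grids of the other case need a
    positive step.\<close>
  case True
  have "(\<integral>r. indicator {0<..0} r *\<^sub>R along \<rho> b r w \<partial>lborel) = 0" for \<rho> w by simp
  then have "noise_part \<tau> t w = noise_part \<theta> t w" if "w \<in> space M" for w
    using True \<theta>_bounds[OF that] \<tau>_bounds(1)[OF that] by (simp add: noise_part_def stopped_def)
  then have ae: "AE w in M. noise_part \<tau> t w = noise_part \<theta> t w" by (intro AE_I2)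
  have "(\<lambda>r w. indicator {0<..t} r *\<^sub>R along \<theta> \<sigma> r w) = (\<lambda>r w. indicator {0<..t} r *\<^sub>R along \<tau> \<sigma> r w)"
    using True by (simp add: fun_eq_iff)
  then show ?thesis
    using ito_limit_cong_AE[OF ito_limit_until_\<tau>[OF t] ae noise_part_measurable[OF admissible_\<theta> t]] by simp
next
  case False
  then have tpos: "0 < t" using t by simp
  let ?H = "\<lambda>a r w. indicator {0<..a} r *\<^sub>R along \<tau> \<sigma> r w"
  let ?H\<theta> = "\<lambda>r w. indicator {0<..t} r *\<^sub>R along \<theta> \<sigma> r w"
  have rH: "path_regular (?H a)" for a by (rule along_path_regular[OF admissible_\<tau> \<sigma>_continuous])
  have rH\<theta>: "path_regular ?H\<theta>" by (rule along_path_regular[OF admissible_\<theta> \<sigma>_continuous])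
  obtain S J where S: "\<And>j. has_simple_integral (S j) (J j)"
    "tends_in_prob0 (\<lambda>j. path_energy (\<lambda>r w. S j r w - ?H t r w))"
    using ito_limit_until_\<tau>[OF t] unfolding ito_limit_def by blast
  have sS: "simple_process (S j)" for j by (rule has_simple_integral_simple[OF S(1)])
  have rS: "path_regular (S j)" for j by (rule simple_process_path_regular[OF sS])
  \<comment> \<open>One sequence of simple integrands, found for the full interval, is cut off at
    every \<open>a\<close>. The sequence must be common, because the node at which a path is cut off
    depends on the path.\<close>
  define J' where "J' a j = (SOME V. has_simple_integral (\<lambda>r w. indicator {0<..a} r *\<^sub>R S j r w) V)" for a j
  have J': "has_simple_integral (\<lambda>r w. indicator {0<..a} r *\<^sub>R S j r w) (J' a j)" for a j
  proof -
    have "simple_process (\<lambda>r w. indicator {0<..a} r *\<^sub>R S j r w)"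
      by (rule simple_process_scaleR[OF simple_process_time_indicator[OF order_refl] sS])
    then obtain V where "has_simple_integral (\<lambda>r w. indicator {0<..a} r *\<^sub>R S j r w) V"
      by (rule simple_process_has_integral)
    then show ?thesis unfolding J'_def by (rule someI[where P = "has_simple_integral S" for S])
  qed
  have J'lim: "tends_in_prob0 (\<lambda>j w. norm (J' a j w - noise_part \<tau> a w))" if a: "0 \<le> a" "a \<le> t" for a
  proof (rule ito_limit_unique_approx[OF ito_limit_until_\<tau>[OF a(1)] J'])
    show "tends_in_prob0 (\<lambda>j. path_energy (\<lambda>r w. indicator {0<..a} r *\<^sub>R S j r w - ?H a r w))"
    proof (rule tends_in_prob0_energy_mono[OF S(2)])
      fix j r w
      show "norm (indicator {0<..a} r *\<^sub>R S j r w - ?H a r w) \<le> norm (S j r w - ?H t r w)"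
        using a by (auto simp: indicator_def)
    qed (intro path_regular_diff rH simple_process_path_regular sS has_simple_integral_simple[OF J'])+
  qed
  define g where "g N k = real k * (t / real N)" for N k :: nat
  have g: "0 \<le> g N k" "k \<le> N \<Longrightarrow> g N k \<le> t" for N k
  proof -
    show "0 \<le> g N k" using t by (simp add: g_def)
    assume "k \<le> N"
    then have "real k * (t / real N) \<le> real N * (t / real N)" using t by (intro mult_right_mono) auto
    then show "g N k \<le> t" using t by (cases "N = 0") (auto simp: g_def)
  qed
  have gN: "g N N = t" if "0 < N" for N using that by (simp add: g_def)
  have gm: "mono (g N)" for N unfolding g_def mono_def using tpos by (intro allI impI mult_right_mono) auto
  have gstep: "g N (Suc k) = g N k + t / real N" for N k by (simp add: g_def algebra_simps add_divide_distrib)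
  have gle: "g N i \<le> g N j \<longleftrightarrow> i \<le> j" if "0 < N" for N i j
  proof
    assume "g N i \<le> g N j"
    then show "i \<le> j"
      unfolding g_def by (subst (asm) mult_le_cancel_right_pos) (use tpos that in auto)
  next
    assume "i \<le> j" then show "g N i \<le> g N j" by (rule monoD[OF gm])
  qed
  \<comment> \<open>Index of the first node not before \<open>\<theta>\<close>, or \<open>N\<close>
    if there is none. Because of rounding up, cell \<open>k\<close> is used exactly when
    \<open>g N k < \<theta> w\<close>, an event known at its left end; this makes the indicator
    \<open>ch\<close> of the random interval a simple process.\<close>
  define \<kappa> where "\<kappa> N w = (LEAST k. k = N \<or> \<theta> w \<le> g N k)" for N w
  have \<kappa>: "\<kappa> N w = N \<or> \<theta> w \<le> g N (\<kappa> N w)" "\<kappa> N w \<le> N" for N w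
    using LeastI[of "\<lambda>k. k = N \<or> \<theta> w \<le> g N k" N] Least_le[of "\<lambda>k. k = N \<or> \<theta> w \<le> g N k" N]
    by (auto simp: \<kappa>_def)
  have \<kappa>_less: "k < \<kappa> N w \<longleftrightarrow> g N k < \<theta> w" if "k < N" for k N w
  proof
    assume "k < \<kappa> N w"
    then have "\<not> (k = N \<or> \<theta> w \<le> g N k)" unfolding \<kappa>_def by (rule not_less_Least)
    then show "g N k < \<theta> w" by simp
  next
    assume *: "g N k < \<theta> w"
    show "k < \<kappa> N w"
    proof (rule ccontr)
      assume "\<not> k < \<kappa> N w"
      then have "\<kappa> N w \<le> k" "\<kappa> N w \<noteq> N" using that by auto
      then have "\<theta> w \<le> g N k" using \<kappa>(1)[of N w] monoD[OF gm[of N], of "\<kappa> N w" k] by linarith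
      then show False using * by simp
    qed
  qed
  have \<kappa>_bounds: "min t (\<theta> w) \<le> g N (\<kappa> N w)" "g N (\<kappa> N w) \<le> min t (\<theta> w) + t / real N"
    if "0 < N" "w \<in> space M" for N w
  proof -
    show "min t (\<theta> w) \<le> g N (\<kappa> N w)" using \<kappa>(1)[of N w] gN[OF that(1)] by auto
    show "g N (\<kappa> N w) \<le> min t (\<theta> w) + t / real N"
    proof (cases "\<kappa> N w")
      case 0
      then show ?thesis using tpos \<theta>_bounds(1)[OF that(2)] by (simp add: g_def)
    next
      case (Suc k)
      then have k: "k < N" using \<kappa>(2)[of N w] by simp
      then have "g N k < \<theta> w" using \<kappa>_less[OF k, of w] Suc by simp
      moreover have "g N k \<le> t" using g(2)[of k N] k by simp
      ultimately show ?thesis unfolding Suc gstep by simp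
    qed
  qed
  define ch where "ch N r w = (indicator {0<..g N (\<kappa> N w)} r :: real)" for N r w
  have sch: "simple_process (ch N)" if N: "0 < N" for N
  proof -
    have cell: "ch N s w = (if g N i < \<theta> w then 1 else 0)" if "i < N" "s \<in> {g N i<..g N (Suc i)}" for i s w
    proof -
      have "s \<le> g N (\<kappa> N w) \<longleftrightarrow> i < \<kappa> N w"
      proof
        assume "s \<le> g N (\<kappa> N w)"
        then have "\<not> g N (\<kappa> N w) \<le> g N i" using that by auto
        then show "i < \<kappa> N w" using gle[OF N] by auto
      next
        assume "i < \<kappa> N w"
        then have "g N (Suc i) \<le> g N (\<kappa> N w)" using gle[OF N] by simp
        then show "s \<le> g N (\<kappa> N w)" using that by auto
      qed
      moreover have "0 < s" using that g(1)[of N i] by auto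
      ultimately show ?thesis using \<kappa>_less[OF that(1)] by (simp add: ch_def)
    qed
    have "simple_on (g N) N (ch N)"
      unfolding simple_on_def
    proof (intro conjI allI impI ballI)
      show "0 \<le> g N 0" "mono (g N)" by (rule g, rule gm)
      fix i assume i: "i < N" "g N i < g N (Suc i)"
      then have e: "ch N (g N (Suc i)) w = (if g N i < \<theta> w then 1 else 0)" for w by (intro cell) auto
      have "ch N (g N (Suc i)) w = indicator {w \<in> space M. g N i < \<theta> w} w" if "w \<in> space (\<F> (g N i))" for w
        using that by (simp add: e)
      moreover have "(indicator {w \<in> space M. g N i < \<theta> w} :: 'w \<Rightarrow> real) \<in> borel_measurable (\<F> (g N i))"
        by (intro borel_measurable_indicator \<theta>_stopping g)
      ultimately show "ch N (g N (Suc i)) \<in> borel_measurable (\<F> (g N i))"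
        by (subst measurable_cong)
      have "norm (ch N (g N (Suc i)) w) \<le> 1" for w by (simp add: e)
      then show "bounded (ch N (g N (Suc i)) ` space M)" by (auto simp: bounded_iff)
      fix s w assume "s \<in> {g N i<..g N (Suc i)}" "w \<in> space M"
      then show "ch N s w = ch N (g N (Suc i)) w" using cell[OF i(1), of s w] e by simp
    next
      fix s w assume s: "s \<notin> {g N 0<..g N N}"
      have "g N (\<kappa> N w) \<le> t" by (rule g(2)[OF \<kappa>(2)])
      then show "ch N s w = 0" using s gN[OF N] by (auto simp: ch_def g_def)
    qed
    then show ?thesis by (auto simp: simple_process_def)
  qed
  define RR where "RR n j r w = ch (Suc n) r w *\<^sub>R S j r w" for n j r w
  define V where "V n j = (SOME V. has_simple_integral (RR n j) V)" for n j
  have sRR: "simple_process (RR n j)" for n j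
    unfolding RR_def[abs_def] by (rule simple_process_scaleR[OF sch sS]) simp
  have V: "has_simple_integral (RR n j) (V n j)" for n j
  proof -
    obtain V where "has_simple_integral (RR n j) V" by (rule simple_process_has_integral[OF sRR])
    then show ?thesis unfolding V_def by (rule someI[where P = "has_simple_integral S" for S])
  qed
  \<comment> \<open>The noise of the process stopped at \<open>\<tau>\<close>, read at the rounded
    time. It links the simple integrals \<open>V\<close>, which converge to it for fixed grid, with
    the noise stopped at \<open>\<theta>\<close>, its limit as the grid is refined.\<close>
  define ZN where "ZN n w = noise_part \<tau> (g (Suc n) (\<kappa> (Suc n) w)) w" for n w
  have \<theta>M: "\<theta> \<in> borel_measurable M" by (rule admissible_measurable[OF admissible_\<theta>])
  have mZN: "ZN n \<in> borel_measurable M" for n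
  proof -
    have "\<kappa> (Suc n) \<in> measurable M (count_space UNIV)"
      unfolding \<kappa>_def[abs_def]
    proof (rule measurable_Least)
      fix k
      have "{w \<in> space M. \<theta> w \<le> g (Suc n) k} \<in> sets M" using \<theta>M by (rule borel_measurable_le) simp
      then show "Measurable.pred M (\<lambda>w. k = Suc n \<or> \<theta> w \<le> g (Suc n) k)" by (cases "k = Suc n") (auto simp: pred_def)
    qed
    then have "(\<lambda>w. (\<lambda>k. noise_part \<tau> (g (Suc n) k)) (\<kappa> (Suc n) w) w) \<in> borel_measurable M"
      by (rule measurable_compose_countable[OF noise_part_measurable[OF admissible_\<tau> g(1)]])
    then show ?thesis by (simp add: ZN_def[abs_def])
  qed
  have VZ: "tends_in_prob0 (\<lambda>j w. norm (V n j w - ZN n w))" for n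
  proof (rule tends_in_prob0_dominated[where C=1])
    \<comment> \<open>The error at the random node is dominated by the sum of the errors at all
      nodes, of which there are finitely many for fixed \<open>n\<close>.\<close>
    show "tends_in_prob0 (\<lambda>j w. \<Sum>k\<in>{..Suc n}. \<bar>norm (J' (g (Suc n) k) j w - noise_part \<tau> (g (Suc n) k) w)\<bar>)"
      by (intro tends_in_prob0_sum J'lim g) auto
    show "(\<lambda>w. norm (V n j w - ZN n w)) \<in> borel_measurable M" for j
      using has_simple_integral_measurable[OF V] mZN by measurable
    show "AE w in M. \<bar>norm (V n j w - ZN n w)\<bar>
      \<le> 1 * \<bar>\<Sum>k\<in>{..Suc n}. \<bar>norm (J' (g (Suc n) k) j w - noise_part \<tau> (g (Suc n) k) w)\<bar>\<bar>" for j
    proof (rule AE_I2)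
      fix w assume w: "w \<in> space M"
      let ?k = "\<kappa> (Suc n) w"
      have "V n j w = J' (g (Suc n) ?k) j w"
        by (rule has_simple_integral_path_cong[OF V J' w]) (simp add: RR_def ch_def)
      then have "norm (V n j w - ZN n w) = \<bar>norm (J' (g (Suc n) ?k) j w - noise_part \<tau> (g (Suc n) ?k) w)\<bar>"
        by (simp add: ZN_def)
      also have "\<dots> \<le> (\<Sum>k\<in>{..Suc n}. \<bar>norm (J' (g (Suc n) k) j w - noise_part \<tau> (g (Suc n) k) w)\<bar>)"
        using \<kappa>(2)[of "Suc n" w]
        by (intro member_le_sum[where f="\<lambda>k. \<bar>norm (J' (g (Suc n) k) j w - noise_part \<tau> (g (Suc n) k) w)\<bar>"]) auto
      also have "\<dots> \<le> \<bar>\<Sum>k\<in>{..Suc n}. \<bar>norm (J' (g (Suc n) k) j w - noise_part \<tau> (g (Suc n) k) w)\<bar>\<bar>"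
        by (rule abs_ge_self)
      finally show "\<bar>norm (V n j w - ZN n w)\<bar>
        \<le> 1 * \<bar>\<Sum>k\<in>{..Suc n}. \<bar>norm (J' (g (Suc n) k) j w - noise_part \<tau> (g (Suc n) k) w)\<bar>\<bar>" by simp
    qed
  qed
  let ?E = "\<lambda>f. expectation (\<lambda>w. min 1 \<bar>f w :: real\<bar>)"
  have ex: "\<exists>j. ?E (\<lambda>w. norm (V n j w - ZN n w)) < inverse (real (Suc n)) \<and>
      ?E (path_energy (\<lambda>r w. S j r w - ?H t r w)) < inverse (real (Suc n))" for n
  proof -
    have p: "0 < inverse (real (Suc n))" by simp
    have "eventually (\<lambda>j. ?E (\<lambda>w. norm (V n j w - ZN n w)) < inverse (real (Suc n))) sequentially"
      by (rule order_tendstoD(2)[OF VZ[of n, unfolded tends_in_prob0_def, THEN conjunct2] p])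
    moreover have "eventually (\<lambda>j. ?E (path_energy (\<lambda>r w. S j r w - ?H t r w)) < inverse (real (Suc n))) sequentially"
      by (rule order_tendstoD(2)[OF S(2)[unfolded tends_in_prob0_def, THEN conjunct2] p])
    ultimately have "eventually (\<lambda>j. ?E (\<lambda>w. norm (V n j w - ZN n w)) < inverse (real (Suc n)) \<and>
      ?E (path_energy (\<lambda>r w. S j r w - ?H t r w)) < inverse (real (Suc n))) sequentially"
      by (rule eventually_conj)
    then show ?thesis by (rule eventually_happens'[OF sequentially_bot])
  qed
  \<comment> \<open>A diagonal sequence: for grid \<open>n\<close> an index at which both the
    integral at the rounded time and the energy distance are accurate up to
    \<open>inverse (real (Suc n))\<close>.\<close>
  define \<iota> where "\<iota> n = (SOME j. ?E (\<lambda>w. norm (V n j w - ZN n w)) < inverse (real (Suc n)) \<and>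
      ?E (path_energy (\<lambda>r w. S j r w - ?H t r w)) < inverse (real (Suc n)))" for n
  have \<iota>': "?E (\<lambda>w. norm (V n (\<iota> n) w - ZN n w)) < inverse (real (Suc n)) \<and>
      ?E (path_energy (\<lambda>r w. S (\<iota> n) r w - ?H t r w)) < inverse (real (Suc n))" for n
    unfolding \<iota>_def by (rule someI_ex[OF ex[of n]])
  note \<iota> = \<iota>'[THEN conjunct1] \<iota>'[THEN conjunct2]
  have rR: "path_regular (RR n j)" for n j
    by (rule simple_process_path_regular[OF has_simple_integral_simple[OF V]])
  have t1: "tends_in_prob0 (\<lambda>n w. norm (V n (\<iota> n) w - ZN n w))"
    unfolding tends_in_prob0_def
  proof (intro conjI allI)
    show "(\<lambda>w. norm (V n (\<iota> n) w - ZN n w)) \<in> borel_measurable M" for n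
      using has_simple_integral_measurable[OF V] mZN by measurable
    show "(\<lambda>n. ?E (\<lambda>w. norm (V n (\<iota> n) w - ZN n w))) \<longlonglongrightarrow> 0"
      by (rule LIMSEQ_squeeze_zero[OF less_imp_le[OF \<iota>(1)] LIMSEQ_inverse_real_of_nat]) simp
  qed
  have t2: "tends_in_prob0 (\<lambda>n. path_energy (\<lambda>r w. S (\<iota> n) r w - ?H t r w))"
    unfolding tends_in_prob0_def
  proof (intro conjI allI)
    show "path_energy (\<lambda>r w. S (\<iota> n) r w - ?H t r w) \<in> borel_measurable M" for n
      by (intro path_energy_measurable path_regular_diff rS rH)
    show "(\<lambda>n. ?E (path_energy (\<lambda>r w. S (\<iota> n) r w - ?H t r w))) \<longlonglongrightarrow> 0"
      by (rule LIMSEQ_squeeze_zero[OF less_imp_le[OF \<iota>(2)] LIMSEQ_inverse_real_of_nat]) simp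
  qed
  have rch: "path_regular (\<lambda>r w. ch (Suc n) r w *\<^sub>R ?H t r w)" for n
  proof (rule path_regular_dominated[OF rH[of t]])
    have "(\<lambda>(w, r). ch (Suc n) r w) \<in> borel_measurable (M \<Otimes>\<^sub>M lborel)"
      using simple_process_path_regular[OF sch[of "Suc n"]] by (simp add: path_regular_def)
    moreover have "(\<lambda>(w, r). ?H t r w) \<in> borel_measurable (M \<Otimes>\<^sub>M lborel)"
      using rH[of t] by (simp add: path_regular_def)
    ultimately show "(\<lambda>(w, r). ch (Suc n) r w *\<^sub>R ?H t r w) \<in> borel_measurable (M \<Otimes>\<^sub>M lborel)"
      unfolding case_prod_beta by (rule borel_measurable_scaleR)
    show "norm (ch (Suc n) r w *\<^sub>R ?H t r w) \<le> norm (?H t r w)" for r w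
      by (auto simp: ch_def indicator_def)
  qed
  have h: "(\<lambda>n. t / real (Suc n)) \<longlonglongrightarrow> 0"
    using tendsto_mult_right_zero[OF LIMSEQ_inverse_real_of_nat, of t] by (simp add: divide_inverse)
  \<comment> \<open>Rounding changes the integrand only between \<open>min t (\<theta> w)\<close>
    and the rounded time, an interval no longer than one grid step. Stated for any \<open>f\<close>,
    as it serves \<open>\<sigma>\<close> in the energy and \<open>b\<close> in the drift.\<close>
  have diff: "ch (Suc n) r w *\<^sub>R (indicator {0<..t} r *\<^sub>R along \<tau> f r w) - indicator {0<..t} r *\<^sub>R along \<theta> f r w
     = indicator {min t (\<theta> w)<..g (Suc n) (\<kappa> (Suc n) w)} r *\<^sub>R along \<tau> f r w"
    if w: "w \<in> space M" for f :: "real ^ 'n \<Rightarrow> 'd::euclidean_space" and n r w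
  proof -
    let ?a = "g (Suc n) (\<kappa> (Suc n) w)"
    have a: "min t (\<theta> w) \<le> ?a" "?a \<le> t" using \<kappa>_bounds(1)[OF _ w] g(2)[OF \<kappa>(2)] by auto
    show ?thesis using a \<theta>_bounds[OF w] tpos by (auto simp: ch_def along_def indicator_def)
  qed
  have t3: "tends_in_prob0 (\<lambda>n. path_energy (\<lambda>r w. ch (Suc n) r w *\<^sub>R ?H t r w - ?H\<theta> r w))"
  proof (rule tends_in_prob0_pointwise)
    show "path_energy (\<lambda>r w. ch (Suc n) r w *\<^sub>R ?H t r w - ?H\<theta> r w) \<in> borel_measurable M" for n
      by (intro path_energy_measurable path_regular_diff rch rH\<theta>)
    show "AE w in M. (\<lambda>n. path_energy (\<lambda>r w. ch (Suc n) r w *\<^sub>R ?H t r w - ?H\<theta> r w) w) \<longlonglongrightarrow> 0"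
    proof (rule AE_I2)
      fix w assume w: "w \<in> space M"
      obtain K where K: "0 \<le> K" "\<And>r. norm (along \<tau> \<sigma> r w) \<le> K"
        using along_path_bounded[OF admissible_\<tau> \<sigma>_continuous w] by metis
      show "(\<lambda>n. path_energy (\<lambda>r w. ch (Suc n) r w *\<^sub>R ?H t r w - ?H\<theta> r w) w) \<longlonglongrightarrow> 0"
      proof (rule LIMSEQ_squeeze_zero[OF _ tendsto_mult_right_zero[OF h, of "K\<^sup>2"] path_energy_nonneg])
        fix n
        let ?a = "g (Suc n) (\<kappa> (Suc n) w)"
        have "path_energy (\<lambda>r w. ch (Suc n) r w *\<^sub>R ?H t r w - ?H\<theta> r w) w \<le> K\<^sup>2 * (?a - min t (\<theta> w))"
        proof (rule path_energy_bounded[OF path_regular_diff[OF rch rH\<theta>] w \<kappa>_bounds(1)[OF _ w]])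
          show "norm (ch (Suc n) r w *\<^sub>R ?H t r w - ?H\<theta> r w) \<le> K * indicator {min t (\<theta> w)<..?a} r" for r
            unfolding diff[OF w] using K by (auto simp: indicator_def)
        qed simp
        also have "\<dots> \<le> K\<^sup>2 * (t / real (Suc n))"
          using \<kappa>_bounds(2)[of "Suc n" w] w by (intro mult_left_mono) auto
        finally show "path_energy (\<lambda>r w. ch (Suc n) r w *\<^sub>R ?H t r w - ?H\<theta> r w) w \<le> K\<^sup>2 * (t / real (Suc n))" .
      qed
    qed
  qed
  have E: "tends_in_prob0 (\<lambda>n. path_energy (\<lambda>r w. RR n (\<iota> n) r w - ?H\<theta> r w))"
  proof (rule tends_in_prob0_add_dominated[OF t2 t3, where C=2])
    show "path_energy (\<lambda>r w. RR n (\<iota> n) r w - ?H\<theta> r w) \<in> borel_measurable M" for n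
      by (intro path_energy_measurable path_regular_diff rR rH\<theta>)
    show "AE w in M. \<bar>path_energy (\<lambda>r w. RR n (\<iota> n) r w - ?H\<theta> r w) w\<bar>
      \<le> 2 * (\<bar>path_energy (\<lambda>r w. S (\<iota> n) r w - ?H t r w) w\<bar> + \<bar>path_energy (\<lambda>r w. ch (Suc n) r w *\<^sub>R ?H t r w - ?H\<theta> r w) w\<bar>)" for n
    proof (rule AE_I2)
      fix w assume w: "w \<in> space M"
      have arith: "x \<le> y \<Longrightarrow> z \<le> 2 * x + 2 * v \<Longrightarrow> z \<le> 2 * (y + v)" for x y z v :: real by simp
      have "path_energy (\<lambda>r w. RR n (\<iota> n) r w - ch (Suc n) r w *\<^sub>R ?H t r w) w
        \<le> path_energy (\<lambda>r w. S (\<iota> n) r w - ?H t r w) w"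
      proof (rule path_energy_mono[OF _ _ w])
        show "norm (RR n (\<iota> n) r w - ch (Suc n) r w *\<^sub>R ?H t r w) \<le> norm (S (\<iota> n) r w - ?H t r w)" for r
          by (auto simp: RR_def ch_def indicator_def)
      qed (intro path_regular_diff rR rch rS rH)+
      then show "\<bar>path_energy (\<lambda>r w. RR n (\<iota> n) r w - ?H\<theta> r w) w\<bar>
      \<le> 2 * (\<bar>path_energy (\<lambda>r w. S (\<iota> n) r w - ?H t r w) w\<bar> + \<bar>path_energy (\<lambda>r w. ch (Suc n) r w *\<^sub>R ?H t r w - ?H\<theta> r w) w\<bar>)"
        unfolding abs_of_nonneg[OF path_energy_nonneg]
        by (rule arith[OF _ path_energy_diff_le[OF rR rH\<theta> rch w, of n "\<iota> n" n]])
    qed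
  qed
  have t4: "tends_in_prob0 (\<lambda>n w. norm (ZN n w - noise_part \<theta> t w))"
  proof (rule tends_in_prob0_pointwise)
    show "(\<lambda>w. norm (ZN n w - noise_part \<theta> t w)) \<in> borel_measurable M" for n
      using mZN noise_part_measurable[OF admissible_\<theta> t] by measurable
    show "AE w in M. (\<lambda>n. norm (ZN n w - noise_part \<theta> t w)) \<longlonglongrightarrow> 0"
    proof (rule AE_I2)
      fix w assume w: "w \<in> space M"
      define a where "a n = g (Suc n) (\<kappa> (Suc n) w)" for n
      have ab: "min t (\<theta> w) \<le> a n" "a n \<le> min t (\<theta> w) + t / real (Suc n)" "0 \<le> a n" "a n \<le> t" for n
        using \<kappa>_bounds[OF _ w, of "Suc n"] g(1) g(2)[OF \<kappa>(2)] by (auto simp: a_def)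
      have "(\<lambda>n. a n - min t (\<theta> w)) \<longlonglongrightarrow> 0"
      proof (rule LIMSEQ_squeeze_zero[OF _ h])
        show "a n - min t (\<theta> w) \<le> t / real (Suc n)" "0 \<le> a n - min t (\<theta> w)" for n
          using ab(1,2)[of n] by linarith+
      qed
      from tendsto_add[OF tendsto_const[of "min t (\<theta> w)"] this] have alim: "a \<longlonglongrightarrow> min t (\<theta> w)" by simp
      have "(\<lambda>n. stopped \<tau> (a n) w) \<longlonglongrightarrow> stopped \<tau> (min t (\<theta> w)) w"
        by (rule continuous_on_tendsto_compose[OF stopped_continuous[OF admissible_\<tau> w] alim])
          (use ab \<theta>_bounds(1)[OF w] t in auto)
      moreover have "stopped \<tau> (min t (\<theta> w)) w = stopped \<theta> t w"
        unfolding stopped_def min_time_\<tau>[OF w] ..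
      ultimately have l1: "(\<lambda>n. stopped \<tau> (a n) w - stopped \<theta> t w) \<longlonglongrightarrow> 0" by (simp add: LIM_zero)
      obtain K where K: "0 \<le> K" "\<And>r. norm (along \<tau> b r w) \<le> K"
        using along_path_bounded[OF admissible_\<tau> b_continuous w] by metis
      let ?D = "\<lambda>\<rho> a. \<integral>r. indicator {0<..a} r *\<^sub>R along \<rho> b r w \<partial>lborel"
      have D: "norm (?D \<tau> (a n) - ?D \<theta> t) \<le> K * (t / real (Suc n))" for n
      proof -
        have i: "integrable lborel (\<lambda>r. indicator {0<..a n} r *\<^sub>R along \<tau> b r w)"
          "integrable lborel (\<lambda>r. indicator {0<..t} r *\<^sub>R along \<theta> b r w)"
          using along_path_regular[OF admissible_\<tau> b_continuous] along_path_regular[OF admissible_\<theta> b_continuous] w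
          by (auto intro: path_regular_integrable1)
        have e: "indicator {0<..a n} r *\<^sub>R along \<tau> b r w - indicator {0<..t} r *\<^sub>R along \<theta> b r w
          = indicator {min t (\<theta> w)<..a n} r *\<^sub>R along \<tau> b r w" for r
        proof -
          have "indicator {0<..a n} r *\<^sub>R along \<tau> b r w = ch (Suc n) r w *\<^sub>R (indicator {0<..t} r *\<^sub>R along \<tau> b r w)"
            using ab(4)[of n] by (auto simp: ch_def a_def indicator_def)
          then show ?thesis using diff[OF w, of n r b] unfolding a_def by (simp only:)
        qed
        have "?D \<tau> (a n) - ?D \<theta> t = (LINT r:{min t (\<theta> w)<..a n}|lborel. along \<tau> b r w)"
          unfolding set_lebesgue_integral_def e[symmetric] using i by simp
        also have "norm \<dots> \<le> K * (a n - min t (\<theta> w))"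
          by (rule norm_set_integral_Ioc_le[OF ab(1) K(2) K(1)])
        also have "\<dots> \<le> K * (t / real (Suc n))" using ab(2)[of n] K(1) by (intro mult_left_mono) linarith+
        finally show ?thesis .
      qed
      have "(\<lambda>n. ?D \<tau> (a n) - ?D \<theta> t) \<longlonglongrightarrow> 0"
        by (rule tendsto_norm_zero_cancel, rule LIMSEQ_squeeze_zero[OF D tendsto_mult_right_zero[OF h] norm_ge_zero])
      from tendsto_norm_zero[OF tendsto_diff[OF l1 this, simplified]]
      show "(\<lambda>n. norm (ZN n w - noise_part \<theta> t w)) \<longlonglongrightarrow> 0"
        by (simp add: ZN_def noise_part_def a_def algebra_simps)
    qed
  qed
  have "tends_in_prob0 (\<lambda>n w. norm (V n (\<iota> n) w - noise_part \<theta> t w))"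
  proof (rule tends_in_prob0_add_dominated[OF t1 t4, where C=1])
    show "(\<lambda>w. norm (V n (\<iota> n) w - noise_part \<theta> t w)) \<in> borel_measurable M" for n
      using has_simple_integral_measurable[OF V] noise_part_measurable[OF admissible_\<theta> t] by measurable
    show "AE w in M. \<bar>norm (V n (\<iota> n) w - noise_part \<theta> t w)\<bar>
      \<le> 1 * (\<bar>norm (V n (\<iota> n) w - ZN n w)\<bar> + \<bar>norm (ZN n w - noise_part \<theta> t w)\<bar>)" for n
    proof (rule AE_I2)
      fix w
      show "\<bar>norm (V n (\<iota> n) w - noise_part \<theta> t w)\<bar>
        \<le> 1 * (\<bar>norm (V n (\<iota> n) w - ZN n w)\<bar> + \<bar>norm (ZN n w - noise_part \<theta> t w)\<bar>)"
        using norm_triangle_ineq[of "V n (\<iota> n) w - ZN n w" "ZN n w - noise_part \<theta> t w"] by simp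
    qed
  qed
  then show ?thesis
    unfolding ito_limit_def using rH\<theta> noise_part_measurable[OF admissible_\<theta> t] V E
    by (intro conjI exI[of _ "\<lambda>n. RR n (\<iota> n)"] exI[of _ "\<lambda>n. V n (\<iota> n)"] allI)
qed

section \<open>Drift and covariation of the stopped process\<close>

definition covariation :: "real ^ 'n \<Rightarrow> real ^ 'n ^ 'n" where
  "covariation x = (\<chi> a c. \<sigma> x $ a \<bullet> \<sigma> x $ c)"

lemma covariation_continuous: "continuous_on UNIV covariation"
  unfolding covariation_def[abs_def]
  by (intro continuous_on_vec_lambda continuous_intros \<sigma>_continuous)

lemma continuous_along_\<theta>_bounded:
  fixes f :: "real ^ 'n \<Rightarrow> 'b::euclidean_space"
  assumes "continuous_on UNIV f"
  obtains K where "0 \<le> K" "\<And>w r. w \<in> space M \<Longrightarrow> norm (along \<theta> f r w) \<le> K"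
proof -
  have "bounded (f ` cball 0 R)"
    by (intro compact_imp_bounded compact_continuous_image continuous_on_subset[OF assms]) auto
  then obtain K where K: "\<And>x. norm x \<le> R \<Longrightarrow> norm (f x) \<le> K"
    unfolding bounded_iff by (metis imageI mem_cball_0)
  show ?thesis
  proof (rule that[of "\<bar>K\<bar>"])
    fix w r assume w: "w \<in> space M"
    show "norm (along \<theta> f r w) \<le> \<bar>K\<bar>"
      using K[OF X_bound[OF w, of r]] by (auto simp: along_def)
  qed simp
qed

definition noise_between :: "real \<Rightarrow> real \<Rightarrow> 'w \<Rightarrow> real ^ 'n" where
  "noise_between s t w = stopped \<theta> t w - stopped \<theta> s w - (LINT r:{s<..t}|lborel. along \<theta> b r w)"

text \<open>An increment of the noise is the integral of the difference of two integrands, which is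
  supported in \<open>{s<..t}\<close> and bounded; so the conditional isometry for limits applies,
  and products of rows of \<open>\<sigma>\<close> are entries of \<open>covariation\<close>.\<close>

lemma noise_between_moments:
  assumes st: "0 \<le> s" "s \<le> t"
    and \<psi>: "\<psi> \<in> borel_measurable (\<F> s)" "\<And>w. w \<in> space M \<Longrightarrow> \<bar>\<psi> w\<bar> \<le> L"
  shows "expectation (\<lambda>w. \<psi> w * noise_between s t w $ a) = 0"
    "expectation (\<lambda>w. \<psi> w * (noise_between s t w $ a * noise_between s t w $ c))
       = expectation (\<lambda>w. \<psi> w * (LINT r:{s<..t}|lborel. along \<theta> covariation r w $ a $ c))"
proof -
  let ?H = "\<lambda>r w. indicator {0<..t} r *\<^sub>R along \<theta> \<sigma> r w - indicator {0<..s} r *\<^sub>R along \<theta> \<sigma> r w"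
  let ?Z = "\<lambda>w. noise_part \<theta> t w - noise_part \<theta> s w"
  have t: "0 \<le> t" using st by simp
  have L: "ito_limit ?H ?Z" by (intro ito_limit_diff ito_limit_until_\<theta> st t)
  have Heq: "?H r w = indicator {s<..t} r *\<^sub>R along \<theta> \<sigma> r w" for r w
    using st by (auto simp: indicator_def)
  obtain K where K: "0 \<le> K" "\<And>w r. w \<in> space M \<Longrightarrow> norm (along \<theta> \<sigma> r w) \<le> K"
    using continuous_along_\<theta>_bounded[OF \<sigma>_continuous] by metis
  have Hle: "norm (?H r w) \<le> K * indicator {s<..t} r" if "w \<in> space M" for r w
    unfolding Heq using K(2)[OF that] by (auto simp: indicator_def)
  have Z: "?Z w = noise_between s t w" if w: "w \<in> space M" for w
  proof -
    have i: "integrable lborel (\<lambda>r. indicator {0<..u} r *\<^sub>R along \<theta> b r w)" for u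
      by (rule path_regular_integrable1[OF along_path_regular[OF admissible_\<theta> b_continuous] w])
    show ?thesis
      using integral_indicator_Ioc_diff[OF st i i] by (simp add: noise_part_def noise_between_def algebra_simps)
  qed
  note m = ito_limit_moments[OF L st K(1) Hle \<psi>]
  have "expectation (\<lambda>w. \<psi> w * noise_between s t w $ a) = expectation (\<lambda>w. \<psi> w * ?Z w $ a)"
    by (intro Bochner_Integration.integral_cong refl) (simp only: Z)
  then show "expectation (\<lambda>w. \<psi> w * noise_between s t w $ a) = 0" using m(1) by simp
  have "expectation (\<lambda>w. \<psi> w * (noise_between s t w $ a * noise_between s t w $ c))
     = expectation (\<lambda>w. \<psi> w * (?Z w $ a * ?Z w $ c))"
    by (intro Bochner_Integration.integral_cong refl) (simp only: Z)
  also have "\<dots> = expectation (\<lambda>w. \<psi> w * (\<integral>r. ?H r w $ a \<bullet> ?H r w $ c \<partial>lborel))" by (rule m(2))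
  also have "\<dots> = expectation (\<lambda>w. \<psi> w * (LINT r:{s<..t}|lborel. along \<theta> covariation r w $ a $ c))"
  proof (intro Bochner_Integration.integral_cong refl)
    fix w
    have "(\<integral>r. ?H r w $ a \<bullet> ?H r w $ c \<partial>lborel) = (LINT r:{s<..t}|lborel. along \<theta> covariation r w $ a $ c)"
      unfolding set_lebesgue_integral_def Heq
      by (intro Bochner_Integration.integral_cong refl) (auto simp: indicator_def along_def covariation_def)
    then show "\<psi> w * (\<integral>r. ?H r w $ a \<bullet> ?H r w $ c \<partial>lborel)
        = \<psi> w * (LINT r:{s<..t}|lborel. along \<theta> covariation r w $ a $ c)" by simp
  qed
  finally show "expectation (\<lambda>w. \<psi> w * (noise_between s t w $ a * noise_between s t w $ c))
       = expectation (\<lambda>w. \<psi> w * (LINT r:{s<..t}|lborel. along \<theta> covariation r w $ a $ c))" .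
qed

lemma stopped_bounded_ito_process:
  assumes T: "0 < T"
  obtains B where "bounded_ito_process M \<F> T R B (stopped \<theta>) (along \<theta> b) (along \<theta> covariation) noise_between"
proof -
  obtain K1 where K1: "0 \<le> K1" "\<And>w r. w \<in> space M \<Longrightarrow> norm (along \<theta> b r w) \<le> K1"
    using continuous_along_\<theta>_bounded[OF b_continuous] by metis
  obtain K2 where K2: "0 \<le> K2" "\<And>w r. w \<in> space M \<Longrightarrow> norm (along \<theta> covariation r w) \<le> K2"
    using continuous_along_\<theta>_bounded[OF covariation_continuous] by metis
  show ?thesis
  proof (rule that[of "K1 + K2"], intro bounded_ito_process.intro prob_space_axioms bounded_ito_process_axioms.intro)
    show "0 < T" by (rule T)
    show "subalgebra M (\<F> t)" for t by (rule subalgebra_wiener_filtration)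
    show "sets (\<F> s) \<subseteq> sets (\<F> t)" if "s \<le> t" for s t by (rule sets_wiener_filtration_mono[OF that])
    show "stopped \<theta> t \<in> borel_measurable (\<F> t)" if "t \<in> {0..T}" for t
      by (rule stopped_measurable[OF admissible_\<theta>]) (use that in simp)
    show "continuous_on {0..T} (\<lambda>t. stopped \<theta> t w)" if "w \<in> space M" for w
      by (rule continuous_on_subset[OF stopped_continuous[OF admissible_\<theta> that]]) auto
    show "norm (stopped \<theta> t w) \<le> R" if "t \<in> {0..T}" "w \<in> space M" for t w
      unfolding stopped_def by (rule X_bound[OF that(2)]) (use that \<theta>_bounds(1)[OF that(2)] in auto)
    show "(\<lambda>(w, r). along \<theta> b r w) \<in> borel_measurable (M \<Otimes>\<^sub>M lborel)"
      "(\<lambda>(w, r). along \<theta> covariation r w) \<in> borel_measurable (M \<Otimes>\<^sub>M lborel)"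
      by (intro along_measurable[OF admissible_\<theta>] b_continuous covariation_continuous)+
    show "norm (along \<theta> b r w) \<le> K1 + K2" if "w \<in> space M" for r w using K1(2)[OF that, of r] K2(1) by linarith
    show "norm (along \<theta> covariation r w) \<le> K1 + K2" if "w \<in> space M" for r w using K2(2)[OF that, of r] K1(1) by linarith
    show "noise_between s t w = stopped \<theta> t w - stopped \<theta> s w - (LINT r:{s<..t}|lborel. along \<theta> b r w)" for s t w
      by (rule noise_between_def)
    show "expectation (\<lambda>w. \<psi> w * noise_between s t w $ a) = 0"
      if "0 \<le> s" "s \<le> t" "t \<le> T" "\<psi> \<in> borel_measurable (\<F> s)" "\<And>w. w \<in> space M \<Longrightarrow> \<bar>\<psi> w\<bar> \<le> L" for s t \<psi> L a
      by (rule noise_between_moments(1)[OF that(1,2,4,5)])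
    show "expectation (\<lambda>w. \<psi> w * (noise_between s t w $ a * noise_between s t w $ c))
       = expectation (\<lambda>w. \<psi> w * (LINT r:{s<..t}|lborel. along \<theta> covariation r w $ a $ c))"
      if "0 \<le> s" "s \<le> t" "t \<le> T" "\<psi> \<in> borel_measurable (\<F> s)" "\<And>w. w \<in> space M \<Longrightarrow> \<bar>\<psi> w\<bar> \<le> L" for s t \<psi> L a c
      by (rule noise_between_moments(2)[OF that(1,2,4,5)])
  qed
qed

end

section \<open>The exit time\<close>

context local_solution
begin

definition exit_set :: "(real ^ 'n) set \<Rightarrow> 'w \<Rightarrow> real set" where
  "exit_set D w = insert (\<tau> w) {r \<in> {0..\<tau> w}. X r w \<notin> D}"

definition exit_time :: "(real ^ 'n) set \<Rightarrow> 'w \<Rightarrow> real" where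
  "exit_time D w = Inf (exit_set D w)"

text \<open>Since \<open>D\<close> is open and the path continuous, the exit set is closed and its
  infimum is attained. Membership in the closure at the exit time follows by taking limits from the
  left.\<close>

lemma exit_time:
  assumes D: "open D" "x0 \<in> D" and w: "w \<in> space M"
  shows "0 \<le> exit_time D w" "exit_time D w \<le> \<tau> w"
    "\<And>r. 0 \<le> r \<Longrightarrow> r < exit_time D w \<Longrightarrow> X r w \<in> D"
    "exit_time D w < \<tau> w \<Longrightarrow> X (exit_time D w) w \<notin> D"
    "\<And>r. r \<in> {0..exit_time D w} \<Longrightarrow> X r w \<in> closure D"
proof -
  let ?S = "exit_set D w"
  note cX = X_continuous_until[OF admissible_\<tau> w]
  have \<tau>0: "0 \<le> \<tau> w" by (rule \<tau>_bounds(1)[OF w])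
  have "closed ({0..\<tau> w} \<inter> (\<lambda>r. X r w) -` (- D))"
    using cX D(1) by (intro continuous_closed_preimage) auto
  moreover have "?S = insert (\<tau> w) ({0..\<tau> w} \<inter> (\<lambda>r. X r w) -` (- D))" by (auto simp: exit_set_def)
  ultimately have cl: "closed ?S" by simp
  have bb: "bdd_below ?S" using \<tau>0 by (auto simp: exit_set_def intro!: bdd_belowI[of _ 0])
  have ne: "?S \<noteq> {}" by (simp add: exit_set_def)
  have mem: "exit_time D w \<in> ?S" unfolding exit_time_def by (rule closed_contains_Inf[OF ne bb cl])
  have low: "exit_time D w \<le> r" if "r \<in> ?S" for r unfolding exit_time_def by (rule cInf_lower[OF that bb])
  show e0: "0 \<le> exit_time D w" using mem \<tau>0 by (auto simp: exit_set_def)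
  show e\<tau>: "exit_time D w \<le> \<tau> w" by (rule low) (simp add: exit_set_def)
  show in_D: "X r w \<in> D" if "0 \<le> r" "r < exit_time D w" for r
    using low[of r] that e\<tau> by (force simp: exit_set_def)
  show "X (exit_time D w) w \<notin> D" if "exit_time D w < \<tau> w" using mem that by (auto simp: exit_set_def)
  show "X r w \<in> closure D" if r: "r \<in> {0..exit_time D w}" for r
  proof (cases "exit_time D w = 0")
    case True
    then show ?thesis using r X_start[OF w] D(2) closure_subset by auto
  next
    case False
    then have lt: "0 < exit_time D w" using e0 by simp
    have cl: "closure {0..<exit_time D w} = {0..exit_time D w}" using closure_atLeastLessThan[OF lt] .
    have "(\<lambda>r. X r w) ` closure {0..<exit_time D w} \<subseteq> closure D"
    proof (rule image_closure_subset)
      show "continuous_on (closure {0..<exit_time D w}) (\<lambda>r. X r w)"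
        unfolding cl by (rule continuous_on_subset[OF cX]) (use e\<tau> in auto)
      show "(\<lambda>r. X r w) ` {0..<exit_time D w} \<subseteq> closure D" using in_D closure_subset by fastforce
    qed simp
    then show ?thesis unfolding cl using r by blast
  qed
qed

text \<open>The event means that \<open>t < \<tau> w\<close> and that the compact piece of path over
  \<open>{0..t}\<close> has positive distance from the complement of \<open>D\<close>. By continuity
  a lower bound \<open>inverse (real (Suc n))\<close> need only be tested at the nodes of all
  equidistant grids, which leaves countable operations on events of \<open>\<F> t\<close>.\<close>

lemma exit_time_stopping:
  assumes D: "open D" "x0 \<in> D" "D \<noteq> UNIV" and t: "0 \<le> t"
  shows "{w \<in> space M. t < exit_time D w} \<in> sets (\<F> t)"
proof -
  define g where "g N k = real k * (t / real N)" for N k :: nat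
  have g: "0 \<le> g N k" "k \<le> N \<Longrightarrow> g N k \<le> t" for N k
  proof -
    show "0 \<le> g N k" using t by (simp add: g_def)
    assume "k \<le> N"
    then have "real k * (t / real N) \<le> real N * (t / real N)" using t by (intro mult_right_mono) auto
    then show "g N k \<le> t" using t by (cases "N = 0") (auto simp: g_def)
  qed
  let ?A = "{w \<in> space M. t < \<tau> w}"
  let ?B = "\<lambda>n N k. {w \<in> space M. inverse (real (Suc n)) \<le> infdist (stopped \<tau> (g N k) w) (- D)}"
  have B: "?B n N k \<in> sets (\<F> t)" if "k \<le> N" for n N k
  proof -
    have "stopped \<tau> (g N k) \<in> borel_measurable (\<F> t)"
      by (rule measurable_filtration_mono[OF stopped_measurable[OF admissible_\<tau> g(1)] g(2)[OF that]])
    then have "(\<lambda>w. infdist (stopped \<tau> (g N k) w) (- D)) \<in> borel_measurable (\<F> t)"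
      by (rule measurable_compose) (intro borel_measurable_continuous_onI continuous_intros)
    then have "{w \<in> space (\<F> t). inverse (real (Suc n)) \<le> infdist (stopped \<tau> (g N k) w) (- D)} \<in> sets (\<F> t)"
      by (intro borel_measurable_le borel_measurable_const)
    then show ?thesis by simp
  qed
  have "{w \<in> space M. t < exit_time D w} = ?A \<inter> (\<Union>n. \<Inter>N. \<Inter>k\<in>{..N}. ?B n N k)"
  proof (intro equalityI subsetI)
    fix w assume "w \<in> {w \<in> space M. t < exit_time D w}"
    then have w: "w \<in> space M" "t < exit_time D w" by auto
    note E = exit_time[OF D(1,2) w(1)]
    have lt: "t < \<tau> w" using E(2) w(2) by simp
    have cX: "continuous_on {0..t} (\<lambda>r. X r w)"
      by (rule continuous_on_subset[OF X_continuous_until[OF admissible_\<tau> w(1)]]) (use lt in auto)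
    have "\<exists>r\<in>{0..t}. \<forall>r'\<in>{0..t}. infdist (X r w) (- D) \<le> infdist (X r' w) (- D)"
      using t cX by (intro continuous_attains_inf continuous_intros) auto
    then obtain r where r: "r \<in> {0..t}" "\<And>r'. r' \<in> {0..t} \<Longrightarrow> infdist (X r w) (- D) \<le> infdist (X r' w) (- D)" by blast
    have "X r w \<in> D" using E(3)[of r] r(1) w(2) by auto
    \<comment> \<open>Here \<open>- D\<close> has to be nonempty: the distance to the empty set is
      \<open>0\<close> by convention.\<close>
    then have "infdist (X r w) (- D) \<noteq> 0"
      using in_closed_iff_infdist_zero[of "- D" "X r w"] D by auto
    then have "0 < infdist (X r w) (- D)" using infdist_nonneg[of "X r w" "- D"] by linarith
    then obtain n where n: "inverse (real (Suc n)) < infdist (X r w) (- D)" using reals_Archimedean by blast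
    have "w \<in> ?B n N k" if "k \<le> N" for N k
    proof -
      have "stopped \<tau> (g N k) w = X (g N k) w" using g(2)[OF that] lt by (simp add: stopped_def min_def)
      then show ?thesis using n r(2)[of "g N k"] g(1) g(2)[OF that] w by auto
    qed
    then show "w \<in> ?A \<inter> (\<Union>n. \<Inter>N. \<Inter>k\<in>{..N}. ?B n N k)" using w lt by auto
  next
    fix w assume "w \<in> ?A \<inter> (\<Union>n. \<Inter>N. \<Inter>k\<in>{..N}. ?B n N k)"
    then obtain n where w: "w \<in> space M" and lt: "t < \<tau> w"
      and n: "\<And>N k. k \<le> N \<Longrightarrow> inverse (real (Suc n)) \<le> infdist (stopped \<tau> (g N k) w) (- D)" by auto
    note E = exit_time[OF D(1,2) w]
    have "X r w \<in> D" if r: "r \<in> {0..t}" for r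
    proof (rule ccontr)
      assume "X r w \<notin> D"
      \<comment> \<open>Picks a node at most one step below \<open>r\<close>; for
        \<open>t = 0\<close>, where the division yields \<open>0\<close>, it is the node
        \<open>0\<close>.\<close>
      define k where "k N = nat \<lfloor>r / t * real N\<rfloor>" for N :: nat
      have q: "0 \<le> r / t" "r / t \<le> 1" using r t by (auto simp: divide_le_eq_1)
      have kN: "k N \<le> N" for N
      proof -
        have "r / t * real N \<le> 1 * real N" using q by (intro mult_right_mono) auto
        then have "\<lfloor>r / t * real N\<rfloor> \<le> \<lfloor>real N\<rfloor>" by (intro floor_mono) simp
        then show ?thesis unfolding k_def by simp
      qed
      have k: "real (k N) \<le> r / t * real N" "r / t * real N \<le> real (k N) + 1" for N
      proof -
        have "0 \<le> r / t * real N" using q(1) by (rule mult_nonneg_nonneg) simp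
        then have e: "real (k N) = of_int \<lfloor>r / t * real N\<rfloor>" by (simp add: k_def)
        show "real (k N) \<le> r / t * real N" "r / t * real N \<le> real (k N) + 1" unfolding e by linarith+
      qed
      have rg: "0 \<le> r - g (Suc N) (k (Suc N))" "r - g (Suc N) (k (Suc N)) \<le> t / real (Suc N)" for N
      proof -
        have h: "0 \<le> t / real (Suc N)" using t by simp
        have e: "r / t * real (Suc N) * (t / real (Suc N)) = r" using r by (cases "t = 0") auto
        have "real (k (Suc N)) * (t / real (Suc N)) \<le> r"
          using mult_right_mono[OF k(1)[of "Suc N"] h] unfolding e .
        moreover have "r \<le> (real (k (Suc N)) + 1) * (t / real (Suc N))"
          using mult_right_mono[OF k(2)[of "Suc N"] h] unfolding e .
        ultimately show "0 \<le> r - g (Suc N) (k (Suc N))" "r - g (Suc N) (k (Suc N)) \<le> t / real (Suc N)"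
          unfolding g_def distrib_right by linarith+
      qed
      have h: "(\<lambda>N. t / real (Suc N)) \<longlonglongrightarrow> 0"
        using tendsto_mult_right_zero[OF LIMSEQ_inverse_real_of_nat, of t] by (simp add: divide_inverse)
      have "(\<lambda>N. r - g (Suc N) (k (Suc N))) \<longlonglongrightarrow> 0" by (rule LIMSEQ_squeeze_zero[OF rg(2) h rg(1)])
      from tendsto_diff[OF tendsto_const[of r] this] have lim: "(\<lambda>N. g (Suc N) (k (Suc N))) \<longlonglongrightarrow> r" by simp
      have "(\<lambda>N. stopped \<tau> (g (Suc N) (k (Suc N))) w) \<longlonglongrightarrow> stopped \<tau> r w"
        by (rule continuous_on_tendsto_compose[OF stopped_continuous[OF admissible_\<tau> w] lim]) (use r g in auto)
      moreover have "stopped \<tau> r w = X r w" using r lt by (simp add: stopped_def min_def)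
      ultimately have "(\<lambda>N. infdist (stopped \<tau> (g (Suc N) (k (Suc N))) w) (- D)) \<longlonglongrightarrow> infdist (X r w) (- D)"
        by (intro tendsto_infdist) simp
      then have "inverse (real (Suc n)) \<le> infdist (X r w) (- D)"
        by (rule LIMSEQ_le_const) (use n[OF kN] in blast)
      moreover have "infdist (X r w) (- D) = 0" using \<open>X r w \<notin> D\<close> by (intro infdist_zero) auto
      ultimately show False by simp
    qed
    then have "t < exit_time D w"
      using E(1,2,4) lt by (metis atLeastAtMost_iff linorder_not_less order_le_less_trans)
    then show "w \<in> {w \<in> space M. t < exit_time D w}" using w by simp
  qed
  moreover have "?A \<in> sets (\<F> t)" using admissible_\<tau> t by (simp add: admissible_def)
  moreover have "(\<Inter>k\<in>{..N}. ?B n N k) \<in> sets (\<F> t)" for n N using B by (intro sets.finite_INT) auto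
  then have "(\<Union>n. \<Inter>N. \<Inter>k\<in>{..N}. ?B n N k) \<in> sets (\<F> t)"
    by (intro sets.countable_UN sets.countable_INT) auto
  ultimately show ?thesis by auto
qed

lemma stopped_solution_exit_time:
  assumes D: "open D" "x0 \<in> D" "D \<noteq> UNIV" "closure D \<subseteq> cball 0 R"
  shows "stopped_solution M W b \<sigma> x0 X \<zeta> \<tau> (exit_time D) R"
proof (intro stopped_solution.intro local_solution_axioms stopped_solution_axioms.intro)
  show "0 \<le> exit_time D w" "exit_time D w \<le> \<tau> w" if "w \<in> space M" for w
    using exit_time(1,2)[OF D(1,2) that] by auto
  show "{w \<in> space M. t < exit_time D w} \<in> sets (\<F> t)" if "0 \<le> t" for t
    by (rule exit_time_stopping[OF D(1,2,3) that])
  show "norm (X r w) \<le> R" if "w \<in> space M" "r \<in> {0..exit_time D w}" for w r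
    using exit_time(5)[OF D(1,2) that] D(4) by auto
qed

end

section \<open>The supermartingale bound\<close>

lemma trace_quadratic:
  fixes S :: "real ^ 'k ^ 'n" and Q :: "real ^ 'n ^ 'n"
  shows "trace (transpose S ** Q ** S) = Q \<bullet> (\<chi> a c. S $ a \<bullet> S $ c)"
proof -
  have "trace (transpose S ** Q ** S) = (\<Sum>j\<in>UNIV. \<Sum>c\<in>UNIV. \<Sum>a\<in>UNIV. S $ a $ j * Q $ a $ c * S $ c $ j)"
    by (simp add: trace_def matrix_matrix_mult_def transpose_def sum_distrib_right)
  also have "\<dots> = (\<Sum>c\<in>UNIV. \<Sum>a\<in>UNIV. \<Sum>j\<in>UNIV. S $ a $ j * Q $ a $ c * S $ c $ j)"
    by (subst sum.swap, intro sum.cong refl, rule sum.swap)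
  also have "\<dots> = (\<Sum>a\<in>UNIV. \<Sum>c\<in>UNIV. \<Sum>j\<in>UNIV. S $ a $ j * Q $ a $ c * S $ c $ j)"
    by (rule sum.swap)
  also have "\<dots> = Q \<bullet> (\<chi> a c. S $ a \<bullet> S $ c)"
    by (simp add: inner_vec_def sum_distrib_left mult_ac)
  finally show ?thesis .
qed

text \<open>The generator of the discounted function is \<open>exp (- \<alpha> * t)\<close> times
  the generator of \<open>v\<close> minus \<open>\<alpha> * v\<close>, so both differential
  inequalities turn into the bound \<open>\<beta> * exp (- \<alpha> * t)\<close>.\<close>

lemma C12_exp_mult:
  fixes v :: "real \<Rightarrow> real ^ 'n \<Rightarrow> real"
  assumes v: "C12_with_derivatives T v vt vx vxx"
  shows "C12_with_derivatives T (\<lambda>t x. exp (- \<alpha> * t) * v t x) (\<lambda>t x. exp (- \<alpha> * t) * (vt t x - \<alpha> * v t x))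
    (\<lambda>t x. exp (- \<alpha> * t) *\<^sub>R vx t x) (\<lambda>t x. exp (- \<alpha> * t) *\<^sub>R vxx t x)"
  unfolding C12_with_derivatives_def
proof (intro conjI ballI allI)
  fix t and x :: "real ^ 'n" assume t: "t \<in> {0..T}"
  have d: "((\<lambda>s. v s x) has_real_derivative vt t x) (at t within {0..T})"
    "(v t has_derivative (\<lambda>h. vx t x \<bullet> h)) (at x)" "(vx t has_derivative (\<lambda>h. vxx t x *v h)) (at x)"
    using v t unfolding C12_with_derivatives_def by blast+
  show "((\<lambda>s. exp (- \<alpha> * s) * v s x) has_real_derivative exp (- \<alpha> * t) * (vt t x - \<alpha> * v t x)) (at t within {0..T})"
    by (auto intro!: derivative_eq_intros d(1) simp: algebra_simps)
  show "((\<lambda>x. exp (- \<alpha> * t) * v t x) has_derivative (\<lambda>h. (exp (- \<alpha> * t) *\<^sub>R vx t x) \<bullet> h)) (at x)"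
    using has_derivative_mult_right[OF d(2), of "exp (- \<alpha> * t)"] by simp
  show "((\<lambda>x. exp (- \<alpha> * t) *\<^sub>R vx t x) has_derivative (\<lambda>h. (exp (- \<alpha> * t) *\<^sub>R vxx t x) *v h)) (at x)"
    using has_derivative_scaleR_right[OF d(3), of "exp (- \<alpha> * t)"] by (simp add: scaleR_matrix_vector_assoc)
next
  note c = C12_continuous[OF v, unfolded case_prod_beta]
  have e: "continuous_on ({0..T} \<times> UNIV) (\<lambda>p :: real \<times> (real ^ 'n). exp (- \<alpha> * fst p))"
    by (intro continuous_intros)
  show "continuous_on ({0..T} \<times> UNIV) (\<lambda>(t, x). exp (- \<alpha> * t) * v t x)"
    "continuous_on ({0..T} \<times> UNIV) (\<lambda>(t, x). exp (- \<alpha> * t) * (vt t x - \<alpha> * v t x))"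
    "continuous_on ({0..T} \<times> UNIV) (\<lambda>(t, x). exp (- \<alpha> * t) *\<^sub>R vx t x)"
    "continuous_on ({0..T} \<times> UNIV) (\<lambda>(t, x). exp (- \<alpha> * t) *\<^sub>R vxx t x)"
    unfolding case_prod_beta by (intro continuous_intros c e)+
qed

text \<open>The last term accounts for paths that are stopped inside \<open>D\<close> because \<open>\<tau>\<close> comes too early.\<close>

lemma (in local_solution) exit_time_bound:
  fixes v :: "real \<Rightarrow> real ^ 'n \<Rightarrow> real"
  assumes D: "open D" "x0 \<in> D" "D \<noteq> UNIV" "closure D \<subseteq> cball 0 R" and T: "0 < T"
    and v: "C12_with_derivatives T v vt vx vxx"
    and gen: "\<And>t x. t \<in> {0..T} \<Longrightarrow> x \<in> D \<Longrightarrow> generator b \<sigma> vt vx vxx t x \<le> \<alpha> * v t x + \<beta>"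
    and bdry: "\<And>t x. t \<in> {0..T} \<Longrightarrow> x \<in> frontier D \<Longrightarrow> vt t x \<le> \<alpha> * v t x + \<beta>"
    and K: "\<And>t x. t \<in> {0..T} \<Longrightarrow> x \<in> cball 0 R \<Longrightarrow> exp (- \<alpha> * t) * (vt t x - \<alpha> * v t x) - \<beta> * exp (- \<alpha> * t) \<le> K"
    and K0: "0 \<le> K"
  defines "Y \<equiv> stopped (exit_time D) T"
  defines "bad \<equiv> {w \<in> space M. \<tau> w < T \<and> Y w \<in> D}"
  shows "exp (- \<alpha> * T) * expectation (\<lambda>w. v T (Y w))
      \<le> v 0 x0 + \<beta> * (LINT r:{0<..T}|lborel. exp (- \<alpha> * r)) + K * T * prob bad"
    and "bad \<in> sets M" and "integrable M (\<lambda>w. v T (Y w))"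
    and "\<And>w. w \<in> space M \<Longrightarrow> Y w \<in> closure D"
proof -
  let ?\<theta> = "exit_time D"
  interpret S: stopped_solution M W b \<sigma> x0 X \<zeta> \<tau> ?\<theta> R by (rule stopped_solution_exit_time[OF D])
  obtain B where "bounded_ito_process M \<F> T R B (stopped ?\<theta>) (along ?\<theta> b) (along ?\<theta> S.covariation) S.noise_between"
    by (rule S.stopped_bounded_ito_process[OF T])
  then interpret I: bounded_ito_process M \<F> T R B "stopped ?\<theta>" "along ?\<theta> b" "along ?\<theta> S.covariation" S.noise_between .
  define e where "e t = exp (- \<alpha> * t)" for t
  let ?ut = "\<lambda>t x. e t * (vt t x - \<alpha> * v t x)"
  have u: "C12_with_derivatives T (\<lambda>t x. e t * v t x) ?ut (\<lambda>t x. e t *\<^sub>R vx t x) (\<lambda>t x. e t *\<^sub>R vxx t x)"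
    unfolding e_def by (rule C12_exp_mult[OF v])
  define g where "g r w = ?ut r (stopped ?\<theta> r w) + e r *\<^sub>R vx r (stopped ?\<theta> r w) \<bullet> along ?\<theta> b r w
      + 1 / 2 * (e r *\<^sub>R vxx r (stopped ?\<theta> r w) \<bullet> along ?\<theta> S.covariation r w)" for r w
  note dyn = I.dynkin_formula[OF u, folded g_def]
  note E = exit_time[OF D(1,2)]
  have mY: "Y \<in> borel_measurable M" unfolding Y_def by (rule I.Y_measurable) (use T in simp)
  show Ycl: "Y w \<in> closure D" if "w \<in> space M" for w
    unfolding Y_def stopped_def by (rule E(5)[OF that]) (use T E(1)[OF that] in auto)
  have m\<tau>: "\<tau> \<in> borel_measurable M" by (rule admissible_measurable[OF admissible_\<tau>])
  have "Y -` D \<inter> space M \<in> sets M" using mY D(1) by (intro measurable_sets) auto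
  moreover have "{w \<in> space M. \<tau> w < T} \<in> sets M" using m\<tau> by measurable
  moreover have "bad = (Y -` D \<inter> space M) \<inter> {w \<in> space M. \<tau> w < T}" by (auto simp: bad_def)
  ultimately show bad: "bad \<in> sets M" by auto
  have bv: "bounded_rv (\<lambda>w. v T (Y w))"
    unfolding Y_def by (rule I.bounded_rv_space_function[OF C12_continuous_space(1)[OF v]]) (use T in auto)
  then show iv: "integrable M (\<lambda>w. v T (Y w))" by (rule bounded_rv_integrable)
  \<comment> \<open>Before the exit the generator condition applies, after an exit through the
    boundary the boundary condition, and on \<open>bad\<close>, where the path is frozen inside
    \<open>D\<close>, the crude bound \<open>K\<close>. The instant \<open>r = ?\<theta> w\<close>
    is left out: there the coefficients are still active while the point may already lie on the
    boundary. It is a null set.\<close>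
  have g_le: "g r w \<le> \<beta> * e r + K * indicator bad w" if w: "w \<in> space M" and r: "r \<in> {0<..T}" "r \<noteq> ?\<theta> w" for r w
  proof (cases "r < ?\<theta> w")
    case True
    have XD: "X r w \<in> D" using E(3)[OF w, of r] True r by simp
    have st: "stopped ?\<theta> r w = X r w" using True by (simp add: stopped_def min_def)
    have al: "along ?\<theta> f r w = f (X r w)" for f :: "real ^ 'n \<Rightarrow> 'd::euclidean_space" using True r by (simp add: along_def)
    have "g r w = e r * (generator b \<sigma> vt vx vxx r (X r w) - \<alpha> * v r (X r w))"
      unfolding g_def st al generator_def trace_quadratic S.covariation_def by (simp add: algebra_simps)
    also have "\<dots> \<le> e r * \<beta>"
      using gen[OF _ XD, of r] r by (intro mult_left_mono) (auto simp: e_def)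
    finally show ?thesis using K0 by (simp add: mult.commute add_increasing2)
  next
    case False
    then have gt: "?\<theta> w < r" using r by simp
    have st: "stopped ?\<theta> r w = X (?\<theta> w) w" using gt by (simp add: stopped_def min_def)
    have al: "along ?\<theta> f r w = 0" for f :: "real ^ 'n \<Rightarrow> 'd::euclidean_space" using gt by (simp add: along_def)
    have gr: "g r w = ?ut r (X (?\<theta> w) w)" unfolding g_def st al by simp
    have cl: "X (?\<theta> w) w \<in> closure D" using E(5)[OF w, of "?\<theta> w"] E(1)[OF w] by simp
    have rT: "r \<in> {0..T}" using r by simp
    show ?thesis
    \<comment> \<open>A path frozen inside \<open>D\<close> has not left \<open>D\<close>, so it was
      stopped by \<open>\<tau>\<close>, and before time \<open>T\<close>: this is the event
      \<open>bad\<close>.\<close>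
    proof (cases "X (?\<theta> w) w \<in> D")
      case True
      then have "?\<theta> w = \<tau> w" using E(2,4)[OF w] by fastforce
      moreover have "Y w = X (?\<theta> w) w" using gt r by (simp add: Y_def stopped_def min_def)
      ultimately have "w \<in> bad" using True w gt r by (simp add: bad_def)
      moreover have "X (?\<theta> w) w \<in> cball 0 R" using cl D(4) by blast
      ultimately show ?thesis using K[OF rT, of "X (?\<theta> w) w"] unfolding gr by (simp add: e_def)
    next
      case False
      then have "X (?\<theta> w) w \<in> frontier D" using cl D(1) by (simp add: frontier_def interior_open)
      then have "vt r (X (?\<theta> w) w) - \<alpha> * v r (X (?\<theta> w) w) \<le> \<beta>" using bdry[OF rT] by (simp add: algebra_simps)
      then have "g r w \<le> e r * \<beta>" unfolding gr by (intro mult_left_mono) (auto simp: e_def)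
      then show ?thesis using K0 by (simp add: mult.commute add_increasing2)
    qed
  qed
  define \<Phi> where "\<Phi> = (LINT r:{0<..T}|lborel. e r)"
  have ie: "set_integrable lborel {0<..T} e"
    unfolding set_integral_Ioc_Icc e_def by (intro borel_integrable_atLeastAtMost' continuous_intros)
  have ic: "set_integrable lborel {0<..T} (\<lambda>r. c :: real)" for c
    unfolding set_integral_Ioc_Icc by (intro borel_integrable_atLeastAtMost' continuous_intros)
  have G_le: "(LINT r:{0<..T}|lborel. g r w) \<le> \<beta> * \<Phi> + K * T * indicator bad w" if w: "w \<in> space M" for w
  proof -
    have "(LINT r:{0<..T}|lborel. g r w) \<le> (LINT r:{0<..T}|lborel. \<beta> * e r + K * indicator bad w)"
    proof (rule set_integral_mono_AE)
      show "set_integrable lborel {0<..T} (\<lambda>r. g r w)" by (rule dyn(3)[OF w])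
      show "set_integrable lborel {0<..T} (\<lambda>r. \<beta> * e r + K * indicator bad w)"
        by (intro set_integral_add set_integrable_mult_right ie ic)
      show "AE r\<in>{0<..T} in lborel. g r w \<le> \<beta> * e r + K * indicator bad w"
        using AE_lborel_singleton[of "?\<theta> w"] by eventually_elim (use g_le[OF w] in blast)
    qed
    also have "\<dots> = \<beta> * \<Phi> + (LINT r:{0<..T}|lborel. K * indicator bad w)"
      unfolding \<Phi>_def by (subst set_integral_add(2)) (auto intro!: set_integrable_mult_right ie ic)
    also have "(LINT r:{0<..T}|lborel. K * indicator bad w) = K * T * indicator bad w"
      using T by (simp add: set_lebesgue_integral_def)
    finally show ?thesis .
  qed
  have e0: "e 0 = 1" by (simp add: e_def)
  have "stopped ?\<theta> 0 w = x0" if "w \<in> space M" for w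
    using E(1)[OF that] X_start[OF that] by (simp add: stopped_def)
  then have "expectation (\<lambda>w. e 0 * v 0 (stopped ?\<theta> 0 w)) = expectation (\<lambda>w. v 0 x0)"
    by (intro Bochner_Integration.integral_cong refl) (simp add: e0)
  then have "expectation (\<lambda>w. e T * v T (Y w)) = v 0 x0 + expectation (\<lambda>w. LINT r:{0<..T}|lborel. g r w)"
    using dyn(1) by (simp add: Y_def prob_space)
  moreover have "expectation (\<lambda>w. LINT r:{0<..T}|lborel. g r w) \<le> expectation (\<lambda>w. \<beta> * \<Phi> + K * T * indicator bad w)"
    using dyn(2) G_le bad
    by (intro integral_mono Bochner_Integration.integrable_add integrable_mult_right integrable_real_indicator)
      (auto simp: emeasure_eq_measure)
  moreover have "expectation (\<lambda>w. \<beta> * \<Phi> + K * T * indicator bad w) = \<beta> * \<Phi> + K * T * prob bad"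
    using bad by (subst Bochner_Integration.integral_add) (auto simp: prob_space emeasure_eq_measure)
  ultimately show "exp (- \<alpha> * T) * expectation (\<lambda>w. v T (Y w))
      \<le> v 0 x0 + \<beta> * (LINT r:{0<..T}|lborel. exp (- \<alpha> * r)) + K * T * prob bad"
    by (simp add: e_def \<Phi>_def)
qed

text \<open>For each \<open>m\<close> the terminal condition turns the bound on the expectation into
  one on the probability of reaching the target with \<open>T < \<tau> m w\<close>. These events
  increase to the reach-avoid event, while the probability of \<open>bad m\<close> tends to
  zero.\<close>

theorem theorem3:
  fixes M :: "'w measure"
    and W :: "real \<Rightarrow> 'w \<Rightarrow> real ^ 'k"
    and b :: "real ^ 'n \<Rightarrow> real ^ 'n"
    and \<sigma> :: "real ^ 'n \<Rightarrow> real ^ 'k ^ 'n"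
    and X :: "real ^ 'n \<Rightarrow> real \<Rightarrow> 'w \<Rightarrow> real ^ 'n"
    and \<zeta> :: "real ^ 'n \<Rightarrow> 'w \<Rightarrow> ennreal"
    and D G :: "(real ^ 'n) set"
    and T \<alpha> \<beta> :: real
    and v vt :: "real \<Rightarrow> real ^ 'n \<Rightarrow> real"
    and vx :: "real \<Rightarrow> real ^ 'n \<Rightarrow> real ^ 'n"
    and vxx :: "real \<Rightarrow> real ^ 'n \<Rightarrow> real ^ 'n ^ 'n"
  assumes "wiener_process M W"
    and "local_lipschitz (UNIV :: real set) UNIV (\<lambda>_. b)"
    and "local_lipschitz (UNIV :: real set) UNIV (\<lambda>_. \<sigma>)"
    and "open D" and "bounded D"
    and "closed G" and "G \<subseteq> D"
    and "0 < T"
    and "\<And>x0. x0 \<in> D - G \<Longrightarrow> maximal_local_strong_solution M W b \<sigma> x0 (X x0) (\<zeta> x0)"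
    and "C12_with_derivatives T v vt vx vxx"
    and "\<And>t x. t \<in> {0..T} \<Longrightarrow> x \<in> D \<Longrightarrow> generator b \<sigma> vt vx vxx t x \<le> \<alpha> * v t x + \<beta>"
    and "\<And>t x. t \<in> {0..T} \<Longrightarrow> x \<in> frontier D \<Longrightarrow> vt t x \<le> \<alpha> * v t x + \<beta>"
    and "\<And>x. x \<in> closure D \<Longrightarrow> v T x \<ge> indicator G x"
  shows "\<forall>x0 \<in> D - G. reach_avoid_prob M (X x0) (\<zeta> x0) D G T \<le>
    (if \<alpha> = 0 then v 0 x0 + \<beta> * T
     else exp (\<alpha> * T) * v 0 x0 + \<beta> / \<alpha> * (exp (\<alpha> * T) - 1))"
proof
  fix x0 assume x0: "x0 \<in> D - G"
  note W = assms(1) and v = assms(10)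
  interpret wiener_process M W by (rule W)
  define Z where "Z = X x0"
  define \<eta> where "\<eta> = \<zeta> x0"
  have sol: "local_strong_solution M W b \<sigma> x0 Z \<eta>"
    and explosion: "AE w in M. \<eta> w < \<infinity> \<longrightarrow>
        Limsup (at_left (enn2real (\<eta> w))) (\<lambda>t. ereal (norm (Z t w))) = \<infinity>"
    using assms(9)[OF x0] by (auto simp: maximal_local_strong_solution_def Z_def \<eta>_def)
  obtain \<tau> :: "nat \<Rightarrow> 'w \<Rightarrow> real" where
    \<tau>_stop: "\<And>m. stopping_time (wiener_filtration M W) (\<lambda>w. ennreal (\<tau> m w))" and
    \<tau>: "\<And>w. w \<in> space M \<Longrightarrow> incseq (\<lambda>m. \<tau> m w) \<and> (\<forall>m. 0 \<le> \<tau> m w \<and> ennreal (\<tau> m w) < \<eta> w) \<and>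
           (\<lambda>m. ennreal (\<tau> m w)) \<longlonglongrightarrow> \<eta> w" and
    eqn: "\<And>m t. t \<ge> 0 \<Longrightarrow> \<exists>V.
           has_ito_integral M W (\<lambda>s w. if s \<le> \<tau> m w then \<sigma> (Z s w) else 0) t V \<and>
           (AE w in M. Z (min t (\<tau> m w)) w =
              x0 + (LINT s:{0..min t (\<tau> m w)}|lborel. b (Z s w)) + V w)"
    using sol unfolding local_strong_solution_def by blast
  have Z: "\<And>w. w \<in> space M \<Longrightarrow> 0 < \<eta> w \<and> Z 0 w = x0 \<and> continuous_on {t. 0 \<le> t \<and> ennreal t < \<eta> w} (\<lambda>t. Z t w)"
    and \<eta>_stop: "stopping_time (wiener_filtration M W) \<eta>"
    and Z_adapted: "\<And>t. 0 \<le> t \<Longrightarrow> Z t \<in> borel_measurable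
        (restrict_space (wiener_filtration M W (ennreal t)) {w \<in> space M. ennreal t < \<eta> w})"
    using sol unfolding local_strong_solution_def by blast+
  have cont: "continuous_on UNIV b" "continuous_on UNIV \<sigma>"
    using local_lipschitz_continuous_on[OF assms(2)] local_lipschitz_continuous_on[OF assms(3)] by auto
  have LS: "local_solution M W b \<sigma> x0 Z \<eta> (\<tau> m)" for m
    by (intro local_solution.intro W local_solution_axioms.intro cont \<eta>_stop \<tau>_stop Z_adapted eqn)
      (use Z \<tau> in blast)+
  have x0D: "x0 \<in> D" using x0 by simp
  have DU: "D \<noteq> UNIV" using assms(5) not_bounded_UNIV by blast
  obtain R where R: "closure D \<subseteq> cball 0 R"
  proof -
    obtain R where "\<forall>x\<in>closure D. norm x \<le> R" using bounded_closure[OF assms(5)] by (auto simp: bounded_iff)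
    then show ?thesis by (intro that[of R]) auto
  qed
  define e where "e = exp (- \<alpha> * T)"
  have e: "0 < e" by (simp add: e_def)
  define \<Phi> where "\<Phi> = (LINT r:{0<..T}|lborel. exp (- \<alpha> * r))"
  define C0 where "C0 = v 0 x0 + \<beta> * \<Phi>"
  obtain K1 where K1: "\<And>t x. t \<in> {0..T} \<Longrightarrow> x \<in> cball 0 R \<Longrightarrow> \<bar>exp (- \<alpha> * t) * (vt t x - \<alpha> * v t x)\<bar> \<le> K1"
    using C12_bounded[OF C12_exp_mult[OF v, of \<alpha>], of R] by metis
  \<comment> \<open>A bound for the growth rate of a path frozen inside \<open>D\<close>: the
    discounted time derivative plus the largest size of
    \<open>\<beta> * exp (- \<alpha> * t)\<close>. It does not depend on \<open>m\<close>, so it is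
    harmless next to the vanishing probability of \<open>bad m\<close>.\<close>
  define K where "K = \<bar>K1\<bar> + \<bar>\<beta>\<bar> * exp (\<bar>\<alpha>\<bar> * T)"
  have K0: "0 \<le> K" by (simp add: K_def)
  have K: "exp (- \<alpha> * t) * (vt t x - \<alpha> * v t x) - \<beta> * exp (- \<alpha> * t) \<le> K"
    if "t \<in> {0..T}" "x \<in> cball 0 R" for t x
  proof -
    have "- \<alpha> * t \<le> \<bar>\<alpha>\<bar> * t" using that by (intro mult_right_mono) auto
    also have "\<dots> \<le> \<bar>\<alpha>\<bar> * T" using that by (intro mult_left_mono) auto
    finally have "exp (- \<alpha> * t) \<le> exp (\<bar>\<alpha>\<bar> * T)" by simp
    then have "\<bar>\<beta>\<bar> * exp (- \<alpha> * t) \<le> \<bar>\<beta>\<bar> * exp (\<bar>\<alpha>\<bar> * T)" by (intro mult_left_mono) auto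
    moreover have "- (\<beta> * exp (- \<alpha> * t)) \<le> \<bar>\<beta>\<bar> * exp (- \<alpha> * t)"
      unfolding minus_mult_left by (intro mult_right_mono) auto
    ultimately show ?thesis using K1[OF that] unfolding K_def by linarith
  qed
  define \<theta> where "\<theta> m = local_solution.exit_time Z (\<tau> m) D" for m
  define Y where "Y m = local_solution.stopped Z (\<theta> m) T" for m
  define bad where "bad m = {w \<in> space M. \<tau> m w < T \<and> Y m w \<in> D}" for m
  note bound = local_solution.exit_time_bound[OF LS assms(4) x0D DU R assms(8) v]
  have EB: "e * expectation (\<lambda>w. v T (Y m w)) \<le> C0 + K * T * prob (bad m)"
    "bad m \<in> sets M" "integrable M (\<lambda>w. v T (Y m w))" for m
    unfolding e_def C0_def \<Phi>_def bad_def Y_def \<theta>_def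
    by (rule bound(1)[OF assms(11,12) K K0], assumption+,
        rule bound(2)[OF assms(11,12) K K0], assumption+,
        rule bound(3)[OF assms(11,12) K K0], assumption+)
  have Y_closure: "Y m w \<in> closure D" if "w \<in> space M" for m w
    unfolding Y_def \<theta>_def by (rule bound(4)[OF assms(11,12) K K0 that])
  have Y_eq: "Y m w = Z (min T (\<theta> m w)) w" for m w
    unfolding Y_def by (rule local_solution.stopped_def[OF LS])
  note ET = local_solution.exit_time[OF LS assms(4) x0D, folded \<theta>_def]
  have vT: "indicator G (Y m w) \<le> v T (Y m w)" if "w \<in> space M" for m w
    using assms(13) Y_closure[OF that] by blast
  define E where "E = {w \<in> space M. ennreal T < \<eta> w \<and> Z T w \<in> G \<and> (\<forall>t\<in>{0..<T}. Z t w \<in> D)}"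
  have \<tau>_meas: "\<tau> m \<in> borel_measurable M" for m
    by (rule local_solution.admissible_measurable[OF LS local_solution.admissible_\<tau>[OF LS]])
  have Y_event: "Y m w \<in> G" if w: "w \<in> E" "T < \<tau> m w" for m w
  proof -
    have sp: "w \<in> space M" using w by (simp add: E_def)
    \<comment> \<open>The event asks for membership in \<open>D\<close> only before
      \<open>T\<close>; at \<open>T\<close> it comes from the target being a subset of
      \<open>D\<close>.\<close>
    have inD: "Z t w \<in> D" if "t \<in> {0..T}" for t
      using that w(1) assms(7) by (cases "t = T") (auto simp: E_def)
    have "T \<le> \<theta> m w"
    proof (rule ccontr)
      assume "\<not> T \<le> \<theta> m w"
      then have "Z (\<theta> m w) w \<notin> D" "\<theta> m w \<in> {0..T}" using ET(4)[OF sp, of m] ET(1)[OF sp, of m] w(2) by auto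
      then show False using inD by blast
    qed
    then show ?thesis using w(1) by (simp add: Y_eq E_def)
  qed
  have bad_lim: "(\<lambda>m. prob (bad m)) \<longlonglongrightarrow> 0"
  proof -
    \<comment> \<open>A path that is bad for infinitely many \<open>m\<close> has a lifetime of at
      most \<open>T\<close> and stays in a ball until then, which contradicts explosion.\<close>
    have "AE w in M. (\<lambda>m. indicator (bad m) w :: real) \<longlonglongrightarrow> 0"
      using explosion AE_space
    proof eventually_elim
      case (elim w)
      have "eventually (\<lambda>m. w \<notin> bad m) sequentially"
      proof (rule ccontr)
        assume "\<not> eventually (\<lambda>m. w \<notin> bad m) sequentially"
        then have freq: "\<exists>m\<ge>m0. w \<in> bad m" for m0
          unfolding eventually_sequentially by blast
        have \<tau>lim: "(\<lambda>m. ennreal (\<tau> m w)) \<longlonglongrightarrow> \<eta> w" and inc: "incseq (\<lambda>m. \<tau> m w)" using \<tau>[OF elim(2)] by auto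
        have late: "\<exists>m. w \<in> bad m \<and> r < \<tau> m w" if "0 \<le> r" "ennreal r < \<eta> w" for r
        proof -
          have "eventually (\<lambda>m. ennreal r < ennreal (\<tau> m w)) sequentially" by (rule order_tendstoD(1)[OF \<tau>lim that(2)])
          then obtain m0 where m0: "ennreal r < ennreal (\<tau> m0 w)" by (auto simp: eventually_sequentially)
          obtain m where m: "m0 \<le> m" "w \<in> bad m" using freq by blast
          have "r < \<tau> m0 w" using m0 that(1) by (simp add: ennreal_less_iff)
          also have "\<dots> \<le> \<tau> m w" using incseqD[OF inc m(1)] .
          finally show ?thesis using m(2) by blast
        qed
        \<comment> \<open>If the lifetime exceeded \<open>T\<close>, some bad index would have
          \<open>\<tau> m w\<close> beyond \<open>T\<close>, against the definition of
          \<open>bad\<close>.\<close>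
        have "\<not> ennreal T < \<eta> w"
        proof
          assume "ennreal T < \<eta> w"
          then obtain m where "w \<in> bad m" "T < \<tau> m w" using late[of T] assms(8) by auto
          then show False by (simp add: bad_def)
        qed
        then have fin: "\<eta> w \<le> ennreal T" by simp
        then have "\<eta> w < \<infinity>" using le_less_trans[of "\<eta> w" "ennreal T" \<infinity>] by simp
        then have Lim: "Limsup (at_left (enn2real (\<eta> w))) (\<lambda>t. ereal (norm (Z t w))) = \<infinity>" using elim(1) by simp
        \<comment> \<open>At a bad index the exit time coincides with \<open>\<tau> m w\<close>, so
          the path lies in the closure of \<open>D\<close> up to \<open>\<tau> m w\<close>; the bad
          indices are cofinal, hence these times exhaust the lifetime.\<close>
        have Zr: "norm (Z r w) \<le> R" if r: "0 \<le> r" "r < enn2real (\<eta> w)" for r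
        proof -
          have "ennreal r < ennreal (enn2real (\<eta> w))" using r by (simp add: ennreal_less_iff)
          also have "\<dots> = \<eta> w" using \<open>\<eta> w < \<infinity>\<close> by (simp add: less_top)
          finally obtain m where m: "w \<in> bad m" "r < \<tau> m w" using late[OF r(1)] by blast
          have "\<theta> m w = \<tau> m w"
          proof (rule ccontr)
            assume "\<theta> m w \<noteq> \<tau> m w"
            then have lt: "\<theta> m w < \<tau> m w" using ET(2)[OF elim(2), of m] by simp
            then have "Z (\<theta> m w) w \<notin> D" by (rule ET(4)[OF elim(2)])
            moreover have "Y m w = Z (\<theta> m w) w" using lt m(1) by (simp add: Y_eq bad_def min_def)
            ultimately show False using m(1) by (simp add: bad_def)
          qed
          then have "Z r w \<in> closure D" using ET(5)[OF elim(2), of r m] r m(2) by simp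
          then show ?thesis using R by auto
        qed
        have pos: "0 < enn2real (\<eta> w)" using Z[OF elim(2)] \<open>\<eta> w < \<infinity>\<close> by (simp add: enn2real_positive_iff less_top)
        have "eventually (\<lambda>r. r \<in> {0<..<enn2real (\<eta> w)}) (at_left (enn2real (\<eta> w)))"
          by (rule eventually_at_left_real[OF pos])
        then have "eventually (\<lambda>r. ereal (norm (Z r w)) \<le> ereal R) (at_left (enn2real (\<eta> w)))"
          by eventually_elim (use Zr in auto)
        then have "Limsup (at_left (enn2real (\<eta> w))) (\<lambda>t. ereal (norm (Z t w))) \<le> ereal R"
          by (rule Limsup_bounded)
        then show False using Lim by simp
      qed
      then show ?case
        by (intro tendsto_eventually) (auto elim: eventually_mono)
    qed
    then have "(\<lambda>m. expectation (\<lambda>w. indicator (bad m) w :: real)) \<longlonglongrightarrow> expectation (\<lambda>w. 0)"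
      by (intro integral_dominated_convergence[where w="\<lambda>_. 1"]) (use EB(2) in \<open>auto simp: indicator_def\<close>)
    then show ?thesis using EB(2) by simp
  qed
  have bound_lim: "(\<lambda>m. C0 + K * T * prob (bad m)) \<longlonglongrightarrow> C0"
    using tendsto_add[OF tendsto_const[of C0] tendsto_mult_right_zero[OF bad_lim, of "K * T"]] by simp
  have "e * measure M E \<le> C0"
  \<comment> \<open>If \<open>E\<close> is not measurable its measure is \<open>0\<close> by
    convention, and it suffices that \<open>C0\<close> is nonnegative, which follows from
    \<open>v T\<close> being nonnegative on the closure of \<open>D\<close>.\<close>
  proof (cases "E \<in> sets M")
    case True
    have Em: "E \<inter> {w \<in> space M. T < \<tau> m w} \<in> sets M" for m
    proof -
      have "{w \<in> space M. T < \<tau> m w} \<in> sets M" using \<tau>_meas[of m] by measurable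
      then show ?thesis using True by blast
    qed
    have le: "e * prob (E \<inter> {w \<in> space M. T < \<tau> m w}) \<le> C0 + K * T * prob (bad m)" for m
    proof -
      have "prob (E \<inter> {w \<in> space M. T < \<tau> m w}) = expectation (indicator (E \<inter> {w \<in> space M. T < \<tau> m w}))"
        using Em by simp
      \<comment> \<open>On the event the stopped process ends in the target, where
        \<open>v T\<close> is at least \<open>1\<close>; elsewhere it ends in the closure of
        \<open>D\<close>, where \<open>v T\<close> is nonnegative.\<close>
      also have "\<dots> \<le> expectation (\<lambda>w. v T (Y m w))"
      proof (rule integral_mono[OF _ EB(3)])
        show "integrable M (indicator (E \<inter> {w \<in> space M. T < \<tau> m w}) :: 'w \<Rightarrow> real)"
          using Em by (simp add: emeasure_eq_measure)
        fix w assume w: "w \<in> space M"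
        show "indicator (E \<inter> {w \<in> space M. T < \<tau> m w}) w \<le> v T (Y m w)"
        proof (cases "w \<in> E \<and> T < \<tau> m w")
          case True
          then show ?thesis using vT[OF w, of m] Y_event[of w m] w by simp
        next
          case False
          have "0 \<le> v T (Y m w)" by (rule order_trans[OF indicator_pos_le vT[OF w]])
          then show ?thesis using False by auto
        qed
      qed
      finally have "e * prob (E \<inter> {w \<in> space M. T < \<tau> m w}) \<le> e * expectation (\<lambda>w. v T (Y m w))"
        using e by (intro mult_left_mono) auto
      also have "\<dots> \<le> C0 + K * T * prob (bad m)" by (rule EB(1))
      finally show ?thesis .
    qed
    have "(\<lambda>m. prob (E \<inter> {w \<in> space M. T < \<tau> m w})) \<longlonglongrightarrow> prob (\<Union>m. E \<inter> {w \<in> space M. T < \<tau> m w})"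
    proof (rule finite_Lim_measure_incseq)
      show "range (\<lambda>m. E \<inter> {w \<in> space M. T < \<tau> m w}) \<subseteq> sets M" using Em by auto
      show "incseq (\<lambda>m. E \<inter> {w \<in> space M. T < \<tau> m w})"
      proof (rule incseq_SucI, safe)
        fix m w assume "w \<in> space M" "T < \<tau> m w"
        moreover have "\<tau> m w \<le> \<tau> (Suc m) w" using \<tau>[OF \<open>w \<in> space M\<close>] by (auto dest: incseq_SucD)
        ultimately show "T < \<tau> (Suc m) w" by linarith
      qed
    qed
    moreover have "(\<Union>m. E \<inter> {w \<in> space M. T < \<tau> m w}) = E"
    proof (intro equalityI subsetI)
      fix w assume w: "w \<in> E"
      then have sp: "w \<in> space M" "ennreal T < \<eta> w" by (auto simp: E_def)
      have "eventually (\<lambda>m. ennreal T < ennreal (\<tau> m w)) sequentially"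
        by (rule order_tendstoD(1)[OF _ sp(2)]) (use \<tau>[OF sp(1)] in blast)
      then obtain m where "ennreal T < ennreal (\<tau> m w)" by (auto simp: eventually_sequentially)
      then have "T < \<tau> m w" using assms(8) by (simp add: ennreal_less_iff)
      then show "w \<in> (\<Union>m. E \<inter> {w \<in> space M. T < \<tau> m w})" using w sp by auto
    qed auto
    ultimately have "(\<lambda>m. e * prob (E \<inter> {w \<in> space M. T < \<tau> m w})) \<longlonglongrightarrow> e * prob E"
      by (intro tendsto_mult_left) simp
    from LIMSEQ_le[OF this bound_lim] le show ?thesis by blast
  next
    case False
    have "0 \<le> C0 + K * T * prob (bad m)" for m
    proof -
      have "0 \<le> expectation (\<lambda>w. v T (Y m w))"
        using vT[of _ m] by (intro Bochner_Integration.integral_nonneg_AE AE_I2) (auto intro: order_trans[OF indicator_pos_le])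
      then have "0 \<le> e * expectation (\<lambda>w. v T (Y m w))" using e by simp
      also have "\<dots> \<le> C0 + K * T * prob (bad m)" by (rule EB(1))
      finally show ?thesis .
    qed
    then have "0 \<le> C0" using LIMSEQ_le_const[OF bound_lim] by blast
    then show ?thesis using False by (simp add: measure_notin_sets)
  qed
  moreover have "reach_avoid_prob M (X x0) (\<zeta> x0) D G T = measure M E"
    by (simp add: reach_avoid_prob_def E_def Z_def \<eta>_def)
  \<comment> \<open>Undoing the discount: \<open>C0\<close> is the claimed bound times
    \<open>exp (- \<alpha> * T)\<close>. The quotient \<open>\<beta> / \<alpha>\<close> comes from
    integrating \<open>exp (- \<alpha> * r)\<close>, and for \<open>\<alpha> = 0\<close> the
    integral is \<open>T\<close>.\<close>
  moreover have "C0 = e * (if \<alpha> = 0 then v 0 x0 + \<beta> * T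
     else exp (\<alpha> * T) * v 0 x0 + \<beta> / \<alpha> * (exp (\<alpha> * T) - 1))"
  proof (cases "\<alpha> = 0")
    case True
    then show ?thesis using assms(8) by (simp add: C0_def \<Phi>_def e_def set_lebesgue_integral_def)
  next
    case False
    have "\<Phi> = (- exp (- \<alpha> * T) / \<alpha>) - (- exp (- \<alpha> * 0) / \<alpha>)"
      unfolding \<Phi>_def
    proof (rule set_integral_Ioc_FTC)
      show "((\<lambda>r. - exp (- \<alpha> * r) / \<alpha>) has_real_derivative exp (- \<alpha> * r)) (at r within {0..T})" for r
        using False by (auto intro!: derivative_eq_intros)
    qed (use assms(8) in \<open>auto intro!: continuous_intros\<close>)
    then have \<Phi>: "\<Phi> = (1 - e) / \<alpha>" by (simp add: e_def diff_divide_distrib)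
    have eE: "e * exp (\<alpha> * T) = 1" by (simp add: e_def exp_minus)
    have "e * (exp (\<alpha> * T) * v 0 x0 + \<beta> / \<alpha> * (exp (\<alpha> * T) - 1))
        = e * exp (\<alpha> * T) * v 0 x0 + \<beta> / \<alpha> * (e * exp (\<alpha> * T) - e)"
      by (simp add: algebra_simps)
    also have "\<dots> = C0" unfolding eE by (simp add: C0_def \<Phi>)
    finally show ?thesis using False by simp
  qed
  ultimately show "reach_avoid_prob M (X x0) (\<zeta> x0) D G T \<le>
    (if \<alpha> = 0 then v 0 x0 + \<beta> * T
     else exp (\<alpha> * T) * v 0 x0 + \<beta> / \<alpha> * (exp (\<alpha> * T) - 1))"
    using e by (simp only: mult_le_cancel_left_pos)
qed

end
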